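(* Let $M$ be a smooth manifold of any dimension and fix any signature. Consider the source-free Einstein-Maxwell equation $\mathcal{EM}$ $$\operatorname{Ric}(g)-\tfrac12R(g)\,g=(dA\circ dA)_0,\qquad \delta_g(dA)=0$$ as a second order PDE system on the pair $(g,A)$, where $g$ is an unknown pseudo-Riemannian metric of the given signature and $A$ an unknown 1-form on $M$. Then (with $T=T_xM$) the only nonzero Spencer $\delta$-cohomology groups of $\mathcal{EM}$, in any dimension and signature, are $$H^{0,0}(\mathcal{EM})\simeq S^2T^*\oplus T^*,\qquad H^{1,1}(\mathcal{EM})\simeq S^2T^*\oplus T^*,\qquad H^{1,2}(\mathcal{EM})\simeq T^*\oplus\mathbb{R}.$$ Moreover, the equation $\mathcal{EM}$ is involutive.
   Context: Ric and $R$ are the Ricci tensor and the scalar curvature of $g$; $\delta_g=\pm*d*$ is the Hodge codifferential. For the 2-form $F=dA$, viewed as a $(1,1)$-tensor (field of endomorphisms of $TM$) by means of $g$, $(F\circ F)_0=F^2-\frac14\operatorname{Tr}(F^2)\,\mathrm{Id}$, converted to a symmetric covariant 2-tensor by means of $g$. Formal theory of PDEs. A PDE system of order $k$ is a submanifold $\mathcal{E}=\mathcal{E}_k\subset J^k\pi$ of the space of $k$-jets of sections of a bundle $\pi:E\to M$ (here $k=2$), such that $\mathcal{E}_k\to J^{k-1}\pi$ is a submersion. Its prolongations are $\mathcal{E}_l=\mathcal{E}_k^{(l-k)}\subset J^l\pi$, $l>k$ (the $l$-jets satisfying the equation together with its total derivatives up to order $l-k$). Let $T=T_xM$ and let $N$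 be the tangent space to the fiber of $\pi$ (here $N=S^2T^*\oplus T^*$). The symbol spaces at a point of $\mathcal{E}_k$ are: $\mathfrak{g}_t=S^tT^*\otimes N$ for $t<k$; $\mathfrak{g}_k\subset S^kT^*\otimes N$ is the tangent space to the fiber of $\mathcal{E}_k\to J^{k-1}\pi$; $\mathfrak{g}_t=(\mathfrak{g}_k\otimes S^{t-k}T^* )\cap(S^tT^*\otimes N)$ for $t>k$. The Spencer $\delta$-complex is $$0\to \mathfrak{g}_t\to \mathfrak{g}_{t-1}\otimes T^*\xrightarrow{\delta}\mathfrak{g}_{t-2}\otimes\Lambda^2T^*\xrightarrow{\delta}\cdots\xrightarrow{\delta}\mathfrak{g}_{t-i}\otimes\Lambda^iT^*\to\cdots,$$ where $\delta$ is the restriction of the symbol of the de Rham differential, $\delta(p^i\otimes v\otimes\omega)=i\,p^{i-1}\otimes v\otimes(p\wedge\omega)$ for $p\in T^*$, $v\in N$, $\omega\in\Lambda^jT^*$. Its cohomology at the term $\mathfrak{g}_i\otimes\Lambda^jT^*$ is denoted $H^{i,j}(\mathcal{E})$. The symbolic system $\oplus_t\mathfrak{g}_t$ of order $k$ is called involutive if $H^{i,j}=0$ for all $i\ne k-1$ with $i+j>0$. The equation $\mathcal{E}$ is called involutive if its symbolic system is involutive and the obstruction $W_k\in H^{k-1,2}(\mathcal{E})$ vanishes; $W_k$ is the obstruction to surjectivity of the projection $\mathcal{E}_{k+1}\to\mathcal{E}_k$, i.e. it vanishes iff this projection is surjective.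
   Formalization: The dimension of M is assumed to be at least 3; in dimension 2 the Einstein tensor vanishes identically and in dimension 1 the system is 0 = 0, so the claimed second-order symbol and H^{1,1} fail there. *)

theory Defs
  imports "HOL-Analysis.Analysis" "HOL-Library.Function_Algebras"
begin

section \<open>Real vector space structure on functions\<close>

instantiation "fun" :: (type, scaleR) scaleR
begin
definition scaleR_fun :: "real \<Rightarrow> ('a \<Rightarrow> 'b) \<Rightarrow> 'a \<Rightarrow> 'b"
  where "scaleR_fun c f = (\<lambda>x. c *\<^sub>R f x)"
instance ..
end

instance "fun" :: (type, real_vector) real_vector
  by standard
    (simp_all add: scaleR_fun_def plus_fun_def fun_eq_iff scaleR_add_right scaleR_add_left)


section \<open>Partial derivatives and smooth manifolds\<close>

definition pd :: "'n::finite \<Rightarrow> (real^'n \<Rightarrow> 'v::real_normed_vector) \<Rightarrow> real^'n \<Rightarrow> 'v"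
  where "pd i f x = frechet_derivative f (at x) (axis i 1)"

fun pds :: "'n::finite list \<Rightarrow> (real^'n \<Rightarrow> 'v::real_normed_vector) \<Rightarrow> real^'n \<Rightarrow> 'v" where
  "pds [] f = f"
| "pds (i # is) f = pd i (pds is f)"

text \<open>Smoothness; only used for open \<open>S\<close>. Differentiability of all iterated partial
  derivatives makes each of them continuous.\<close>

definition smooth_on :: "(real^'n::finite) set \<Rightarrow> (real^'n \<Rightarrow> 'v::real_normed_vector) \<Rightarrow> bool"
  where "smooth_on S f \<longleftrightarrow> (\<forall>is. \<forall>x\<in>S. pds is f differentiable (at x))"

type_synonym ('m, 'n) chart = "'m set \<times> ('m \<Rightarrow> real^'n)"

definition smooth_manifold :: "'m topology \<Rightarrow> ('m, 'n::finite) chart set \<Rightarrow> bool"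
  where "smooth_manifold M \<A> \<longleftrightarrow>
    Hausdorff_space M
    \<and> (\<exists>\<B>. countable \<B> \<and> openin M = arbitrary union_of (\<lambda>V. V \<in> \<B>))
    \<and> topspace M = (\<Union>(U, \<phi>)\<in>\<A>. U)
    \<and> (\<forall>(U, \<phi>)\<in>\<A>. openin M U \<and> open (\<phi> ` U)
          \<and> homeomorphic_map (subtopology M U) (top_of_set (\<phi> ` U)) \<phi>)
    \<and> (\<forall>(U, \<phi>)\<in>\<A>. \<forall>(V, \<psi>)\<in>\<A>. smooth_on (\<phi> ` (U \<inter> V)) (\<psi> \<circ> inv_into U \<phi>))"


section \<open>Jets and symbols\<close>

text \<open>Over a chart domain, with its trivialisation of the bundle, a \<open>k\<close>-jet at a given point is
  recorded by its jet coordinates: the list \<open>[i\<^sub>1, \<dots>, i\<^sub>r]\<close>, \<open>r \<le> k\<close>, is mapped to the value of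
  \<open>\<partial>\<^sub>i\<^sub>1 \<dots> \<partial>\<^sub>i\<^sub>r s\<close>, and longer lists are mapped to 0.\<close>

type_synonym ('n, 'v) jet = "'n list \<Rightarrow> 'v"

definition jet :: "nat \<Rightarrow> (real^'n::finite \<Rightarrow> 'v::real_normed_vector) \<Rightarrow> real^'n \<Rightarrow> ('n, 'v) jet"
  where "jet k s a = (\<lambda>is. if length is \<le> k then pds is s a else 0)"

definition jet_proj :: "nat \<Rightarrow> ('n, 'v::zero) jet \<Rightarrow> ('n, 'v) jet"
  where "jet_proj k \<theta> = (\<lambda>is. if length is \<le> k then \<theta> is else 0)"

text \<open>For an equation \<open>\<Delta> s = 0\<close> of order \<open>k\<close> on the local sections \<open>s \<in> S\<close> near \<open>a\<close>, this is the
  fibre over \<open>a\<close> of \<open>\<E>\<^sub>k\<close> (if \<open>l = k\<close>) and of its prolongation \<open>\<E>\<^sub>l\<close> (if \<open>l > k\<close>). By definition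
  of the total derivative, \<open>D\<^sub>i\<^sub>1 \<dots> D\<^sub>i\<^sub>r \<Delta>\<close> evaluated at the jet of \<open>s\<close> is
  \<open>\<partial>\<^sub>i\<^sub>1 \<dots> \<partial>\<^sub>i\<^sub>r (\<Delta> s)\<close>.\<close>

definition equation_jets ::
  "(real^'n::finite \<Rightarrow> 'v::real_normed_vector) set
    \<Rightarrow> ((real^'n \<Rightarrow> 'v) \<Rightarrow> real^'n \<Rightarrow> 'w::real_normed_vector)
    \<Rightarrow> nat \<Rightarrow> nat \<Rightarrow> real^'n \<Rightarrow> ('n, 'v) jet set"
  where "equation_jets S \<Delta> k l a =
    {jet l s a | s. s \<in> S \<and> (\<forall>is. length is \<le> l - k \<longrightarrow> pds is (\<Delta> s) a = 0)}"

text \<open>Velocities at \<open>\<theta>\<close> of curves in \<open>Q\<close>; for a submanifold \<open>Q\<close> this is its tangent space.\<close>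

definition tangent_space ::
  "('n, 'v::real_normed_vector) jet set \<Rightarrow> ('n, 'v) jet \<Rightarrow> ('n, 'v) jet set"
  where "tangent_space Q \<theta> =
    {v. \<exists>\<gamma> :: real \<Rightarrow> ('n, 'v) jet. \<gamma> 0 = \<theta> \<and> (\<forall>t. \<gamma> t \<in> Q)
          \<and> (\<forall>is. ((\<lambda>t. \<gamma> t is) has_vector_derivative v is) (at 0))}"

text \<open>\<open>S\<^sup>t T\<^sup>* \<otimes> N\<close> as symmetric tensors with components in \<open>N\<close>. In the jet coordinates above, a
  homogeneous polynomial of degree \<open>t\<close> corresponds to the tensor of its \<open>t\<close>-th partial derivatives,
  so that \<open>p\<^sup>t \<otimes> v\<close> has components \<open>t! p\<^sub>i\<^sub>1 \<dots> p\<^sub>i\<^sub>t v\<close>.\<close>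

definition sym_tensors :: "nat \<Rightarrow> 'v::real_vector set \<Rightarrow> ('n, 'v) jet set"
  where "sym_tensors t N =
    {f. (\<forall>is. length is = t \<longrightarrow> f is \<in> N) \<and> (\<forall>is. length is \<noteq> t \<longrightarrow> f is = 0)
      \<and> (\<forall>is js. mset is = mset js \<longrightarrow> f is = f js)}"

text \<open>The symbol spaces of an equation of order \<open>k\<close> with fibre \<open>Ek\<close> (over the base point), at
  \<open>\<theta> \<in> Ek\<close>. For \<open>t > k\<close>, contraction of the first \<open>t - k\<close> indices of \<open>f \<in> S\<^sup>t T\<^sup>* \<otimes> N\<close> with any basis
  vectors has to give an element of \<open>\<g>\<^sub>k\<close>.\<close>

definition symbol_space ::
  "'v::real_normed_vector set \<Rightarrow> nat \<Rightarrow> ('n, 'v) jet set \<Rightarrow> ('n, 'v) jet \<Rightarrow> nat \<Rightarrow> ('n, 'v) jet set"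
  where "symbol_space N k Ek \<theta> t =
    (let gk = tangent_space {\<theta>' \<in> Ek. jet_proj (k - 1) \<theta>' = jet_proj (k - 1) \<theta>} \<theta>
     in if t < k then sym_tensors t N
        else if t = k then gk
        else {f \<in> sym_tensors t N. \<forall>js. length js = t - k \<longrightarrow>
                (\<lambda>is. if length is = k then f (js @ is) else 0) \<in> gk})"


section \<open>Spencer cohomology and involutivity\<close>

text \<open>An element of \<open>\<g>\<^sub>i \<otimes> \<Lambda>\<^sup>j T\<^sup>*\<close> is an alternating \<open>j\<close>-form with values in \<open>\<g>\<^sub>i\<close>, given by its
  components: its first argument is the list of the \<open>j\<close> form indices, the second one the list of the
  \<open>i\<close> indices of the symmetric tensor.\<close>

type_synonym ('n, 'v) cochain = "'n list \<Rightarrow> ('n, 'v) jet"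

definition del_nth :: "nat \<Rightarrow> 'a list \<Rightarrow> 'a list"
  where "del_nth m xs = take m xs @ drop (Suc m) xs"

definition cochains :: "(nat \<Rightarrow> ('n, 'v::real_vector) jet set) \<Rightarrow> nat \<Rightarrow> nat \<Rightarrow> ('n, 'v) cochain set"
  where "cochains g i j =
    {\<omega>. (\<forall>js. \<omega> js \<in> g i) \<and> (\<forall>js. length js \<noteq> j \<longrightarrow> \<omega> js = 0)
      \<and> (\<forall>us a b vs. \<omega> (us @ a # b # vs) = - \<omega> (us @ b # a # vs))}"

text \<open>In the normalisation of \<open>sym_tensors\<close>, \<open>\<delta>(p\<^sup>i \<otimes> v \<otimes> \<omega>) = i p\<^sup>i\<^sup>-\<^sup>1 \<otimes> v \<otimes> (p \<and> \<omega>)\<close>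
  carries no further factor.\<close>

definition spencer_delta :: "('n, 'v::real_vector) cochain \<Rightarrow> ('n, 'v) cochain"
  where "spencer_delta \<omega> =
    (\<lambda>js is. \<Sum>m<length js. (-1) ^ m *\<^sub>R \<omega> (del_nth m js) (js ! m # is))"

definition cocycles :: "(nat \<Rightarrow> ('n, 'v::real_vector) jet set) \<Rightarrow> nat \<Rightarrow> nat \<Rightarrow> ('n, 'v) cochain set"
  where "cocycles g i j = {\<omega> \<in> cochains g i j. spencer_delta \<omega> = 0}"

definition coboundaries :: "(nat \<Rightarrow> ('n, 'v::real_vector) jet set) \<Rightarrow> nat \<Rightarrow> nat \<Rightarrow> ('n, 'v) cochain set"
  where "coboundaries g i j =
    (if j = 0 then {0} else spencer_delta ` cochains g (i + 1) (j - 1))"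

definition cohomology_class ::
  "(nat \<Rightarrow> ('n, 'v::real_vector) jet set) \<Rightarrow> nat \<Rightarrow> nat \<Rightarrow> ('n, 'v) cochain \<Rightarrow> ('n, 'v) cochain set"
  where "cohomology_class g i j \<omega> = (\<lambda>\<beta>. \<omega> + \<beta>) ` coboundaries g i j"

definition spencer_cohomology ::
  "(nat \<Rightarrow> ('n, 'v::real_vector) jet set) \<Rightarrow> nat \<Rightarrow> nat \<Rightarrow> ('n, 'v) cochain set set"
  where "spencer_cohomology g i j = cohomology_class g i j ` cocycles g i j"

definition cohomology_zero :: "(nat \<Rightarrow> ('n, 'v::real_vector) jet set) \<Rightarrow> nat \<Rightarrow> nat \<Rightarrow> bool"
  where "cohomology_zero g i j \<longleftrightarrow> spencer_cohomology g i j = {cohomology_class g i j 0}"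

text \<open>Isomorphism of real vector spaces between \<open>H\<^sup>i\<^sup>,\<^sup>j\<close> and a subspace \<open>W\<close>.\<close>

definition cohomology_iso ::
  "(nat \<Rightarrow> ('n, 'v::real_vector) jet set) \<Rightarrow> nat \<Rightarrow> nat \<Rightarrow> 'w::real_vector set \<Rightarrow> bool"
  where "cohomology_iso g i j W \<longleftrightarrow>
    (\<exists>\<Phi>. bij_betw \<Phi> (spencer_cohomology g i j) W
      \<and> (\<forall>\<omega>\<in>cocycles g i j. \<forall>\<eta>\<in>cocycles g i j. \<forall>a b.
            \<Phi> (cohomology_class g i j (a *\<^sub>R \<omega> + b *\<^sub>R \<eta>))
              = a *\<^sub>R \<Phi> (cohomology_class g i j \<omega>) + b *\<^sub>R \<Phi> (cohomology_class g i j \<eta>)))"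

definition involutive_symbol :: "nat \<Rightarrow> (nat \<Rightarrow> ('n, 'v::real_vector) jet set) \<Rightarrow> bool"
  where "involutive_symbol k g \<longleftrightarrow>
    (\<forall>i j. i \<noteq> k - 1 \<and> i + j > 0 \<longrightarrow> cohomology_zero g i j)"

text \<open>\<open>E c l x\<close> is the fibre of \<open>\<E>\<^sub>l\<close> over \<open>x\<close> in the chart \<open>c\<close>. The last conjunct, surjectivity of
  \<open>\<E>\<^sub>k\<^sub>+\<^sub>1 \<rightarrow> \<E>\<^sub>k\<close>, is the vanishing of the obstruction \<open>W\<^sub>k\<close>.\<close>

definition involutive_equation ::
  "('m, 'n::finite) chart set \<Rightarrow> 'v::real_normed_vector set \<Rightarrow> nat
    \<Rightarrow> (('m, 'n) chart \<Rightarrow> nat \<Rightarrow> 'm \<Rightarrow> ('n, 'v) jet set) \<Rightarrow> bool"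
  where "involutive_equation \<A> N k E \<longleftrightarrow>
    (\<forall>c\<in>\<A>. \<forall>x\<in>fst c.
      (\<forall>\<theta>\<in>E c k x. involutive_symbol k (symbol_space N k (E c k x) \<theta>))
      \<and> jet_proj k ` E c (k + 1) x = E c k x)"


section \<open>Exterior calculus in a chart\<close>

text \<open>Forms are given by their components, a \<open>p\<close>-form being evaluated on lists of length \<open>p\<close>.\<close>

definition ext_deriv :: "(real^'n::finite \<Rightarrow> 'n list \<Rightarrow> real) \<Rightarrow> real^'n \<Rightarrow> 'n list \<Rightarrow> real"
  where "ext_deriv \<omega> x is = (\<Sum>m<length is. (-1) ^ m * pd (is ! m) (\<lambda>y. \<omega> y (del_nth m is)) x)"

text \<open>Orientation of the chart. The operator \<open>*d*\<close> does not depend on it.\<close>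

definition coord_order :: "'n::finite list"
  where "coord_order = (SOME is. distinct is \<and> set is = UNIV)"

definition levi_civita :: "'n::finite list \<Rightarrow> real"
  where "levi_civita is =
    (if distinct is \<and> set is = UNIV
     then of_int (sign (THE \<pi>. \<pi> permutes UNIV \<and> map \<pi> coord_order = is)) else 0)"

definition raise_indices :: "nat \<Rightarrow> real^'n::finite^'n \<Rightarrow> ('n list \<Rightarrow> real) \<Rightarrow> 'n list \<Rightarrow> real"
  where "raise_indices p G \<omega> is =
    (\<Sum>js\<in>{js. length js = p}. (\<Prod>m<p. matrix_inv G $ (is ! m) $ (js ! m)) * \<omega> js)"

text \<open>The Hodge star of the metric with matrix \<open>G\<close> on \<open>p\<close>-forms.\<close>

definition hodge :: "nat \<Rightarrow> real^'n::finite^'n \<Rightarrow> ('n list \<Rightarrow> real) \<Rightarrow> 'n list \<Rightarrow> real"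
  where "hodge p G \<omega> js =
    sqrt \<bar>det G\<bar> / fact p *
      (\<Sum>is\<in>{is. length is = p}. raise_indices p G \<omega> is * levi_civita (is @ js))"

text \<open>The codifferential \<open>*d*\<close> on \<open>p\<close>-forms, up to the sign depending on \<open>p\<close>, the dimension and
  the signature.\<close>

definition codiff ::
  "nat \<Rightarrow> (real^'n::finite \<Rightarrow> real^'n^'n) \<Rightarrow> (real^'n \<Rightarrow> 'n list \<Rightarrow> real) \<Rightarrow> real^'n \<Rightarrow> 'n list \<Rightarrow> real"
  where "codiff p g \<omega> x =
    hodge (CARD('n) - p + 1) (g x) (ext_deriv (\<lambda>y. hodge p (g y) (\<omega> y)) x)"


section \<open>Curvature in a chart\<close>

definition christoffel :: "(real^'n::finite \<Rightarrow> real^'n^'n) \<Rightarrow> 'n \<Rightarrow> 'n \<Rightarrow> 'n \<Rightarrow> real^'n \<Rightarrow> real"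
  where "christoffel g k i j x =
    (\<Sum>l\<in>UNIV. matrix_inv (g x) $ k $ l *
      (pd i (\<lambda>y. g y $ j $ l) x + pd j (\<lambda>y. g y $ i $ l) x - pd l (\<lambda>y. g y $ i $ j) x)) / 2"

definition ricci :: "(real^'n::finite \<Rightarrow> real^'n^'n) \<Rightarrow> real^'n \<Rightarrow> real^'n^'n"
  where "ricci g x = (\<chi> i j.
    (\<Sum>k\<in>UNIV. pd k (christoffel g k i j) x - pd j (christoffel g k i k) x)
    + (\<Sum>k\<in>UNIV. \<Sum>l\<in>UNIV. christoffel g k k l x * christoffel g l i j x
                           - christoffel g k j l x * christoffel g l i k x))"

definition scalar_curv :: "(real^'n::finite \<Rightarrow> real^'n^'n) \<Rightarrow> real^'n \<Rightarrow> real"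
  where "scalar_curv g x = (\<Sum>i\<in>UNIV. \<Sum>j\<in>UNIV. matrix_inv (g x) $ i $ j * ricci g x $ i $ j)"


section \<open>The Einstein-Maxwell equation\<close>

type_synonym 'n fibre = "(real^'n^'n) \<times> (real^'n)"

text \<open>\<open>S\<^sup>2 T\<^sup>* \<oplus> T\<^sup>*\<close>, the tangent space to the fibre of the bundle of pairs \<open>(g, A)\<close>.\<close>

definition fibre_tangent :: "'n::finite fibre set"
  where "fibre_tangent = {(h, \<alpha>). transpose h = h}"

definition has_signature :: "real^'n::finite^'n \<Rightarrow> nat \<Rightarrow> nat \<Rightarrow> bool"
  where "has_signature G p q \<longleftrightarrow> transpose G = G \<and>
    (\<exists>(P :: real^'n^'n) I. invertible P \<and> card I = p \<and> card (- I) = q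
      \<and> transpose P ** G ** P = (\<chi> i j. if i = j then (if i \<in> I then 1 else -1) else 0))"

definition potential_form :: "(real^'n::finite \<Rightarrow> real^'n) \<Rightarrow> real^'n \<Rightarrow> 'n list \<Rightarrow> real"
  where "potential_form A x is = (case is of [i] \<Rightarrow> A x $ i | _ \<Rightarrow> 0)"

definition field_strength :: "(real^'n::finite \<Rightarrow> real^'n) \<Rightarrow> real^'n \<Rightarrow> 'n list \<Rightarrow> real"
  where "field_strength A = ext_deriv (potential_form A)"

text \<open>\<open>F = dA\<close> as the endomorphism \<open>F\<^sup>i\<^sub>j = g\<^sup>i\<^sup>k F\<^sub>k\<^sub>j\<close>, for the metric matrix \<open>G\<close> at the point.\<close>

definition field_endo :: "real^'n::finite^'n \<Rightarrow> ('n list \<Rightarrow> real) \<Rightarrow> real^'n^'n"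
  where "field_endo G F = matrix_inv G ** (\<chi> i j. F [i, j])"

text \<open>\<open>(F \<circ> F)\<^sub>0\<close> as a covariant 2-tensor; the factor is 1/4 in every dimension.\<close>

definition energy_momentum :: "real^'n::finite^'n \<Rightarrow> ('n list \<Rightarrow> real) \<Rightarrow> real^'n^'n"
  where "energy_momentum G F =
    (let F2 = field_endo G F ** field_endo G F in G ** (F2 - (trace F2 / 4) *\<^sub>R mat 1))"

definition einstein_maxwell :: "(real^'n::finite \<Rightarrow> 'n fibre) \<Rightarrow> real^'n \<Rightarrow> 'n fibre"
  where "einstein_maxwell s x =
    (let g = fst \<circ> s; F = field_strength (snd \<circ> s)
     in (ricci g x - (scalar_curv g x / 2) *\<^sub>R g x - energy_momentum (g x) (F x),
         \<chi> i. codiff 2 g F x [i]))"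

text \<open>Coordinate expressions, in a chart, of the smooth sections \<open>(g, A)\<close> over neighbourhoods of
  \<open>x\<close>; \<open>s\<close> gives the components of \<open>(g, A)\<close> with respect to the coordinate coframe of the chart.\<close>

definition metric_potential_sections ::
  "'m topology \<Rightarrow> nat \<Rightarrow> nat \<Rightarrow> ('m, 'n::finite) chart \<Rightarrow> 'm \<Rightarrow> (real^'n \<Rightarrow> 'n fibre) set"
  where "metric_potential_sections M p q = (\<lambda>(U, \<phi>) x.
    {s \<circ> inv_into U \<phi> | s. \<exists>W. openin M W \<and> x \<in> W \<and> W \<subseteq> U
        \<and> smooth_on (\<phi> ` W) (s \<circ> inv_into U \<phi>)
        \<and> (\<forall>y\<in>W. has_signature (fst (s y)) p q)})"

definition EM :: "'m topology \<Rightarrow> nat \<Rightarrow> nat \<Rightarrow> ('m, 'n::finite) chart \<Rightarrow> nat \<Rightarrow> 'm \<Rightarrow> ('n, 'n fibre) jet set"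
  where "EM M p q c l x =
    equation_jets (metric_potential_sections M p q c x) einstein_maxwell 2 l (snd c x)"

definition EM_symbol ::
  "'m topology \<Rightarrow> nat \<Rightarrow> nat \<Rightarrow> ('m, 'n::finite) chart \<Rightarrow> 'm \<Rightarrow> ('n, 'n fibre) jet
    \<Rightarrow> nat \<Rightarrow> ('n, 'n fibre) jet set"
  where "EM_symbol M p q c x \<theta> = symbol_space fibre_tangent 2 (EM M p q c 2 x) \<theta>"

end

theory Submission
  imports Defs "HOL-Combinatorics.Multiset_Permutations"
begin

text \<open>Let \<open>N = S\<^sup>2T\<^sup>* \<oplus> T\<^sup>*\<close>, let \<open>\<sigma>\<^sub>1\<close> be the linearised Einstein-Maxwell operator with constant
  coefficients, and let \<open>\<sigma>\<^sub>2\<close> be the divergence, which expresses the contracted Bianchi identity and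
  \<open>\<delta>\<^sup>2 = 0\<close>. The sequence
  \<open>0 \<rightarrow> \<g>\<^sub>t \<rightarrow> S\<^sup>tT\<^sup>* \<otimes> N \<rightarrow> S\<^sup>t\<^sup>-\<^sup>2T\<^sup>* \<otimes> N \<rightarrow> S\<^sup>t\<^sup>-\<^sup>3T\<^sup>* \<otimes> (T\<^sup>* \<oplus> \<real>) \<rightarrow> 0\<close> is exact for all \<open>t\<close>: in harmonic
  gauge \<open>\<sigma>\<^sub>1\<close> becomes the wave operator, which is surjective on formal power series, and the gauge
  can be corrected by harmonic series. The three right-hand columns have trivial Spencer cohomology in positive
  degree, so a diagram chase with the Koszul homotopy leaves only \<open>H\<^sup>0\<^sup>,\<^sup>0\<close>, \<open>H\<^sup>1\<^sup>,\<^sup>1\<close> and \<open>H\<^sup>1\<^sup>,\<^sup>2\<close>,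
  one for each of the columns.

  To leading order, a change of the jet of a section changes the equation by \<open>\<sigma>\<^sub>1\<close>; hence the second
  order symbol is \<open>ker \<sigma>\<^sub>1\<close>. If a section solves the equation at a point, then its
  first derivatives there form a tensor in \<open>ker \<sigma>\<^sub>2\<close>, by the contracted Bianchi identity and
  \<open>\<delta>\<^sup>2 = 0\<close>. By exactness it is in the image of \<open>\<sigma>\<^sub>1\<close>, so that a change of the 3-jet
  cancels it; this proves that \<open>\<E>\<^sub>3 \<rightarrow> \<E>\<^sub>2\<close> is surjective.\<close>

section \<open>Solvability of the linearised equations\<close>

text \<open>The delicate point is to correct the gauge without destroying the solution of the wave
  equation, in every signature. A right inverse of the wave operator that commutes with
  \<open>d e\<close> for one direction \<open>e\<close> provides harmonic antiderivatives in that
  direction; these suffice, because contracting with column \<open>e\<close> of \<open>G\<close>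
  reduces every divergence equation to \<open>d e\<close>. Such an inverse solves for a coefficient
  of \<gamma> with both indices different from \<open>e\<close>; in general this takes dimension at
  least 3, as does the trace reversal with its factor 1/(n - 2). The locale records what is needed
  of the power series. On the nonlinear side, \<open>close k\<close> compares functions modulo terms
  vanishing to order k at the base point. Quadratic Christoffel terms and the stress tensor involve
  first derivatives only and drop out of the linearisation. The codifferential is replaced by the
  divergence of F, of which it is a nowhere zero multiple, and the metric is varied by congruences
  to keep its signature.\<close>

locale wave_system =
  fixes d :: "'n::finite \<Rightarrow> 'a::real_vector \<Rightarrow> 'a" and G \<gamma> :: "real^'n^'n" and e :: 'n
  assumes lin: "linear (d i)" and comm: "d i (d j u) = d j (d i u)"
    and symG: "transpose G = G" and symg: "transpose \<gamma> = \<gamma>" and inv: "\<gamma> ** G = mat 1"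
    and card3: "CARD('n) \<ge> 3"
    and box_surj: "\<exists>u. (\<Sum>i\<in>UNIV. \<Sum>j\<in>UNIV. \<gamma>$i$j *\<^sub>R d i (d j u)) = f"
    and der_surj: "(\<Sum>i\<in>UNIV. \<Sum>j\<in>UNIV. \<gamma>$i$j *\<^sub>R d i (d j u)) = 0
      \<Longrightarrow> \<exists>w. (\<Sum>i\<in>UNIV. \<Sum>j\<in>UNIV. \<gamma>$i$j *\<^sub>R d i (d j w)) = 0 \<and> d e w = u"
    and der_surj': "\<exists>w. d e w = u"
begin

definition D where "D i u = (\<Sum>j\<in>UNIV. \<gamma>$i$j *\<^sub>R d j u)"
definition box where "box u = (\<Sum>i\<in>UNIV. d i (D i u))"
definition tr :: "('n \<Rightarrow> 'n \<Rightarrow> 'a) \<Rightarrow> 'a" where "tr z = (\<Sum>i\<in>UNIV. \<Sum>j\<in>UNIV. \<gamma>$i$j *\<^sub>R z i j)"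
definition dv where "dv z j = (\<Sum>k\<in>UNIV. D k (z k j))"
text \<open>Its vanishing is the linearised harmonic (de Donder) gauge condition: the divergence of
  the trace-reversed tensor.\<close>

definition bian where "bian h j = dv h j - (1/2) *\<^sub>R d j (tr h)"
text \<open>The Ricci tensor linearised at the constant metric \<open>G\<close>, where products of
  Christoffel symbols contribute nothing.\<close>

definition ric where "ric h i j = (1/2) *\<^sub>R (d i (dv h j) + d j (dv h i) - box (h i j) - d i (d j (tr h)))"
definition ein where "ein h i j = ric h i j - (G$i$j / 2) *\<^sub>R tr (ric h)"
definition mxw where "mxw a i = (\<Sum>k\<in>UNIV. D k (d k (a i) - d i (a k)))"

lemma d_simps: "d i (u + v) = d i u + d i v" "d i (u - v) = d i u - d i v" "d i (- u) = - d i u"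
  "d i (c *\<^sub>R u) = c *\<^sub>R d i u" "d i 0 = 0" "d i (sum f A) = (\<Sum>x\<in>A. d i (f x))"
  using lin[of i] by (simp_all add: linear_add linear_diff linear_scale linear_neg linear_0 linear_sum)

lemma linD: "linear (D i)"
  unfolding D_def
  by (intro linearI) (simp_all add: d_simps scaleR_add_right sum.distrib scaleR_sum_right mult.commute)

lemma D_simps: "D i (u + v) = D i u + D i v" "D i (u - v) = D i u - D i v" "D i (- u) = - D i u"
  "D i (c *\<^sub>R u) = c *\<^sub>R D i u" "D i 0 = 0" "D i (sum f A) = (\<Sum>x\<in>A. D i (f x))"
  using linD[of i] by (simp_all add: linear_add linear_diff linear_scale linear_neg linear_0 linear_sum)

lemma dD: "d i (D j u) = D j (d i u)"
  unfolding D_def by (simp add: d_simps comm)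

lemma DD: "D i (D j u) = D j (D i u)"
  by (simp add: D_def[of i] dD D_simps)

lemma box_simps: "box (u + v) = box u + box v" "box (u - v) = box u - box v" "box (- u) = - box u"
  "box (c *\<^sub>R u) = c *\<^sub>R box u" "box 0 = 0" "box (sum f A) = (\<Sum>x\<in>A. box (f x))"
  unfolding box_def
  by (simp_all add: D_simps d_simps sum.distrib sum_subtractf sum_negf scaleR_sum_right sum.swap[of _ UNIV A])

lemma boxd: "box (d i u) = d i (box u)" and boxD: "box (D i u) = D i (box u)"
  unfolding box_def by (simp_all add: d_simps D_simps dD comm DD)

lemma box_eq: "box u = (\<Sum>i\<in>UNIV. \<Sum>j\<in>UNIV. \<gamma>$i$j *\<^sub>R d i (d j u))"
  unfolding box_def D_def by (simp add: d_simps)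

lemma gs: "\<gamma>$i$j = \<gamma>$j$i" and Gs: "G$i$j = G$j$i"
  using symg symG by (metis transpose_def vec_lambda_beta)+

lemma inv_nth: "(\<Sum>k\<in>UNIV. \<gamma>$i$k * G$k$j) = (if i = j then 1 else 0)"
  using arg_cong[OF inv, of "\<lambda>A. A$i$j"] by (simp add: matrix_matrix_mult_def mat_def)

lemma inv_nth': "(\<Sum>k\<in>UNIV. G$i$k * \<gamma>$k$j) = (if i = j then 1 else 0)"
  using inv_nth[of j i] by (simp add: gs[of j] Gs[of _ i] mult.commute eq_commute[of i])

text \<open>Lowering the index undoes \<open>D\<close>. Hence the covector
  \<open>G$k$e *\<^sub>R c\<close> has divergence \<open>d e c\<close>, which turns a divergence
  equation into an antiderivative in direction \<open>e\<close>.\<close>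

lemma GD: "(\<Sum>k\<in>UNIV. G$k$j *\<^sub>R D k u) = d j u"
proof -
  have "(\<Sum>k\<in>UNIV. G$k$j *\<^sub>R D k u) = (\<Sum>l\<in>UNIV. \<Sum>k\<in>UNIV. (G$j$k * \<gamma>$k$l) *\<^sub>R d l u)"
    unfolding D_def by (subst sum.swap) (simp add: scaleR_sum_right Gs[of _ j])
  also have "\<dots> = (\<Sum>l\<in>UNIV. (if j = l then 1 else 0) *\<^sub>R d l u)"
    by (simp only: scaleR_sum_left[symmetric] inv_nth')
  also have "\<dots> = d j u"
    by (simp add: if_distrib[of "\<lambda>c. c *\<^sub>R _"] cong: if_cong)
  finally show ?thesis .
qed

lemma tr_simps: "tr (\<lambda>i j. y i j + z i j) = tr y + tr z" "tr (\<lambda>i j. y i j - z i j) = tr y - tr z"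
  "tr (\<lambda>i j. c *\<^sub>R z i j) = c *\<^sub>R tr z" "tr (\<lambda>i j. box (z i j)) = box (tr z)"
  unfolding tr_def
  by (simp_all add: scaleR_add_right scaleR_diff_right sum.distrib sum_subtractf scaleR_sum_right
     box_simps mult.commute)

lemma tr_G: "tr (\<lambda>i j. (c * G$i$j) *\<^sub>R u) = (c * real CARD('n)) *\<^sub>R u"
proof -
  have "tr (\<lambda>i j. (c * G$i$j) *\<^sub>R u) = (\<Sum>i\<in>UNIV. (c * (\<Sum>j\<in>UNIV. \<gamma>$i$j * G$j$i)) *\<^sub>R u)"
    unfolding tr_def scaleR_scaleR sum_distrib_left scaleR_sum_left
    by (intro sum.cong refl) (simp add: Gs[of _ i for i] mult.left_commute)
  thus ?thesis unfolding inv_nth by (simp add: mult.commute flip: scaleR_sum_left)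
qed

lemma tr_dd: "tr (\<lambda>i j. d i (d j u)) = box u"
  by (simp add: tr_def box_eq)

lemma tr_sum1: "(\<Sum>i\<in>UNIV. \<Sum>j\<in>UNIV. \<gamma>$i$j *\<^sub>R d i (v j)) = (\<Sum>j\<in>UNIV. D j (v j))"
  unfolding D_def by (subst sum.swap) (simp add: gs)

lemma tr_sum2: "(\<Sum>i\<in>UNIV. \<Sum>j\<in>UNIV. \<gamma>$i$j *\<^sub>R d j (v i)) = (\<Sum>j\<in>UNIV. D j (v j))"
  unfolding D_def by simp

lemma dv_simps: "dv (\<lambda>i j. y i j + z i j) j = dv y j + dv z j" "dv (\<lambda>i j. y i j - z i j) j = dv y j - dv z j"
  "dv (\<lambda>i j. c *\<^sub>R z i j) j = c *\<^sub>R dv z j" "dv (\<lambda>i j. box (z i j)) j = box (dv z j)"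
  unfolding dv_def
  by (simp_all add: D_simps sum.distrib sum_subtractf scaleR_sum_right box_simps boxD)

lemma dv_G: "dv (\<lambda>i j. (c * G$i$j) *\<^sub>R u) j = c *\<^sub>R d j u"
  unfolding dv_def using GD[of j u] by (simp add: D_simps scaleR_sum_right[symmetric] flip: scaleR_scaleR)

lemma tr_ric: "tr (ric h) = (\<Sum>k\<in>UNIV. D k (dv h k)) - box (tr h)"
proof -
  have "tr (ric h) = (1/2) *\<^sub>R ((\<Sum>k\<in>UNIV. D k (dv h k)) + (\<Sum>k\<in>UNIV. D k (dv h k)) - box (tr h) - box (tr h))"
    unfolding ric_def[abs_def] tr_simps tr_dd using tr_sum1[of "dv h"] tr_sum2[of "dv h"] by (simp add: tr_def)
  moreover have "x + x - y - y = 2 *\<^sub>R (x - y)" for x y :: 'a by (simp add: scaleR_2)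
  ultimately show ?thesis by simp
qed

lemma box_Dd: "(\<Sum>k\<in>UNIV. D k (d k u)) = box u"
  by (simp add: box_def dD)

text \<open>The linearised contracted Bianchi identity: after commuting derivatives the two wave
  terms cancel, and by \<open>tr_ric\<close> half the gradient of the trace remains.\<close>

lemma dv_ric: "dv (ric h) j = (1/2) *\<^sub>R d j (tr (ric h))"
proof -
  have "dv (ric h) j = (1/2) *\<^sub>R (box (dv h j) + d j (\<Sum>k\<in>UNIV. D k (dv h k)) - box (dv h j) - d j (box (tr h)))"
  proof -
    have 1: "dv (\<lambda>i j. d i (dv h j)) j = box (dv h j)" and 2: "dv (\<lambda>i j. d i (d j (tr h))) j = d j (box (tr h))"
      by (simp_all add: dv_def box_Dd boxd)
    have 3: "dv (\<lambda>i j. d j (dv h i)) j = d j (\<Sum>k\<in>UNIV. D k (dv h k))"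
      by (subst dv_def) (simp add: d_simps dD)
    show ?thesis unfolding ric_def[abs_def] dv_simps 1 2 3 ..
  qed
  thus ?thesis by (simp add: tr_ric d_simps)
qed

lemma dv_ein: "dv (ein h) j = 0"
proof -
  have "dv (ein h) j = dv (ric h) j - dv (\<lambda>i j. (1/2 * G$i$j) *\<^sub>R tr (ric h)) j"
    unfolding ein_def[abs_def] dv_simps by simp
  thus ?thesis by (simp only: dv_G dv_ric) simp
qed

text \<open>The two double sums exchange when the summation indices are swapped, because the raised
  derivatives commute.\<close>

lemma dv_mxw: "(\<Sum>i\<in>UNIV. D i (mxw a i)) = 0"
proof -
  have "(\<Sum>i\<in>UNIV. D i (mxw a i)) = (\<Sum>i\<in>UNIV. \<Sum>k\<in>UNIV. D i (D k (d k (a i)))) - (\<Sum>i\<in>UNIV. \<Sum>k\<in>UNIV. D i (D k (d i (a k))))"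
    by (simp add: mxw_def D_simps sum_subtractf)
  also have "(\<Sum>i\<in>UNIV. \<Sum>k\<in>UNIV. D i (D k (d i (a k)))) = (\<Sum>i\<in>UNIV. \<Sum>k\<in>UNIV. D i (D k (d k (a i))))"
    by (subst sum.swap) (simp add: DD)
  finally show ?thesis by simp
qed

lemma vec_harmonic: 
  assumes "box u = 0" shows "\<exists>w. box w = 0 \<and> d e w = u"
  using der_surj[of u] assms unfolding box_eq by blast

lemma mxw_eq: "mxw a i = box (a i) - d i (\<Sum>k\<in>UNIV. D k (a k))"
  by (simp add: mxw_def D_simps sum_subtractf box_Dd d_simps dD)

text \<open>Lorenz gauge. Componentwise solutions of the wave equation have a divergence that is
  itself harmonic; it is removed by subtracting a harmonic covector, which leaves
  \<open>box (a i)\<close> unchanged.\<close>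

lemma mxw_exact:
  assumes "(\<Sum>i\<in>UNIV. D i (w i)) = 0"
  shows "\<exists>a. \<forall>i. mxw a i = w i"
proof -
  obtain R where R: "\<And>f. box (R f) = f" using box_surj unfolding box_eq[symmetric] by metis
  define a where "a i = R (w i)" for i
  have a: "box (a i) = w i" for i by (simp add: a_def R)
  define u where "u = (\<Sum>k\<in>UNIV. D k (a k))"
  have "box u = 0" by (simp add: u_def box_simps boxD a assms)
  then obtain c where c: "box c = 0" "d e c = u" using vec_harmonic by blast
  \<comment> \<open>By \<open>GD\<close> the subtracted covector has divergence
    \<open>d e c = u\<close>.\<close>
  define b where "b i = a i - G$e$i *\<^sub>R c" for i
  have "(\<Sum>k\<in>UNIV. D k (b k)) = u - (\<Sum>k\<in>UNIV. G$k$e *\<^sub>R D k c)"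
    by (simp add: b_def D_simps sum_subtractf u_def Gs[of e])
  hence "(\<Sum>k\<in>UNIV. D k (b k)) = 0" by (simp add: GD c)
  hence "mxw b i = w i" for i
    by (simp add: mxw_eq b_def box_simps c a d_simps)
  thus ?thesis by blast
qed

lemma dvv_surj: "\<exists>w. (\<Sum>i\<in>UNIV. D i (w i)) = f"
proof -
  obtain c where c: "d e c = f" using der_surj' by blast
  have "(\<Sum>k\<in>UNIV. D k (G$k$e *\<^sub>R c)) = f" by (simp add: D_simps GD c)
  thus ?thesis by (intro exI[of _ "\<lambda>k. G$k$e *\<^sub>R c"])
qed

text \<open>A symmetric tensor with prescribed divergence \<open>b\<close>, supported on the directions that involve
  \<open>e\<close>; harmonic if the antiderivatives are.\<close>

lemma dv_solve:
  assumes C: "\<And>j. d e (C j) = b j" and E: "d e E = (\<Sum>k\<in>UNIV. D k (C k))"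
  defines "z \<equiv> \<lambda>i j. G$i$e *\<^sub>R C j + G$j$e *\<^sub>R C i - (G$i$e * G$j$e) *\<^sub>R E"
  shows "dv z j = b j"
proof -
  have "dv z j = (\<Sum>k\<in>UNIV. G$k$e *\<^sub>R D k (C j)) + G$j$e *\<^sub>R (\<Sum>k\<in>UNIV. D k (C k)) - G$j$e *\<^sub>R (\<Sum>k\<in>UNIV. G$k$e *\<^sub>R D k E)"
    by (simp add: z_def dv_def D_simps sum.distrib sum_subtractf scaleR_sum_right mult.commute)
  thus ?thesis by (simp add: GD C E)
qed

lemma dv_surj: "\<exists>z. (\<forall>i j. z i j = z j i) \<and> (\<forall>j. dv z j = b j)"
proof -
  obtain J where J: "\<And>u. d e (J u) = u" using der_surj' by metis
  define C where "C j = J (b j)" for j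
  have C: "d e (C j) = b j" for j by (simp add: C_def J)
  obtain E where E: "d e E = (\<Sum>k\<in>UNIV. D k (C k))" using J by blast
  show ?thesis
    by (intro exI[of _ "\<lambda>i j. G$i$e *\<^sub>R C j + G$j$e *\<^sub>R C i - (G$i$e * G$j$e) *\<^sub>R E"] conjI allI dv_solve[OF C E])
      (simp add: ac_simps)
qed

lemma dv_surj_harmonic: 
  assumes "\<And>j. box (b j) = 0" 
  shows "\<exists>z. (\<forall>i j. z i j = z j i) \<and> (\<forall>j. dv z j = b j) \<and> (\<forall>i j. box (z i j) = 0)"
proof -
  obtain H where H: "\<And>u. box u = 0 \<Longrightarrow> box (H u) = 0 \<and> d e (H u) = u" using vec_harmonic by metis
  define C where "C j = H (b j)" for j
  have C: "d e (C j) = b j" "box (C j) = 0" for j using H[OF assms[of j]] by (simp_all add: C_def)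
  have "box (\<Sum>k\<in>UNIV. D k (C k)) = 0" by (simp add: box_simps boxD C D_simps)
  then obtain E where E: "d e E = (\<Sum>k\<in>UNIV. D k (C k))" "box E = 0" using vec_harmonic by blast
  show ?thesis
    by (intro exI[of _ "\<lambda>i j. G$i$e *\<^sub>R C j + G$j$e *\<^sub>R C i - (G$i$e * G$j$e) *\<^sub>R E"] conjI allI dv_solve[OF C(1) E(1)])
      (simp_all add: ac_simps box_simps C E)
qed

text \<open>Trace reversal inverts the passage from a tensor to its Einstein combination; taking the
  trace of that equation forces the factor 1/(n - 2). The gauge expression of \<open>S\<close> is
  the divergence of \<open>z\<close>, so a divergence-free source is compatible with harmonic
  gauge.\<close>

lemma trace_reverse:
  fixes z :: "'n \<Rightarrow> 'n \<Rightarrow> 'a"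
  defines "S \<equiv> \<lambda>i j. z i j - (1 / (real CARD('n) - 2) * G$i$j) *\<^sub>R tr z"
  shows "tr S = (- 2 / (real CARD('n) - 2)) *\<^sub>R tr z"
    and "S i j - (G$i$j / 2) *\<^sub>R tr S = z i j"
    and "bian S j = dv z j"
proof -
  have n: "real CARD('n) - 2 \<noteq> 0" using card3 by simp
  have "tr S = tr z - (1 / (real CARD('n) - 2) * real CARD('n)) *\<^sub>R tr z"
    unfolding S_def tr_simps tr_G ..
  also have "\<dots> = (1 - 1 / (real CARD('n) - 2) * real CARD('n)) *\<^sub>R tr z"
    by (simp add: algebra_simps)
  also have "1 - 1 / (real CARD('n) - 2) * real CARD('n) = - 2 / (real CARD('n) - 2)"
    using n by (simp add: field_simps)
  finally show trS: "tr S = (- 2 / (real CARD('n) - 2)) *\<^sub>R tr z" .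
  show "S i j - (G$i$j / 2) *\<^sub>R tr S = z i j"
    unfolding trS by (simp add: S_def)
  show "bian S j = dv z j"
    unfolding bian_def trS d_simps unfolding S_def dv_simps dv_G by simp
qed

text \<open>The trace term is split evenly between the two gauge terms. In harmonic gauge only -1/2
  times the wave operator is left.\<close>

lemma ric_bian: "ric h i j = (1/2) *\<^sub>R (d i (bian h j) + d j (bian h i) - box (h i j))"
proof -
  have "d i (d j (tr h)) = (1/2) *\<^sub>R d i (d j (tr h)) + (1/2) *\<^sub>R d j (d i (tr h))"
    unfolding comm[of i j] by (simp flip: scaleR_left.add)
  thus ?thesis unfolding ric_def bian_def by (simp add: d_simps algebra_simps)
qed

text \<open>With \<open>S\<close> the trace reversal of \<open>z\<close>, the equation becomes
  \<open>ric h = S\<close>. Solving \<open>box\<close> componentwise with source -2 \<open>S\<close>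
  leaves a gauge defect \<open>bian h0\<close>, harmonic because \<open>z\<close> is
  divergence-free; a harmonic tensor \<open>k\<close> with the same defect is subtracted.\<close>

lemma ein_exact:
  assumes sym: "\<And>i j. z i j = z j i" and dvz: "\<And>j. dv z j = 0"
  shows "\<exists>h. (\<forall>i j. h i j = h j i) \<and> (\<forall>i j. ein h i j = z i j)"
proof -
  define S where "S = (\<lambda>i j. z i j - (1 / (real CARD('n) - 2) * G$i$j) *\<^sub>R tr z)"
  note S = trace_reverse[of z, folded S_def]
  obtain R where R: "\<And>f. box (R f) = f" using box_surj unfolding box_eq[symmetric] by metis
  define h0 where "h0 i j = R (-2 *\<^sub>R S i j)" for i j
  have h0: "box (h0 i j) = -2 *\<^sub>R S i j" "h0 i j = h0 j i" for i j
    by (simp_all add: h0_def R S_def sym[of i] Gs[of i])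
  have bian0: "box (bian h0 j) = 0" for j
  proof -
    have "box (bian h0 j) = dv (\<lambda>i j. box (h0 i j)) j - (1/2) *\<^sub>R d j (tr (\<lambda>i j. box (h0 i j)))"
      by (simp add: bian_def box_simps boxd dv_simps tr_simps)
    also have "\<dots> = -2 *\<^sub>R bian S j"
      unfolding h0 dv_simps tr_simps bian_def d_simps by (simp add: algebra_simps)
    finally show ?thesis by (simp add: S dvz)
  qed
  from dv_surj_harmonic[of "bian h0", OF bian0] obtain k' where k': "\<And>i j. k' i j = k' j i" "\<And>j. dv k' j = bian h0 j"
    "\<And>i j. box (k' i j) = 0" by blast
  \<comment> \<open>Trace reversal of \<open>k'\<close> converts its prescribed divergence into a
    prescribed value of \<open>bian\<close>.\<close>
  define k where "k = (\<lambda>i j. k' i j - (1 / (real CARD('n) - 2) * G$i$j) *\<^sub>R tr k')"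
  have k: "bian k j = bian h0 j" "k i j = k j i" "box (k i j) = 0" for i j
  proof -
    show "bian k j = bian h0 j" using trace_reverse(3)[of k', folded k_def] k' by simp
    have "box (tr k') = tr (\<lambda>i j. box (k' i j))" by (simp only: tr_simps)
    hence "box (tr k') = 0" by (simp add: k' tr_def)
    thus "k i j = k j i" "box (k i j) = 0" by (simp_all add: k_def box_simps k'(3) Gs[of i]) (metis k'(1))
  qed
  define h where "h = (\<lambda>i j. h0 i j - k i j)"
  have "bian h j = 0" for j
    using k(1)[of j] unfolding h_def bian_def dv_simps tr_simps d_simps by (simp add: algebra_simps)
  hence "ric h i j = S i j" for i j
    unfolding ric_bian by (simp add: d_simps h_def box_simps h0 k)
  hence "ric h = S" by (intro ext)
  moreover have "S i j - (G$i$j / 2) *\<^sub>R tr S = z i j" for i j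
    using S(2)[of i j] by (simp add: S_def)
  ultimately have "ein h i j = z i j" for i j by (simp add: ein_def)
  moreover have "h i j = h j i" for i j unfolding h_def using h0(2) k(2) by metis
  ultimately show ?thesis by blast
qed

end

section \<open>Formal power series and the wave equation\<close>

lemma sum_fun_apply: "(\<Sum>i\<in>A. f i) x = (\<Sum>i\<in>A. f i x)"
  by (induction A rule: infinite_finite_induct) simp_all

text \<open>A power series is given by its derivatives at the base point, one for each multiset of
  indices; in this normalisation differentiation is a shift without factors.\<close>

definition mder :: "'n \<Rightarrow> ('n multiset \<Rightarrow> 'v) \<Rightarrow> 'n multiset \<Rightarrow> 'v"
  where "mder i f = (\<lambda>M. f (add_mset i M))"

lemma linear_mder: "linear (mder i)"
  by (rule linearI) (simp_all add: mder_def fun_eq_iff scaleR_fun_def)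

lemma mder_commute: "mder i (mder j f) = mder j (mder i f)"
  by (simp add: mder_def add_mset_commute)

text \<open>The solution of \<open>\<Sum> \<gamma>\<^sup>i\<^sup>j \<partial>\<^sub>i \<partial>\<^sub>j u = f\<close> without terms divisible by \<open>x\<^sub>b x\<^sub>c\<close> in place of
  Cauchy data. The other second derivatives occurring in the operator contain fewer
  indices from \<open>{b, c}\<close>, so the recursion terminates.\<close>

function wave_sol :: "('n::finite \<times> 'n \<Rightarrow> real) \<Rightarrow> real \<Rightarrow> 'n \<Rightarrow> 'n \<Rightarrow> ('n multiset \<Rightarrow> real) \<Rightarrow> 'n multiset \<Rightarrow> real" where
  "wave_sol A \<kappa> b c f M =
    (if {#b, c#} \<subseteq># M then
       (f (M - {#b, c#}) - (\<Sum>p\<in>- ({b, c} \<times> {b, c}). A p * wave_sol A \<kappa> b c f (M - {#b, c#} + {#fst p, snd p#}))) / \<kappa>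
     else 0)"
  by auto
termination
proof (relation "Wellfounded.measure (\<lambda>(A, \<kappa>, b, c, f, M). size (filter_mset (\<lambda>x. x \<in> {b, c}) M))", goal_cases)
  case (2 A \<kappa> b c f M p)
  then obtain i j N where "p = (i, j)" "\<not> (i \<in> {b, c} \<and> j \<in> {b, c})" "M = N + {#b, c#}"
    by (metis ComplD SigmaI subset_mset.diff_add surj_pair)
  then show ?case by auto
qed simp

declare wave_sol.simps [simp del]

text \<open>Induction along the recursion of \<open>wave_sol\<close>: exchanging \<open>b\<close>,
  \<open>c\<close> for a pair not contained in {b, c} lowers the number of indices from {b,
  c}.\<close>

lemma wave_sol_induct:
  assumes "\<And>M. \<not> {#b, c#} \<subseteq># M \<Longrightarrow> P M"
    and "\<And>N. (\<And>p. p \<in> - ({b, c} \<times> {b, c}) \<Longrightarrow> P (N + {#fst p, snd p#})) \<Longrightarrow> P (N + {#b, c#})"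
  shows "P (M :: 'n multiset)"
proof (induction "size (filter_mset (\<lambda>x. x \<in> {b, c}) M)" arbitrary: M rule: less_induct)
  case less
  show ?case
  proof (cases "{#b, c#} \<subseteq># M")
    case True
    then obtain N where M: "M = N + {#b, c#}" by (metis subset_mset.diff_add)
    show ?thesis unfolding M
      by (rule assms(2), rule less) (auto simp: M)
  qed (rule assms(1))
qed

lemma wave_sol_step: 
  "wave_sol A \<kappa> b c f (N + {#b, c#}) =
    (f N - (\<Sum>p\<in>- ({b, c} \<times> {b, c}). A p * wave_sol A \<kappa> b c f (N + {#fst p, snd p#}))) / \<kappa>"
  by (subst wave_sol.simps) simp

lemma wave_sol_zero: "wave_sol A \<kappa> b c (\<lambda>_. 0) M = 0"
proof (induction M rule: wave_sol_induct[of b c])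
  case (1 M)
  then show ?case by (subst wave_sol.simps) simp
next
  case (2 N)
  show ?case unfolding wave_sol_step
    using 2 by (subst sum.neutral) simp_all
qed

text \<open>Since \<open>e\<close> is neither \<open>b\<close> nor \<open>c\<close>, an extra index
  \<open>e\<close> does not affect divisibility by the leading pair and is carried along by the
  recursion. The resulting commutation with the derivative is what yields harmonic
  antiderivatives.\<close>

lemma wave_sol_mder:
  assumes "e \<noteq> b" "e \<noteq> c"
  shows "wave_sol A \<kappa> b c (mder e f) M = wave_sol A \<kappa> b c f (add_mset e M)"
proof (induction M rule: wave_sol_induct[of b c])
  case (1 M)
  have "\<not> {#b, c#} \<subseteq># add_mset e M"
  proof
    assume "{#b, c#} \<subseteq># add_mset e M"
    moreover have "count {#b, c#} x \<le> count M x" if "count {#b, c#} x \<le> count (add_mset e M) x" for x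
      using that assms by (cases "x = e") auto
    ultimately have "{#b, c#} \<subseteq># M" by (meson subseteq_mset_def)
    with 1 show False by blast
  qed
  with 1 show ?case by (subst (1 2) wave_sol.simps) simp
next
  case (2 N)
  have "wave_sol A \<kappa> b c (mder e f) (N + {#b, c#}) =
    (f (add_mset e N) - (\<Sum>p\<in>- ({b, c} \<times> {b, c}). A p * wave_sol A \<kappa> b c f (add_mset e N + {#fst p, snd p#}))) / \<kappa>"
    unfolding wave_sol_step mder_def[of e f]
    by (intro arg_cong2[of _ _ _ _ "(/)"] arg_cong2[of _ _ _ _ "(-)"] sum.cong arg_cong2[of _ _ _ _ "(*)"] refl)
      (use 2 in \<open>simp add: mder_def add_mset_commute\<close>)
  also have "\<dots> = wave_sol A \<kappa> b c f (add_mset e N + {#b, c#})"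
    by (rule wave_sol_step[symmetric])
  finally show ?case by (simp add: add_mset_commute)
qed

text \<open>The entries of \<open>A\<close> with both indices in {b, c} act together as the single
  coefficient \<kappa> by which \<open>wave_sol\<close> divides; this covers a diagonal leading term
  as well as a pair of equal off-diagonal ones.\<close>

lemma wave_sol_box:
  fixes A :: "'n::finite \<times> 'n \<Rightarrow> real"
  assumes "\<kappa> \<noteq> 0" and \<kappa>: "\<And>F :: 'n \<times> 'n \<Rightarrow> real. (\<And>i j. F (i, j) = F (j, i)) \<Longrightarrow>
     (\<Sum>p\<in>{b, c} \<times> {b, c}. A p * F p) = \<kappa> * F (b, c)"
  shows "(\<Sum>i\<in>UNIV. \<Sum>j\<in>UNIV. A (i, j) * wave_sol A \<kappa> b c f (add_mset i (add_mset j M))) = f M"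
proof -
  let ?F = "\<lambda>p. wave_sol A \<kappa> b c f (M + {#fst p, snd p#})"
  have "(\<Sum>i\<in>UNIV. \<Sum>j\<in>UNIV. A (i, j) * wave_sol A \<kappa> b c f (add_mset i (add_mset j M))) = (\<Sum>p\<in>UNIV. A p * ?F p)"
    by (simp add: sum.cartesian_product) (simp add: split_def)
  also have "\<dots> = (\<Sum>p\<in>{b, c} \<times> {b, c}. A p * ?F p) + (\<Sum>p\<in>-({b, c} \<times> {b, c}). A p * ?F p)"
    by (subst sum.union_disjoint[symmetric]) (auto intro!: sum.cong)
  also have "(\<Sum>p\<in>{b, c} \<times> {b, c}. A p * ?F p) = \<kappa> * ?F (b, c)"
    by (rule \<kappa>) (simp add: add_mset_commute)
  also have "\<kappa> * ?F (b, c) = f M - (\<Sum>p\<in>- ({b, c} \<times> {b, c}). A p * ?F p)"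
    using \<open>\<kappa> \<noteq> 0\<close> wave_sol_step[of A \<kappa> b c f M] by simp
  finally show ?thesis by simp
qed

text \<open>A nonzero coefficient with both indices different from \<open>e\<close> is sought. A
  diagonal one is taken if there is any; otherwise the diagonal entries at \<open>b\<close> and
  \<open>c\<close> vanish, and the two off-diagonal terms give twice the entry as \<kappa>.\<close>

lemma leading_term:
  fixes \<gamma> G :: "real^'n^'n"
  assumes symg: "transpose \<gamma> = \<gamma>" and inv: "\<gamma> ** G = mat 1" and card3: "CARD('n::finite) \<ge> 3"
  obtains b c \<kappa> where "b \<noteq> e" "c \<noteq> e" "\<kappa> \<noteq> 0"
    "\<And>F :: 'n \<times> 'n \<Rightarrow> real. (\<And>i j. F (i, j) = F (j, i)) \<Longrightarrow>
     (\<Sum>p\<in>{b, c} \<times> {b, c}. \<gamma>$(fst p)$(snd p) * F p) = \<kappa> * F (b, c)"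
proof -
  have gs: "\<gamma>$i$j = \<gamma>$j$i" for i j
    using symg by (metis transpose_def vec_lambda_beta)
  show thesis
  proof (cases "\<exists>b. b \<noteq> e \<and> \<gamma>$b$b \<noteq> 0")
    case True
    then obtain b where "b \<noteq> e" "\<gamma>$b$b \<noteq> 0" by blast
    then show thesis by (intro that[of b b "\<gamma>$b$b"]) auto
  next
    case False
    have "\<exists>b c. b \<noteq> e \<and> c \<noteq> e \<and> \<gamma>$b$c \<noteq> 0"
    proof (rule ccontr)
      assume *: "\<not> ?thesis"
      have "\<exists>b c. b \<noteq> e \<and> c \<noteq> e \<and> b \<noteq> c"
      proof (rule ccontr)
        assume "\<not> ?thesis"
        then obtain x where "UNIV \<subseteq> {e, x}" by blast
        hence "CARD('n) \<le> card {e, x}" by (intro card_mono) auto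
        also have "\<dots> \<le> 2" by (simp add: card_insert_if)
        finally show False using card3 by simp
      qed
      then obtain b c where bc: "b \<noteq> e" "c \<noteq> e" "b \<noteq> c" by blast
      have row: "\<gamma>$i$k * G$k$j = (if k = e then \<gamma>$i$e * G$e$j else 0)" if "i \<noteq> e" for i j k
      proof (cases "k = e")
        case False
        with * that have "\<gamma>$i$k = 0" by blast
        with False show ?thesis by simp
      qed simp
      have "(\<Sum>k\<in>UNIV. \<gamma>$i$k * G$k$j) = \<gamma>$i$e * G$e$j" if "i \<noteq> e" for i j
        by (subst sum.cong[OF refl row[OF that]]) simp
      hence "\<gamma>$i$e * G$e$j = (if i = j then 1 else 0)" if "i \<noteq> e" for i j
        using that arg_cong[OF inv, of "\<lambda>A. A$i$j"] by (simp add: matrix_matrix_mult_def mat_def)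
      \<comment> \<open>If all entries away from \<open>e\<close> vanished, then \<gamma>_be G_eb =
        1, \<gamma>_be G_ec = 0 and \<gamma>_ce G_ec = 1, which is impossible.\<close>
      from this[of b b] this[of b c] this[of c c] bc show False by auto
    qed
    then obtain b c where bc: "b \<noteq> e" "c \<noteq> e" "\<gamma>$b$c \<noteq> 0" by blast
    with False have "b \<noteq> c" "\<gamma>$b$b = 0" "\<gamma>$c$c = 0" by auto
    with bc show thesis
      by (intro that[of b c "2 * \<gamma>$b$c"]) (auto simp: sum.cartesian_product[symmetric] gs[of c b] simp flip: split_def)
  qed
qed

lemma wave_system_series:
  fixes \<gamma> G :: "real^'n::finite^'n"
  assumes symG: "transpose G = G" and symg: "transpose \<gamma> = \<gamma>" and inv: "\<gamma> ** G = mat 1"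
    and card3: "CARD('n) \<ge> 3"
  shows "wave_system (mder :: 'n \<Rightarrow> ('n multiset \<Rightarrow> real) \<Rightarrow> _) G \<gamma> e"
proof -
  obtain b c \<kappa> where bc: "b \<noteq> e" "c \<noteq> e" "\<kappa> \<noteq> 0"
    and \<kappa>: "\<And>F :: 'n \<times> 'n \<Rightarrow> real. (\<And>i j. F (i, j) = F (j, i)) \<Longrightarrow>
     (\<Sum>p\<in>{b, c} \<times> {b, c}. \<gamma>$(fst p)$(snd p) * F p) = \<kappa> * F (b, c)"
    by (rule leading_term[OF symg inv card3]) blast
  define E where "E = wave_sol (\<lambda>p. \<gamma>$(fst p)$(snd p)) \<kappa> b c"
  define B where "B u = (\<Sum>i\<in>UNIV. \<Sum>j\<in>UNIV. \<gamma>$i$j *\<^sub>R mder i (mder j u))" for u :: "'n multiset \<Rightarrow> real"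
  have B: "B u M = (\<Sum>i\<in>UNIV. \<Sum>j\<in>UNIV. \<gamma>$i$j * u (add_mset i (add_mset j M)))" for u M
    unfolding B_def by (simp add: sum_fun_apply scaleR_fun_def mder_def add_mset_commute)
  have BE: "B (E f) = f" for f
    using wave_sol_box[OF bc(3) \<kappa>, of f] by (simp add: fun_eq_iff B E_def)
  have Ed: "mder e (E f) = E (mder e f)" for f
    using bc by (simp add: fun_eq_iff E_def wave_sol_mder mder_def[of e "wave_sol _ _ _ _ _"])
  have E0: "E 0 = 0" by (simp add: E_def fun_eq_iff wave_sol_zero zero_fun_def)
  \<comment> \<open>The antiderivative in direction \<open>e\<close> that vanishes on the hyperplane
    where this coordinate is zero.\<close>
  define I where "I f M = (if e \<in># M then f (M - {#e#}) else 0)" for f :: "'n multiset \<Rightarrow> real" and M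
  have dI: "mder e (I f) = f" for f by (simp add: fun_eq_iff mder_def I_def)
  have Bd: "B (mder e u) = mder e (B u)" for u
    by (simp add: fun_eq_iff B mder_def add_mset_commute)
  have Bdiff: "B (u - v) = B u - B v" for u v
    by (simp add: fun_eq_iff B right_diff_distrib sum_subtractf)
  have "\<exists>w. B w = 0 \<and> mder e w = u" if "B u = 0" for u
  proof (intro exI conjI)
    \<comment> \<open>\<open>E\<close> removes the defect of the antiderivative. As \<open>E\<close>
      and \<open>B\<close> commute with \<open>mder e\<close>, the derivative of the correction is E
      (B u) = 0.\<close>
    let ?w = "I u - E (B (I u))"
    show "B ?w = 0" by (simp add: Bdiff BE)
    show "mder e ?w = u"
      using that by (simp add: linear_diff[OF linear_mder] dI Ed Bd[symmetric] E0)
  qed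
  then show ?thesis
    using symG symg inv card3 BE dI
    by (unfold_locales) (auto simp: linear_add[OF linear_mder] linear_scale[OF linear_mder] mder_commute B_def)
qed

section \<open>Spencer cohomology\<close>

lemma linear_right_inverse_on:
  assumes "linear (f :: 'a::real_vector \<Rightarrow> 'b::real_vector)" "subspace V"
  obtains g where "linear g" "\<And>v. v \<in> f ` V \<Longrightarrow> f (g v) = v" "\<And>v. g v \<in> V"
proof -
  have "Vector_Spaces.linear (*\<^sub>R) (*\<^sub>R) f" using assms(1) by (simp add: linear_def)
  moreover have "module.subspace (*\<^sub>R) V" using assms(2) by (simp add: subspace_raw_def)
  moreover have "vector_space_pair ((*\<^sub>R) :: real \<Rightarrow> 'a \<Rightarrow> 'a) ((*\<^sub>R) :: real \<Rightarrow> 'b \<Rightarrow> 'b)"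
    by (simp add: vector_space_pair_def real_vector.vector_space_axioms)
  ultimately obtain g where "g ` UNIV \<subseteq> V" "Vector_Spaces.linear (*\<^sub>R) (*\<^sub>R) g" "\<forall>v\<in>f ` V. f (g v) = v"
    using vector_space_pair.linear_exists_right_inverse_on[of "(*\<^sub>R)" "(*\<^sub>R)" f V] by metis
  thus thesis by (intro that[of g]) (auto simp: linear_def)
qed

lemma scaleR_apply: "(c *\<^sub>R f) x = c *\<^sub>R f x"
  by (simp add: scaleR_fun_def)

section \<open>Symmetric tensors and alternating forms as functions of index lists\<close>

definition symf :: "('n list \<Rightarrow> 'v) \<Rightarrow> bool"
  where "symf f \<longleftrightarrow> (\<forall>is js. mset is = mset js \<longrightarrow> f is = f js)"

definition shift :: "'n \<Rightarrow> ('n list \<Rightarrow> 'v) \<Rightarrow> 'n list \<Rightarrow> 'v"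
  where "shift i f = (\<lambda>is. f (i # is))"

definition alternating :: "('n list \<Rightarrow> 'v::ab_group_add) \<Rightarrow> bool"
  where "alternating \<omega> \<longleftrightarrow> (\<forall>us a b vs. \<omega> (us @ a # b # vs) = - \<omega> (us @ b # a # vs))"

lemma symfD: "symf f \<Longrightarrow> mset is = mset js \<Longrightarrow> f is = f js"
  unfolding symf_def by blast

lemma symf_shift: "symf f \<Longrightarrow> symf (shift i f)"
  by (simp add: symf_def shift_def)

lemma symf_add: "symf f \<Longrightarrow> symf g \<Longrightarrow> symf (f + g)"
  unfolding symf_def plus_fun_def by metis

lemma symf_scaleR: "symf f \<Longrightarrow> symf (c *\<^sub>R f)"
  unfolding symf_def scaleR_fun_def by metis

lemma symf_zero: "symf 0"
  by (simp add: symf_def)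

lemma shift_commute: "symf f \<Longrightarrow> shift i (shift j f) = shift j (shift i f)"
  unfolding shift_def by (rule ext, erule symfD) simp

text \<open>Adjacent swaps bring the head of one list to the front of the other; the tails are
  handled by induction.\<close>

lemma symf_via_swaps:
  assumes "\<And>us a b vs. f (us @ a # b # vs) = f (us @ b # a # vs)"
  shows "symf f"
proof -
  have "f is = f js" if "mset is = mset js" for "is" js :: "'a list"
    using that assms
  proof (induction "is" arbitrary: js f)
    case (Cons a "is")
    from Cons.prems(1) obtain us vs where js: "js = us @ a # vs"
      by (metis list.set_intros(1) set_mset_mset split_list)
    have mv: "f (xs @ us @ a # vs) = f (xs @ a # us @ vs)" for xs
    proof (induction us arbitrary: xs)
      case (Cons u us)
      from Cons[of "xs @ [u]"] show ?case using \<open>\<And>us a b vs. f (us @ a # b # vs) = f (us @ b # a # vs)\<close>[of xs a u "us @ vs"] by simp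
    qed simp
    have "f (a # is) = f (a # us @ vs)"
      using Cons.prems(2)[of "a # _"] by (intro Cons.IH[where f = "\<lambda>l. f (a # l)"]) (use Cons.prems(1) js in auto)
    with mv[of "[]"] show ?case by (simp add: js)
  qed simp
  thus ?thesis unfolding symf_def by blast
qed

lemma sym_tensors_iff:
  "f \<in> sym_tensors t N \<longleftrightarrow> symf f \<and> (\<forall>is. length is = t \<longrightarrow> f is \<in> N) \<and> (\<forall>is. length is \<noteq> t \<longrightarrow> f is = 0)"
  unfolding sym_tensors_def symf_def by blast

lemma subspace_sym_tensors:
  assumes "subspace N" shows "subspace (sym_tensors t N :: ('n list \<Rightarrow> 'v::real_vector) set)"
proof (rule subspaceI)
  show "0 \<in> sym_tensors t N" using subspace_0[OF assms] by (simp add: sym_tensors_iff symf_zero)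
  fix f g :: "'n list \<Rightarrow> 'v" and c :: real
  assume f: "f \<in> sym_tensors t N"
  show "c *\<^sub>R f \<in> sym_tensors t N"
    using f subspace_scale[OF assms] by (simp add: sym_tensors_iff symf_scaleR) (simp add: scaleR_fun_def)
  assume g: "g \<in> sym_tensors t N"
  show "f + g \<in> sym_tensors t N"
    using f g subspace_add[OF assms] by (simp add: sym_tensors_iff symf_add)
qed

lemma spencer_delta_Nil: "spencer_delta \<omega> [] = 0"
  by (simp add: spencer_delta_def fun_eq_iff)

text \<open>Splitting off the first form index replaces the bookkeeping of signs by an induction on
  the list.\<close>

lemma spencer_delta_Cons:
  "spencer_delta \<omega> (a # js) is = \<omega> js (a # is) - spencer_delta (\<lambda>ks. \<omega> (a # ks)) js is"
  unfolding spencer_delta_def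
  by (simp only: length_Cons sum.lessThan_Suc_shift) (simp add: del_nth_def sum_negf)

lemma spencer_delta_eq:
  "spencer_delta \<omega> js = (\<Sum>m<length js. (-1) ^ m *\<^sub>R shift (js ! m) (\<omega> (del_nth m js)))"
proof -
  have "(\<Sum>m\<in>A. F m) x = (\<Sum>m\<in>A. F m x)" for F :: "nat \<Rightarrow> 'a list \<Rightarrow> 'b" and A x
    by (induction A rule: infinite_finite_induct) simp_all
  thus ?thesis by (simp add: fun_eq_iff spencer_delta_def shift_def scaleR_fun_def)
qed

lemma spencer_delta_diff: "spencer_delta (\<omega> - \<eta>) = spencer_delta \<omega> - spencer_delta \<eta>"
  and spencer_delta_add: "spencer_delta (\<omega> + \<eta>) = spencer_delta \<omega> + spencer_delta \<eta>"
  and spencer_delta_scaleR: "spencer_delta (c *\<^sub>R \<omega>) = c *\<^sub>R spencer_delta \<omega>"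
  and spencer_delta_0: "spencer_delta 0 = 0"
  by (simp_all add: spencer_delta_def fun_eq_iff scaleR_diff_right scaleR_add_right sum_subtractf
       sum.distrib scaleR_fun_def scaleR_sum_right mult.commute)

lemma spencer_delta_neg: "spencer_delta (- \<omega>) = - spencer_delta \<omega>"
  by (simp add: spencer_delta_def fun_eq_iff sum_negf)

lemma alternatingI: "(\<And>us a b vs. \<omega> (us @ a # b # vs) = - \<omega> (us @ b # a # vs)) \<Longrightarrow> alternating \<omega>"
  unfolding alternating_def by blast

lemma alternating_swap: "alternating \<omega> \<Longrightarrow> \<omega> (us @ a # b # vs) = - \<omega> (us @ b # a # vs)"
  unfolding alternating_def by blast

lemma alternating_shift:
  assumes "alternating \<omega>" shows "alternating (\<lambda>ks. shift c (\<omega> ks))"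
proof (rule alternatingI)
  fix us a b vs
  from alternating_swap[OF assms, of us a b vs]
  show "shift c (\<omega> (us @ a # b # vs)) = - shift c (\<omega> (us @ b # a # vs))"
    by (simp add: shift_def fun_eq_iff)
qed

lemma alternating_add:
  assumes "alternating \<omega>" "alternating \<eta>" shows "alternating (\<omega> + \<eta>)"
proof (rule alternatingI)
  fix us a b vs
  from assms[THEN alternating_swap, of us a b vs]
  show "(\<omega> + \<eta>) (us @ a # b # vs) = - (\<omega> + \<eta>) (us @ b # a # vs)" by simp
qed

lemma alternating_scaleR:
  fixes \<omega> :: "'n list \<Rightarrow> 'v::real_vector"
  assumes "alternating \<omega>" shows "alternating (c *\<^sub>R \<omega>)"
proof (rule alternatingI)
  fix us a b vs
  from alternating_swap[OF assms, of us a b vs]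
  show "(c *\<^sub>R \<omega>) (us @ a # b # vs) = - (c *\<^sub>R \<omega>) (us @ b # a # vs)" by (simp add: scaleR_apply)
qed

lemma alternating_Cons: "alternating \<omega> \<Longrightarrow> alternating (\<lambda>ks. \<omega> (a # ks))"
  unfolding alternating_def by (metis append_Cons)

lemma alternatingD: "alternating \<omega> \<Longrightarrow> \<omega> (a # b # vs) = - \<omega> (b # a # vs)"
  unfolding alternating_def by (metis append_Nil)

lemma alternating_spencer_delta:
  assumes "alternating \<omega>" shows "alternating (spencer_delta \<omega>)"
proof -
  have "spencer_delta \<omega> (us @ a # b # vs) is = - spencer_delta \<omega> (us @ b # a # vs) is" for us a b vs "is"
    using assms
  proof (induction us arbitrary: \<omega>)
    case Nil
    have "(\<lambda>ks. \<omega> (a # b # ks)) = 0 - (\<lambda>ks. \<omega> (b # a # ks))"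
      by (intro ext, subst alternatingD[OF Nil]) simp
    then have "spencer_delta (\<lambda>ks. \<omega> (a # b # ks)) = - spencer_delta (\<lambda>ks. \<omega> (b # a # ks))"
      by (simp only: spencer_delta_diff spencer_delta_0) simp
    then show ?case by (simp add: spencer_delta_Cons)
  next
    case (Cons c us)
    show ?case
      using Cons.IH[OF alternating_Cons[OF Cons.prems, of c]] alternating_swap[OF Cons.prems, of us a b vs]
      by (simp add: spencer_delta_Cons)
  qed
  thus ?thesis by (intro alternatingI ext, unfold uminus_apply)
qed

lemma spencer_delta_shift:
  assumes "\<And>ks. symf (\<omega> ks)"
  shows "spencer_delta (\<lambda>ks. shift b (\<omega> ks)) js is = spencer_delta \<omega> js (b # is)"
  unfolding spencer_delta_def shift_def
  by (intro sum.cong refl arg_cong2[of _ _ _ _ "(*\<^sub>R)"] symfD[OF assms]) simp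

lemma symf_spencer_delta:
  assumes "\<And>ks. symf (\<omega> ks)" shows "symf (spencer_delta \<omega> js)"
  unfolding symf_def spencer_delta_def
  by (intro allI impI sum.cong refl arg_cong2[of _ _ _ _ "(*\<^sub>R)"] symfD[OF assms]) simp

text \<open>When both differentials are expanded along the first form index, the cross terms agree
  by \<open>spencer_delta_shift\<close> and have opposite signs.\<close>

lemma spencer_delta_delta:
  assumes "\<And>ks. symf (\<omega> ks)" shows "spencer_delta (spencer_delta \<omega>) js is = 0"
  using assms
proof (induction js arbitrary: \<omega> "is")
  case (Cons a js)
  have *: "(\<lambda>ks. spencer_delta \<omega> (a # ks)) = (\<lambda>ks. shift a (\<omega> ks)) - spencer_delta (\<lambda>ks. \<omega> (a # ks))"
    by (simp add: fun_eq_iff spencer_delta_Cons shift_def)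
  show ?case
    unfolding spencer_delta_Cons[of "spencer_delta \<omega>"] * spencer_delta_diff
    using Cons.IH[of "\<lambda>ks. \<omega> (a # ks)"] by (simp add: spencer_delta_shift Cons.prems)
qed (simp add: spencer_delta_Nil)

text \<open>The homotopy operator: contraction of a form with the Euler vector field.\<close>

primrec koszul :: "('n list \<Rightarrow> 'n list \<Rightarrow> 'v::real_vector) \<Rightarrow> 'n list \<Rightarrow> 'n list \<Rightarrow> 'v" where
  "koszul \<omega> js [] = 0"
| "koszul \<omega> js (b # is) = \<omega> (b # js) is + koszul (\<lambda>ks. shift b (\<omega> ks)) js is"

lemma koszul_diff: "koszul (\<omega> - \<eta>) js is = koszul \<omega> js is - koszul \<eta> js is"
proof (induction "is" arbitrary: \<omega> \<eta>)
  case (Cons b "is")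
  from Cons[of "\<lambda>ks. shift b (\<omega> ks)" "\<lambda>ks. shift b (\<eta> ks)"]
  show ?case by (simp add: shift_def fun_diff_def)
qed simp

lemma koszul_scaleR: "koszul (c *\<^sub>R \<omega>) js is = c *\<^sub>R koszul \<omega> js is"
proof (induction "is" arbitrary: \<omega>)
  case (Cons b "is")
  from Cons[of "\<lambda>ks. shift b (\<omega> ks)"]
  show ?case by (simp add: shift_def scaleR_fun_def scaleR_add_right)
qed simp

lemma koszul_neg: "koszul (- \<omega>) js is = - koszul \<omega> js is"
  using koszul_scaleR[of "-1" \<omega> js "is"] by simp

lemma koszul_add: "koszul (\<omega> + \<eta>) js is = koszul \<omega> js is + koszul \<eta> js is"
  using koszul_diff[of \<omega> "- \<eta>" js "is"] by (simp add: koszul_neg)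

lemma linear_koszul: "linear koszul"
  by (rule linearI; rule ext; rule ext) (simp_all only: plus_fun_apply scaleR_apply koszul_add koszul_scaleR)

lemma linear_spencer_delta: "linear spencer_delta"
  by (rule linearI) (simp_all add: spencer_delta_add spencer_delta_scaleR)

text \<open>Moving the contracted index past the first form index costs one sign.\<close>

lemma koszul_Cons_alternating:
  assumes "alternating \<omega>"
  shows "koszul \<omega> (a # ks) is = - koszul (\<lambda>ls. \<omega> (a # ls)) ks is"
  using assms
proof (induction "is" arbitrary: \<omega>)
  case (Cons b "is")
  have "alternating (\<lambda>ks. shift b (\<omega> ks))"
    by (rule alternating_shift) (rule Cons.prems)
  from Cons.IH[OF this] show ?case
    using alternatingD[OF Cons.prems, of a b ks] by simp
qed simp

text \<open>Cartan's formula for the Euler vector field, whose Lie derivative multiplies by the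
  total degree. The induction runs over the form indices; for 0-forms it runs over the symmetric
  indices instead.\<close>

lemma koszul_homotopy:
  assumes "alternating \<omega>" "\<And>ks. symf (\<omega> ks)"
  shows "spencer_delta (koszul \<omega>) js is + koszul (spencer_delta \<omega>) js is
    = real (length js + length is) *\<^sub>R \<omega> js is"
  using assms
proof (induction js arbitrary: \<omega> "is")
  case Nil
  show ?case using Nil
  proof (induction "is" arbitrary: \<omega>)
    case (Cons b "is")
    have "alternating (\<lambda>ks. shift b (\<omega> ks))"
      by (rule alternating_shift) (rule Cons.prems)
    from Cons.IH[OF this symf_shift[OF Cons.prems(2)]]
    have IH: "koszul (spencer_delta (\<lambda>ks. shift b (\<omega> ks))) [] is = real (length is) *\<^sub>R \<omega> [] (b # is)"
      by (simp add: spencer_delta_Nil) (simp add: shift_def)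
    have eq: "(\<lambda>ks. shift b (spencer_delta \<omega> ks)) = spencer_delta (\<lambda>ks. shift b (\<omega> ks))"
      by (intro ext) (simp only: spencer_delta_shift[of \<omega>, OF Cons.prems(2)], simp only: shift_def)
    show ?case
      by (simp add: spencer_delta_Nil spencer_delta_Cons eq IH scaleR_add_left)
  qed (simp add: spencer_delta_Nil)
next
  case (Cons a js)
  have eq: "(\<lambda>ks. koszul \<omega> (a # ks)) = - koszul (\<lambda>ks. \<omega> (a # ks))"
    by (simp add: fun_eq_iff koszul_Cons_alternating[OF Cons.prems(1)])
  have 1: "spencer_delta (koszul \<omega>) (a # js) is = \<omega> (a # js) is + koszul (\<lambda>ks. shift a (\<omega> ks)) js is
      + spencer_delta (koszul (\<lambda>ks. \<omega> (a # ks))) js is"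
    unfolding spencer_delta_Cons eq spencer_delta_neg by simp
  have eq': "(\<lambda>ks. spencer_delta \<omega> (a # ks)) = (\<lambda>ks. shift a (\<omega> ks)) - spencer_delta (\<lambda>ks. \<omega> (a # ks))"
    by (simp add: fun_eq_iff spencer_delta_Cons shift_def)
  have 2: "koszul (spencer_delta \<omega>) (a # js) is = - koszul (\<lambda>ks. shift a (\<omega> ks)) js is
      + koszul (spencer_delta (\<lambda>ks. \<omega> (a # ks))) js is"
    unfolding koszul_Cons_alternating[OF alternating_spencer_delta[OF Cons.prems(1)]] eq' koszul_diff by simp
  from Cons.IH[OF alternating_Cons[OF Cons.prems(1)], of a "is"] Cons.prems(2)
  show ?case unfolding 1 2 by (simp add: algebra_simps)
qed

lemma symf_koszul:
  assumes "\<And>ks. symf (\<omega> ks)" shows "symf (koszul \<omega> js)"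
proof (rule symf_via_swaps)
  fix us a b vs
  show "koszul \<omega> js (us @ a # b # vs) = koszul \<omega> js (us @ b # a # vs)"
    using assms
  proof (induction us arbitrary: \<omega>)
    case Nil
    then show ?case by (simp add: shift_commute[of _ a b]) (simp add: shift_def)
  next
    case (Cons c us)
    have "\<omega> (c # js) (us @ a # b # vs) = \<omega> (c # js) (us @ b # a # vs)"
      by (rule symfD[OF Cons.prems]) simp
    with Cons show ?case by (simp add: symf_shift)
  qed
qed

lemma alternating_koszul:
  assumes "alternating \<omega>" shows "alternating (koszul \<omega>)"
proof -
  have "koszul \<omega> (us @ a # b # vs) is = - koszul \<omega> (us @ b # a # vs) is" for us a b vs "is"
    using assms
  proof (induction "is" arbitrary: \<omega>)
    case (Cons c "is")
    have "alternating (\<lambda>ks. shift c (\<omega> ks))"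
      by (rule alternating_shift) (rule Cons.prems)
    from Cons.IH[OF this] show ?case
      using alternating_swap[OF Cons.prems, of "c # us" a b vs] by simp
  qed simp
  thus ?thesis by (intro alternatingI ext, unfold uminus_apply)
qed

lemma koszul_in:
  assumes "subspace N" "\<And>ks ls. \<omega> ks ls \<in> N" shows "koszul \<omega> js is \<in> N"
  using assms(2)
proof (induction "is" arbitrary: \<omega>)
  case (Cons b "is")
  then show ?case using subspace_add[OF assms(1)] by (simp add: shift_def)
qed (simp add: subspace_0[OF assms(1)])

text \<open>The offset \<open>c\<close> counts indices already consumed by \<open>shift\<close>; it
  makes the induction work and is 0 in the application.\<close>

lemma koszul_support:
  assumes "\<And>ks ls. \<omega> ks ls \<noteq> 0 \<Longrightarrow> length ks = Suc j \<and> length ls + c = i"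
    and "koszul \<omega> js is \<noteq> 0"
  shows "length js = j \<and> length is + c = Suc i"
  using assms
proof (induction "is" arbitrary: \<omega> c)
  case (Cons b "is")
  show ?case
  proof (cases "\<omega> (b # js) is = 0")
    case False
    then show ?thesis using Cons.prems(1) by fastforce
  next
    case True
    with Cons.prems(2) have "koszul (\<lambda>ks. shift b (\<omega> ks)) js is \<noteq> 0" by simp
    moreover have "length ks = Suc j \<and> length ls + Suc c = i" if "shift b (\<omega> ks) ls \<noteq> 0" for ks ls
      using Cons.prems(1)[of ks "b # ls"] that by (simp add: shift_def)
    ultimately show ?thesis using Cons.IH[of "\<lambda>ks. shift b (\<omega> ks)" "Suc c"] by fastforce
  qed
qed simp

section \<open>Cochains with values in symmetric tensors\<close>

lemma cochains_iff:
  "\<omega> \<in> cochains g i j \<longleftrightarrow> (\<forall>js. \<omega> js \<in> g i) \<and> (\<forall>js. length js \<noteq> j \<longrightarrow> \<omega> js = 0) \<and> alternating \<omega>"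
  by (simp add: cochains_def alternating_def)

abbreviation tensor_cochains :: "'v::real_vector set \<Rightarrow> nat \<Rightarrow> nat \<Rightarrow> ('n, 'v) cochain set"
  where "tensor_cochains N \<equiv> cochains (\<lambda>t. sym_tensors t N)"

lemma subspace_cochains:
  assumes "subspace (g i)" shows "subspace (cochains g i j :: ('n, 'v::real_vector) cochain set)"
proof (rule subspaceI)
  show "0 \<in> cochains g i j" using subspace_0[OF assms] by (simp add: cochains_iff alternating_def)
  fix \<omega> \<eta> :: "('n, 'v) cochain" and c :: real
  assume w: "\<omega> \<in> cochains g i j"
  show "c *\<^sub>R \<omega> \<in> cochains g i j"
    using w subspace_scale[OF assms] by (simp add: cochains_iff alternating_scaleR scaleR_apply)
  assume n: "\<eta> \<in> cochains g i j"
  show "\<omega> + \<eta> \<in> cochains g i j"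
    using w n subspace_add[OF assms] by (simp add: cochains_iff alternating_add)
qed

lemma tensor_cochains_iff:
  assumes "subspace N"
  shows "\<omega> \<in> tensor_cochains N i j \<longleftrightarrow> (\<forall>js. symf (\<omega> js)) \<and> (\<forall>js is. \<omega> js is \<in> N) \<and>
     (\<forall>js is. \<omega> js is \<noteq> 0 \<longrightarrow> length js = j \<and> length is = i) \<and> alternating \<omega>"
  using subspace_0[OF assms] unfolding cochains_iff sym_tensors_iff fun_eq_iff zero_fun_apply by metis

lemma koszul_cochains:
  assumes "subspace N" "\<omega> \<in> tensor_cochains N i (Suc j)"
  shows "koszul \<omega> \<in> tensor_cochains N (Suc i) j"
proof -
  note w = assms(2)[unfolded tensor_cochains_iff[OF assms(1)]]
  have "symf (koszul \<omega> js)" for js using w symf_koszul by blast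
  moreover have "alternating (koszul \<omega>)" using w alternating_koszul by blast
  moreover have "koszul \<omega> js is \<in> N" for js "is" using w koszul_in[OF assms(1)] by blast
  moreover have "length js = j \<and> length is = Suc i" if "koszul \<omega> js is \<noteq> 0" for js "is"
    using koszul_support[of \<omega> j 0 i, OF _ that] w by simp
  ultimately show ?thesis unfolding tensor_cochains_iff[OF assms(1)] by blast
qed

lemma koszul_cochains_0:
  assumes "subspace N" "\<omega> \<in> tensor_cochains N i 0" shows "koszul \<omega> = 0"
proof -
  have "\<omega> ks ls = 0" if "ks \<noteq> []" for ks ls
    using assms(2) that unfolding tensor_cochains_iff[OF assms(1)] by (metis length_0_conv)
  hence "koszul \<omega> js is = 0" for js "is"
  proof (induction "is" arbitrary: \<omega>)
    case (Cons b "is")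
    have "koszul (\<lambda>ks. shift b (\<omega> ks)) js is = 0"
      using Cons.prems by (intro Cons.IH) (simp add: shift_def)
    with Cons.prems show ?case by simp
  qed simp
  thus ?thesis by (simp add: fun_eq_iff)
qed

lemma spencer_delta_cochains:
  assumes N: "subspace N" and \<omega>: "\<omega> \<in> tensor_cochains N (Suc i) j"
  shows "spencer_delta \<omega> \<in> tensor_cochains N i (Suc j)"
proof -
  note w = \<omega>[unfolded tensor_cochains_iff[OF N]]
  have "spencer_delta \<omega> js is \<in> N" for js "is"
    using w unfolding spencer_delta_def by (intro subspace_sum[OF N] subspace_scale[OF N]) auto
  moreover have "length js = Suc j \<and> length is = i" if nz: "spencer_delta \<omega> js is \<noteq> 0" for js "is"
  proof -
    obtain m where "m < length js" "\<omega> (del_nth m js) (js ! m # is) \<noteq> 0"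
      using nz unfolding spencer_delta_def by (metis (no_types, lifting) lessThan_iff scaleR_zero_right sum.neutral)
    with w have "length (del_nth m js) = j" "length is = i" "m < length js" by fastforce+
    thus ?thesis by (auto simp: del_nth_def)
  qed
  moreover have "symf (spencer_delta \<omega> js)" for js using w symf_spencer_delta by blast
  moreover have "alternating (spencer_delta \<omega>)" using w alternating_spencer_delta by blast
  ultimately show ?thesis unfolding tensor_cochains_iff[OF N] by blast
qed

lemma spencer_delta_cochains_0:
  assumes N: "subspace N" and \<omega>: "\<omega> \<in> tensor_cochains N 0 j" shows "spencer_delta \<omega> = 0"
proof -
  have "\<omega> ks (b # ls) = 0" for ks b ls
    using \<omega> unfolding tensor_cochains_iff[OF N] by (metis length_0_conv list.discI)
  thus ?thesis by (simp add: fun_eq_iff spencer_delta_def)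
qed

lemma tensor_homotopy:
  assumes N: "subspace N" and \<omega>: "\<omega> \<in> tensor_cochains N i j"
  shows "spencer_delta (koszul \<omega>) + koszul (spencer_delta \<omega>) = real (i + j) *\<^sub>R \<omega>"
proof -
  have "real (length js + length is) *\<^sub>R \<omega> js is = real (i + j) *\<^sub>R \<omega> js is" for js "is"
    using \<omega>[unfolded tensor_cochains_iff[OF N]] by (cases "\<omega> js is = 0") auto
  moreover have "alternating \<omega>" "symf (\<omega> ks)" for ks
    using \<omega> unfolding tensor_cochains_iff[OF N] by blast+
  ultimately show ?thesis
    by (intro ext) (simp only: plus_fun_apply koszul_homotopy scaleR_apply)
qed

text \<open>The homotopy formula is divided by the total degree, which is positive because the form
  degree is.\<close>

lemma poincare:
  assumes N: "subspace N" and \<omega>: "\<omega> \<in> tensor_cochains N i (Suc j)" and closed: "spencer_delta \<omega> = 0"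
  shows "\<exists>\<eta>\<in>tensor_cochains N (Suc i) j. spencer_delta \<eta> = \<omega>"
proof
  let ?\<eta> = "(1 / real (i + Suc j)) *\<^sub>R koszul \<omega>"
  show "?\<eta> \<in> tensor_cochains N (Suc i) j"
    by (intro subspace_scale subspace_cochains subspace_sym_tensors koszul_cochains assms)
  have "koszul (spencer_delta \<omega>) = 0" unfolding closed by (rule linear_0[OF linear_koszul])
  with tensor_homotopy[OF N \<omega>] have "spencer_delta (koszul \<omega>) = real (i + Suc j) *\<^sub>R \<omega>" by simp
  thus "spencer_delta ?\<eta> = \<omega>" by (simp add: spencer_delta_scaleR)
qed

text \<open>Contraction kills 0-forms, so the homotopy formula reads 0 = i \<omega>.\<close>

lemma closed_0_form:
  assumes N: "subspace N" and \<omega>: "\<omega> \<in> tensor_cochains N i 0" and closed: "spencer_delta \<omega> = 0" and "i > 0"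
  shows "\<omega> = 0"
  using tensor_homotopy[OF N \<omega>] closed koszul_cochains_0[OF N \<omega>] \<open>i > 0\<close>
  by (simp add: spencer_delta_0 linear_0[OF linear_koszul])

section \<open>Cohomology groups as quotient spaces\<close>

lemma subspace_ker: "linear f \<Longrightarrow> subspace {x. f x = 0}"
  by (simp add: subspace_def linear_add linear_scale linear_0)

lemma subspace_tensor_cochains: "subspace V \<Longrightarrow> subspace (tensor_cochains V i j)"
  by (rule subspace_cochains) (rule subspace_sym_tensors)

lemma subspace_cocycles:
  assumes "subspace (g i)" shows "subspace (cocycles g i j)"
  unfolding cocycles_def
  using subspace_inter[OF subspace_cochains[where g = g and i = i, OF assms] subspace_ker[OF linear_spencer_delta]] by (simp add: Int_def)

lemma subspace_coboundaries:
  assumes "subspace (g (Suc i))" shows "subspace (coboundaries g i j)"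
  using linear_subspace_image[OF linear_spencer_delta subspace_cochains[where g = g and i = "Suc i", OF assms]]
  by (simp add: coboundaries_def subspace_single_0)

lemma cohomology_class_eq_iff:
  assumes B: "subspace (coboundaries g i j)"
  shows "cohomology_class g i j \<omega> = cohomology_class g i j \<eta> \<longleftrightarrow> \<omega> - \<eta> \<in> coboundaries g i j"
proof
  assume eq: "cohomology_class g i j \<omega> = cohomology_class g i j \<eta>"
  have "\<omega> + 0 \<in> cohomology_class g i j \<omega>"
    unfolding cohomology_class_def by (rule imageI) (rule subspace_0[OF B])
  hence "\<omega> + 0 \<in> cohomology_class g i j \<eta>" unfolding eq .
  then obtain \<beta> where "\<beta> \<in> coboundaries g i j" "\<omega> = \<eta> + \<beta>"
    unfolding cohomology_class_def by auto
  thus "\<omega> - \<eta> \<in> coboundaries g i j" by simp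
next
  have sub: "cohomology_class g i j \<omega> \<subseteq> cohomology_class g i j \<eta>" if "\<omega> - \<eta> \<in> coboundaries g i j" for \<omega> \<eta>
  proof
    fix x assume "x \<in> cohomology_class g i j \<omega>"
    then obtain \<beta> where "\<beta> \<in> coboundaries g i j" "x = \<eta> + ((\<omega> - \<eta>) + \<beta>)"
      unfolding cohomology_class_def by auto
    thus "x \<in> cohomology_class g i j \<eta>"
      unfolding cohomology_class_def using subspace_add[OF B that] by blast
  qed
  assume *: "\<omega> - \<eta> \<in> coboundaries g i j"
  hence "\<eta> - \<omega> \<in> coboundaries g i j" using subspace_neg[OF B] by force
  with * show "cohomology_class g i j \<omega> = cohomology_class g i j \<eta>" using sub by blast
qed

lemma cohomology_zeroI:
  assumes "subspace (g i)" "subspace (g (Suc i))" "cocycles g i j \<subseteq> coboundaries g i j"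
  shows "cohomology_zero g i j"
proof -
  have "cohomology_class g i j \<omega> = cohomology_class g i j 0" if "\<omega> \<in> cocycles g i j" for \<omega>
    using that assms(3) by (subst cohomology_class_eq_iff[OF subspace_coboundaries[of g i, OF assms(2)]]) auto
  moreover have "0 \<in> cocycles g i j" by (rule subspace_0[OF subspace_cocycles[of g i, OF assms(1)]])
  ultimately show ?thesis unfolding cohomology_zero_def spencer_cohomology_def by blast
qed

text \<open>The isomorphism theorem. Since classes are sets, the map induced by
  \<open>\<phi>\<close> evaluates it on a chosen representative, and the kernel condition makes the
  choice irrelevant.\<close>

lemma cohomology_isoI:
  assumes g: "subspace (g i)" "subspace (g (Suc i))" and \<phi>: "linear \<phi>"
    and W: "\<phi> ` cocycles g i j = W"
    and ker: "\<And>\<omega>. \<omega> \<in> cocycles g i j \<Longrightarrow> \<phi> \<omega> = 0 \<longleftrightarrow> \<omega> \<in> coboundaries g i j"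
  shows "cohomology_iso g i j W"
proof -
  let ?c = "cohomology_class g i j"
  note Z = subspace_cocycles[of g i j, OF g(1)] and B = subspace_coboundaries[of g i j, OF g(2)]
  have eq: "?c \<omega> = ?c \<eta> \<longleftrightarrow> \<phi> \<omega> = \<phi> \<eta>" if "\<omega> \<in> cocycles g i j" "\<eta> \<in> cocycles g i j" for \<omega> \<eta>
    using ker[OF subspace_diff[OF Z that]] by (simp add: cohomology_class_eq_iff[OF B] linear_diff[OF \<phi>])
  define \<Phi> where "\<Phi> C = \<phi> (SOME \<omega>. \<omega> \<in> cocycles g i j \<and> ?c \<omega> = C)" for C
  have \<Phi>: "\<Phi> (?c \<omega>) = \<phi> \<omega>" if "\<omega> \<in> cocycles g i j" for \<omega>
  proof -
    have "\<exists>\<eta>. \<eta> \<in> cocycles g i j \<and> ?c \<eta> = ?c \<omega>" using that by blast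
    from someI_ex[OF this] eq that show ?thesis unfolding \<Phi>_def by blast
  qed
  have "bij_betw \<Phi> (spencer_cohomology g i j) W"
    unfolding bij_betw_def
  proof
    show "inj_on \<Phi> (spencer_cohomology g i j)"
      unfolding spencer_cohomology_def by (rule inj_onI, elim imageE) (metis \<Phi> eq)
    show "\<Phi> ` spencer_cohomology g i j = W"
      unfolding spencer_cohomology_def image_image using \<Phi> W by (simp cong: image_cong)
  qed
  moreover have "\<Phi> (?c (a *\<^sub>R \<omega> + b *\<^sub>R \<eta>)) = a *\<^sub>R \<Phi> (?c \<omega>) + b *\<^sub>R \<Phi> (?c \<eta>)"
    if "\<omega> \<in> cocycles g i j" "\<eta> \<in> cocycles g i j" for \<omega> \<eta> a b
  proof -
    have "a *\<^sub>R \<omega> + b *\<^sub>R \<eta> \<in> cocycles g i j"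
      using that by (intro subspace_add[OF Z] subspace_scale[OF Z])
    thus ?thesis using that by (simp add: \<Phi> linear_add[OF \<phi>] linear_scale[OF \<phi>])
  qed
  ultimately show ?thesis unfolding cohomology_iso_def by blast
qed

lemma cohomology_iso_nonzero:
  assumes "cohomology_iso g i j W" "u \<in> W" "v \<in> W" "u \<noteq> v" shows "\<not> cohomology_zero g i j"
proof
  assume "cohomology_zero g i j"
  with assms(1) obtain \<Phi> where "bij_betw \<Phi> {cohomology_class g i j 0} W"
    unfolding cohomology_iso_def cohomology_zero_def by metis
  hence "W = {\<Phi> (cohomology_class g i j 0)}" by (simp add: bij_betw_def)
  with assms show False by simp
qed

section \<open>Tensor maps extended to cochains\<close>

definition lift :: "('a \<Rightarrow> 'b) \<Rightarrow> ('n list \<Rightarrow> 'a) \<Rightarrow> 'n list \<Rightarrow> 'b"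
  where "lift \<sigma> \<omega> = (\<lambda>js. \<sigma> (\<omega> js))"

lemma lift_cochains:
  assumes "linear \<sigma>" "\<And>f. f \<in> g a \<Longrightarrow> \<sigma> f \<in> h b" "\<omega> \<in> cochains g a j"
  shows "lift \<sigma> \<omega> \<in> cochains h b j"
proof -
  have "alternating (lift \<sigma> \<omega>)"
  proof (rule alternatingI)
    fix us c d vs
    have "alternating \<omega>" using assms(3) by (simp add: cochains_iff)
    from alternating_swap[OF this, of us c d vs]
    show "lift \<sigma> \<omega> (us @ c # d # vs) = - lift \<sigma> \<omega> (us @ d # c # vs)"
      by (simp add: lift_def linear_neg[OF assms(1)])
  qed
  with assms show ?thesis by (auto simp: cochains_iff lift_def linear_0)
qed

lemma lift_add: "linear \<sigma> \<Longrightarrow> lift \<sigma> (\<omega> + \<eta>) = lift \<sigma> \<omega> + lift \<sigma> \<eta>"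
  and lift_diff: "linear \<sigma> \<Longrightarrow> lift \<sigma> (\<omega> - \<eta>) = lift \<sigma> \<omega> - lift \<sigma> \<eta>"
  and lift_scaleR: "linear \<sigma> \<Longrightarrow> lift \<sigma> (c *\<^sub>R \<omega>) = c *\<^sub>R lift \<sigma> \<omega>"
  and lift_0: "linear \<sigma> \<Longrightarrow> lift \<sigma> 0 = 0"
  by (rule ext, simp add: lift_def linear_add linear_diff linear_scale linear_0 scaleR_apply)+

lemma linear_lift: "linear \<sigma> \<Longrightarrow> linear (lift \<sigma>)"
  by (rule linearI) (simp_all add: lift_add lift_scaleR)

lemma spencer_delta_lift:
  assumes \<sigma>: "linear \<sigma>" "\<And>f i. symf f \<Longrightarrow> \<sigma> (shift i f) = shift i (\<sigma> f)" and "\<And>ks. symf (\<omega> ks)"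
  shows "spencer_delta (lift \<sigma> \<omega>) = lift \<sigma> (spencer_delta \<omega>)"
  by (rule ext) (simp add: lift_def spencer_delta_eq linear_sum[OF \<sigma>(1)] linear_scale[OF \<sigma>(1)] assms)

text \<open>A value placed at the empty list; it serves both as a tensor of degree 0 and as a
  0-form.\<close>

definition point :: "'v \<Rightarrow> 'n list \<Rightarrow> 'v::zero"
  where "point v = (\<lambda>is. if is = [] then v else 0)"

lemma point_Nil [simp]: "point v [] = v" by (simp add: point_def)

lemma point_cochains: 
  assumes "f \<in> g i" "subspace (g i)" shows "point f \<in> cochains g i 0"
  using assms by (auto simp: cochains_iff point_def subspace_0 intro!: alternatingI)

lemma point_sym_tensors: "v \<in> N \<Longrightarrow> point v \<in> sym_tensors 0 N"
  unfolding sym_tensors_iff by (auto simp: point_def symf_def)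

lemma cochains_0_eq: "\<omega> \<in> cochains g i 0 \<Longrightarrow> \<omega> = point (\<omega> [])"
  by (auto simp: cochains_iff point_def)

lemma sym_tensors_0_eq: "f \<in> sym_tensors 0 N \<Longrightarrow> f = point (f [])"
  by (auto simp: sym_tensors_iff point_def)

text \<open>Isolates what the cohomology computation needs of the Einstein-Maxwell symbols: an
  operator of order 2 and its compatibility operator of order 1, both commuting with derivatives,
  and exactness in each polynomial degree. Exactness at the left end is built into the definition of
  \<open>symbol\<close> as a kernel.\<close>

locale symbol_complex =
  fixes N :: "'v::real_vector set" and V1 :: "'w::real_vector set" and V2 :: "'u::real_vector set"
    and \<sigma>1 :: "('n, 'v) jet \<Rightarrow> ('n, 'w) jet" and \<sigma>2 :: "('n, 'w) jet \<Rightarrow> ('n, 'u) jet"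
  assumes N: "subspace N" and V1: "subspace V1" and V2: "subspace V2"
    and lin1: "linear \<sigma>1" and lin2: "linear \<sigma>2"
    and shift1: "symf f \<Longrightarrow> \<sigma>1 (shift i f) = shift i (\<sigma>1 f)"
    and shift2: "symf z \<Longrightarrow> \<sigma>2 (shift i z) = shift i (\<sigma>2 z)"
    and degree1: "f \<in> sym_tensors (t + 2) N \<Longrightarrow> \<sigma>1 f \<in> sym_tensors t V1"
    and low1: "f \<in> sym_tensors t N \<Longrightarrow> t < 2 \<Longrightarrow> \<sigma>1 f = 0"
    and degree2: "z \<in> sym_tensors (t + 1) V1 \<Longrightarrow> \<sigma>2 z \<in> sym_tensors t V2"
    and low2: "z \<in> sym_tensors 0 V1 \<Longrightarrow> \<sigma>2 z = 0"
    and comp: "f \<in> sym_tensors t N \<Longrightarrow> \<sigma>2 (\<sigma>1 f) = 0"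
    and exact: "z \<in> sym_tensors t V1 \<Longrightarrow> \<sigma>2 z = 0 \<Longrightarrow> \<exists>f\<in>sym_tensors (t + 2) N. \<sigma>1 f = z"
    and surj: "y \<in> sym_tensors t V2 \<Longrightarrow> \<exists>z\<in>sym_tensors (t + 1) V1. \<sigma>2 z = y"
begin

definition symbol :: "nat \<Rightarrow> ('n, 'v) jet set"
  where "symbol t = {f \<in> sym_tensors t N. \<sigma>1 f = 0}"

lemma subspace_symbol: "subspace (symbol t)"
  unfolding symbol_def
  using subspace_inter[OF subspace_sym_tensors[OF N] subspace_ker[OF lin1]] by (simp add: Int_def)

lemma symbol_cochains_iff: "\<omega> \<in> cochains symbol i j \<longleftrightarrow> \<omega> \<in> tensor_cochains N i j \<and> lift \<sigma>1 \<omega> = 0"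
  by (auto simp: cochains_iff symbol_def lift_def fun_eq_iff)

lemma symbol_cochains_low: "i < 2 \<Longrightarrow> cochains symbol i j = tensor_cochains N i j"
proof -
  assume "i < 2"
  hence "symbol i = sym_tensors i N" using low1 by (auto simp: symbol_def)
  thus ?thesis by (simp add: cochains_def)
qed

lemma symf_cochain: "subspace V \<Longrightarrow> \<omega> \<in> tensor_cochains V i j \<Longrightarrow> symf (\<omega> ks)"
  by (simp add: cochains_iff sym_tensors_iff)

lemma delta_lift1: "\<omega> \<in> tensor_cochains N i j \<Longrightarrow> spencer_delta (lift \<sigma>1 \<omega>) = lift \<sigma>1 (spencer_delta \<omega>)"
  by (rule spencer_delta_lift[OF lin1 shift1 symf_cochain[OF N]])

lemma delta_lift2: "\<omega> \<in> tensor_cochains V1 i j \<Longrightarrow> spencer_delta (lift \<sigma>2 \<omega>) = lift \<sigma>2 (spencer_delta \<omega>)"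
  by (rule spencer_delta_lift[OF lin2 shift2 symf_cochain[OF V1]])

lemma lift1_cochains: "\<omega> \<in> tensor_cochains N (Suc (Suc i)) j \<Longrightarrow> lift \<sigma>1 \<omega> \<in> tensor_cochains V1 i j"
  using lift_cochains[OF lin1, of "\<lambda>t. sym_tensors t N" "Suc (Suc i)" "\<lambda>t. sym_tensors t V1" i \<omega> j] degree1[of _ i] by simp

lemma lift2_cochains: "\<omega> \<in> tensor_cochains V1 (Suc i) j \<Longrightarrow> lift \<sigma>2 \<omega> \<in> tensor_cochains V2 i j"
  using lift_cochains[OF lin2, of "\<lambda>t. sym_tensors t V1" "Suc i" "\<lambda>t. sym_tensors t V2" i \<omega> j] degree2[of _ i] by simp

lemma lift2_low: "\<omega> \<in> tensor_cochains V1 0 j \<Longrightarrow> lift \<sigma>2 \<omega> = 0"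
  by (auto simp: cochains_iff lift_def fun_eq_iff[of _ 0] low2)

lemma lift_comp: "\<omega> \<in> tensor_cochains N i j \<Longrightarrow> lift \<sigma>2 (lift \<sigma>1 \<omega>) = 0"
  by (rule ext) (use comp in \<open>force simp: cochains_iff lift_def\<close>)

text \<open>Linear right inverses lift preimages from tensors to alternating cochains.\<close>

lemma exact_cochains:
  assumes z: "\<zeta> \<in> tensor_cochains V1 t j" "lift \<sigma>2 \<zeta> = 0"
  shows "\<exists>\<eta>\<in>tensor_cochains N (Suc (Suc t)) j. lift \<sigma>1 \<eta> = \<zeta>"
proof -
  obtain R where R: "linear R" "\<And>v. v \<in> \<sigma>1 ` sym_tensors (t + 2) N \<Longrightarrow> \<sigma>1 (R v) = v" "\<And>v. R v \<in> sym_tensors (t + 2) N"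
    using linear_right_inverse_on[OF lin1 subspace_sym_tensors[OF N, of "t + 2"]] by metis
  have "\<sigma>1 (R (\<zeta> js)) = \<zeta> js" for js
  proof (rule R(2))
    have "\<sigma>2 (\<zeta> js) = 0" using z(2) by (metis lift_def zero_fun_apply)
    thus "\<zeta> js \<in> \<sigma>1 ` sym_tensors (t + 2) N" using exact[of "\<zeta> js" t] z(1) unfolding cochains_iff by (metis imageI)
  qed
  hence "lift \<sigma>1 (lift R \<zeta>) = \<zeta>" by (simp add: lift_def)
  moreover have "lift R \<zeta> \<in> tensor_cochains N (t + 2) j"
    by (rule lift_cochains[OF R(1) _ z(1)]) (rule R(3))
  ultimately show ?thesis by auto
qed

lemma surj_cochains:
  assumes z: "\<rho> \<in> tensor_cochains V2 t j"
  shows "\<exists>\<zeta>\<in>tensor_cochains V1 (Suc t) j. lift \<sigma>2 \<zeta> = \<rho>"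
proof -
  obtain R where R: "linear R" "\<And>v. v \<in> \<sigma>2 ` sym_tensors (t + 1) V1 \<Longrightarrow> \<sigma>2 (R v) = v" "\<And>v. R v \<in> sym_tensors (t + 1) V1"
    using linear_right_inverse_on[OF lin2 subspace_sym_tensors[OF V1, of "t + 1"]] by metis
  have "\<sigma>2 (R (\<rho> js)) = \<rho> js" for js
    by (rule R(2)) (use surj[of "\<rho> js" t] z in \<open>unfold cochains_iff, metis imageI\<close>)
  hence "lift \<sigma>2 (lift R \<rho>) = \<rho>" by (simp add: lift_def)
  moreover have "lift R \<rho> \<in> tensor_cochains V1 (t + 1) j"
    by (rule lift_cochains[OF R(1) _ z]) (rule R(3))
  ultimately show ?thesis by auto
qed

lemma delta_delta: "subspace V \<Longrightarrow> \<omega> \<in> tensor_cochains V i j \<Longrightarrow> spencer_delta (spencer_delta \<omega>) = 0"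
  by (intro ext) (simp add: spencer_delta_delta symf_cochain)

text \<open>A closed cochain outside bidegree (0, 0) is zero or exact. In the second case a
  primitive is lifted through the surjection and then differentiated.\<close>

lemma closed_lift2:
  assumes \<nu>: "\<nu> \<in> tensor_cochains V2 i j" and closed: "spencer_delta \<nu> = 0" and "i + j > 0"
  shows "\<exists>\<zeta>\<in>tensor_cochains V1 (Suc i) j. spencer_delta \<zeta> = 0 \<and> lift \<sigma>2 \<zeta> = \<nu>"
proof (cases j)
  case 0
  with closed_0_form[OF V2, of \<nu> i] assms have "\<nu> = 0" by simp
  thus ?thesis
    using subspace_0[OF subspace_tensor_cochains[OF V1]]
    by (intro bexI[of _ 0]) (simp_all add: spencer_delta_0 lift_0[OF lin2])
next
  case (Suc j')
  then obtain \<rho> where \<rho>: "\<rho> \<in> tensor_cochains V2 (Suc i) j'" "spencer_delta \<rho> = \<nu>"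
    using poincare[OF V2] \<nu> closed by blast
  then obtain \<zeta> where \<zeta>: "\<zeta> \<in> tensor_cochains V1 (Suc (Suc i)) j'" "lift \<sigma>2 \<zeta> = \<rho>"
    using surj_cochains by blast
  show ?thesis
  proof (intro bexI conjI)
    show "lift \<sigma>2 (spencer_delta \<zeta>) = \<nu>" by (simp flip: delta_lift2[OF \<zeta>(1)] add: \<zeta> \<rho>)
    show "spencer_delta \<zeta> \<in> tensor_cochains V1 (Suc i) j"
      unfolding Suc by (rule spencer_delta_cochains[OF V1 \<zeta>(1)])
  qed (rule delta_delta[OF V1 \<zeta>(1)])
qed

text \<open>Take a primitive \<open>\<zeta>\<close> of \<open>\<mu>\<close>. Its image under
  \<open>\<sigma>2\<close> is closed, so \<open>closed_lift2\<close> provides a closed correction of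
  \<open>\<zeta>\<close> that makes the image zero; a preimage under \<open>\<sigma>1\<close> is
  then differentiated. The bidegree condition keeps the image of \<open>\<zeta>\<close> away from
  (0, 0).\<close>

lemma closed_lift1:
  assumes \<mu>: "\<mu> \<in> tensor_cochains V1 i j" and closed: "spencer_delta \<mu> = 0" "lift \<sigma>2 \<mu> = 0"
    and "i > 0 \<or> j > 1"
  shows "\<exists>\<theta>\<in>tensor_cochains N (Suc (Suc i)) j. spencer_delta \<theta> = 0 \<and> lift \<sigma>1 \<theta> = \<mu>"
proof (cases j)
  case 0
  with closed_0_form[OF V1, of \<mu> i] assms have "\<mu> = 0" by simp
  thus ?thesis
    using subspace_0[OF subspace_tensor_cochains[OF N]]
    by (intro bexI[of _ 0]) (simp_all add: spencer_delta_0 lift_0[OF lin1])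
next
  case (Suc j')
  then obtain \<zeta> where \<zeta>: "\<zeta> \<in> tensor_cochains V1 (Suc i) j'" "spencer_delta \<zeta> = \<mu>"
    using poincare[OF V1] \<mu> closed by blast
  have "spencer_delta (lift \<sigma>2 \<zeta>) = 0" by (simp add: delta_lift2[OF \<zeta>(1)] \<zeta> closed)
  with closed_lift2[OF lift2_cochains[OF \<zeta>(1)]] Suc assms(4)
  obtain \<zeta>' where \<zeta>': "\<zeta>' \<in> tensor_cochains V1 (Suc i) j'" "spencer_delta \<zeta>' = 0" "lift \<sigma>2 \<zeta>' = lift \<sigma>2 \<zeta>"
    by auto
  have "\<zeta> - \<zeta>' \<in> tensor_cochains V1 (Suc i) j'"
    by (intro subspace_diff subspace_tensor_cochains V1 \<zeta> \<zeta>')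
  moreover have "lift \<sigma>2 (\<zeta> - \<zeta>') = 0" by (simp add: lift_diff[OF lin2] \<zeta>')
  ultimately obtain \<eta> where \<eta>: "\<eta> \<in> tensor_cochains N (Suc (Suc (Suc i))) j'" "lift \<sigma>1 \<eta> = \<zeta> - \<zeta>'"
    using exact_cochains by blast
  show ?thesis
  proof (intro bexI conjI)
    show "lift \<sigma>1 (spencer_delta \<eta>) = \<mu>"
      by (simp flip: delta_lift1[OF \<eta>(1)] add: \<eta> \<zeta> \<zeta>' spencer_delta_diff)
    show "spencer_delta \<eta> \<in> tensor_cochains N (Suc (Suc i)) j"
      unfolding Suc by (rule spencer_delta_cochains[OF N \<eta>(1)])
  qed (rule delta_delta[OF N \<eta>(1)])
qed

text \<open>A cocycle has a tensor-valued primitive \<open>\<eta>\<close>; the obstruction to its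
  lying in the symbol is the closed cochain \<open>lift \<sigma>1 \<eta>\<close>. A closed
  \<open>\<theta>\<close> with the same image is subtracted. In positive form degree, (1, 1) and (1,
  2) are exactly the cases that the bidegree condition of \<open>closed_lift1\<close> rules
  out.\<close>

lemma symbol_cohomology_zero:
  assumes "(i, j) \<notin> {(0, 0), (1, 1), (1, 2)}" shows "cohomology_zero symbol i j"
proof (rule cohomology_zeroI[where g = symbol, OF subspace_symbol subspace_symbol], rule subsetI)
  fix \<omega> assume "\<omega> \<in> cocycles symbol i j"
  hence \<omega>: "\<omega> \<in> tensor_cochains N i j" "lift \<sigma>1 \<omega> = 0" "spencer_delta \<omega> = 0"
    by (simp_all add: cocycles_def symbol_cochains_iff)
  show "\<omega> \<in> coboundaries symbol i j"
  proof (cases j)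
    case 0
    with closed_0_form[OF N, of \<omega> i] \<omega> assms show ?thesis by (simp add: coboundaries_def)
  next
    case (Suc j')
    with poincare[OF N] \<omega> obtain \<eta> where \<eta>: "\<eta> \<in> tensor_cochains N (Suc i) j'" "spencer_delta \<eta> = \<omega>" by blast
    have "\<exists>\<theta>\<in>tensor_cochains N (Suc i) j'. spencer_delta \<theta> = 0 \<and> lift \<sigma>1 \<theta> = lift \<sigma>1 \<eta>"
    proof (cases i)
      case 0
      \<comment> \<open>Here \<open>\<eta>\<close> has tensor degree 1, below the order of
        \<open>\<sigma>1\<close>.\<close>
      hence "lift \<sigma>1 \<eta> = 0" using \<eta>(1) symbol_cochains_low[of "Suc i" j'] symbol_cochains_iff by auto
      thus ?thesis 
        using subspace_0[OF subspace_tensor_cochains[OF N]]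
        by (intro bexI[of _ 0]) (simp_all add: spencer_delta_0 lift_0[OF lin1])
    next
      case (Suc i')
      have "lift \<sigma>1 \<eta> \<in> tensor_cochains V1 i' j'" using lift1_cochains \<eta>(1) Suc by simp
      from closed_lift1[OF this] show ?thesis
        using assms Suc \<open>j = Suc j'\<close> \<omega>(2) lift_comp[OF \<eta>(1)] by (auto simp: delta_lift1[OF \<eta>(1)] \<eta>(2))
    qed
    then obtain \<theta> where \<theta>: "\<theta> \<in> tensor_cochains N (Suc i) j'" "spencer_delta \<theta> = 0" "lift \<sigma>1 \<theta> = lift \<sigma>1 \<eta>" by blast
    have "\<eta> - \<theta> \<in> tensor_cochains N (Suc i) j'"
      by (intro subspace_diff subspace_tensor_cochains N \<eta> \<theta>)
    hence "\<eta> - \<theta> \<in> cochains symbol (Suc i) j'" by (simp add: symbol_cochains_iff lift_diff[OF lin1] \<theta>)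
    moreover have "spencer_delta (\<eta> - \<theta>) = \<omega>" by (simp add: spencer_delta_diff \<theta> \<eta>)
    ultimately show ?thesis unfolding coboundaries_def using Suc by force
  qed
qed

lemma koszul_delta:
  assumes "subspace V" "\<omega> \<in> tensor_cochains V i j"
  shows "koszul (spencer_delta \<omega>) = real (i + j) *\<^sub>R \<omega> - spencer_delta (koszul \<omega>)"
  using tensor_homotopy[OF assms] by (simp add: algebra_simps)

lemma koszul_delta_0:
  assumes "subspace V" "\<omega> \<in> tensor_cochains V i 0"
  shows "koszul (spencer_delta \<omega>) = real i *\<^sub>R \<omega>"
  using koszul_delta[OF assms] koszul_cochains_0[OF assms] by (simp add: spencer_delta_0)

lemma symbol_cohomology_00: "cohomology_iso symbol 0 0 N"
proof (rule cohomology_isoI[where g = symbol and \<phi> = "\<lambda>\<omega>. \<omega> [] []", OF subspace_symbol subspace_symbol])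
  show "linear (\<lambda>\<omega> :: ('n, 'v) cochain. \<omega> [] [])" by (rule linearI) (simp_all add: scaleR_apply)
  have "v \<in> (\<lambda>\<omega>. \<omega> [] []) ` cocycles symbol 0 0" if "v \<in> N" for v
  proof
    show "point (point v) \<in> cocycles symbol 0 0"
      using point_cochains[of "point v" "\<lambda>t. sym_tensors t N" 0] point_sym_tensors[OF that] subspace_sym_tensors[OF N]
      by (auto simp: cocycles_def symbol_cochains_low spencer_delta_cochains_0[OF N])
  qed simp
  thus "(\<lambda>\<omega>. \<omega> [] []) ` cocycles symbol 0 0 = N"
    by (auto simp: cocycles_def symbol_cochains_low) (auto simp: cochains_iff sym_tensors_iff)
  fix \<omega> assume "\<omega> \<in> cocycles symbol 0 0"
  hence "\<omega> = point (\<omega> [])" "\<omega> [] = point (\<omega> [] [])"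
    using cochains_0_eq[of \<omega>] sym_tensors_0_eq[of "\<omega> []" N]
    by (auto simp: cocycles_def symbol_cochains_low) (auto simp: cochains_iff)
  hence "\<omega> = point (point (\<omega> [] []))" by metis
  moreover have "point (point (0::'v)) = 0" by (simp add: point_def fun_eq_iff)
  ultimately show "\<omega> [] [] = 0 \<longleftrightarrow> \<omega> \<in> coboundaries symbol 0 0"
    by (auto simp: coboundaries_def)
qed

lemma lift_point: "\<omega> \<in> tensor_cochains V 0 0 \<Longrightarrow> \<omega> [] [] = 0 \<Longrightarrow> \<omega> = 0"
proof -
  assume \<omega>: "\<omega> \<in> tensor_cochains V 0 0" "\<omega> [] [] = 0"
  hence "\<omega> = point (\<omega> [])" "\<omega> [] = point (\<omega> [] [])"
    using cochains_0_eq[of \<omega>] sym_tensors_0_eq[of "\<omega> []" V] by (auto simp: cochains_iff)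
  with \<omega>(2) show "\<omega> = 0" by (metis (no_types, lifting) ext point_def zero_fun_apply)
qed

text \<open>The class of a cocycle is measured by \<open>\<sigma>1\<close> of its Koszul primitive,
  a constant in \<open>V1\<close>. If the constant is zero, the primitive lies in the
  symbol.\<close>

lemma symbol_cohomology_11: "cohomology_iso symbol 1 1 V1"
proof (rule cohomology_isoI[where g = symbol and \<phi> = "\<lambda>\<omega>. lift \<sigma>1 (koszul \<omega>) [] []", OF subspace_symbol subspace_symbol])
  let ?\<phi> = "\<lambda>\<omega>. lift \<sigma>1 (koszul \<omega>) [] []"
  show "linear ?\<phi>"
    by (rule linearI)
      (simp_all add: linear_add[OF linear_koszul] linear_scale[OF linear_koszul] lift_add[OF lin1] lift_scaleR[OF lin1] scaleR_apply)
  have cocycle: "koszul \<omega> \<in> tensor_cochains N 2 0" "spencer_delta (koszul \<omega>) = 2 *\<^sub>R \<omega>"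
    "lift \<sigma>1 (koszul \<omega>) \<in> tensor_cochains V1 0 0"
    if "\<omega> \<in> cocycles symbol 1 1" for \<omega>
  proof -
    have \<omega>: "\<omega> \<in> tensor_cochains N 1 (Suc 0)" "spencer_delta \<omega> = 0"
      using that by (simp_all add: cocycles_def symbol_cochains_low)
    show "koszul \<omega> \<in> tensor_cochains N 2 0" using koszul_cochains[OF N \<omega>(1)] by (simp add: numeral_2_eq_2)
    thus "lift \<sigma>1 (koszul \<omega>) \<in> tensor_cochains V1 0 0" using lift1_cochains[of "koszul \<omega>" 0 0] by (simp add: numeral_2_eq_2)
    show "spencer_delta (koszul \<omega>) = 2 *\<^sub>R \<omega>"
      using tensor_homotopy[OF N \<omega>(1)] unfolding \<omega>(2) linear_0[OF linear_koszul] by simp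
  qed
  have "v \<in> ?\<phi> ` cocycles symbol 1 1" if "v \<in> V1" for v
  proof -
    \<comment> \<open>The Koszul operator sends the coboundary of \<open>point f\<close> to
      \<open>2 *\<^sub>R point f\<close>; the factor is compensated here.\<close>
    have half: "(1/2) *\<^sub>R v \<in> V1" using that V1 by (simp add: subspace_scale)
    obtain f where f: "f \<in> sym_tensors 2 N" "\<sigma>1 f = point ((1/2) *\<^sub>R v)"
      using exact[OF point_sym_tensors[OF half] low2[OF point_sym_tensors[OF half]]] by (auto simp: numeral_2_eq_2)
    have p: "point f \<in> tensor_cochains N (Suc 1) 0"
      using point_cochains[of f "\<lambda>t. sym_tensors t N" 2, OF f(1) subspace_sym_tensors[OF N]] by (simp add: numeral_2_eq_2)
    have "v = ?\<phi> (spencer_delta (point f))"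
      using koszul_delta_0[OF N p] by (simp add: lift_def linear_scale[OF lin1] scaleR_apply f)
    moreover have "spencer_delta (point f) \<in> cocycles symbol 1 1"
      using spencer_delta_cochains[OF N p] delta_delta[OF N p] by (simp add: cocycles_def symbol_cochains_low)
    ultimately show ?thesis by (rule image_eqI)
  qed
  moreover have "?\<phi> \<omega> \<in> V1" if "\<omega> \<in> cocycles symbol 1 1" for \<omega>
    using cocycle(3)[OF that] by (simp add: cochains_iff sym_tensors_iff)
  ultimately show "?\<phi> ` cocycles symbol 1 1 = V1" by blast
  fix \<omega> assume \<omega>: "\<omega> \<in> cocycles symbol 1 1"
  show "?\<phi> \<omega> = 0 \<longleftrightarrow> \<omega> \<in> coboundaries symbol 1 1"
  proof
    assume "?\<phi> \<omega> = 0"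
    hence "lift \<sigma>1 (koszul \<omega>) = 0" using cocycle(3)[OF \<omega>] lift_point by blast
    hence "koszul \<omega> \<in> cochains symbol 2 0" by (simp add: symbol_cochains_iff cocycle(1)[OF \<omega>])
    hence "(1/2) *\<^sub>R koszul \<omega> \<in> cochains symbol 2 0" by (intro subspace_scale subspace_cochains subspace_symbol)
    moreover have "spencer_delta ((1/2) *\<^sub>R koszul \<omega>) = \<omega>" by (simp add: spencer_delta_scaleR cocycle(2)[OF \<omega>])
    ultimately show "\<omega> \<in> coboundaries symbol 1 1"
      by (simp add: coboundaries_def numeral_2_eq_2) (metis imageI)
  next
    assume "\<omega> \<in> coboundaries symbol 1 1"
    then obtain \<eta> where \<eta>: "\<eta> \<in> cochains symbol 2 0" "\<omega> = spencer_delta \<eta>" by (auto simp: coboundaries_def numeral_2_eq_2)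
    hence "koszul \<omega> = 2 *\<^sub>R \<eta>" using koszul_delta_0[OF N, of \<eta> 2] by (simp add: symbol_cochains_iff)
    thus "?\<phi> \<omega> = 0" using \<eta>(1) by (simp add: symbol_cochains_iff lift_scaleR[OF lin1])
  qed
qed

text \<open>\<open>\<psi>\<close> is the zigzag through the three columns: a primitive in the first,
  its image in the second, a primitive there, its image in \<open>V2\<close>. Koszul contractions
  supply the primitives linearly, up to the factors 3 and 1.\<close>

lemma symbol_cohomology_12: "cohomology_iso symbol 1 2 V2"
proof -
  define \<psi> where "\<psi> \<omega> = lift \<sigma>2 (koszul (lift \<sigma>1 (koszul \<omega>)))" for \<omega>
  have lin_\<psi>: "linear \<psi>"
    unfolding \<psi>_def using linear_compose[OF linear_compose[OF linear_koszul linear_lift[OF lin1]] linear_compose[OF linear_koszul linear_lift[OF lin2]]]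
    by (simp add: o_def)
  have cocycle: "koszul \<omega> \<in> tensor_cochains N 2 1" "spencer_delta (koszul \<omega>) = 3 *\<^sub>R \<omega>"
    "lift \<sigma>1 (koszul \<omega>) \<in> tensor_cochains V1 0 1" 
    "koszul (lift \<sigma>1 (koszul \<omega>)) \<in> tensor_cochains V1 1 0"
    "spencer_delta (koszul (lift \<sigma>1 (koszul \<omega>))) = lift \<sigma>1 (koszul \<omega>)"
    "\<psi> \<omega> \<in> tensor_cochains V2 0 0"
    if "\<omega> \<in> cocycles symbol 1 2" for \<omega>
  proof -
    have \<omega>: "\<omega> \<in> tensor_cochains N 1 (Suc 1)" "spencer_delta \<omega> = 0"
      using that by (simp_all add: cocycles_def symbol_cochains_low numeral_2_eq_2)
    show 1: "koszul \<omega> \<in> tensor_cochains N 2 1" using koszul_cochains[OF N \<omega>(1)] by (simp add: numeral_2_eq_2)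
    thus 2: "lift \<sigma>1 (koszul \<omega>) \<in> tensor_cochains V1 0 1" using lift1_cochains[of "koszul \<omega>" 0 1] by (simp add: numeral_2_eq_2)
    thus 3: "koszul (lift \<sigma>1 (koszul \<omega>)) \<in> tensor_cochains V1 1 0" using koszul_cochains[OF V1, of "lift \<sigma>1 (koszul \<omega>)" 0 0] by simp
    thus "\<psi> \<omega> \<in> tensor_cochains V2 0 0" unfolding \<psi>_def using lift2_cochains[of _ 0 0] by simp
    show "spencer_delta (koszul \<omega>) = 3 *\<^sub>R \<omega>"
      using tensor_homotopy[OF N \<omega>(1)] unfolding \<omega>(2) linear_0[OF linear_koszul] by simp
    have "spencer_delta (lift \<sigma>1 (koszul \<omega>)) = 0" by (rule spencer_delta_cochains_0[OF V1 2])
    thus "spencer_delta (koszul (lift \<sigma>1 (koszul \<omega>))) = lift \<sigma>1 (koszul \<omega>)"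
      using tensor_homotopy[OF V1 2] by (simp add: linear_0[OF linear_koszul])
  qed
  \<comment> \<open>Using \<open>\<eta>\<close> instead of the Koszul primitive changes the zigzag
    only by \<open>\<sigma>2\<close> after \<open>\<sigma>1\<close> of a tensor, which is zero. This
    gives both surjectivity and the vanishing of \<open>\<psi>\<close> on coboundaries.\<close>
  have \<psi>_delta: "\<psi> (spencer_delta \<eta>) = 3 *\<^sub>R lift \<sigma>2 (koszul (lift \<sigma>1 \<eta>))" if \<eta>: "\<eta> \<in> tensor_cochains N 2 1" for \<eta>
  proof -
    have k: "koszul \<eta> \<in> tensor_cochains N 3 0" using koszul_cochains[OF N, of \<eta> 2 0] \<eta> by (simp add: numeral_3_eq_3)
    hence m: "lift \<sigma>1 (koszul \<eta>) \<in> tensor_cochains V1 1 0" using lift1_cochains[of "koszul \<eta>" 1 0] by (simp add: numeral_3_eq_3)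
    have "koszul (lift \<sigma>1 (koszul (spencer_delta \<eta>))) = 3 *\<^sub>R koszul (lift \<sigma>1 \<eta>) - koszul (spencer_delta (lift \<sigma>1 (koszul \<eta>)))"
      by (simp add: koszul_delta[OF N \<eta>] lift_diff[OF lin1] lift_scaleR[OF lin1] delta_lift1[OF k]
          linear_diff[OF linear_koszul] linear_scale[OF linear_koszul])
    also have "koszul (spencer_delta (lift \<sigma>1 (koszul \<eta>))) = lift \<sigma>1 (koszul \<eta>)"
      using koszul_delta_0[OF V1 m] by simp
    finally show ?thesis
      unfolding \<psi>_def by (simp only: lift_diff[OF lin2] diff_zero lift_scaleR[OF lin2] lift_comp[OF k])
  qed
  show ?thesis
  proof (rule cohomology_isoI[where g = symbol and \<phi> = "\<lambda>\<omega>. \<psi> \<omega> [] []", OF subspace_symbol subspace_symbol])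
    show "linear (\<lambda>\<omega>. \<psi> \<omega> [] [])"
      by (rule linearI) (simp_all add: linear_add[OF lin_\<psi>] linear_scale[OF lin_\<psi>] scaleR_apply)
    have "v \<in> (\<lambda>\<omega>. \<psi> \<omega> [] []) ` cocycles symbol 1 2" if "v \<in> V2" for v
    proof -
      have third: "(1/3) *\<^sub>R v \<in> V2" using that V2 by (simp add: subspace_scale)
      obtain z where z: "z \<in> sym_tensors 1 V1" "\<sigma>2 z = point ((1/3) *\<^sub>R v)"
        using surj[OF point_sym_tensors[OF third]] by auto
      have p: "point z \<in> tensor_cochains V1 (Suc 0) 0"
        using point_cochains[of z "\<lambda>t. sym_tensors t V1" 1, OF z(1) subspace_sym_tensors[OF V1]] by simp
      have "spencer_delta (point z) \<in> tensor_cochains V1 0 1"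
        using spencer_delta_cochains[OF V1 p] by simp
      then obtain \<eta> where \<eta>: "\<eta> \<in> tensor_cochains N 2 1" "lift \<sigma>1 \<eta> = spencer_delta (point z)"
        using exact_cochains[of "spencer_delta (point z)" 0 1] lift2_low by (auto simp: numeral_2_eq_2)
      have "v = \<psi> (spencer_delta \<eta>) [] []"
        using koszul_delta_0[OF V1 p] unfolding \<psi>_delta[OF \<eta>(1)] \<eta>(2) by (simp add: lift_def scaleR_apply z)
      moreover have "spencer_delta \<eta> \<in> cocycles symbol 1 2"
        using spencer_delta_cochains[OF N, of \<eta> 1 1] delta_delta[OF N \<eta>(1)] \<eta>(1)
        by (simp add: cocycles_def symbol_cochains_low numeral_2_eq_2)
      ultimately show ?thesis by (rule image_eqI)
    qed
    moreover have "\<psi> \<omega> [] [] \<in> V2" if "\<omega> \<in> cocycles symbol 1 2" for \<omega>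
      using cocycle(6)[OF that] by (simp add: cochains_iff sym_tensors_iff)
    ultimately show "(\<lambda>\<omega>. \<psi> \<omega> [] []) ` cocycles symbol 1 2 = V2" by blast
    fix \<omega> assume \<omega>: "\<omega> \<in> cocycles symbol 1 2"
    note c = cocycle[OF \<omega>]
    show "\<psi> \<omega> [] [] = 0 \<longleftrightarrow> \<omega> \<in> coboundaries symbol 1 2"
    proof
      assume "\<psi> \<omega> [] [] = 0"
      hence "lift \<sigma>2 (koszul (lift \<sigma>1 (koszul \<omega>))) = 0" using c(6) lift_point unfolding \<psi>_def by blast
      then obtain \<eta> where \<eta>: "\<eta> \<in> tensor_cochains N (Suc 2) 0" "lift \<sigma>1 \<eta> = koszul (lift \<sigma>1 (koszul \<omega>))"
        using exact_cochains[OF c(4)] by (auto simp: numeral_2_eq_2)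
      \<comment> \<open>Subtracting a closed cochain keeps the differential and moves the primitive
        into the kernel of \<open>\<sigma>1\<close>.\<close>
      let ?\<theta> = "koszul \<omega> - spencer_delta \<eta>"
      have "?\<theta> \<in> tensor_cochains N 2 1"
        using spencer_delta_cochains[OF N \<eta>(1)] c(1) by (intro subspace_diff subspace_tensor_cochains N) simp_all
      moreover have "lift \<sigma>1 ?\<theta> = 0"
        by (simp add: lift_diff[OF lin1] delta_lift1[OF \<eta>(1), symmetric] \<eta>(2) c(5))
      ultimately have "(1/3) *\<^sub>R ?\<theta> \<in> cochains symbol 2 1"
        by (intro subspace_scale subspace_cochains subspace_symbol) (simp add: symbol_cochains_iff)
      moreover have "spencer_delta ((1/3) *\<^sub>R ?\<theta>) = \<omega>"
        by (simp add: spencer_delta_scaleR spencer_delta_diff c(2) delta_delta[OF N \<eta>(1)])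
      ultimately show "\<omega> \<in> coboundaries symbol 1 2"
        by (simp add: coboundaries_def numeral_2_eq_2) (metis imageI)
    next
      assume "\<omega> \<in> coboundaries symbol 1 2"
      then obtain \<eta> where \<eta>: "\<eta> \<in> cochains symbol 2 1" "\<omega> = spencer_delta \<eta>" by (auto simp: coboundaries_def numeral_2_eq_2)
      thus "\<psi> \<omega> [] [] = 0"
        by (simp add: symbol_cochains_iff \<psi>_delta linear_0[OF linear_koszul] lift_0[OF lin2])
    qed
  qed
qed

end

section \<open>The symbol of the Einstein-Maxwell equation\<close>

text \<open>The second-order part of the Ricci tensor: \<open>H a b\<close> stands for the second
  derivative of the metric perturbation in directions \<open>a\<close> and \<open>b\<close>, and
  \<gamma> for the inverse metric.\<close>

definition lin_ricci :: "real^'n::finite^'n \<Rightarrow> ('n \<Rightarrow> 'n \<Rightarrow> real^'n^'n) \<Rightarrow> real^'n^'n"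
  where "lin_ricci \<gamma> H = (\<chi> i j. (\<Sum>k\<in>UNIV. \<Sum>l\<in>UNIV. \<gamma>$k$l *
    (H k i $ j $ l - H k l $ i $ j - H j i $ k $ l + H j l $ i $ k)) / 2)"

definition lin_em :: "real^'n::finite^'n \<Rightarrow> real^'n^'n \<Rightarrow> ('n \<Rightarrow> 'n \<Rightarrow> 'n fibre) \<Rightarrow> 'n fibre"
  where "lin_em G \<gamma> Q = (let r = lin_ricci \<gamma> (\<lambda>a b. fst (Q a b)) in
    (r - ((\<Sum>i\<in>UNIV. \<Sum>j\<in>UNIV. \<gamma>$i$j * r$i$j) / 2) *\<^sub>R G,
     \<chi> j. \<Sum>m\<in>UNIV. \<Sum>i\<in>UNIV. \<gamma>$m$i * (snd (Q m i) $ j - snd (Q m j) $ i)))"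

text \<open>\<open>Z k\<close> stands for the derivative in direction \<open>k\<close> of the two
  left-hand sides; both components are divergences.\<close>

definition lin_bianchi :: "real^'n::finite^'n \<Rightarrow> ('n \<Rightarrow> 'n fibre) \<Rightarrow> (real^'n) \<times> real"
  where "lin_bianchi \<gamma> Z = (\<chi> j. \<Sum>i\<in>UNIV. \<Sum>k\<in>UNIV. \<gamma>$i$k * fst (Z k) $ i $ j,
    \<Sum>i\<in>UNIV. \<Sum>k\<in>UNIV. \<gamma>$i$k * snd (Z k) $ i)"

definition em_symbol_map :: "real^'n::finite^'n \<Rightarrow> real^'n^'n \<Rightarrow> ('n, 'n fibre) jet \<Rightarrow> ('n, 'n fibre) jet"
  where "em_symbol_map G \<gamma> f = (\<lambda>is. lin_em G \<gamma> (\<lambda>a b. f (a # b # is)))"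

definition bianchi_symbol_map :: "real^'n::finite^'n \<Rightarrow> ('n, 'n fibre) jet \<Rightarrow> ('n, (real^'n) \<times> real) jet"
  where "bianchi_symbol_map \<gamma> z = (\<lambda>is. lin_bianchi \<gamma> (\<lambda>k. z (k # is)))"

lemma fibre_tangent_iff: "u \<in> fibre_tangent \<longleftrightarrow> (\<forall>i j. fst u $ i $ j = fst u $ j $ i)"
  by (cases u) (auto simp: fibre_tangent_def transpose_def vec_eq_iff)

lemma subspace_fibre_tangent: "subspace (fibre_tangent :: 'n::finite fibre set)"
  by (auto simp: subspace_def fibre_tangent_iff)

lemma lin_ricci_linear: "lin_ricci \<gamma> (\<lambda>a b. H a b + K a b) = lin_ricci \<gamma> H + lin_ricci \<gamma> K"
  "lin_ricci \<gamma> (\<lambda>a b. c *\<^sub>R H a b) = c *\<^sub>R lin_ricci \<gamma> H"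
proof -
  show "lin_ricci \<gamma> (\<lambda>a b. H a b + K a b) = lin_ricci \<gamma> H + lin_ricci \<gamma> K"
    unfolding lin_ricci_def vec_eq_iff
    by (simp add: add_divide_distrib[symmetric] sum.distrib[symmetric] algebra_simps)
  show "lin_ricci \<gamma> (\<lambda>a b. c *\<^sub>R H a b) = c *\<^sub>R lin_ricci \<gamma> H"
    unfolding lin_ricci_def vec_eq_iff
    by (simp add: sum_distrib_left algebra_simps)
qed

lemma lin_em_add: "lin_em G \<gamma> (\<lambda>a b. P a b + Q a b) = lin_em G \<gamma> P + lin_em G \<gamma> Q"
proof -
  have "(\<chi> j. \<Sum>m\<in>UNIV. \<Sum>i\<in>UNIV. \<gamma>$m$i * (snd (P m i + Q m i) $ j - snd (P m j + Q m j) $ i))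
    = (\<chi> j. \<Sum>m\<in>UNIV. \<Sum>i\<in>UNIV. \<gamma>$m$i * (snd (P m i) $ j - snd (P m j) $ i))
     + (\<chi> j. \<Sum>m\<in>UNIV. \<Sum>i\<in>UNIV. \<gamma>$m$i * (snd (Q m i) $ j - snd (Q m j) $ i))"
    unfolding vec_eq_iff by (simp add: sum.distrib[symmetric] algebra_simps)
  thus ?thesis
    by (simp add: lin_em_def Let_def lin_ricci_linear distrib_left sum.distrib add_divide_distrib scaleR_add_left)
qed

lemma lin_em_scaleR:
  fixes G \<gamma> :: "real^'n::finite^'n"
  shows "lin_em G \<gamma> (\<lambda>a b. c *\<^sub>R P a b) = c *\<^sub>R lin_em G \<gamma> P"
proof -
  have "(\<chi> j. \<Sum>m\<in>UNIV. \<Sum>i\<in>UNIV. \<gamma>$m$i * (snd (c *\<^sub>R P m i) $ j - snd (c *\<^sub>R P m j) $ i))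
    = c *\<^sub>R (\<chi> j. \<Sum>m\<in>UNIV. \<Sum>i\<in>UNIV. \<gamma>$m$i * (snd (P m i) $ j - snd (P m j) $ i))"
    unfolding vec_eq_iff by (simp add: sum_distrib_left algebra_simps)
  moreover have "(\<Sum>i\<in>UNIV. \<Sum>j\<in>UNIV. \<gamma>$i$j * (c * r$i$j)) / 2 = c * ((\<Sum>i\<in>UNIV. \<Sum>j\<in>UNIV. \<gamma>$i$j * r$i$j) / 2)" for r :: "real^'n^'n"
    by (simp add: sum_distrib_left mult.left_commute)
  ultimately show ?thesis
    by (simp add: lin_em_def Let_def lin_ricci_linear scaleR_diff_right)
qed

lemma lin_em_0: "lin_em G \<gamma> (\<lambda>a b. 0) = 0"
  using lin_em_scaleR[of G \<gamma> 0 "\<lambda>a b. 0"] by simp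

lemma lin_bianchi_0: "lin_bianchi \<gamma> (\<lambda>a. 0) = 0"
  by (simp add: lin_bianchi_def zero_prod_def vec_eq_iff)

lemma linear_em_symbol_map: "linear (em_symbol_map G \<gamma>)"
  by (rule linearI; rule ext) (simp_all add: em_symbol_map_def lin_em_add lin_em_scaleR scaleR_apply)

lemma linear_bianchi_symbol_map: "linear (bianchi_symbol_map \<gamma>)"
  by (rule linearI; rule ext)
    (simp_all add: bianchi_symbol_map_def lin_bianchi_def scaleR_apply vec_eq_iff
      distrib_left sum.distrib sum_distrib_left mult.left_commute)

text \<open>Exchanging \<open>i\<close> and \<open>j\<close> swaps the first and the fourth term,
  after relabelling of the summation indices.\<close>

lemma lin_ricci_sym:
  assumes "\<And>a b. H a b = H b a" "\<And>a b i j. H a b $ i $ j = H a b $ j $ i" "transpose \<gamma> = \<gamma>"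
  shows "lin_ricci \<gamma> H $ i $ j = lin_ricci \<gamma> H $ j $ i"
proof -
  have gs: "\<gamma>$i$j = \<gamma>$j$i" for i j using assms(3) by (metis transpose_def vec_lambda_beta)
  have "(\<Sum>k\<in>UNIV. \<Sum>l\<in>UNIV. \<gamma>$k$l * H k i $ j $ l) = (\<Sum>k\<in>UNIV. \<Sum>l\<in>UNIV. \<gamma>$k$l * H i l $ j $ k)" for i j
    by (subst sum.swap, intro sum.cong refl) (metis gs assms(1))
  hence "lin_ricci \<gamma> H $ i $ j = ((\<Sum>k\<in>UNIV. \<Sum>l\<in>UNIV. \<gamma>$k$l * H i l $ j $ k) - (\<Sum>k\<in>UNIV. \<Sum>l\<in>UNIV. \<gamma>$k$l * H k l $ i $ j)
      - (\<Sum>k\<in>UNIV. \<Sum>l\<in>UNIV. \<gamma>$k$l * H j i $ k $ l) + (\<Sum>k\<in>UNIV. \<Sum>l\<in>UNIV. \<gamma>$k$l * H j l $ i $ k)) / 2" for i j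
    by (simp add: lin_ricci_def distrib_left right_diff_distrib sum.distrib sum_subtractf)
  from this[of i j] this[of j i] show ?thesis
    by (simp add: assms(2)[of _ _ i j] assms(1)[of i j])
qed

text \<open>An arbitrary enumeration; it carries symmetric functions of lists over to the
  multiset-indexed power series.\<close>

definition list_of :: "'n multiset \<Rightarrow> 'n list" where "list_of M = (SOME l. mset l = M)"

lemma mset_list_of [simp]: "mset (list_of M) = M"
  unfolding list_of_def by (rule someI_ex) (rule ex_mset)

lemma symf_list_of: "symf f \<Longrightarrow> mset is = M \<Longrightarrow> f (list_of M) = f is"
  by (rule symfD) simp_all

section \<open>The symbol maps in terms of power series\<close>

context
  fixes G \<gamma> :: "real^'n::finite^'n"
  assumes symG: "transpose G = G" and symg: "transpose \<gamma> = \<gamma>" and inv: "\<gamma> ** G = mat 1"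
    and card3: "CARD('n) \<ge> 3"
begin

interpretation W: wave_system "mder :: 'n \<Rightarrow> ('n multiset \<Rightarrow> real) \<Rightarrow> _" G \<gamma> undefined
  by (rule wave_system_series[OF symG symg inv card3])

lemmas series_simps = sum_fun_apply scaleR_apply mder_def plus_fun_apply minus_apply

lemma W_D: "W.D i u M = (\<Sum>j\<in>UNIV. \<gamma>$i$j * u (add_mset j M))"
  by (simp add: W.D_def series_simps)

lemma W_dv: "W.dv z j M = (\<Sum>k\<in>UNIV. \<Sum>l\<in>UNIV. \<gamma>$k$l * z k j (add_mset l M))"
  by (simp add: W.dv_def series_simps W_D)

lemma W_tr: "W.tr z M = (\<Sum>k\<in>UNIV. \<Sum>l\<in>UNIV. \<gamma>$k$l * z k l M)"
  by (simp add: W.tr_def series_simps)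

lemma W_ric:
  assumes h: "\<And>i j. h i j = h j i"
  shows "W.ric h i j M = lin_ricci \<gamma> (\<lambda>a b. \<chi> i j. h i j (add_mset a (add_mset b M))) $ i $ j"
proof -
  have 1: "(\<Sum>k\<in>UNIV. \<Sum>l\<in>UNIV. \<gamma>$k$l * h j l (add_mset i (add_mset k M))) = W.dv h j (add_mset i M)"
    unfolding W_dv by (subst sum.swap) (simp add: W.gs[of _ x for x] h[of j] add_mset_commute)
  have 2: "(\<Sum>k\<in>UNIV. \<Sum>l\<in>UNIV. \<gamma>$k$l * h i k (add_mset j (add_mset l M))) = W.dv h i (add_mset j M)"
    unfolding W_dv by (simp add: h[of i] add_mset_commute)
  have 3: "(\<Sum>k\<in>UNIV. \<Sum>l\<in>UNIV. \<gamma>$k$l * h i j (add_mset k (add_mset l M))) = W.box (h i j) M"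
    unfolding W.box_eq by (simp add: series_simps add_mset_commute)
  have 4: "(\<Sum>k\<in>UNIV. \<Sum>l\<in>UNIV. \<gamma>$k$l * h k l (add_mset j (add_mset i M))) = W.tr h (add_mset i (add_mset j M))"
    unfolding W_tr by (simp add: add_mset_commute)
  have "lin_ricci \<gamma> (\<lambda>a b. \<chi> i j. h i j (add_mset a (add_mset b M))) $ i $ j =
    ((\<Sum>k\<in>UNIV. \<Sum>l\<in>UNIV. \<gamma>$k$l * h j l (add_mset i (add_mset k M)))
     - (\<Sum>k\<in>UNIV. \<Sum>l\<in>UNIV. \<gamma>$k$l * h i j (add_mset k (add_mset l M)))
     - (\<Sum>k\<in>UNIV. \<Sum>l\<in>UNIV. \<gamma>$k$l * h k l (add_mset j (add_mset i M)))
     + (\<Sum>k\<in>UNIV. \<Sum>l\<in>UNIV. \<gamma>$k$l * h i k (add_mset j (add_mset l M)))) / 2"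
    by (simp add: lin_ricci_def distrib_left right_diff_distrib sum.distrib sum_subtractf add_mset_commute[of i])
  thus ?thesis unfolding 1 2 3 4 by (simp add: W.ric_def series_simps add_mset_commute)
qed

lemma W_em:
  assumes h: "\<And>i j. h i j = h j i"
  shows "lin_em G \<gamma> (\<lambda>a b. (\<chi> i j. h i j (add_mset a (add_mset b M)), \<chi> i. w i (add_mset a (add_mset b M))))
    = (\<chi> i j. W.ein h i j M, \<chi> i. W.mxw w i M)"
proof -
  have "W.ein h i j M = W.ric h i j M - G$i$j / 2 * (\<Sum>k\<in>UNIV. \<Sum>l\<in>UNIV. \<gamma>$k$l * W.ric h k l M)" for i j
    by (simp add: W.ein_def series_simps W_tr)
  moreover have "W.mxw w j M = (\<Sum>m\<in>UNIV. \<Sum>i\<in>UNIV. \<gamma>$m$i * (w j (add_mset m (add_mset i M)) - w i (add_mset m (add_mset j M))))" for j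
    unfolding W.mxw_def sum_fun_apply W_D
    by (subst sum.swap) (simp add: series_simps W.gs[of _ x for x] add_mset_commute)
  ultimately show ?thesis
    unfolding lin_em_def Let_def by (simp add: vec_eq_iff W_ric[OF h])
qed

lemma W_bianchi:
  "lin_bianchi \<gamma> (\<lambda>k. (\<chi> i j. z i j (add_mset k M), \<chi> i. w i (add_mset k M)))
    = (\<chi> j. W.dv z j M, (\<Sum>i\<in>UNIV. W.D i (w i)) M)"
  by (simp add: lin_bianchi_def W_dv sum_fun_apply W_D vec_eq_iff)

lemma jet_components:
  fixes f :: "('n, 'n fibre) jet"
  assumes "f \<in> sym_tensors t fibre_tangent"
  obtains h w where "\<And>i j. h i j = h j i" "\<And>is. f is = (\<chi> i j. h i j (mset is), \<chi> i. w i (mset is))"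
proof
  let ?h = "\<lambda>i j M. fst (f (list_of M)) $ i $ j"
  have "f is \<in> fibre_tangent" for "is"
    using assms subspace_0[OF subspace_fibre_tangent] unfolding sym_tensors_iff by metis
  thus "?h i j = ?h j i" for i j by (simp add: fibre_tangent_iff fun_eq_iff)
  have "symf f" using assms by (simp add: sym_tensors_iff)
  thus "f is = (\<chi> i j. ?h i j (mset is), \<chi> i. snd (f (list_of (mset is))) $ i)" for "is"
    by (simp add: symf_list_of prod_eq_iff vec_eq_iff)
qed

text \<open>Exactness and surjectivity are taken from the power series. The operators have constant
  coefficients and are homogeneous, so a solution can be truncated to the one degree that is
  wanted.\<close>

lemma em_symbol_complex:
  "symbol_complex fibre_tangent fibre_tangent UNIV (em_symbol_map G \<gamma>) (bianchi_symbol_map \<gamma>)"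
proof (rule symbol_complex.intro)
  let ?N = "fibre_tangent :: 'n fibre set"
  let ?s1 = "em_symbol_map G \<gamma>" and ?s2 = "bianchi_symbol_map \<gamma>"
  show "subspace ?N" "subspace ?N" by (rule subspace_fibre_tangent)+
  show "linear ?s1" "linear ?s2" by (rule linear_em_symbol_map linear_bianchi_symbol_map)+
  {
    fix f :: "('n, 'n fibre) jet" and i assume f: "symf f"
    have "f (i # a # b # is) = f (a # b # i # is)" for a b "is" by (rule symfD[OF f]) simp
    thus "?s1 (shift i f) = shift i (?s1 f)" by (simp add: em_symbol_map_def shift_def)
    have "f (i # a # is) = f (a # i # is)" for a "is" by (rule symfD[OF f]) simp
    thus "?s2 (shift i f) = shift i (?s2 f)" by (simp add: bianchi_symbol_map_def shift_def)
  }
  {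
    fix f :: "('n, 'n fibre) jet" and t assume f: "f \<in> sym_tensors t ?N"
    then obtain h w where h: "\<And>i j. h i j = h j i" and fe: "\<And>is. f is = (\<chi> i j. h i j (mset is), \<chi> i. w i (mset is))"
      using jet_components by blast
    have s1: "?s1 f is = (\<chi> i j. W.ein h i j (mset is), \<chi> i. W.mxw w i (mset is))" for "is"
      using W_em[OF h] by (simp add: em_symbol_map_def fe)
    have "?s2 (?s1 f) is = 0" for "is"
      unfolding bianchi_symbol_map_def s1 mset.simps W_bianchi W.dv_ein W.dv_mxw
      by (simp add: zero_prod_def vec_eq_iff)
    thus "?s2 (?s1 f) = 0" by (simp add: fun_eq_iff)
    assume "t < 2" 
    with f have "f (a # b # is) = 0" for a b "is" by (simp add: sym_tensors_iff)
    thus "?s1 f = 0" by (simp add: em_symbol_map_def fun_eq_iff lin_em_0)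
  }
  {
    fix f :: "('n, 'n fibre) jet" and t assume f: "f \<in> sym_tensors (t + 2) ?N"
    then have sf: "symf f" by (simp add: sym_tensors_iff)
    have "symf (?s1 f)"
      unfolding symf_def
    proof (intro allI impI)
      fix "is" js :: "'n list" assume "mset is = mset js"
      hence "f (a # b # is) = f (a # b # js)" for a b by (intro symfD[OF sf]) simp
      thus "?s1 f is = ?s1 f js" by (simp add: em_symbol_map_def)
    qed
    moreover have "?s1 f is \<in> ?N" for "is"
    proof -
      have "f ks \<in> ?N" for ks
        using f subspace_0[OF subspace_fibre_tangent] unfolding sym_tensors_iff by metis
      hence "fst (f (a # b # is)) $ i $ j = fst (f (a # b # is)) $ j $ i" for a b i j
        by (simp add: fibre_tangent_iff)
      moreover have "f (a # b # is) = f (b # a # is)" for a b by (rule symfD[OF sf]) simp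
      ultimately have "lin_ricci \<gamma> (\<lambda>a b. fst (f (a # b # is))) $ i $ j = lin_ricci \<gamma> (\<lambda>a b. fst (f (a # b # is))) $ j $ i" for i j
        by (intro lin_ricci_sym symg) metis+
      thus ?thesis by (simp add: em_symbol_map_def lin_em_def Let_def fibre_tangent_iff W.Gs)
    qed
    moreover have "?s1 f is = 0" if "length is \<noteq> t" for "is"
    proof -
      have "f (a # b # is) = 0" for a b using f that by (simp add: sym_tensors_iff)
      thus ?thesis by (simp add: em_symbol_map_def lin_em_0)
    qed
    ultimately show "?s1 f \<in> sym_tensors t ?N" by (simp add: sym_tensors_iff)
  }
  {
    fix z :: "('n, 'n fibre) jet" and t assume z: "z \<in> sym_tensors (t + 1) ?N"
    then have sf: "symf z" by (simp add: sym_tensors_iff)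
    have "symf (?s2 z)"
      unfolding symf_def
    proof (intro allI impI)
      fix "is" js :: "'n list" assume "mset is = mset js"
      hence "z (a # is) = z (a # js)" for a by (intro symfD[OF sf]) simp
      thus "?s2 z is = ?s2 z js" by (simp add: bianchi_symbol_map_def)
    qed
    moreover have "?s2 z is = 0" if "length is \<noteq> t" for "is"
    proof -
      have "z (a # is) = 0" for a using z that by (simp add: sym_tensors_iff)
      thus ?thesis by (simp add: bianchi_symbol_map_def lin_bianchi_0)
    qed
    ultimately show "?s2 z \<in> sym_tensors t UNIV" by (simp add: sym_tensors_iff)
  }
  {
    fix z :: "('n, 'n fibre) jet" assume z: "z \<in> sym_tensors 0 ?N"
    hence "z (a # is) = 0" for a "is" by (simp add: sym_tensors_iff)
    thus "?s2 z = 0" by (simp add: fun_eq_iff bianchi_symbol_map_def lin_bianchi_0)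
  }
  {
    fix z :: "('n, 'n fibre) jet" and t assume z: "z \<in> sym_tensors t ?N" "?s2 z = 0"
    then obtain y v where y: "\<And>i j. y i j = y j i" and ze: "\<And>is. z is = (\<chi> i j. y i j (mset is), \<chi> i. v i (mset is))"
      using jet_components by blast
    have "(\<chi> j. W.dv y j (mset is), (\<Sum>i\<in>UNIV. W.D i (v i)) (mset is)) = 0" for "is"
      using fun_cong[OF z(2), of "is"] unfolding bianchi_symbol_map_def ze mset.simps W_bianchi by simp
    hence "W.dv y j (mset is) = 0" "(\<Sum>i\<in>UNIV. W.D i (v i)) (mset is) = 0" for j "is"
      by (simp_all add: zero_prod_def vec_eq_iff)
    hence "W.dv y j = 0" "(\<Sum>i\<in>UNIV. W.D i (v i)) = 0" for j
      by (metis ext mset_list_of zero_fun_apply)+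
    then obtain h w where h: "\<And>i j. h i j = h j i" "\<And>i j. W.ein h i j = y i j" and w: "\<And>i. W.mxw w i = v i"
      using W.ein_exact[of y] W.mxw_exact[of v] y by metis
    define f :: "('n, 'n fibre) jet" where
      "f is = (if length is = t + 2 then (\<chi> i j. h i j (mset is), \<chi> i. w i (mset is)) else 0)" for "is"
    have "f \<in> sym_tensors (t + 2) ?N"
      unfolding sym_tensors_iff
    proof (intro conjI allI impI)
      show "symf f" unfolding symf_def f_def by (metis size_mset)
      show "f is \<in> ?N" for "is" 
        by (simp add: f_def fibre_tangent_iff) (metis h(1))
    qed (simp add: f_def)
    moreover have "?s1 f = z"
    proof
      fix "is"
      show "?s1 f is = z is"
      proof (cases "length is = t")
        case True
        thus ?thesis using W_em[where h = h and M = "mset is" and w = w, OF h(1)] by (simp add: em_symbol_map_def f_def ze h w)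
      next
        case False
        thus ?thesis using z(1) by (simp add: em_symbol_map_def f_def lin_em_0 sym_tensors_iff)
      qed
    qed
    ultimately show "\<exists>f\<in>sym_tensors (t + 2) ?N. ?s1 f = z" by blast
  }
  {
    fix y :: "('n, (real^'n) \<times> real) jet" and t assume y: "y \<in> sym_tensors t UNIV"
    hence sy: "symf y" by (simp add: sym_tensors_iff)
    obtain h where h: "\<And>i j. h i j = h j i" "\<And>j. W.dv h j = (\<lambda>M. fst (y (list_of M)) $ j)"
      using W.dv_surj[of "\<lambda>j M. fst (y (list_of M)) $ j"] by blast
    obtain w where w: "(\<Sum>i\<in>UNIV. W.D i (w i)) = (\<lambda>M. snd (y (list_of M)))"
      using W.dvv_surj by blast
    define z :: "('n, 'n fibre) jet" where
      "z is = (if length is = t + 1 then (\<chi> i j. h i j (mset is), \<chi> i. w i (mset is)) else 0)" for "is"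
    have "z \<in> sym_tensors (t + 1) ?N"
      unfolding sym_tensors_iff
    proof (intro conjI allI impI)
      show "symf z" unfolding symf_def z_def by (metis size_mset)
      show "z is \<in> ?N" for "is" 
        by (simp add: z_def fibre_tangent_iff) (metis h(1))
    qed (simp add: z_def)
    moreover have "?s2 z = y"
    proof
      fix "is"
      show "?s2 z is = y is"
      proof (cases "length is = t")
        case True
        have "?s2 z is = (\<chi> j. W.dv h j (mset is), (\<Sum>i\<in>UNIV. W.D i (w i)) (mset is))"
          using W_bianchi[of h "mset is" w] True by (simp add: bianchi_symbol_map_def z_def)
        thus ?thesis by (simp add: h w symf_list_of[OF sy] prod_eq_iff vec_eq_iff)
      next
        case False
        thus ?thesis using y by (simp add: bianchi_symbol_map_def z_def lin_bianchi_0 sym_tensors_iff)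
      qed
    qed
    ultimately show "\<exists>z\<in>sym_tensors (t + 1) ?N. ?s2 z = y" by blast
  }
qed (rule subspace_UNIV)

end

section \<open>Iterated partial derivatives\<close>

lemma pd_eq: "(f has_derivative f') (at x) \<Longrightarrow> pd i f x = f' (axis i 1)"
  unfolding pd_def using frechet_derivative_at by metis

lemma has_derivative_frechet: "f differentiable (at x) \<Longrightarrow> (f has_derivative frechet_derivative f (at x)) (at x)"
  by (simp add: frechet_derivative_works)

lemma has_derivative_cong_open:
  assumes "open S" "x \<in> S" "\<And>y. y \<in> S \<Longrightarrow> f y = g y"
  shows "(f has_derivative f') (at x) \<longleftrightarrow> (g has_derivative f') (at x)"
  using has_derivative_transform_within_open[of f f' x UNIV S g] has_derivative_transform_within_open[of g f' x UNIV S f] assms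
  by auto

lemma pd_cong_open:
  assumes "open S" "x \<in> S" "\<And>y. y \<in> S \<Longrightarrow> f y = g y"
  shows "pd i f x = pd i g x"
  unfolding pd_def frechet_derivative_def using has_derivative_cong_open[OF assms] by simp

lemma differentiable_cong_open:
  assumes "open S" "x \<in> S" "\<And>y. y \<in> S \<Longrightarrow> f y = g y"
  shows "f differentiable (at x) \<longleftrightarrow> g differentiable (at x)"
  unfolding differentiable_def using has_derivative_cong_open[OF assms] by simp

lemma pds_cong_open:
  assumes "open S" "x \<in> S" "\<And>y. y \<in> S \<Longrightarrow> f y = g y"
  shows "pds is f x = pds is g x"
  using assms(2,3)
proof (induction "is" arbitrary: x)
  case (Cons i "is")
  show ?case
    unfolding pds.simps by (rule pd_cong_open[OF assms(1) Cons.prems(1)]) (rule Cons.IH[OF _ Cons.prems(2)])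
qed simp

lemma pds_append: "pds (is @ js) f = pds is (pds js f)"
  by (induction "is") simp_all

lemma pds_snoc: "pds (is @ [i]) f = pds is (pd i f)"
  by (simp add: pds_append)

text \<open>Smoothness to finite order. It admits an induction in which derivatives of products,
  inverses and roots refer back to the functions themselves.\<close>

definition diff_on :: "nat \<Rightarrow> (real^'n::finite) set \<Rightarrow> (real^'n \<Rightarrow> 'v::real_normed_vector) \<Rightarrow> bool"
  where "diff_on n S f \<longleftrightarrow> (\<forall>is. length is \<le> n \<longrightarrow> (\<forall>x\<in>S. pds is f differentiable (at x)))"

lemma smooth_on_iff_diff_on: "smooth_on S f \<longleftrightarrow> (\<forall>n. diff_on n S f)"
  by (auto simp: smooth_on_def diff_on_def)

lemma diff_on_0: "diff_on 0 S f \<longleftrightarrow> (\<forall>x\<in>S. f differentiable (at x))"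
  by (simp add: diff_on_def)

text \<open>The innermost derivative is split off, so that an induction hypothesis applies to
  \<open>pd i f\<close>.\<close>

lemma diff_on_Suc: "diff_on (Suc n) S f \<longleftrightarrow> (\<forall>x\<in>S. f differentiable (at x)) \<and> (\<forall>i. diff_on n S (pd i f))"
proof (intro iffI conjI allI ballI)
  assume *: "diff_on (Suc n) S f"
  show "f differentiable (at x)" if "x \<in> S" for x
    using *[unfolded diff_on_def, rule_format, of "[]"] that by simp
  show "diff_on n S (pd i f)" for i
    unfolding diff_on_def
  proof (intro allI impI ballI)
    fix "is" :: "'a list" and x assume "length is \<le> n" "x \<in> S"
    thus "pds is (pd i f) differentiable (at x)"
      using *[unfolded diff_on_def, rule_format, of "is @ [i]" x] by (simp add: pds_snoc)
  qed
next
  assume *: "(\<forall>x\<in>S. f differentiable (at x)) \<and> (\<forall>i. diff_on n S (pd i f))"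
  show "diff_on (Suc n) S f"
    unfolding diff_on_def
  proof (intro allI impI ballI)
    fix "is" :: "'a list" and x assume "length is \<le> Suc n" "x \<in> S"
    with * show "pds is f differentiable (at x)"
      by (cases "is" rule: rev_cases) (auto simp: pds_snoc diff_on_def)
  qed
qed

lemma diff_on_mono: "diff_on (Suc n) S f \<Longrightarrow> diff_on n S f"
  by (auto simp: diff_on_def)

lemma diff_onD: "diff_on n S f \<Longrightarrow> x \<in> S \<Longrightarrow> f differentiable (at x)"
  using diff_on_def[of n S f] by (metis le0 list.size(3) pds.simps(1))

lemma diff_on_cong:
  fixes f :: "real^'n::finite \<Rightarrow> 'v::real_normed_vector"
  assumes "open S" "\<And>x. x \<in> S \<Longrightarrow> f x = g x" "diff_on n S g"
  shows "diff_on n S f"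
  unfolding diff_on_def
proof (intro allI impI ballI)
  fix "is" :: "'n list" and x assume "length is \<le> n" "x \<in> S"
  have eq: "pds is f y = pds is g y" if "y \<in> S" for y
    using pds_cong_open[OF assms(1) that, of f g] assms(2) by blast
  have "pds is g differentiable (at x)" using \<open>length is \<le> n\<close> \<open>x \<in> S\<close> assms(3) by (simp add: diff_on_def)
  thus "pds is f differentiable (at x)"
    using differentiable_cong_open[OF assms(1) \<open>x \<in> S\<close>, of "pds is f" "pds is g"] eq by blast
qed

lemma smooth_on_cong:
  assumes "open S" "\<And>x. x \<in> S \<Longrightarrow> f x = g x" "smooth_on S g"
  shows "smooth_on S f"
  using diff_on_cong[of S f g] assms unfolding smooth_on_iff_diff_on by blast

lemma smooth_onD: "smooth_on S f \<Longrightarrow> x \<in> S \<Longrightarrow> f differentiable (at x)"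
  using smooth_on_iff_diff_on diff_onD by metis

lemma smooth_on_pd: "smooth_on S f \<Longrightarrow> smooth_on S (pd i f)"
  using smooth_on_iff_diff_on diff_on_Suc by metis

lemma smooth_on_pds: "smooth_on S f \<Longrightarrow> smooth_on S (pds is f)"
  by (induction "is") (simp_all add: smooth_on_pd)

lemma smooth_on_subset: "smooth_on S f \<Longrightarrow> T \<subseteq> S \<Longrightarrow> smooth_on T f"
  by (auto simp: smooth_on_def)

lemma pd_add: "f differentiable (at x) \<Longrightarrow> g differentiable (at x) \<Longrightarrow> pd i (\<lambda>y. f y + g y) x = pd i f x + pd i g x"
  using pd_eq[OF has_derivative_add[OF has_derivative_frechet has_derivative_frechet]] by (simp add: pd_def)

lemma pd_diff: "f differentiable (at x) \<Longrightarrow> g differentiable (at x) \<Longrightarrow> pd i (\<lambda>y. f y - g y) x = pd i f x - pd i g x"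
  using pd_eq[OF has_derivative_diff[OF has_derivative_frechet has_derivative_frechet]] by (simp add: pd_def)

lemma pd_const: "pd i (\<lambda>y. c) x = 0"
  by (rule pd_eq[OF has_derivative_const])

lemma pd_linear: "bounded_linear L \<Longrightarrow> f differentiable (at x) \<Longrightarrow> pd i (\<lambda>y. L (f y)) x = L (pd i f x)"
  using pd_eq[OF bounded_linear.has_derivative[OF _ has_derivative_frechet], of L f x i] by (simp add: pd_def)

lemma pd_bilinear:
  assumes "bounded_bilinear B" "f differentiable (at x)" "g differentiable (at x)"
  shows "pd i (\<lambda>y. B (f y) (g y)) x = B (f x) (pd i g x) + B (pd i f x) (g x)"
  using pd_eq[OF bounded_bilinear.FDERIV[OF assms(1) has_derivative_frechet[OF assms(2)] has_derivative_frechet[OF assms(3)]], of i]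
  by (simp add: pd_def)

lemma differentiable_linear: "bounded_linear L \<Longrightarrow> f differentiable (at x) \<Longrightarrow> (\<lambda>y. L (f y)) differentiable (at x)"
  unfolding differentiable_def using bounded_linear.has_derivative by blast

lemma differentiable_bilinear:
  assumes "bounded_bilinear B" "f differentiable (at x)" "g differentiable (at x)"
  shows "(\<lambda>y. B (f y) (g y)) differentiable (at x)"
  using bounded_bilinear.FDERIV[OF assms(1) has_derivative_frechet[OF assms(2)] has_derivative_frechet[OF assms(3)]]
  unfolding differentiable_def by blast

lemma diff_on_add:
  assumes "open S" shows "diff_on n S f \<Longrightarrow> diff_on n S g \<Longrightarrow> diff_on n S (\<lambda>x. f x + g x)"
proof (induction n arbitrary: f g)
  case (Suc n)
  have "diff_on n S (pd i (\<lambda>x. f x + g x))" for i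
    by (rule diff_on_cong[OF assms _ Suc.IH[of "pd i f" "pd i g"]])
      (use Suc.prems in \<open>auto simp: diff_on_Suc pd_add\<close>)
  then show ?case using Suc.prems unfolding diff_on_Suc by (auto intro: differentiable_add)
qed (auto simp: diff_on_0 intro: differentiable_add)

lemma diff_on_linear:
  assumes "open S" "bounded_linear L" shows "diff_on n S f \<Longrightarrow> diff_on n S (\<lambda>x. L (f x))"
proof (induction n arbitrary: f)
  case (Suc n)
  have "diff_on n S (pd i (\<lambda>x. L (f x)))" for i
    by (rule diff_on_cong[OF assms(1) _ Suc.IH[of "pd i f"]])
      (use Suc.prems in \<open>auto simp: diff_on_Suc pd_linear[OF assms(2)]\<close>)
  then show ?case using Suc.prems unfolding diff_on_Suc by (auto intro: differentiable_linear[OF assms(2)])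
qed (auto simp: diff_on_0 intro: differentiable_linear[OF assms(2)])

lemma diff_on_bilinear:
  assumes "open S" "bounded_bilinear B"
  shows "diff_on n S f \<Longrightarrow> diff_on n S g \<Longrightarrow> diff_on n S (\<lambda>x. B (f x) (g x))"
proof (induction n arbitrary: f g)
  case (Suc n)
  have "diff_on n S (pd i (\<lambda>x. B (f x) (g x)))" for i
  proof (rule diff_on_cong[OF assms(1)])
    show "diff_on n S (\<lambda>x. B (f x) (pd i g x) + B (pd i f x) (g x))"
      using Suc.prems diff_on_mono[OF Suc.prems(1)] diff_on_mono[OF Suc.prems(2)] unfolding diff_on_Suc
      by (intro diff_on_add[OF assms(1)] Suc.IH) auto
  qed (use Suc.prems in \<open>auto simp: diff_on_Suc intro: pd_bilinear[OF assms(2)]\<close>)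
  then show ?case using Suc.prems unfolding diff_on_Suc by (auto intro: differentiable_bilinear[OF assms(2)])
qed (auto simp: diff_on_0 intro: differentiable_bilinear[OF assms(2)])

lemma pds_zero: "pds is (\<lambda>x. 0) = (\<lambda>x. 0)"
proof (induction "is")
  case (Cons i "is")
  have "pd i (\<lambda>y. 0) = (\<lambda>y. 0 :: 'b)" by (rule ext) (rule pd_const)
  then show ?case by (simp add: Cons)
qed simp

lemma smooth_on_const: "smooth_on S (\<lambda>x. c)"
  unfolding smooth_on_def
proof (intro allI ballI)
  fix "is" :: "'a list" and x
  have "pd i (\<lambda>y. c) = (\<lambda>y. 0 :: 'b)" for i :: 'a by (rule ext) (rule pd_const)
  thus "pds is (\<lambda>x. c) differentiable (at x)"
    by (cases "is" rule: rev_cases) (simp_all add: pds_snoc pds_zero)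
qed

lemma smooth_on_add: "open S \<Longrightarrow> smooth_on S f \<Longrightarrow> smooth_on S g \<Longrightarrow> smooth_on S (\<lambda>x. f x + g x)"
  by (simp add: smooth_on_iff_diff_on diff_on_add)

lemma smooth_on_linear: "open S \<Longrightarrow> bounded_linear L \<Longrightarrow> smooth_on S f \<Longrightarrow> smooth_on S (\<lambda>x. L (f x))"
  by (simp add: smooth_on_iff_diff_on diff_on_linear)

lemma smooth_on_bilinear: "open S \<Longrightarrow> bounded_bilinear B \<Longrightarrow> smooth_on S f \<Longrightarrow> smooth_on S g \<Longrightarrow> smooth_on S (\<lambda>x. B (f x) (g x))"
  by (simp add: smooth_on_iff_diff_on diff_on_bilinear)

lemma smooth_on_minus: "open S \<Longrightarrow> smooth_on S f \<Longrightarrow> smooth_on S (\<lambda>x. - f x)"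
  using smooth_on_linear[OF _ bounded_linear_minus[OF bounded_linear_ident]] by blast

lemma smooth_on_diff: "open S \<Longrightarrow> smooth_on S f \<Longrightarrow> smooth_on S g \<Longrightarrow> smooth_on S (\<lambda>x. f x - g x)"
  using smooth_on_add[of S f "\<lambda>x. - g x"] smooth_on_minus[of S g] by simp

lemma smooth_on_sum: "open S \<Longrightarrow> (\<And>i. i \<in> A \<Longrightarrow> smooth_on S (f i)) \<Longrightarrow> smooth_on S (\<lambda>x. \<Sum>i\<in>A. f i x)"
  by (induction A rule: infinite_finite_induct) (simp_all add: smooth_on_const smooth_on_add)

lemma smooth_on_mult: "open S \<Longrightarrow> smooth_on S f \<Longrightarrow> smooth_on S g \<Longrightarrow> smooth_on S (\<lambda>x. f x * g x :: real)"
  by (rule smooth_on_bilinear[OF _ bounded_bilinear_mult])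

lemma smooth_on_scaleR: "open S \<Longrightarrow> smooth_on S f \<Longrightarrow> smooth_on S g \<Longrightarrow> smooth_on S (\<lambda>x. f x *\<^sub>R g x)"
  by (rule smooth_on_bilinear[OF _ bounded_bilinear_scaleR])

lemma smooth_on_prod: "open S \<Longrightarrow> (\<And>i. i \<in> A \<Longrightarrow> smooth_on S (f i)) \<Longrightarrow> smooth_on S (\<lambda>x. \<Prod>i\<in>A. f i x :: real)"
  by (induction A rule: infinite_finite_induct) (simp_all add: smooth_on_const smooth_on_mult)

lemma smooth_on_nth: "open S \<Longrightarrow> smooth_on S f \<Longrightarrow> smooth_on S (\<lambda>x. f x $ i)"
  using smooth_on_linear[OF _ bounded_linear_vec_nth] by blast

lemma pd_nth: "f differentiable (at x) \<Longrightarrow> pd i (\<lambda>y. f y $ k) x = pd i f x $ k"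
  using pd_linear[OF bounded_linear_vec_nth] by blast

lemma bounded_linear_axis: "bounded_linear (\<lambda>x. axis k x :: ('a::real_normed_vector)^'n)"
proof (rule bounded_linear_intro[where K = 1])
  show "norm (axis k x :: 'a^'n) \<le> norm x * 1" for x
    by (simp add: norm_vec_def L2_set_def axis_def if_distrib[of norm] if_distrib[of "\<lambda>c. c\<^sup>2"] cong: if_cong)
qed (simp_all add: axis_def vec_eq_iff)

lemma vec_lambda_sum: "(\<chi> k. f k) = (\<Sum>k\<in>UNIV. axis k (f k) :: ('a::real_normed_vector)^'n::finite)"
  by (simp add: vec_eq_iff axis_def if_distrib cong: if_cong)

lemma smooth_on_vec: 
  fixes f :: "'k::finite \<Rightarrow> real^'n::finite \<Rightarrow> 'v::real_normed_vector"
  shows "open S \<Longrightarrow> (\<And>k. smooth_on S (f k)) \<Longrightarrow> smooth_on S (\<lambda>x. \<chi> k. f k x)"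
  unfolding vec_lambda_sum by (intro smooth_on_sum smooth_on_linear[OF _ bounded_linear_axis])

lemma smooth_on_vecI: 
  fixes f :: "real^'n::finite \<Rightarrow> 'v::real_normed_vector^'k::finite"
  shows "open S \<Longrightarrow> (\<And>k. smooth_on S (\<lambda>x. f x $ k)) \<Longrightarrow> smooth_on S f"
  using smooth_on_vec[of S "\<lambda>k x. f x $ k"] by simp

lemma smooth_on_fst: "open S \<Longrightarrow> smooth_on S f \<Longrightarrow> smooth_on S (\<lambda>x. fst (f x))"
  using smooth_on_linear[OF _ bounded_linear_fst] by blast

lemma smooth_on_snd: "open S \<Longrightarrow> smooth_on S f \<Longrightarrow> smooth_on S (\<lambda>x. snd (f x))"
  using smooth_on_linear[OF _ bounded_linear_snd] by blast

lemma smooth_on_Pair: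
  assumes "open S" "smooth_on S f" "smooth_on S g" shows "smooth_on S (\<lambda>x. (f x, g x))"
proof -
  have "smooth_on S (\<lambda>x. (f x, 0) + (0, g x))"
    by (intro smooth_on_add assms smooth_on_linear[where L = "\<lambda>u. (u, 0)"] smooth_on_linear[where L = "\<lambda>u. (0, u)"] 
       bounded_linear_Pair bounded_linear_ident bounded_linear_zero)
  thus ?thesis by simp
qed

lemma bounded_bilinear_matrix_mult: "bounded_bilinear ((**) :: real^'n::finite^'m::finite \<Rightarrow> real^'p::finite^'n \<Rightarrow> real^'p^'m)"
proof -
  have "bilinear ((**) :: real^'n^'m \<Rightarrow> real^'p^'n \<Rightarrow> real^'p^'m)"
    unfolding bilinear_def
    by (intro allI conjI linearI)
      (simp_all add: matrix_add_ldistrib matrix_matrix_mult_def vec_eq_iff sum.distrib sum_distrib_left algebra_simps)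
  thus ?thesis by (simp add: bilinear_conv_bounded_bilinear)
qed

lemma bounded_linear_transpose: "bounded_linear (transpose :: real^'n::finite^'m::finite \<Rightarrow> real^'m^'n)"
  unfolding linear_conv_bounded_linear[symmetric]
  by (rule linearI) (simp_all add: transpose_def vec_eq_iff)

lemma smooth_on_matrix_mult:
  "open S \<Longrightarrow> smooth_on S f \<Longrightarrow> smooth_on S g \<Longrightarrow> smooth_on S (\<lambda>x. f x ** g x :: real^'n::finite^'m::finite)"
  by (rule smooth_on_bilinear[OF _ bounded_bilinear_matrix_mult])

lemma pd_inverse:
  fixes f :: "real^'n::finite \<Rightarrow> real"
  assumes "f differentiable (at x)" "f x \<noteq> 0"
  shows "pd i (\<lambda>y. inverse (f y)) x = - pd i f x * (inverse (f x) * inverse (f x))"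
  using pd_eq[OF Deriv.has_derivative_inverse[OF assms(2) has_derivative_frechet[OF assms(1)]], of i] 
  by (simp add: pd_def)

text \<open>The derivative is a smooth function times the square of the inverse, which the induction
  hypothesis controls to one order less.\<close>

lemma smooth_on_inverse:
  fixes f :: "real^'n::finite \<Rightarrow> real"
  assumes "open S" "smooth_on S f" "\<And>x. x \<in> S \<Longrightarrow> f x \<noteq> 0"
  shows "smooth_on S (\<lambda>x. inverse (f x))"
proof -
  have d: "(\<lambda>y. inverse (f y)) differentiable (at x)" if "x \<in> S" for x
    using Deriv.has_derivative_inverse[OF assms(3)[OF that] has_derivative_frechet[OF smooth_onD[OF assms(2) that]]]
    unfolding differentiable_def by blast
  have "diff_on n S (\<lambda>x. inverse (f x))" for n
  proof (induction n)
    case (Suc n)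
    have "diff_on n S (pd i (\<lambda>x. inverse (f x)))" for i
    proof (rule diff_on_cong[OF assms(1)])
      have "diff_on n S (\<lambda>x. - pd i f x)"
        using smooth_on_minus[OF assms(1) smooth_on_pd[OF assms(2)]] by (simp add: smooth_on_iff_diff_on)
      thus "diff_on n S (\<lambda>x. - pd i f x * (inverse (f x) * inverse (f x)))"
        using Suc by (intro diff_on_bilinear[OF assms(1) bounded_bilinear_mult])
    qed (use pd_inverse smooth_onD[OF assms(2)] assms(3) in blast)
    with d show ?case by (simp add: diff_on_Suc)
  qed (simp add: diff_on_0 d)
  thus ?thesis by (simp add: smooth_on_iff_diff_on)
qed

text \<open>The derivative is written as a multiple of the root itself, with the sign of
  \<open>f\<close> absorbed by the inverse; this form feeds the induction in
  \<open>smooth_on_sqrt_abs\<close>.\<close>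

lemma has_derivative_sqrt_abs:
  fixes f :: "real^'n::finite \<Rightarrow> real"
  assumes "(f has_derivative f') (at x)" "f x \<noteq> 0"
  shows "((\<lambda>y. sqrt \<bar>f y\<bar>) has_derivative (\<lambda>v. sqrt \<bar>f x\<bar> * (f' v * inverse (f x)) / 2)) (at x)"
proof -
  have 1: "((\<lambda>y. sqrt \<bar>y\<bar>) has_real_derivative (sqrt \<bar>c\<bar> * inverse c / 2)) (at c)" if "c \<noteq> 0" for c :: real
  proof -
    have q: "sgn c * inverse (sqrt \<bar>c\<bar>) / 2 = sqrt \<bar>c\<bar> * inverse c / 2"
    proof -
      have "\<bar>c\<bar> = sqrt \<bar>c\<bar> * sqrt \<bar>c\<bar>" by simp
      hence "inverse (sqrt \<bar>c\<bar>) = sqrt \<bar>c\<bar> * inverse \<bar>c\<bar>" using that by (simp add: field_simps)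
      thus ?thesis using that by (simp add: sgn_if)
    qed
    have "((\<lambda>y. sqrt \<bar>y\<bar>) has_real_derivative (inverse (sqrt \<bar>c\<bar>) / 2 * sgn c)) (at c)"
    proof (cases "c > 0")
      case True
      hence "(sqrt has_real_derivative (inverse (sqrt \<bar>c\<bar>) / 2 * sgn c)) (at c)"
        using DERIV_real_sqrt[of c] by simp
      thus ?thesis
        by (rule has_field_derivative_transform_within_open[where S = "{0<..}"]) (use True in auto)
    next
      case False
      hence "((\<lambda>y. sqrt (- y)) has_real_derivative (inverse (sqrt (- c)) / 2 * (- 1))) (at c)"
        using that by (intro DERIV_chain2[of sqrt] DERIV_real_sqrt) (auto intro!: derivative_eq_intros)
      hence "((\<lambda>y. sqrt (- y)) has_real_derivative (inverse (sqrt \<bar>c\<bar>) / 2 * sgn c)) (at c)"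
        using False that by simp
      thus ?thesis
        by (rule has_field_derivative_transform_within_open[where S = "{..<0}"]) (use False that in auto)
    qed
    thus ?thesis using q by (simp add: mult.commute)
  qed
  from has_derivative_compose[OF assms(1) 1[OF assms(2), unfolded has_field_derivative_def]]
  show ?thesis by (simp add: mult_ac)
qed

lemma pd_sqrt_abs:
  fixes f :: "real^'n::finite \<Rightarrow> real"
  assumes "f differentiable (at x)" "f x \<noteq> 0"
  shows "pd i (\<lambda>y. sqrt \<bar>f y\<bar>) x = sqrt \<bar>f x\<bar> * (pd i f x * inverse (f x)) / 2"
  using pd_eq[OF has_derivative_sqrt_abs[OF has_derivative_frechet[OF assms(1)] assms(2)], of i] by (simp add: pd_def)

lemma smooth_on_sqrt_abs:
  fixes f :: "real^'n::finite \<Rightarrow> real"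
  assumes "open S" "smooth_on S f" "\<And>x. x \<in> S \<Longrightarrow> f x \<noteq> 0"
  shows "smooth_on S (\<lambda>x. sqrt \<bar>f x\<bar>)"
proof -
  have d: "(\<lambda>y. sqrt \<bar>f y\<bar>) differentiable (at x)" if "x \<in> S" for x
    using has_derivative_sqrt_abs[OF has_derivative_frechet[OF smooth_onD[OF assms(2) that]] assms(3)[OF that]]
    unfolding differentiable_def by blast
  have "diff_on n S (\<lambda>x. sqrt \<bar>f x\<bar>)" for n
  proof (induction n)
    case (Suc n)
    have "diff_on n S (pd i (\<lambda>x. sqrt \<bar>f x\<bar>))" for i
    proof (rule diff_on_cong[OF assms(1)])
      have "diff_on n S (\<lambda>x. pd i f x * inverse (f x) * (1/2))"
        using smooth_on_mult[OF assms(1) smooth_on_mult[OF assms(1) smooth_on_pd[OF assms(2)] smooth_on_inverse[OF assms]] smooth_on_const]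
        unfolding smooth_on_iff_diff_on by blast
      thus "diff_on n S (\<lambda>x. sqrt \<bar>f x\<bar> * (pd i f x * inverse (f x) * (1/2)))"
        by (rule diff_on_bilinear[OF assms(1) bounded_bilinear_mult Suc])
    qed (use pd_sqrt_abs smooth_onD[OF assms(2)] assms(3) in force)
    with d show ?case by (simp add: diff_on_Suc)
  qed (simp add: diff_on_0 d)
  thus ?thesis by (simp add: smooth_on_iff_diff_on)
qed

section \<open>Symmetry of second partial derivatives\<close>

lemma deriv_along_axis:
  fixes f :: "real^'n::finite \<Rightarrow> real"
  assumes "f differentiable (at (p + t *\<^sub>R axis i 1))"
  shows "((\<lambda>t. f (p + t *\<^sub>R axis i 1)) has_real_derivative pd i f (p + t *\<^sub>R axis i 1)) (at t)"
proof -
  have 1: "((\<lambda>t. p + t *\<^sub>R axis i 1) has_derivative (\<lambda>h. h *\<^sub>R axis i 1)) (at t)"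
    by (auto intro!: derivative_eq_intros)
  note 2 = has_derivative_frechet[OF assms]
  have "linear (frechet_derivative f (at (p + t *\<^sub>R axis i 1)))"
    using 2 by (rule has_derivative_linear)
  with has_derivative_compose[OF 1 2] show ?thesis
    by (simp add: has_field_derivative_def pd_def linear_scale mult.commute[of _ "frechet_derivative _ _ _"])
qed

text \<open>The mean value theorem is applied twice: in direction \<open>i\<close> to the increment
  over the step in direction \<open>j\<close>, then in direction \<open>j\<close> to
  \<open>pd i f\<close>.\<close>

lemma second_difference:
  fixes f :: "real^'n::finite \<Rightarrow> real"
  assumes f: "smooth_on (ball x r) f" and h: "0 < h" "2 * h < r"
  shows "\<exists>y. dist x y \<le> 2 * h \<and>
    f (x + h *\<^sub>R axis i 1 + h *\<^sub>R axis j 1) - f (x + h *\<^sub>R axis i 1) - f (x + h *\<^sub>R axis j 1) + f x = h * h * pd j (pd i f) y"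
proof -
  have near: "dist x (x + s *\<^sub>R axis i 1 + t *\<^sub>R axis j 1) \<le> 2 * h" if "0 \<le> s" "s \<le> h" "0 \<le> t" "t \<le> h" for s t
  proof -
    have "norm (s *\<^sub>R axis i (1::real) + t *\<^sub>R axis j 1) \<le> \<bar>s\<bar> + \<bar>t\<bar>"
      by (rule order_trans[OF norm_triangle_ineq]) simp
    moreover have "x - (x + s *\<^sub>R axis i 1 + t *\<^sub>R axis j 1) = - (s *\<^sub>R axis i 1 + t *\<^sub>R axis j 1)" by simp
    ultimately show ?thesis using that unfolding dist_norm by (simp only: norm_minus_cancel)
  qed
  have inb: "x + s *\<^sub>R axis i 1 + t *\<^sub>R axis j 1 \<in> ball x r" if "0 \<le> s" "s \<le> h" "0 \<le> t" "t \<le> h" for s t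
    using near[OF that] h by simp
  define u where "u s = f (x + h *\<^sub>R axis j 1 + s *\<^sub>R axis i 1) - f (x + s *\<^sub>R axis i 1)" for s
  have "DERIV u s :> pd i f (x + h *\<^sub>R axis j 1 + s *\<^sub>R axis i 1) - pd i f (x + s *\<^sub>R axis i 1)" if "0 \<le> s" "s \<le> h" for s
    unfolding u_def using inb[of s h] inb[of s 0] that h
    by (intro DERIV_diff deriv_along_axis smooth_onD[OF f]) (simp_all add: add_ac)
  then obtain s where s: "0 < s" "s < h"
    "u h - u 0 = (h - 0) * (pd i f (x + h *\<^sub>R axis j 1 + s *\<^sub>R axis i 1) - pd i f (x + s *\<^sub>R axis i 1))"
    using MVT2[OF h(1), of u "\<lambda>s. pd i f (x + h *\<^sub>R axis j 1 + s *\<^sub>R axis i 1) - pd i f (x + s *\<^sub>R axis i 1)"] by blast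
  have "DERIV (\<lambda>t. pd i f ((x + s *\<^sub>R axis i 1) + t *\<^sub>R axis j 1)) t :> pd j (pd i f) ((x + s *\<^sub>R axis i 1) + t *\<^sub>R axis j 1)"
    if "0 \<le> t" "t \<le> h" for t
    using inb[of s t] that s by (intro deriv_along_axis smooth_onD[OF smooth_on_pd[OF f]]) simp_all
  then obtain t where t: "0 < t" "t < h"
    "pd i f ((x + s *\<^sub>R axis i 1) + h *\<^sub>R axis j 1) - pd i f ((x + s *\<^sub>R axis i 1) + 0 *\<^sub>R axis j 1)
      = (h - 0) * pd j (pd i f) ((x + s *\<^sub>R axis i 1) + t *\<^sub>R axis j 1)"
    using MVT2[OF h(1), of "\<lambda>t. pd i f ((x + s *\<^sub>R axis i 1) + t *\<^sub>R axis j 1)"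
      "\<lambda>t. pd j (pd i f) ((x + s *\<^sub>R axis i 1) + t *\<^sub>R axis j 1)"] by blast
  have "x + h *\<^sub>R axis j 1 + s *\<^sub>R axis i 1 = x + s *\<^sub>R axis i 1 + h *\<^sub>R axis j 1"
    "x + h *\<^sub>R axis j 1 + h *\<^sub>R axis i 1 = x + h *\<^sub>R axis i 1 + h *\<^sub>R axis j (1::real)"
    by (simp_all add: add_ac)
  with s(3) t(3) have "f (x + h *\<^sub>R axis i 1 + h *\<^sub>R axis j 1) - f (x + h *\<^sub>R axis i 1) - f (x + h *\<^sub>R axis j 1) + f x
      = h * h * pd j (pd i f) ((x + s *\<^sub>R axis i 1) + t *\<^sub>R axis j 1)"
    by (simp add: u_def algebra_simps)
  with near[of s t] s t show ?thesis by (intro exI[of _ "x + s *\<^sub>R axis i 1 + t *\<^sub>R axis j 1"]) auto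
qed

text \<open>The second difference is symmetric in the two directions, so the two mixed derivatives
  take a common value at points arbitrarily near \<open>x\<close>; both are continuous.\<close>

lemma pd_commute_real:
  fixes f :: "real^'n::finite \<Rightarrow> real"
  assumes "open S" "smooth_on S f" "x \<in> S"
  shows "pd i (pd j f) x = pd j (pd i f) x"
proof (rule ccontr)
  assume neq: "\<not> ?thesis"
  \<comment> \<open>Half the gap: values closer than this to the two limits cannot coincide.\<close>
  define e where "e = \<bar>pd i (pd j f) x - pd j (pd i f) x\<bar> / 2"
  hence e: "e > 0" using neq by simp
  obtain r where r: "r > 0" "ball x r \<subseteq> S" using assms open_contains_ball by blast
  have c: "isCont (pd i (pd j f)) x" for i j
    using smooth_onD[OF smooth_on_pd[OF smooth_on_pd[OF assms(2)]] assms(3)] differentiable_imp_continuous_within by blast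
  obtain d1 where d1: "d1 > 0" "\<And>y. dist y x < d1 \<Longrightarrow> dist (pd i (pd j f) y) (pd i (pd j f) x) < e"
    using c[of i j] e unfolding continuous_at_eps_delta by blast
  obtain d2 where d2: "d2 > 0" "\<And>y. dist y x < d2 \<Longrightarrow> dist (pd j (pd i f) y) (pd j (pd i f) x) < e"
    using c[of j i] e unfolding continuous_at_eps_delta by blast
  define h where "h = min r (min d1 d2) / 4"
  have h: "0 < h" "2 * h < r" "2 * h < d1" "2 * h < d2" using r d1 d2 by (auto simp: h_def)
  note fs = smooth_on_subset[OF assms(2) r(2)]
  obtain y where y: "dist x y \<le> 2 * h"
    "f (x + h *\<^sub>R axis i 1 + h *\<^sub>R axis j 1) - f (x + h *\<^sub>R axis i 1) - f (x + h *\<^sub>R axis j 1) + f x = h * h * pd j (pd i f) y"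
    using second_difference[OF fs h(1,2), of i j] by blast
  obtain z where z: "dist x z \<le> 2 * h"
    "f (x + h *\<^sub>R axis j 1 + h *\<^sub>R axis i 1) - f (x + h *\<^sub>R axis j 1) - f (x + h *\<^sub>R axis i 1) + f x = h * h * pd i (pd j f) z"
    using second_difference[OF fs h(1,2), of j i] by blast
  have "x + h *\<^sub>R axis j 1 + h *\<^sub>R axis i 1 = x + h *\<^sub>R axis i 1 + h *\<^sub>R axis j (1::real)" by (simp add: add_ac)
  from y(2) z(2)[unfolded this] have "h * h * pd j (pd i f) y = h * h * pd i (pd j f) z" by linarith
  hence "pd j (pd i f) y = pd i (pd j f) z" using h by simp
  with d1(2)[of z] d2(2)[of y] y(1) z(1) h show False
    unfolding e_def by (simp add: dist_real_def dist_commute field_simps abs_if split: if_splits)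
qed

lemma pd_commute:
  fixes f :: "real^'n::finite \<Rightarrow> 'v::euclidean_space"
  assumes "open S" "smooth_on S f" "x \<in> S"
  shows "pd i (pd j f) x = pd j (pd i f) x"
proof (rule euclidean_eqI)
  fix b :: 'v assume "b \<in> Basis"
  let ?L = "\<lambda>v. v \<bullet> b"
  have L: "bounded_linear ?L" by (rule bounded_linear_inner_left)
  have "pd i (pd j f) x \<bullet> b = pd i (pd j (\<lambda>y. f y \<bullet> b)) x" for i j
    using pd_linear[OF L smooth_onD[OF smooth_on_pd[OF assms(2)] assms(3)]]
      pd_cong_open[OF assms(1,3), of "\<lambda>y. pd j f y \<bullet> b" "pd j (\<lambda>y. f y \<bullet> b)"] pd_linear[OF L smooth_onD[OF assms(2)]]
    by metis
  thus "pd i (pd j f) x \<bullet> b = pd j (pd i f) x \<bullet> b"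
    using pd_commute_real[OF assms(1) smooth_on_linear[OF assms(1) L assms(2)] assms(3)] by simp
qed

lemma pds_perm:
  fixes f :: "real^'n::finite \<Rightarrow> 'v::euclidean_space"
  assumes "open S" "smooth_on S f" "x \<in> S" 
  shows "pds (us @ a # b # vs) f x = pds (us @ b # a # vs) f x"
  unfolding pds_append
  by (rule pds_cong_open[OF assms(1,3)]) (simp add: pd_commute[OF assms(1) smooth_on_pds[OF assms(2)]])

lemma pds_add:
  assumes "open S" "smooth_on S f" "smooth_on S g" "x \<in> S"
  shows "pds is (\<lambda>y. f y + g y) x = pds is f x + pds is g x"
  using assms(4)
proof (induction "is" arbitrary: x)
  case (Cons i "is")
  have "pd i (pds is (\<lambda>y. f y + g y)) x = pd i (\<lambda>y. pds is f y + pds is g y) x"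
    by (rule pd_cong_open[OF assms(1) Cons.prems Cons.IH])
  also have "\<dots> = pd i (pds is f) x + pd i (pds is g) x"
    by (rule pd_add[OF smooth_onD[OF smooth_on_pds[OF assms(2)] Cons.prems] smooth_onD[OF smooth_on_pds[OF assms(3)] Cons.prems]])
  finally show ?case by simp
qed simp

lemma pds_linear:
  assumes "open S" "bounded_linear L" "smooth_on S f" "x \<in> S"
  shows "pds is (\<lambda>y. L (f y)) x = L (pds is f x)"
  using assms(4)
proof (induction "is" arbitrary: x)
  case (Cons i "is")
  have "pd i (pds is (\<lambda>y. L (f y))) x = pd i (\<lambda>y. L (pds is f y)) x"
    by (rule pd_cong_open[OF assms(1) Cons.prems Cons.IH])
  also have "\<dots> = L (pd i (pds is f) x)"
    by (rule pd_linear[OF assms(2) smooth_onD[OF smooth_on_pds[OF assms(3)] Cons.prems]])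
  finally show ?case by simp
qed simp

lemma pds_diff:
  assumes "open S" "smooth_on S f" "smooth_on S g" "x \<in> S"
  shows "pds is (\<lambda>y. f y - g y) x = pds is f x - pds is g x"
  using pds_add[OF assms(1,2) smooth_on_minus[OF assms(1,3)] assms(4)]
    pds_linear[OF assms(1) bounded_linear_minus[OF bounded_linear_ident] assms(3,4)] by simp

section \<open>Order of vanishing at a point\<close>

definition vanishes :: "nat \<Rightarrow> real^'n::finite \<Rightarrow> (real^'n \<Rightarrow> 'v::real_normed_vector) \<Rightarrow> bool"
  where "vanishes k a f \<longleftrightarrow> (\<forall>is. length is < k \<longrightarrow> pds is f a = 0)"

lemma vanishes_0 [simp]: "vanishes 0 a f"
  by (simp add: vanishes_def)

lemma vanishes_Suc: "vanishes (Suc k) a f \<longleftrightarrow> f a = 0 \<and> (\<forall>i. vanishes k a (pd i f))"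
proof (intro iffI conjI allI)
  assume *: "vanishes (Suc k) a f"
  show "f a = 0" using *[unfolded vanishes_def, rule_format, of "[]"] by simp
  show "vanishes k a (pd i f)" for i
    unfolding vanishes_def
  proof (intro allI impI)
    fix "is" :: "'a list" assume "length is < k"
    thus "pds is (pd i f) a = 0" using *[unfolded vanishes_def, rule_format, of "is @ [i]"] by (simp add: pds_snoc)
  qed
next
  assume *: "f a = 0 \<and> (\<forall>i. vanishes k a (pd i f))"
  show "vanishes (Suc k) a f"
    unfolding vanishes_def
  proof (intro allI impI)
    fix "is" :: "'a list" assume "length is < Suc k"
    with * show "pds is f a = 0" by (cases "is" rule: rev_cases) (auto simp: pds_snoc vanishes_def)
  qed
qed

lemma vanishes_pd: "vanishes (Suc k) a f \<Longrightarrow> vanishes k a (pd i f)"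
  by (simp add: vanishes_Suc)

lemma vanishes_mono: "vanishes k a f \<Longrightarrow> l \<le> k \<Longrightarrow> vanishes l a f"
  by (simp add: vanishes_def)

lemma vanishes_cong: "open S \<Longrightarrow> a \<in> S \<Longrightarrow> (\<And>y. y \<in> S \<Longrightarrow> f y = g y) \<Longrightarrow> vanishes k a g \<Longrightarrow> vanishes k a f"
  using pds_cong_open[of S a f g] by (simp add: vanishes_def)

context
  fixes S :: "(real^'n::finite) set" and a
  assumes S: "open S" "a \<in> S"
begin

lemma vanishes_add: "smooth_on S f \<Longrightarrow> smooth_on S g \<Longrightarrow> vanishes k a f \<Longrightarrow> vanishes k a g \<Longrightarrow> vanishes k a (\<lambda>x. f x + g x)"
  unfolding vanishes_def by (simp add: pds_add[OF S(1) _ _ S(2)])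

lemma vanishes_linear: "bounded_linear L \<Longrightarrow> smooth_on S f \<Longrightarrow> vanishes k a f \<Longrightarrow> vanishes k a (\<lambda>x. L (f x))"
  unfolding vanishes_def by (simp add: pds_linear[OF S(1) _ _ S(2)] linear_0 bounded_linear.linear)

lemma vanishes_diff: "smooth_on S f \<Longrightarrow> smooth_on S g \<Longrightarrow> vanishes k a f \<Longrightarrow> vanishes k a g \<Longrightarrow> vanishes k a (\<lambda>x. f x - g x)"
  unfolding vanishes_def by (simp add: pds_diff[OF S(1) _ _ S(2)])

text \<open>Vanishing orders add. In each term of the Leibniz rule the order of one factor drops by
  one; a factor of order 0 cannot drop, but then the other factor alone has the order
  required.\<close>

lemma vanishes_bilinear:
  assumes B: "bounded_bilinear B"
  shows "smooth_on S f \<Longrightarrow> smooth_on S g \<Longrightarrow> vanishes k a f \<Longrightarrow> vanishes l a g \<Longrightarrow> vanishes (k + l) a (\<lambda>x. B (f x) (g x))"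
proof (induction m \<equiv> "k + l" arbitrary: k l f g)
  case (Suc m)
  have "vanishes m a (pd i (\<lambda>x. B (f x) (g x)))" for i
  proof (rule vanishes_cong[OF S])
    show "pd i (\<lambda>x. B (f x) (g x)) y = B (f y) (pd i g y) + B (pd i f y) (g y)" if "y \<in> S" for y
      by (rule pd_bilinear[OF B smooth_onD[OF Suc.prems(1) that] smooth_onD[OF Suc.prems(2) that]])
    have "vanishes m a (\<lambda>x. B (f x) (pd i g x))"
    proof (cases l)
      case 0
      have "vanishes m a f" using Suc.prems(3) Suc.hyps(2) 0 by (auto intro: vanishes_mono)
      with Suc.hyps(1)[of m 0 f "pd i g"] Suc.prems show ?thesis by (simp add: smooth_on_pd)
    next
      case (Suc l')
      with Suc.hyps(1)[of k l' f "pd i g"] Suc.hyps(2) Suc.prems show ?thesis by (simp add: smooth_on_pd vanishes_pd)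
    qed
    moreover have "vanishes m a (\<lambda>x. B (pd i f x) (g x))"
    proof (cases k)
      case 0
      have "vanishes m a g" using Suc.prems(4) Suc.hyps(2) 0 by (auto intro: vanishes_mono)
      with Suc.hyps(1)[of 0 m "pd i f" g] Suc.prems show ?thesis by (simp add: smooth_on_pd)
    next
      case (Suc k')
      with Suc.hyps(1)[of k' l "pd i f" g] Suc.hyps(2) Suc.prems show ?thesis by (simp add: smooth_on_pd vanishes_pd)
    qed
    ultimately show "vanishes m a (\<lambda>x. B (f x) (pd i g x) + B (pd i f x) (g x))"
      by (intro vanishes_add smooth_on_bilinear[OF S(1) B] smooth_on_pd Suc.prems)
  qed
  moreover have "B (f a) (g a) = 0"
  proof (cases k)
    case 0
    hence "g a = 0" using Suc.prems(4) Suc.hyps(2) by (cases l) (auto simp: vanishes_Suc)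
    thus ?thesis by (simp add: bounded_bilinear.zero_right[OF B])
  next
    case (Suc k')
    hence "f a = 0" using Suc.prems(3) by (simp add: vanishes_Suc)
    thus ?thesis by (simp add: bounded_bilinear.zero_left[OF B])
  qed
  ultimately show ?case unfolding Suc.hyps(2)[symmetric] vanishes_Suc by blast
qed simp

end

section \<open>Curvature and the contracted Bianchi identity\<close>

interpretation matmul: bounded_bilinear "(**) :: real^'n::finite^'m::finite \<Rightarrow> real^'p::finite^'n \<Rightarrow> real^'p^'m"
  by (rule bounded_bilinear_matrix_mult)

lemmas matmul_simps = matmul.add_left matmul.add_right matmul.diff_left matmul.diff_right
  matmul.minus_left matmul.minus_right matrix_mul_assoc

lemma transpose_simps:
  fixes A B :: "real^'n::finite^'n"
  shows "transpose (A + B) = transpose A + transpose B" "transpose (A - B) = transpose A - transpose B"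
    "transpose (- A) = - transpose A" "transpose (A ** B) = transpose B ** transpose A"
    "transpose (c *\<^sub>R A) = c *\<^sub>R transpose A"
  by (simp_all add: matrix_transpose_mul) (simp_all add: transpose_def vec_eq_iff)

lemma transpose_nth [simp]: "transpose A $ i $ j = A $ j $ i"
  by (simp add: transpose_def)

lemma matrix_mult_nth: "(A ** B) $ i $ j = (\<Sum>k\<in>UNIV. A $ i $ k * B $ k $ j)"
  by (simp add: matrix_matrix_mult_def)

lemma trace_mult_commute: "trace (A ** B) = trace (B ** (A :: real^'n::finite^'n))"
  unfolding trace_def matrix_mult_nth by (subst sum.swap) (simp add: mult.commute)

lemma pd_matrix_mult:
  fixes f g :: "real^'k::finite \<Rightarrow> real^'n::finite^'n"
  shows "f differentiable (at x) \<Longrightarrow> g differentiable (at x) \<Longrightarrow> pd i (\<lambda>y. f y ** g y) x = f x ** pd i g x + pd i f x ** g x"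
  by (rule pd_bilinear[OF bounded_bilinear_matrix_mult])

lemma pd_mult:
  fixes f g :: "real^'k::finite \<Rightarrow> real"
  shows "f differentiable (at x) \<Longrightarrow> g differentiable (at x) \<Longrightarrow> pd i (\<lambda>y. f y * g y) x = f x * pd i g x + pd i f x * g x"
  by (rule pd_bilinear[OF bounded_bilinear_mult])

lemma pd_scaleR:
  "f differentiable (at x) \<Longrightarrow> g differentiable (at x) \<Longrightarrow> pd i (\<lambda>y. f y *\<^sub>R g y) x = f x *\<^sub>R pd i g x + pd i f x *\<^sub>R g x"
  by (rule pd_bilinear[OF bounded_bilinear_scaleR])

lemma pd_sum:
  "(\<And>k. k \<in> A \<Longrightarrow> f k differentiable (at x)) \<Longrightarrow> pd i (\<lambda>y. \<Sum>k\<in>A. f k y) x = (\<Sum>k\<in>A. pd i (f k) x)"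
  by (induction A rule: infinite_finite_induct) (simp_all add: pd_const pd_add)

lemma smooth_on_det:
  fixes M :: "real^'k::finite \<Rightarrow> real^'n::finite^'n"
  assumes S: "open S" and "smooth_on S M" shows "smooth_on S (\<lambda>x. det (M x))"
  unfolding det_def
  by (intro smooth_on_sum smooth_on_mult smooth_on_const smooth_on_prod smooth_on_nth assms)

lemma pd_prod:
  fixes f :: "'a \<Rightarrow> real^'k::finite \<Rightarrow> real"
  assumes "finite A" "\<And>i. i \<in> A \<Longrightarrow> f i differentiable (at x)"
  shows "pd k (\<lambda>y. \<Prod>i\<in>A. f i y) x = (\<Sum>i\<in>A. pd k (f i) x * (\<Prod>j\<in>A - {i}. f j x))
    \<and> (\<lambda>y. \<Prod>i\<in>A. f i y) differentiable (at x)"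
  using assms
proof (induction A rule: finite_induct)
  case (insert a A)
  have "pd k (\<lambda>y. \<Prod>i\<in>insert a A. f i y) x = f a x * (\<Sum>i\<in>A. pd k (f i) x * (\<Prod>j\<in>A - {i}. f j x)) + pd k (f a) x * (\<Prod>i\<in>A. f i x)"
    using insert by (simp add: pd_mult)
  also have "(\<Sum>i\<in>A. pd k (f i) x * (\<Prod>j\<in>insert a A - {i}. f j x)) = (\<Sum>i\<in>A. f a x * (pd k (f i) x * (\<Prod>j\<in>A - {i}. f j x)))"
  proof (rule sum.cong[OF refl])
    fix i assume "i \<in> A"
    hence "insert a A - {i} = insert a (A - {i})" using insert by auto
    thus "pd k (f i) x * (\<Prod>j\<in>insert a A - {i}. f j x) = f a x * (pd k (f i) x * (\<Prod>j\<in>A - {i}. f j x))"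
      using insert by (simp add: mult.left_commute)
  qed
  hence "f a x * (\<Sum>i\<in>A. pd k (f i) x * (\<Prod>j\<in>A - {i}. f j x)) + pd k (f a) x * (\<Prod>i\<in>A. f i x)
      = (\<Sum>i\<in>insert a A. pd k (f i) x * (\<Prod>j\<in>insert a A - {i}. f j x))"
    using insert by (simp add: sum_distrib_left)
  finally show ?case using insert by (simp add: differentiable_mult)
qed (simp add: pd_const)

text \<open>Jacobi's formula, row by row. If the derivative of the matrix is
  \<open>Q ** M x\<close>, its row \<open>i\<close> is a combination of the rows of
  \<open>M x\<close>, and putting it in place of row \<open>i\<close> multiplies the determinant by
  \<open>Q $ i $ i\<close>.\<close>

lemma pd_det:
  fixes M :: "real^'k::finite \<Rightarrow> real^'n::finite^'n"
  assumes M: "M differentiable (at x)" and inv: "N ** M x = mat 1"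
  shows "pd k (\<lambda>y. det (M y)) x = det (M x) * trace (N ** pd k M x)"
proof -
  have d: "(\<lambda>y. M y $ i $ j) differentiable (at x)" for i j
    using differentiable_linear[OF bounded_linear_vec_nth differentiable_linear[OF bounded_linear_vec_nth M]] by simp
  have e: "pd k (\<lambda>y. M y $ i $ j) x = pd k M x $ i $ j" for i j
    using pd_nth[OF M, of k i] pd_nth[OF differentiable_linear[OF bounded_linear_vec_nth M], of k i j] by simp
  let ?P = "{p. p permutes (UNIV :: 'n set)}"
  define Q where "Q = pd k M x ** N"
  have QM: "pd k M x = Q ** M x" unfolding Q_def using inv by (simp flip: matrix_mul_assoc)
  have "pd k (\<lambda>y. det (M y)) x = (\<Sum>p\<in>?P. of_int (sign p) * pd k (\<lambda>y. \<Prod>i\<in>UNIV. M y $ i $ p i) x)"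
    unfolding det_def using pd_prod[of UNIV "\<lambda>i y. M y $ i $ _ i" x] d
    by (subst pd_sum) (auto intro!: differentiable_mult sum.cong simp: pd_mult pd_const)
  also have "\<dots> = (\<Sum>p\<in>?P. \<Sum>i\<in>UNIV. of_int (sign p) * (pd k M x $ i $ p i * (\<Prod>j\<in>UNIV - {i}. M x $ j $ p j)))"
    using pd_prod[of UNIV "\<lambda>i y. M y $ i $ _ i" x] d by (auto simp: sum_distrib_left e intro!: sum.cong)
  also have "\<dots> = (\<Sum>i\<in>UNIV. det (\<chi> r. if r = i then pd k M x $ i else M x $ r))"
  proof (subst sum.swap, rule sum.cong[OF refl])
    fix i :: 'n
    show "(\<Sum>p\<in>?P. of_int (sign p) * (pd k M x $ i $ p i * (\<Prod>j\<in>UNIV - {i}. M x $ j $ p j)))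
      = det (\<chi> r. if r = i then pd k M x $ i else M x $ r)"
      unfolding det_def
    proof (rule sum.cong[OF refl])
      fix p :: "'n \<Rightarrow> 'n"
      have "(\<Prod>r\<in>UNIV. (\<chi> r. if r = i then pd k M x $ i else M x $ r) $ r $ p r)
        = pd k M x $ i $ p i * (\<Prod>j\<in>UNIV - {i}. M x $ j $ p j)"
        by (subst prod.remove[of _ i]) (auto intro!: prod.cong)
      thus "of_int (sign p) * (pd k M x $ i $ p i * (\<Prod>j\<in>UNIV - {i}. M x $ j $ p j))
        = of_int (sign p) * (\<Prod>r\<in>UNIV. (\<chi> r. if r = i then pd k M x $ i else M x $ r) $ r $ p r)"
        by simp
    qed
  qed
  also have "\<dots> = (\<Sum>i\<in>UNIV. Q $ i $ i * det (M x))"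
  proof (rule sum.cong[OF refl])
    fix i :: 'n
    have row: "row r A = A $ r" for r and A :: "real^'n^'n" by (simp add: row_def)
    have "pd k M x $ i = (\<Sum>l\<in>UNIV. Q $ i $ l *s M x $ l)"
      unfolding QM by (simp add: vec_eq_iff matrix_mult_nth)
    thus "det (\<chi> r. if r = i then pd k M x $ i else M x $ r) = Q $ i $ i * det (M x)"
      using cramer_lemma_transpose[of i "Q $ i" "M x"] unfolding row by presburger
  qed
  also have "\<dots> = det (M x) * trace Q" by (simp add: trace_def sum_distrib_left mult.commute)
  finally show ?thesis by (simp add: Q_def trace_mult_commute[of N])
qed

lemma matrix_inv_mult:
  fixes A :: "real^'n::finite^'n"
  assumes "det A \<noteq> 0"
  shows "matrix_inv A ** A = mat 1" "A ** matrix_inv A = mat 1"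
proof -
  have "\<exists>B. A ** B = mat 1 \<and> B ** A = mat 1" using assms invertible_det_nz[of A] by (simp add: invertible_def)
  from someI_ex[OF this] show "matrix_inv A ** A = mat 1" "A ** matrix_inv A = mat 1"
    unfolding matrix_inv_def by auto
qed

lemma matrix_inv_symmetric:
  fixes A :: "real^'n::finite^'n"
  assumes "det A \<noteq> 0" "transpose A = A"
  shows "transpose (matrix_inv A) = matrix_inv A"
proof -
  have "transpose (matrix_inv A) ** A = mat 1"
    using arg_cong[OF matrix_inv_mult(2)[OF assms(1)], of transpose] assms(2) by (simp add: transpose_simps transpose_mat)
  hence "transpose (matrix_inv A) ** (A ** matrix_inv A) = matrix_inv A"
    by (simp add: matrix_mul_assoc)
  thus ?thesis by (simp add: matrix_inv_mult[OF assms(1)])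
qed

text \<open>By Cramer's rule the entries are quotients of determinants of smooth matrices.\<close>

lemma smooth_on_matrix_inv:
  fixes M :: "real^'k::finite \<Rightarrow> real^'n::finite^'n"
  assumes S: "open S" and M: "smooth_on S M" and d: "\<And>x. x \<in> S \<Longrightarrow> det (M x) \<noteq> 0"
  shows "smooth_on S (\<lambda>x. matrix_inv (M x))"
proof (intro smooth_on_vecI[OF S])
  fix i j
  show "smooth_on S (\<lambda>x. matrix_inv (M x) $ i $ j)"
  proof (rule smooth_on_cong[OF S])
    fix x assume "x \<in> S"
    have "M x *v column j (matrix_inv (M x)) = axis j 1"
      using arg_cong[OF matrix_inv_mult(2)[OF d[OF \<open>x \<in> S\<close>]], of "column j"]
      by (simp add: vec_eq_iff column_def matrix_vector_mult_def matrix_mult_nth mat_def axis_def eq_commute)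
    hence "column j (matrix_inv (M x)) = (\<chi> k. det (\<chi> r c. if c = k then axis j 1 $ r else M x $ r $ c) / det (M x))"
      using cramer[OF d[OF \<open>x \<in> S\<close>]] by blast
    thus "matrix_inv (M x) $ i $ j = det (\<chi> r c. if c = i then axis j 1 $ r else M x $ r $ c) * inverse (det (M x))"
      by (simp add: vec_eq_iff column_def divide_inverse)
  next
    have "smooth_on S (\<lambda>x. \<chi> r c. if c = i then axis j 1 $ r else M x $ r $ c)"
    proof (intro smooth_on_vecI[OF S])
      fix r c
      show "smooth_on S (\<lambda>x. (\<chi> r c. if c = i then axis j 1 $ r else M x $ r $ c) $ r $ c)"
        by (cases "c = i") (simp_all add: smooth_on_const smooth_on_nth S M)
    qed
    thus "smooth_on S (\<lambda>x. det (\<chi> r c. if c = i then axis j 1 $ r else M x $ r $ c) * inverse (det (M x)))"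
      by (intro smooth_on_mult smooth_on_inverse smooth_on_det S M d)
  qed
qed

section \<open>The Levi-Civita connection and its curvature in matrix form\<close>

locale metric_field =
  fixes S :: "(real^'n::finite) set" and g :: "real^'n \<Rightarrow> real^'n^'n"
  assumes S: "open S" and g: "smooth_on S g" and sym: "x \<in> S \<Longrightarrow> transpose (g x) = g x"
    and det: "x \<in> S \<Longrightarrow> det (g x) \<noteq> 0"
begin

definition \<gamma> where "\<gamma> x = matrix_inv (g x)"
text \<open>Connection matrices, one for each direction, with the upper index as row. The curvature
  becomes a matrix-valued 2-form, so Bianchi identities can be checked as matrix identities.\<close>

definition \<Gamma> where "\<Gamma> i x = (\<chi> k l. christoffel g k i l x)"
definition R where "R i j x = pd i (\<Gamma> j) x - pd j (\<Gamma> i) x + \<Gamma> i x ** \<Gamma> j x - \<Gamma> j x ** \<Gamma> i x"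
text \<open>The covariant derivative of a covariant 2-tensor.\<close>

definition cov :: "'n \<Rightarrow> (real^'n \<Rightarrow> real^'n^'n) \<Rightarrow> real^'n \<Rightarrow> real^'n^'n"
  where "cov m M x = pd m M x - transpose (\<Gamma> m x) ** M x - M x ** \<Gamma> m x"

lemma inv1: "x \<in> S \<Longrightarrow> \<gamma> x ** g x = mat 1" and inv2: "x \<in> S \<Longrightarrow> g x ** \<gamma> x = mat 1"
  by (simp_all add: \<gamma>_def matrix_inv_mult det)

lemma \<gamma>_sym: "x \<in> S \<Longrightarrow> transpose (\<gamma> x) = \<gamma> x"
  by (simp add: \<gamma>_def matrix_inv_symmetric det sym)

lemma smooth_\<gamma>: "smooth_on S \<gamma>"
  unfolding \<gamma>_def by (rule smooth_on_matrix_inv[OF S g det])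

lemma pd_entry:
  assumes "smooth_on S (M :: real^'n \<Rightarrow> real^'n^'n)" "x \<in> S"
  shows "pd k (\<lambda>y. M y $ i $ j) x = pd k M x $ i $ j"
  using pd_nth[OF smooth_onD[OF smooth_on_nth[OF S assms(1)] assms(2)], of k i j] pd_nth[OF smooth_onD[OF assms], of k i] by simp

lemma pd_transpose:
  assumes "smooth_on S (M :: real^'n \<Rightarrow> real^'n^'n)" "x \<in> S"
  shows "pd k (\<lambda>y. transpose (M y)) x = transpose (pd k M x)"
  by (rule pd_linear[OF bounded_linear_transpose smooth_onD[OF assms]])

lemma pd_sym:
  assumes "smooth_on S (M :: real^'n \<Rightarrow> real^'n^'n)" "x \<in> S" "\<And>y. y \<in> S \<Longrightarrow> transpose (M y) = M y"
  shows "transpose (pd k M x) = pd k M x"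
  using pd_cong_open[OF S assms(2), of "\<lambda>y. transpose (M y)" M k] assms(3) pd_transpose[OF assms(1,2), of k] by simp

lemma pd_const_on:
  assumes "x \<in> S" "\<And>y. y \<in> S \<Longrightarrow> f y = c"
  shows "pd k f x = 0"
  using pd_cong_open[OF S assms] by (simp add: pd_const)

text \<open>Christoffel symbols of the first kind; the row index is the one to be raised.\<close>

definition chr where "chr i x = (\<chi> p l. (pd i g x $ l $ p + pd l g x $ i $ p - pd p g x $ i $ l) / 2)"

lemma \<Gamma>_eq: "x \<in> S \<Longrightarrow> \<Gamma> i x = \<gamma> x ** chr i x"
  by (simp add: vec_eq_iff \<Gamma>_def chr_def christoffel_def matrix_mult_nth pd_entry[OF g] \<gamma>_def sum_divide_distrib)

lemma smooth_\<Gamma>: "smooth_on S (\<Gamma> i)"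
proof (rule smooth_on_cong[OF S \<Gamma>_eq])
  have "smooth_on S (chr i)"
    unfolding chr_def divide_inverse
    by (intro smooth_on_vec smooth_on_mult smooth_on_add smooth_on_diff smooth_on_nth smooth_on_pd smooth_on_const g S)
  thus "smooth_on S (\<lambda>x. \<gamma> x ** chr i x)" by (intro smooth_on_matrix_mult S smooth_\<gamma>)
qed

lemma \<Gamma>_sym: "x \<in> S \<Longrightarrow> \<Gamma> i x $ k $ l = \<Gamma> l x $ k $ i"
proof -
  assume x: "x \<in> S"
  have "pd p g x $ i $ l = pd p g x $ l $ i" for p
    using pd_sym[OF g x sym, of p] by (metis transpose_nth)
  thus ?thesis by (simp add: \<Gamma>_eq[OF x] matrix_mult_nth chr_def add.commute)
qed

text \<open>Metric compatibility: \<open>chr i\<close> plus its transpose is the derivative of the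
  metric.\<close>

lemma pd_g: "x \<in> S \<Longrightarrow> pd i g x = transpose (\<Gamma> i x) ** g x + g x ** \<Gamma> i x"
proof -
  assume x: "x \<in> S"
  have 1: "g x ** \<Gamma> i x = chr i x" by (simp add: \<Gamma>_eq[OF x] matrix_mul_assoc inv2[OF x])
  have "transpose (\<Gamma> i x) ** g x = transpose (g x ** \<Gamma> i x)" by (simp add: transpose_simps sym[OF x])
  moreover have "pd p g x $ i $ l = pd p g x $ l $ i" for p i l
    using pd_sym[OF g x sym, of p] by (metis transpose_nth)
  hence "transpose (chr i x) + chr i x = pd i g x"
    by (simp add: vec_eq_iff chr_def) (simp add: field_simps)
  ultimately show ?thesis by (simp add: 1)
qed

lemmas diff_\<Gamma> = smooth_onD[OF smooth_\<Gamma>] and diff_\<gamma> = smooth_onD[OF smooth_\<gamma>] and diff_g = smooth_onD[OF g]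

lemma pd_\<gamma>: "x \<in> S \<Longrightarrow> pd i \<gamma> x = - (\<Gamma> i x ** \<gamma> x) - \<gamma> x ** transpose (\<Gamma> i x)"
proof -
  assume x: "x \<in> S"
  have "pd i (\<lambda>y. g y ** \<gamma> y) x = 0" by (rule pd_const_on[OF x]) (rule inv2)
  hence "\<gamma> x ** (g x ** pd i \<gamma> x + pd i g x ** \<gamma> x) = 0"
    using pd_matrix_mult[OF diff_g[OF x] diff_\<gamma>[OF x]] by (simp add: matmul.zero_right)
  hence "pd i \<gamma> x + \<gamma> x ** transpose (\<Gamma> i x) ** (g x ** \<gamma> x) + \<Gamma> i x ** \<gamma> x = 0"
    by (simp add: matmul_simps pd_g[OF x] inv1[OF x] add.assoc)
  thus ?thesis by (simp add: inv2[OF x] algebra_simps eq_neg_iff_add_eq_0)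
qed

lemma smooth_R: "smooth_on S (R i j)"
  unfolding R_def[abs_def]
  by (intro smooth_on_diff smooth_on_add smooth_on_matrix_mult smooth_on_pd smooth_\<Gamma> S)

lemma R_anti: "R i j x = - R j i x"
  by (simp add: R_def)

lemma pd_R:
  assumes x: "x \<in> S"
  shows "pd m (R i j) x = pd m (pd i (\<Gamma> j)) x - pd m (pd j (\<Gamma> i)) x
    + (\<Gamma> i x ** pd m (\<Gamma> j) x + pd m (\<Gamma> i) x ** \<Gamma> j x) - (\<Gamma> j x ** pd m (\<Gamma> i) x + pd m (\<Gamma> j) x ** \<Gamma> i x)"
proof -
  note sm = smooth_on_matrix_mult[OF S smooth_\<Gamma> smooth_\<Gamma>] smooth_on_pd[OF smooth_\<Gamma>]
  note d = sm[THEN smooth_onD, OF x] smooth_on_diff[OF S sm(2) sm(2), THEN smooth_onD, OF x]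
    smooth_on_add[OF S smooth_on_diff[OF S sm(2) sm(2)] sm(1), THEN smooth_onD, OF x]
  show ?thesis unfolding R_def[abs_def] by (simp add: pd_diff pd_add d pd_matrix_mult diff_\<Gamma>[OF x])
qed

text \<open>Only the connection terms of the endomorphism part are included. The second derivatives
  of the connection cancel because partial derivatives commute.\<close>

lemma second_bianchi:
  assumes x: "x \<in> S"
  defines "D \<equiv> \<lambda>m i j. pd m (R i j) x + \<Gamma> m x ** R i j x - R i j x ** \<Gamma> m x"
  shows "D m i j + D i j m + D j m i = 0"
  using pd_commute[OF S smooth_\<Gamma> x, of m i j] pd_commute[OF S smooth_\<Gamma> x, of m j i] pd_commute[OF S smooth_\<Gamma> x, of i j m]
  unfolding D_def pd_R[OF x] unfolding R_def matmul_simps by (simp add: algebra_simps)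

text \<open>Second derivatives of the metric commute; expressed through \<open>pd_g\<close>, this is
  skewness of the curvature with respect to the metric, here with the index raised.\<close>

lemma R_skew:
  assumes x: "x \<in> S"
  shows "R i j x ** \<gamma> x + \<gamma> x ** transpose (R i j x) = 0"
proof -
  have 1: "pd i (pd j g) x = (transpose (\<Gamma> j x) ** (transpose (\<Gamma> i x) ** g x + g x ** \<Gamma> i x) + transpose (pd i (\<Gamma> j) x) ** g x)
    + (g x ** pd i (\<Gamma> j) x + (transpose (\<Gamma> i x) ** g x + g x ** \<Gamma> i x) ** \<Gamma> j x)" for i j
  proof -
    have st: "smooth_on S (\<lambda>y. transpose (\<Gamma> j y))" by (rule smooth_on_linear[OF S bounded_linear_transpose smooth_\<Gamma>])
    have "pd i (pd j g) x = pd i (\<lambda>y. transpose (\<Gamma> j y) ** g y + g y ** \<Gamma> j y) x"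
      by (rule pd_cong_open[OF S x pd_g])
    also have "\<dots> = (transpose (\<Gamma> j x) ** pd i g x + transpose (pd i (\<Gamma> j) x) ** g x) + (g x ** pd i (\<Gamma> j) x + pd i g x ** \<Gamma> j x)"
      using smooth_onD[OF smooth_on_matrix_mult[OF S st g] x] smooth_onD[OF smooth_on_matrix_mult[OF S g smooth_\<Gamma>] x]
      by (simp add: pd_add pd_matrix_mult smooth_onD[OF st x] diff_g[OF x] diff_\<Gamma>[OF x] pd_transpose[OF smooth_\<Gamma> x])
    finally show ?thesis unfolding pd_g[OF x] .
  qed
  have "g x ** R i j x + transpose (R i j x) ** g x = pd i (pd j g) x - pd j (pd i g) x"
    unfolding 1 R_def transpose_simps matmul_simps by (simp add: algebra_simps)
  hence "\<gamma> x ** (g x ** R i j x + transpose (R i j x) ** g x) ** \<gamma> x = 0"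
    using pd_commute[OF S g x, of i j] by (simp add: matmul.zero_right matmul.zero_left)
  moreover have "\<gamma> x ** transpose (R i j x) ** g x ** \<gamma> x = \<gamma> x ** transpose (R i j x) ** (g x ** \<gamma> x)"
    by (simp only: matrix_mul_assoc)
  ultimately show ?thesis by (simp add: matmul_simps inv1[OF x] inv2[OF x])
qed

definition Ric where "Ric x = (\<chi> l j. \<Sum>k\<in>UNIV. R k j x $ k $ l)"

text \<open>The two conventions are matched by the symmetry of the lower Christoffel indices, which
  passes to their derivatives.\<close>

lemma ricci_eq: 
  assumes x: "x \<in> S" shows "ricci g x = Ric x"
proof -
  have c: "christoffel g k i j y = \<Gamma> i y $ k $ j" for k i j y by (simp add: \<Gamma>_def)
  have p: "pd m (christoffel g k i j) x = pd m (\<Gamma> i) x $ k $ j" for m k i j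
    unfolding pd_entry[OF smooth_\<Gamma> x, symmetric] using c by (metis ext)
  have p': "pd m (\<Gamma> i) x $ k $ j = pd m (\<Gamma> j) x $ k $ i" for m i j k
    unfolding pd_entry[OF smooth_\<Gamma> x, symmetric] by (rule pd_cong_open[OF S x \<Gamma>_sym])
  show ?thesis
    unfolding ricci_def Ric_def R_def vec_eq_iff
    by (simp add: c p p'[of _ _ j for j] matrix_mult_nth sum.distrib sum_subtractf)
      (simp add: p' \<Gamma>_sym[OF x] sum_subtractf)
qed

lemma smooth_Ric: "smooth_on S Ric"
  unfolding Ric_def[abs_def]
  by (intro smooth_on_vec smooth_on_sum smooth_on_nth smooth_R S)

lemma pd_Ric: 
  assumes x: "x \<in> S" shows "pd m Ric x $ l $ j = (\<Sum>k\<in>UNIV. pd m (R k j) x $ k $ l)"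
proof -
  have d: "(\<lambda>y. R k j y $ k $ l) differentiable (at x)" for k
    by (rule smooth_onD[OF smooth_on_nth[OF S smooth_on_nth[OF S smooth_R]] x])
  show ?thesis
    unfolding pd_entry[OF smooth_Ric x, symmetric] by (simp add: Ric_def pd_sum d pd_entry[OF smooth_R x])
qed

text \<open>The full covariant derivative: in contrast to \<open>second_bianchi\<close>, the form
  indices receive connection terms as well.\<close>

definition covR where "covR m i j x = pd m (R i j) x + \<Gamma> m x ** R i j x - R i j x ** \<Gamma> m x
  - (\<Sum>p\<in>UNIV. \<Gamma> m x $ p $ i *\<^sub>R R p j x) - (\<Sum>p\<in>UNIV. \<Gamma> m x $ p $ j *\<^sub>R R i p x)"

lemma covR_anti:
  assumes x: "x \<in> S" shows "covR m i j x = - covR m j i x"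
proof -
  have "R i j = (\<lambda>y. - R j i y)" by (rule ext) (rule R_anti)
  hence "pd m (R i j) x = - pd m (R j i) x"
    using pd_linear[OF bounded_linear_minus[OF bounded_linear_ident] smooth_onD[OF smooth_R x]] by metis
  moreover have "(\<Sum>p\<in>UNIV. \<Gamma> m x $ p $ i *\<^sub>R R p j x) = - (\<Sum>p\<in>UNIV. \<Gamma> m x $ p $ i *\<^sub>R R j p x)" for i j
    unfolding R_anti[of _ j] by (simp add: sum_negf)
  ultimately show ?thesis
    unfolding covR_def R_anti[of i j] by (simp add: matmul_simps)
qed

text \<open>The connection terms of the form indices cancel in pairs in the cyclic sum, because the
  connection is torsion-free.\<close>

lemma covR_cyclic:
  assumes x: "x \<in> S" shows "covR m i j x + covR i j m x + covR j m i x = 0"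
proof -
  define D where "D m i j = pd m (R i j) x + \<Gamma> m x ** R i j x - R i j x ** \<Gamma> m x" for m i j
  define A where "A m i j = (\<Sum>p\<in>UNIV. \<Gamma> m x $ p $ i *\<^sub>R R p j x)" for m i j
  define C where "C m i j = (\<Sum>p\<in>UNIV. \<Gamma> m x $ p $ j *\<^sub>R R i p x)" for m i j
  have A: "A m i j = - C i j m" for m i j
    unfolding A_def C_def \<Gamma>_sym[OF x, of i _ m] R_anti[of j] by (simp add: sum_negf)
  have "covR m i j x = D m i j - A m i j - C m i j" for m i j
    unfolding covR_def D_def A_def C_def ..
  moreover have "D m i j + D i j m + D j m i = 0"
    unfolding D_def by (rule second_bianchi[OF x])
  ultimately show ?thesis by (simp add: A add.assoc)
qed

text \<open>Covariant differentiation of \<open>R_skew\<close>: the inverse metric is parallel, so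
  skewness is inherited.\<close>

lemma covR_skew:
  assumes x: "x \<in> S" shows "covR m i j x ** \<gamma> x + transpose (covR m i j x ** \<gamma> x) = 0"
proof -
  let ?B = "R i j x ** \<gamma> x"
  have sk: "R i j x ** \<gamma> x + \<gamma> x ** transpose (R i j x) = 0" for i j by (rule R_skew[OF x])
  have st: "smooth_on S (\<lambda>y. transpose (R i j y))" by (rule smooth_on_linear[OF S bounded_linear_transpose smooth_R])
  have "pd m (\<lambda>y. R i j y ** \<gamma> y + \<gamma> y ** transpose (R i j y)) x = 0"
    by (rule pd_const_on[OF x]) (rule R_skew)
  moreover have "pd m (\<lambda>y. R i j y ** \<gamma> y + \<gamma> y ** transpose (R i j y)) x
    = (R i j x ** pd m \<gamma> x + pd m (R i j) x ** \<gamma> x) + (\<gamma> x ** transpose (pd m (R i j) x) + pd m \<gamma> x ** transpose (R i j x))"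
    using smooth_onD[OF smooth_on_matrix_mult[OF S smooth_R smooth_\<gamma>] x] smooth_onD[OF smooth_on_matrix_mult[OF S smooth_\<gamma> st] x]
    by (simp add: pd_add pd_matrix_mult smooth_onD[OF smooth_R x] smooth_onD[OF st x] diff_\<gamma>[OF x] pd_transpose[OF smooth_R x])
  ultimately have 1: "pd m (R i j) x ** \<gamma> x + \<gamma> x ** transpose (pd m (R i j) x)
    = R i j x ** \<Gamma> m x ** \<gamma> x + ?B ** transpose (\<Gamma> m x)
      + \<Gamma> m x ** (\<gamma> x ** transpose (R i j x)) + \<gamma> x ** transpose (\<Gamma> m x) ** transpose (R i j x)"
    unfolding pd_\<gamma>[OF x] matmul_simps by (simp add: algebra_simps)
  have 2: "\<gamma> x ** transpose (R i j x) = - ?B" using sk[of i j] by (simp add: eq_neg_iff_add_eq_0 add.commute)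
  have 3: "(\<Sum>p\<in>UNIV. c p *\<^sub>R R (a p) (b p) x) ** \<gamma> x + \<gamma> x ** transpose (\<Sum>p\<in>UNIV. c p *\<^sub>R R (a p) (b p) x) = 0"
    for c and a b :: "'n \<Rightarrow> 'n"
  proof -
    have "transpose (\<Sum>p\<in>UNIV. c p *\<^sub>R R (a p) (b p) x) = (\<Sum>p\<in>UNIV. c p *\<^sub>R transpose (R (a p) (b p) x))"
      by (simp add: vec_eq_iff)
    hence "(\<Sum>p\<in>UNIV. c p *\<^sub>R R (a p) (b p) x) ** \<gamma> x + \<gamma> x ** transpose (\<Sum>p\<in>UNIV. c p *\<^sub>R R (a p) (b p) x)
      = (\<Sum>p\<in>UNIV. c p *\<^sub>R (R (a p) (b p) x ** \<gamma> x + \<gamma> x ** transpose (R (a p) (b p) x)))"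
      by (simp add: matmul.sum_left matmul.sum_right matmul.scaleR_left matmul.scaleR_right scaleR_add_right sum.distrib)
    thus ?thesis by (simp add: sk)
  qed
  have "covR m i j x ** \<gamma> x + transpose (covR m i j x ** \<gamma> x)
    = (pd m (R i j) x ** \<gamma> x + \<gamma> x ** transpose (pd m (R i j) x)) + \<Gamma> m x ** ?B - R i j x ** \<Gamma> m x ** \<gamma> x
      + (\<gamma> x ** transpose (R i j x)) ** transpose (\<Gamma> m x) - \<gamma> x ** transpose (\<Gamma> m x) ** transpose (R i j x)"
    using 3[of "\<lambda>p. \<Gamma> m x $ p $ i" "\<lambda>p. p" "\<lambda>_. j"] 3[of "\<lambda>p. \<Gamma> m x $ p $ j" "\<lambda>_. i" "\<lambda>p. p"]
    unfolding covR_def transpose_simps matmul_simps \<gamma>_sym[OF x] by (simp add: algebra_simps)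
  thus ?thesis unfolding 1 2 by (simp add: matmul_simps)
qed

text \<open>Contraction commutes with covariant differentiation: the connection terms of the
  contracted pair cancel.\<close>

lemma covR_trace:
  assumes x: "x \<in> S" shows "(\<Sum>k\<in>UNIV. covR m k j x $ k $ l) = cov m Ric x $ l $ j"
proof -
  have a: "(\<Sum>k\<in>UNIV. (\<Gamma> m x ** R k j x) $ k $ l) = (\<Sum>k\<in>UNIV. (\<Sum>p\<in>UNIV. \<Gamma> m x $ p $ k *\<^sub>R R p j x) $ k $ l)"
    by (simp add: matrix_mult_nth) (subst sum.swap, simp)
  have b: "(\<Sum>k\<in>UNIV. (R k j x ** \<Gamma> m x) $ k $ l) = (transpose (\<Gamma> m x) ** Ric x) $ l $ j"
    by (simp add: matrix_mult_nth Ric_def sum_distrib_left sum_distrib_right) (subst sum.swap, simp add: mult.commute)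
  have c: "(\<Sum>k\<in>UNIV. (\<Sum>p\<in>UNIV. \<Gamma> m x $ p $ j *\<^sub>R R k p x) $ k $ l) = (Ric x ** \<Gamma> m x) $ l $ j"
    by (simp add: matrix_mult_nth Ric_def sum_distrib_left sum_distrib_right) (subst sum.swap, simp add: mult.commute)
  have "(\<Sum>k\<in>UNIV. covR m k j x $ k $ l) = (\<Sum>k\<in>UNIV. pd m (R k j) x $ k $ l) + (\<Sum>k\<in>UNIV. (\<Gamma> m x ** R k j x) $ k $ l)
    - (\<Sum>k\<in>UNIV. (R k j x ** \<Gamma> m x) $ k $ l) - (\<Sum>k\<in>UNIV. (\<Sum>p\<in>UNIV. \<Gamma> m x $ p $ k *\<^sub>R R p j x) $ k $ l)
    - (\<Sum>k\<in>UNIV. (\<Sum>p\<in>UNIV. \<Gamma> m x $ p $ j *\<^sub>R R k p x) $ k $ l)"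
    by (simp only: covR_def vector_minus_component vector_add_component sum.distrib sum_subtractf)
  thus ?thesis unfolding a b c by (simp add: cov_def pd_Ric[OF x])
qed

text \<open>The double trace of the cyclic identity. Antisymmetry in the form indices and skewness
  of the raised curvature turn two of its three terms into the same divergence of the Ricci
  tensor.\<close>

lemma contracted_bianchi:
  assumes x: "x \<in> S"
  shows "(\<Sum>i\<in>UNIV. \<Sum>l\<in>UNIV. \<gamma> x $ i $ l * cov j Ric x $ l $ i) = 2 * (\<Sum>i\<in>UNIV. \<Sum>l\<in>UNIV. \<gamma> x $ i $ l * cov i Ric x $ l $ j)"
proof -
  define B where "B m i j = covR m i j x ** \<gamma> x" for m i j
  have gs: "\<gamma> x $ i $ j = \<gamma> x $ j $ i" for i j using \<gamma>_sym[OF x] by (metis transpose_nth)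
  have tr: "(\<Sum>m\<in>UNIV. B a m b $ m $ i) = (\<Sum>l\<in>UNIV. \<gamma> x $ i $ l * cov a Ric x $ l $ b)" for a b i
    unfolding covR_trace[OF x, symmetric] B_def matrix_mult_nth sum_distrib_left
    by (subst sum.swap) (simp add: gs[of _ i] mult.commute)
  have sk: "B m i j $ a $ b = - B m i j $ b $ a" for m i j a b
    using arg_cong[OF covR_skew[OF x, of m i j], of "\<lambda>M. M $ a $ b"] by (simp add: B_def eq_neg_iff_add_eq_0)
  have an: "B m i j = - B m j i" for m i j unfolding B_def covR_anti[OF x, of m i j] by (simp add: matmul.minus_left)
  have "B m i j + B i j m + B j m i = 0" for m i j
    using covR_cyclic[OF x, of m i j] by (simp add: B_def matmul.zero_left flip: matmul.add_left)
  hence "(\<Sum>i\<in>UNIV. \<Sum>m\<in>UNIV. (B m i j + B i j m + B j m i) $ m $ i) = 0" by simp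
  hence "(\<Sum>i\<in>UNIV. \<Sum>m\<in>UNIV. B m i j $ m $ i) + (\<Sum>i\<in>UNIV. \<Sum>m\<in>UNIV. B i j m $ m $ i) + (\<Sum>i\<in>UNIV. \<Sum>m\<in>UNIV. B j m i $ m $ i) = 0"
    by (simp add: sum.distrib)
  moreover have "(\<Sum>i\<in>UNIV. \<Sum>m\<in>UNIV. B j m i $ m $ i) = (\<Sum>i\<in>UNIV. \<Sum>l\<in>UNIV. \<gamma> x $ i $ l * cov j Ric x $ l $ i)"
    by (simp add: tr)
  moreover have "(\<Sum>i\<in>UNIV. \<Sum>m\<in>UNIV. B m i j $ m $ i) = - (\<Sum>i\<in>UNIV. \<Sum>l\<in>UNIV. \<gamma> x $ i $ l * cov i Ric x $ l $ j)"
    unfolding tr[symmetric] sum_negf[symmetric] sk[symmetric] by (rule sum.swap)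
  moreover have "(\<Sum>i\<in>UNIV. \<Sum>m\<in>UNIV. B i j m $ m $ i) = - (\<Sum>i\<in>UNIV. \<Sum>l\<in>UNIV. \<gamma> x $ i $ l * cov i Ric x $ l $ j)"
    unfolding tr[symmetric] sum_negf[symmetric] by (simp add: an[of _ j])
  ultimately show ?thesis by simp
qed

end

section \<open>The electromagnetic field\<close>

lemma sum_antisym_zero:
  fixes f :: "'n::finite \<Rightarrow> 'n \<Rightarrow> real"
  assumes "\<And>i j. f i j = - f j i" shows "(\<Sum>i\<in>UNIV. \<Sum>j\<in>UNIV. f i j) = 0"
proof -
  have "(\<Sum>i\<in>UNIV. \<Sum>j\<in>UNIV. f i j) = (\<Sum>i\<in>UNIV. \<Sum>j\<in>UNIV. - f j i)" 
    by (rule sum.cong[OF refl], rule sum.cong[OF refl], rule assms)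
  also have "\<dots> = - (\<Sum>i\<in>UNIV. \<Sum>j\<in>UNIV. f j i)" by (simp add: sum_negf)
  also have "(\<Sum>i\<in>UNIV. \<Sum>j\<in>UNIV. f j i) = (\<Sum>i\<in>UNIV. \<Sum>j\<in>UNIV. f i j)" by (rule sum.swap)
  finally show ?thesis by simp
qed

lemma trace_simps:
  fixes A B :: "real^'n::finite^'n"
  shows "trace (A + B) = trace A + trace B" "trace (A - B) = trace A - trace B" "trace (- A) = - trace A"
    "trace (c *\<^sub>R A) = c * trace A" "trace (transpose A) = trace A" "trace (0 :: real^'n^'n) = 0"
  by (simp_all add: trace_def sum.distrib sum_subtractf sum_negf sum_distrib_left)

lemma bounded_linear_trace: "bounded_linear (trace :: real^'n::finite^'n \<Rightarrow> real)"
  unfolding linear_conv_bounded_linear[symmetric] by (rule linearI) (simp_all add: trace_simps)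

lemma trace_mult: "trace (A ** B) = (\<Sum>i\<in>UNIV. \<Sum>k\<in>UNIV. A $ i $ k * B $ k $ i)"
  by (simp add: trace_def matrix_mult_nth)

context metric_field
begin

lemma first_bianchi:
  assumes x: "x \<in> S"
  shows "R i j x $ k $ l + R j l x $ k $ i + R l i x $ k $ j = 0"
proof -
  have p: "pd m (\<Gamma> i) x $ k $ j = pd m (\<Gamma> j) x $ k $ i" for m i j k
    unfolding pd_entry[OF smooth_\<Gamma> x, symmetric] by (rule pd_cong_open[OF S x \<Gamma>_sym])
  have q: "(\<Gamma> i x ** \<Gamma> j x) $ k $ l = (\<Gamma> i x ** \<Gamma> l x) $ k $ j" for i j l
    by (simp add: matrix_mult_nth \<Gamma>_sym[OF x, of j _ l])
  show ?thesis
    using p[of i j k l] p[of j l k i] p[of l i k j] q[of i j l] q[of j l i] q[of l i j] by (simp add: R_def)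
qed

text \<open>Skewness makes the curvature similar to minus its transpose.\<close>

lemma trace_R: "x \<in> S \<Longrightarrow> trace (R i j x) = 0"
proof -
  assume x: "x \<in> S"
  have "(R i j x ** \<gamma> x + \<gamma> x ** transpose (R i j x)) ** g x = 0"
    by (simp add: R_skew[OF x] matmul.zero_left)
  moreover have "R i j x ** \<gamma> x ** g x = R i j x" by (simp flip: matrix_mul_assoc add: inv1[OF x])
  ultimately have "R i j x + \<gamma> x ** transpose (R i j x) ** g x = 0" by (simp add: matmul_simps)
  from arg_cong[OF this, of trace]
  have "trace (R i j x) + trace (\<gamma> x ** transpose (R i j x) ** g x) = 0"
    by (simp only: trace_simps)
  moreover have "trace (\<gamma> x ** transpose (R i j x) ** g x) = trace (g x ** (\<gamma> x ** transpose (R i j x)))"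
    by (rule trace_mult_commute)
  ultimately show ?thesis by (simp add: matrix_mul_assoc inv2[OF x] trace_simps)
qed

text \<open>The trace of the first Bianchi identity, in which the third contribution is
  \<open>trace_R\<close>.\<close>

lemma Ric_sym: "x \<in> S \<Longrightarrow> transpose (Ric x) = Ric x"
proof -
  assume x: "x \<in> S"
  have "Ric x $ l $ j = Ric x $ j $ l" for l j
  proof -
    have "(\<Sum>k\<in>UNIV. R k j x $ k $ l + R j l x $ k $ k + R l k x $ k $ j) = 0"
      by (simp add: first_bianchi[OF x])
    moreover have "(\<Sum>k\<in>UNIV. R l k x $ k $ j) = - Ric x $ j $ l"
      unfolding R_anti[of l] by (simp add: Ric_def sum_negf)
    ultimately show ?thesis
      using trace_R[OF x, of j l] by (simp add: sum.distrib Ric_def trace_def)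
  qed
  thus ?thesis by (simp add: vec_eq_iff)
qed

definition dvg where "dvg M x j = (\<Sum>i\<in>UNIV. \<Sum>l\<in>UNIV. \<gamma> x $ i $ l * cov i M x $ l $ j)"

lemma \<gamma>_nth: "x \<in> S \<Longrightarrow> \<gamma> x $ i $ j = \<gamma> x $ j $ i"
  using \<gamma>_sym[of x] by (metis transpose_nth)

lemma dvg_eq: "x \<in> S \<Longrightarrow> dvg M x j = (\<Sum>i\<in>UNIV. \<Sum>k\<in>UNIV. \<gamma> x $ i $ k * cov k M x $ i $ j)"
  unfolding dvg_def by (subst sum.swap) (simp add: \<gamma>_nth)

lemma cov_diff:
  assumes "smooth_on S M" "smooth_on S N" "x \<in> S"
  shows "cov m (\<lambda>y. M y - N y) x = cov m M x - cov m N x"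
  by (simp add: cov_def pd_diff[OF smooth_onD[OF assms(1,3)] smooth_onD[OF assms(2,3)]] matmul_simps)

lemma dvg_diff:
  assumes "smooth_on S M" "smooth_on S N" "x \<in> S"
  shows "dvg (\<lambda>y. M y - N y) x j = dvg M x j - dvg N x j"
  by (simp add: dvg_def cov_diff[OF assms] right_diff_distrib sum_subtractf)

text \<open>The metric is parallel, so only the derivative of the factor survives.\<close>

lemma dvg_conformal:
  assumes x: "x \<in> S" and f: "smooth_on S f"
  shows "dvg (\<lambda>y. f y *\<^sub>R g y) x j = pd j f x"
proof -
  have "cov m (\<lambda>y. f y *\<^sub>R g y) x = pd m f x *\<^sub>R g x" for m
    by (simp add: cov_def pd_scaleR[OF smooth_onD[OF f x] diff_g[OF x]] pd_g[OF x] matmul.scaleR_left matmul.scaleR_right algebra_simps)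
  hence "dvg (\<lambda>y. f y *\<^sub>R g y) x j = (\<Sum>i\<in>UNIV. pd i f x * (\<gamma> x ** g x) $ i $ j)"
    by (simp add: dvg_def matrix_mult_nth sum_distrib_left mult_ac)
  also have "\<dots> = (\<Sum>i\<in>UNIV. if i = j then pd i f x else 0)"
    by (intro sum.cong refl) (simp add: inv1[OF x] mat_def)
  finally show ?thesis by simp
qed

lemma smooth_scalar: "smooth_on S (\<lambda>y. trace (\<gamma> y ** Ric y))"
  by (intro smooth_on_linear[OF S bounded_linear_trace] smooth_on_matrix_mult S smooth_\<gamma> smooth_Ric)

text \<open>The connection terms form a commutator, so they disappear under the trace.\<close>

lemma pd_\<gamma>_mult:
  assumes x: "x \<in> S" and M: "smooth_on S M"
  shows "pd m (\<lambda>y. \<gamma> y ** M y) x = \<gamma> x ** cov m M x + \<gamma> x ** M x ** \<Gamma> m x - \<Gamma> m x ** \<gamma> x ** M x"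
  unfolding pd_matrix_mult[OF diff_\<gamma>[OF x] smooth_onD[OF M x]] pd_\<gamma>[OF x] cov_def matmul_simps
  by (simp add: algebra_simps)

lemma pd_scalar: 
  assumes x: "x \<in> S"
  shows "pd j (\<lambda>y. trace (\<gamma> y ** Ric y)) x = 2 * dvg Ric x j"
proof -
  have "pd j (\<lambda>y. trace (\<gamma> y ** Ric y)) x = trace (pd j (\<lambda>y. \<gamma> y ** Ric y) x)"
    by (rule pd_linear[OF bounded_linear_trace smooth_onD[OF smooth_on_matrix_mult[OF S smooth_\<gamma> smooth_Ric] x]])
  also have "\<dots> = trace (\<gamma> x ** cov j Ric x)"
    using trace_mult_commute[of "\<gamma> x ** Ric x" "\<Gamma> j x"]
    by (simp add: pd_\<gamma>_mult[OF x smooth_Ric] trace_simps matrix_mul_assoc)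
  also have "\<dots> = 2 * dvg Ric x j"
    using contracted_bianchi[OF x, of j] by (simp add: trace_mult dvg_def)
  finally show ?thesis .
qed

lemma scalar_curv_eq: "x \<in> S \<Longrightarrow> scalar_curv g x = trace (\<gamma> x ** Ric x)"
proof -
  assume x: "x \<in> S"
  have "Ric x $ i $ j = Ric x $ j $ i" for i j
    using arg_cong[OF Ric_sym[OF x], of "\<lambda>M. M $ j $ i"] by simp
  thus ?thesis
    unfolding scalar_curv_def trace_mult ricci_eq[OF x] \<gamma>_def
    by (intro sum.cong refl arg_cong2[of _ _ _ _ "(*)"])
qed

lemma dvg_einstein:
  assumes x: "x \<in> S"
  shows "dvg (\<lambda>y. Ric y - (trace (\<gamma> y ** Ric y) / 2) *\<^sub>R g y) x j = 0"
proof -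
  have sm: "smooth_on S (\<lambda>y. trace (\<gamma> y ** Ric y) / 2)"
    unfolding divide_inverse by (intro smooth_on_mult smooth_on_const S smooth_scalar)
  have "pd j (\<lambda>y. trace (\<gamma> y ** Ric y) / 2) x = pd j (\<lambda>y. trace (\<gamma> y ** Ric y)) x / 2"
    using pd_linear[OF bounded_linear_divide smooth_onD[OF smooth_scalar x]] by blast
  thus ?thesis
    using dvg_diff[OF smooth_Ric smooth_on_scaleR[OF S sm g] x] dvg_conformal[OF x sm] pd_scalar[OF x] by simp
qed

definition vol where "vol x = sqrt \<bar>det (g x)\<bar>"

lemma smooth_vol: "smooth_on S vol"
  unfolding vol_def by (rule smooth_on_sqrt_abs[OF S smooth_on_det[OF S g] det])

text \<open>Jacobi's formula; the logarithmic derivative of the root is half that of the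
  determinant, and metric compatibility supplies the compensating factor 2.\<close>

lemma pd_vol: "x \<in> S \<Longrightarrow> pd c vol x = vol x * trace (\<Gamma> c x)"
proof -
  assume x: "x \<in> S"
  have "trace (\<gamma> x ** transpose (\<Gamma> c x) ** g x) = trace (\<Gamma> c x)"
    using trace_mult_commute[of "\<gamma> x ** transpose (\<Gamma> c x)" "g x"] by (simp add: matrix_mul_assoc inv2[OF x] trace_simps)
  hence "trace (\<gamma> x ** pd c g x) = 2 * trace (\<Gamma> c x)"
    by (simp add: pd_g[OF x] matmul_simps trace_simps inv1[OF x])
  thus ?thesis
    unfolding vol_def using pd_sqrt_abs[OF smooth_onD[OF smooth_on_det[OF S g] x] det[OF x], of c]
    by (simp add: pd_det[OF diff_g[OF x] inv1[OF x]] det[OF x])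
qed

end

locale em_field = metric_field S g for S :: "(real^'n::finite) set" and g +
  fixes A :: "real^'n \<Rightarrow> real^'n"
  assumes A: "smooth_on S A"
begin

definition F where "F x = (\<chi> i j. pd i A x $ j - pd j A x $ i)"
definition X where "X x = \<gamma> x ** F x"
text \<open>The bivector obtained from \<open>F\<close> by raising both indices.\<close>

definition \<Phi> where "\<Phi> x = \<gamma> x ** F x ** \<gamma> x"
definition T where "T x = F x ** X x - (trace (X x ** X x) / 4) *\<^sub>R g x"
definition Y where "Y x = (\<chi> j. dvg F x j)"
definition Ein where "Ein x = Ric x - (trace (\<gamma> x ** Ric x) / 2) *\<^sub>R g x"

lemma field_strength_eq: "x \<in> S \<Longrightarrow> field_strength A x [i, j] = F x $ i $ j"
  using pd_nth[OF smooth_onD[OF A]]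
  by (simp add: field_strength_def ext_deriv_def F_def potential_form_def numeral_2_eq_2 del_nth_def)

lemma smooth_F: "smooth_on S F"
  unfolding F_def[abs_def] by (intro smooth_on_vec smooth_on_diff smooth_on_nth smooth_on_pd A S)

lemma smooth_X: "smooth_on S X"
  unfolding X_def[abs_def] by (intro smooth_on_matrix_mult smooth_F smooth_\<gamma> S)

lemma smooth_\<Phi>: "smooth_on S \<Phi>"
  unfolding \<Phi>_def[abs_def] by (intro smooth_on_matrix_mult smooth_F smooth_\<gamma> S)

lemma smooth_cov: "smooth_on S M \<Longrightarrow> smooth_on S (cov m M)"
  unfolding cov_def[abs_def]
  by (intro smooth_on_diff smooth_on_matrix_mult smooth_on_pd smooth_on_linear[OF S bounded_linear_transpose] smooth_\<Gamma> S)

lemma smooth_Y: "smooth_on S Y"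
  unfolding Y_def[abs_def] dvg_def
  by (intro smooth_on_vec smooth_on_sum smooth_on_mult smooth_on_nth smooth_cov smooth_F smooth_\<gamma> S)

lemma smooth_trXX: "smooth_on S (\<lambda>y. trace (X y ** X y) / 4)"
  unfolding divide_inverse by (intro smooth_on_mult smooth_on_const smooth_on_linear[OF S bounded_linear_trace] smooth_on_matrix_mult S smooth_X)

lemma smooth_T: "smooth_on S T"
  unfolding T_def[abs_def] by (intro smooth_on_diff smooth_on_scaleR smooth_on_matrix_mult smooth_trXX smooth_X smooth_F S g)

lemma smooth_Ein: "smooth_on S Ein"
  unfolding Ein_def[abs_def] divide_inverse
  by (intro smooth_on_diff smooth_on_scaleR smooth_on_mult smooth_on_const smooth_scalar smooth_Ric S g)

lemma F_skew: "transpose (F x) = - F x"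
  by (simp add: vec_eq_iff F_def)

lemma F_nth: "F x $ i $ j = - F x $ j $ i"
  by (simp add: F_def)

lemma energy_momentum_eq: 
  assumes x: "x \<in> S" shows "energy_momentum (g x) (field_strength A x) = T x"
proof -
  have "(\<chi> i j. field_strength A x [i, j]) = F x" by (simp add: vec_eq_iff field_strength_eq[OF x])
  hence e: "field_endo (g x) (field_strength A x) = X x" by (simp add: field_endo_def X_def \<gamma>_def)
  show ?thesis
    unfolding energy_momentum_def e Let_def T_def matmul_simps
    by (simp add: matmul.scaleR_right) (simp add: X_def matrix_mul_assoc inv2[OF x])
qed

lemma T_sym: "x \<in> S \<Longrightarrow> transpose (T x) = T x"
  by (simp add: T_def X_def transpose_simps F_skew sym \<gamma>_sym matmul_simps)

lemma Ein_sym: "x \<in> S \<Longrightarrow> transpose (Ein x) = Ein x"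
  by (simp add: Ein_def transpose_simps sym Ric_sym)

lemma pd_X: "x \<in> S \<Longrightarrow> pd m X x = \<gamma> x ** cov m F x + X x ** \<Gamma> m x - \<Gamma> m x ** X x"
  unfolding X_def[abs_def] by (simp add: pd_\<gamma>_mult smooth_F matrix_mul_assoc)

lemma cov_FX:
  assumes x: "x \<in> S"
  shows "cov m (\<lambda>y. F y ** X y) x = cov m F x ** X x + F x ** \<gamma> x ** cov m F x"
  unfolding cov_def[of m "\<lambda>y. F y ** X y"] pd_matrix_mult[OF smooth_onD[OF smooth_F x] smooth_onD[OF smooth_X x]] pd_X[OF x]
  unfolding cov_def matmul_simps by (simp add: algebra_simps)

lemma pd_trXX: 
  assumes x: "x \<in> S"
  shows "pd m (\<lambda>y. trace (X y ** X y) / 4) x = trace (\<Phi> x ** cov m F x) / 2"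
proof -
  have "pd m (\<lambda>y. trace (X y ** X y) / 4) x = trace (pd m (\<lambda>y. X y ** X y) x) / 4"
    using pd_linear[OF bounded_linear_compose[OF bounded_linear_divide bounded_linear_trace]
       smooth_onD[OF smooth_on_matrix_mult[OF S smooth_X smooth_X] x]] by blast
  also have "trace (pd m (\<lambda>y. X y ** X y) x) = trace (X x ** pd m X x) + trace (pd m X x ** X x)"
    by (simp add: pd_matrix_mult[OF smooth_onD[OF smooth_X x] smooth_onD[OF smooth_X x]] trace_simps)
  also have "\<dots> = 2 * trace (X x ** pd m X x)" by (simp add: trace_mult_commute[of "pd m X x"])
  also have "trace (X x ** pd m X x) = trace (X x ** \<gamma> x ** cov m F x)"
    using trace_mult_commute[of "X x" "X x ** \<Gamma> m x"]
    by (simp add: pd_X[OF x] matmul_simps trace_simps)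
  finally show ?thesis by (simp add: \<Phi>_def X_def)
qed

text \<open>This is dF = 0: second derivatives of the potential cancel, and so do the connection
  terms, the connection being torsion-free.\<close>

lemma F_bianchi:
  assumes x: "x \<in> S"
  shows "cov i F x $ k $ j + cov k F x $ j $ i + cov j F x $ i $ k = 0"
proof -
  have pF: "pd i F x $ k $ j = pd i (pd k A) x $ j - pd i (pd j A) x $ k" for i k j
  proof -
    have d: "(\<lambda>y. pd k A y $ j) differentiable (at x)" for k j
      by (rule smooth_onD[OF smooth_on_nth[OF S smooth_on_pd[OF A]] x])
    have "pd i F x $ k $ j = pd i (\<lambda>y. pd k A y $ j - pd j A y $ k) x"
      unfolding pd_entry[OF smooth_F x, symmetric] by (simp add: F_def)
    thus ?thesis by (simp add: pd_diff d pd_nth[OF smooth_onD[OF smooth_on_pd[OF A] x]])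
  qed
  define a where "a i k j = (\<Sum>p\<in>UNIV. \<Gamma> i x $ p $ k * F x $ p $ j)" for i k j
  have a: "a i k j = a k i j" for i k j by (simp add: a_def \<Gamma>_sym[OF x, of i _ k])
  have "(F x ** \<Gamma> i x) $ k $ j = - a i j k" for i k j
    unfolding a_def matrix_mult_nth F_nth[of x k] by (simp add: sum_negf mult.commute)
  moreover have "(transpose (\<Gamma> i x) ** F x) $ k $ j = a i k j" for i k j
    by (simp add: a_def matrix_mult_nth)
  ultimately have c: "cov i F x $ k $ j = pd i F x $ k $ j - a i k j + a i j k" for i k j
    by (simp add: cov_def)
  show ?thesis
    unfolding c pF pd_commute[OF S A x, of i k] pd_commute[OF S A x, of j i] pd_commute[OF S A x, of k j]
    using a[of i k j] a[of k j i] a[of j i k] by simp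
qed

lemma cov_F_skew: "x \<in> S \<Longrightarrow> cov m F x $ i $ j = - cov m F x $ j $ i"
proof -
  assume x: "x \<in> S"
  have "pd m (\<lambda>y. transpose (F y)) x = - pd m F x"
    unfolding F_skew by (rule pd_linear[OF bounded_linear_minus[OF bounded_linear_ident] smooth_onD[OF smooth_F x]])
  hence pT: "transpose (pd m F x) = - pd m F x" by (simp only: pd_transpose[OF smooth_F x])
  have "transpose (cov m F x) = - cov m F x"
    unfolding cov_def transpose_simps F_skew pT by (simp add: matmul_simps)
  from arg_cong[OF this, of "\<lambda>M. M $ j $ i"] show ?thesis by simp
qed

lemma \<Phi>_skew: "x \<in> S \<Longrightarrow> \<Phi> x $ i $ j = - \<Phi> x $ j $ i"
proof -
  assume x: "x \<in> S"
  have "transpose (\<Phi> x) = - \<Phi> x"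
    by (simp add: \<Phi>_def transpose_simps F_skew \<gamma>_sym[OF x] matmul_simps)
  from arg_cong[OF this, of "\<lambda>M. M $ j $ i"] show ?thesis by simp
qed

text \<open>Conservation of energy-momentum. One term of the divergence contains \<open>Y\<close>
  and vanishes at the point; by \<open>F_bianchi\<close> and skewness the other is half of
  \<open>trace (\<Phi> x ** cov j F x)\<close>, which cancels the gradient of the trace term. The
  factor 1/4 makes this balance exact in every dimension.\<close>

lemma dvg_T:
  assumes x: "x \<in> S" and Y: "Y x = 0"
  shows "dvg T x j = 0"
proof -
  define N where "N i k j = cov i F x $ k $ j" for i k j
  have N: "N i k j = - N i j k" "N i k j + N k j i + N j i k = 0" for i k j
    unfolding N_def by (rule cov_F_skew[OF x], rule F_bianchi[OF x])
  have "dvg (\<lambda>y. F y ** X y) x j = (\<Sum>i\<in>UNIV. \<Sum>l\<in>UNIV. \<gamma> x $ i $ l * (cov i F x ** X x) $ l $ j)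
     + (\<Sum>i\<in>UNIV. \<Sum>l\<in>UNIV. \<gamma> x $ i $ l * (F x ** \<gamma> x ** cov i F x) $ l $ j)"
    by (simp add: dvg_def cov_FX[OF x] distrib_left sum.distrib)
  also have "(\<Sum>i\<in>UNIV. \<Sum>l\<in>UNIV. \<gamma> x $ i $ l * (cov i F x ** X x) $ l $ j) = (\<Sum>k\<in>UNIV. dvg F x k * X x $ k $ j)"
  proof -
    have "(\<Sum>i\<in>UNIV. \<Sum>l\<in>UNIV. \<gamma> x $ i $ l * (cov i F x ** X x) $ l $ j)
      = (\<Sum>i\<in>UNIV. \<Sum>k\<in>UNIV. \<Sum>l\<in>UNIV. \<gamma> x $ i $ l * cov i F x $ l $ k * X x $ k $ j)"
      unfolding matrix_mult_nth sum_distrib_left mult.assoc by (intro sum.cong[OF refl] sum.swap)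
    also have "\<dots> = (\<Sum>k\<in>UNIV. \<Sum>i\<in>UNIV. \<Sum>l\<in>UNIV. \<gamma> x $ i $ l * cov i F x $ l $ k * X x $ k $ j)"
      by (rule sum.swap)
    finally show ?thesis by (simp add: dvg_def sum_distrib_right)
  qed
  also have "\<dots> = 0" using Y by (simp add: Y_def vec_eq_iff)
  also have "(\<Sum>i\<in>UNIV. \<Sum>l\<in>UNIV. \<gamma> x $ i $ l * (F x ** \<gamma> x ** cov i F x) $ l $ j)
      = (\<Sum>i\<in>UNIV. (\<gamma> x ** (F x ** \<gamma> x ** cov i F x)) $ i $ j)"
    by (simp add: matrix_mult_nth[of "\<gamma> x"])
  also have "\<dots> = (\<Sum>i\<in>UNIV. \<Sum>k\<in>UNIV. \<Phi> x $ i $ k * N i k j)"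
    by (simp add: \<Phi>_def N_def matrix_mul_assoc) (simp add: matrix_mult_nth[of _ "cov _ F x"])
  finally have 1: "dvg (\<lambda>y. F y ** X y) x j = (\<Sum>i\<in>UNIV. \<Sum>k\<in>UNIV. \<Phi> x $ i $ k * N i k j)" by simp
  have 2: "trace (\<Phi> x ** cov j F x) = (\<Sum>i\<in>UNIV. \<Sum>k\<in>UNIV. \<Phi> x $ i $ k * N j k i)"
    by (simp add: trace_mult N_def)
  have "(\<Sum>i\<in>UNIV. \<Sum>k\<in>UNIV. \<Phi> x $ i $ k * (2 * N i k j - N j k i)) = 0"
  proof (rule sum_antisym_zero)
    fix i k
    \<comment> \<open>By the cyclic identity the bracket is symmetric in \<open>i\<close> and
      \<open>k\<close>, whereas \<Phi> is skew.\<close>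
    have "2 * N i k j - N j k i = N i k j + N k i j"
      using N(1)[of j k i] N(2)[of i k j] N(1)[of k i j] by linarith
    moreover have "2 * N k i j - N j i k = N k i j + N i k j"
      using N(1)[of j i k] N(2)[of k i j] N(1)[of i k j] by linarith
    ultimately show "\<Phi> x $ i $ k * (2 * N i k j - N j k i) = - (\<Phi> x $ k $ i * (2 * N k i j - N j i k))"
      using \<Phi>_skew[OF x, of i k] by simp
  qed
  hence "2 * dvg (\<lambda>y. F y ** X y) x j = trace (\<Phi> x ** cov j F x)"
    unfolding 1 2 by (simp add: right_diff_distrib sum_subtractf sum_distrib_left mult.left_commute)
  thus ?thesis
    unfolding T_def[abs_def]
    using dvg_diff[OF smooth_on_matrix_mult[OF S smooth_F smooth_X] smooth_on_scaleR[OF S smooth_trXX g] x]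
      dvg_conformal[OF x smooth_trXX] pd_trXX[OF x] by simp
qed

text \<open>Where a tensor vanishes, its covariant and partial derivatives agree. It is therefore
  enough that the equations hold at the point itself.\<close>

lemma einstein_divergence:
  assumes x: "x \<in> S" and Y: "Y x = 0" and E: "Ein x - T x = 0"
  shows "(\<Sum>i\<in>UNIV. \<Sum>k\<in>UNIV. \<gamma> x $ i $ k * pd k (\<lambda>y. Ein y - T y) x $ i $ j) = 0"
proof -
  have "cov k (\<lambda>y. Ein y - T y) x = pd k (\<lambda>y. Ein y - T y) x" for k
    by (simp add: cov_def E matmul.zero_left matmul.zero_right)
  moreover have "dvg (\<lambda>y. Ein y - T y) x j = 0"
    using dvg_diff[OF smooth_Ein smooth_T x] dvg_T[OF x Y] dvg_einstein[OF x] by (simp add: Ein_def[abs_def])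
  ultimately show ?thesis by (simp add: dvg_eq[OF x])
qed

text \<open>The coordinate divergence of the bivector density \<open>vol\<close> times \<Phi>, which
  needs no connection.\<close>

definition Z where "Z b x = (\<Sum>c\<in>UNIV. pd c (\<lambda>y. vol y * \<Phi> y $ c $ b) x)"

text \<open>The derivative of \<open>vol\<close> cancels one connection term; the other pairs the
  symmetric lower indices of the connection with the skew \<Phi>.\<close>

lemma Z_eq: 
  assumes x: "x \<in> S" shows "Z b x = vol x * (\<Sum>j\<in>UNIV. \<gamma> x $ b $ j * Y x $ j)"
proof -
  have pd\<Phi>: "pd c \<Phi> x = \<gamma> x ** cov c F x ** \<gamma> x - \<Gamma> c x ** \<Phi> x - \<Phi> x ** transpose (\<Gamma> c x)" for c
  proof -
    have e: "\<Phi> = (\<lambda>y. X y ** \<gamma> y)" by (simp add: \<Phi>_def[abs_def] X_def)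
    show ?thesis
      unfolding e pd_matrix_mult[OF smooth_onD[OF smooth_X x] diff_\<gamma>[OF x]] pd_X[OF x] pd_\<gamma>[OF x] matmul_simps
      by (simp add: algebra_simps)
  qed
  have "pd c (\<lambda>y. vol y * \<Phi> y $ c $ b) x = vol x * (trace (\<Gamma> c x) * \<Phi> x $ c $ b + pd c \<Phi> x $ c $ b)" for c
    using pd_mult[OF smooth_onD[OF smooth_vol x] smooth_onD[OF smooth_on_nth[OF S smooth_on_nth[OF S smooth_\<Phi>]] x]]
    by (simp add: pd_entry[OF smooth_\<Phi> x] pd_vol[OF x] distrib_left)
  hence "Z b x = vol x * ((\<Sum>c\<in>UNIV. trace (\<Gamma> c x) * \<Phi> x $ c $ b) + (\<Sum>c\<in>UNIV. (\<gamma> x ** cov c F x ** \<gamma> x) $ c $ b)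
      - (\<Sum>c\<in>UNIV. (\<Gamma> c x ** \<Phi> x) $ c $ b) - (\<Sum>c\<in>UNIV. (\<Phi> x ** transpose (\<Gamma> c x)) $ c $ b))"
    by (simp add: Z_def pd\<Phi> sum_distrib_left[symmetric] sum.distrib sum_subtractf)
  also have "(\<Sum>c\<in>UNIV. (\<Phi> x ** transpose (\<Gamma> c x)) $ c $ b) = 0"
    unfolding matrix_mult_nth transpose_nth
  proof (rule sum_antisym_zero)
    show "\<Phi> x $ c $ p * \<Gamma> c x $ b $ p = - (\<Phi> x $ p $ c * \<Gamma> p x $ b $ c)" for c p
      using \<Phi>_skew[OF x, of c p] \<Gamma>_sym[OF x, of c b p] by simp
  qed
  also have "(\<Sum>c\<in>UNIV. (\<Gamma> c x ** \<Phi> x) $ c $ b) = (\<Sum>c\<in>UNIV. trace (\<Gamma> c x) * \<Phi> x $ c $ b)"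
    unfolding matrix_mult_nth trace_def sum_distrib_right
    by (subst sum.swap) (simp add: \<Gamma>_sym[OF x, of _ _ c for c])
  also have "(\<Sum>c\<in>UNIV. (\<gamma> x ** cov c F x ** \<gamma> x) $ c $ b) = (\<Sum>j\<in>UNIV. \<gamma> x $ b $ j * Y x $ j)"
    unfolding matrix_mult_nth[of _ "\<gamma> x"] Y_def dvg_def
    by (subst sum.swap) (simp add: matrix_mult_nth sum_distrib_left sum_distrib_right \<gamma>_nth[OF x, of b] mult_ac)
  finally show ?thesis by simp
qed

text \<open>The iterated divergence of a skew bivector density vanishes since partial derivatives
  commute. As \<open>Y x = 0\<close>, differentiating \<open>Z_eq\<close> leaves only derivatives of
  \<open>Y\<close>.\<close>

lemma maxwell_divergence:
  assumes x: "x \<in> S" and Y: "Y x = 0"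
  shows "(\<Sum>i\<in>UNIV. \<Sum>k\<in>UNIV. \<gamma> x $ i $ k * pd k Y x $ i) = 0"
proof -
  define W where "W c b y = vol y * \<Phi> y $ c $ b" for c b y
  have sW: "smooth_on S (W c b)" for c b
    unfolding W_def[abs_def] by (intro smooth_on_mult smooth_on_nth smooth_vol smooth_\<Phi> S)
  have "(\<Sum>b\<in>UNIV. pd b (Z b) x) = (\<Sum>b\<in>UNIV. \<Sum>c\<in>UNIV. pd b (pd c (W c b)) x)"
    unfolding Z_def[abs_def] W_def[symmetric, abs_def] using smooth_onD[OF smooth_on_pd[OF sW] x] by (simp add: pd_sum)
  also have "\<dots> = 0"
  proof (rule sum_antisym_zero)
    fix b c
    have "pd c (W c b) y = - pd c (W b c) y" if "y \<in> S" for y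
    proof -
      have "pd c (W c b) y = pd c (\<lambda>y. - W b c y) y"
        by (rule pd_cong_open[OF S that]) (simp add: W_def \<Phi>_skew[of _ c b])
      thus ?thesis using pd_linear[OF bounded_linear_minus[OF bounded_linear_ident] smooth_onD[OF sW that]] by metis
    qed
    hence "pd b (pd c (W c b)) x = pd b (\<lambda>y. - pd c (W b c) y) x" by (rule pd_cong_open[OF S x])
    also have "\<dots> = - pd b (pd c (W b c)) x"
      using pd_linear[OF bounded_linear_minus[OF bounded_linear_ident] smooth_onD[OF smooth_on_pd[OF sW] x]] by blast
    finally show "pd b (pd c (W c b)) x = - pd c (pd b (W b c)) x"
      using pd_commute[OF S sW x] by simp
  qed
  finally have "(\<Sum>b\<in>UNIV. pd b (Z b) x) = 0" .
  moreover have "pd b (Z b) x = vol x * (\<Sum>j\<in>UNIV. \<gamma> x $ b $ j * pd b Y x $ j)" for b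
  proof -
    have s: "smooth_on S (\<lambda>y. \<gamma> y $ b $ j)" "smooth_on S (\<lambda>y. Y y $ j)" for j
      by (intro smooth_on_nth S smooth_\<gamma> smooth_Y)+
    have ss: "smooth_on S (\<lambda>y. \<gamma> y $ b $ j * Y y $ j)" for j by (intro smooth_on_mult s S)
    have "pd b (Z b) x = pd b (\<lambda>y. vol y * (\<Sum>j\<in>UNIV. \<gamma> y $ b $ j * Y y $ j)) x"
      by (rule pd_cong_open[OF S x Z_eq])
    also have "\<dots> = vol x * pd b (\<lambda>y. \<Sum>j\<in>UNIV. \<gamma> y $ b $ j * Y y $ j) x"
      using pd_mult[OF smooth_onD[OF smooth_vol x] smooth_onD[OF smooth_on_sum[OF S ss] x]] Y by simp
    also have "pd b (\<lambda>y. \<Sum>j\<in>UNIV. \<gamma> y $ b $ j * Y y $ j) x = (\<Sum>j\<in>UNIV. pd b (\<lambda>y. \<gamma> y $ b $ j * Y y $ j) x)"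
      by (rule pd_sum) (rule smooth_onD[OF ss x])
    also have "\<dots> = (\<Sum>j\<in>UNIV. \<gamma> x $ b $ j * pd b Y x $ j)"
      using Y by (simp add: pd_mult[OF smooth_onD[OF s(1) x] smooth_onD[OF s(2) x]] pd_nth[OF smooth_onD[OF smooth_Y x]])
    finally show ?thesis .
  qed
  ultimately have "vol x * (\<Sum>b\<in>UNIV. \<Sum>j\<in>UNIV. \<gamma> x $ b $ j * pd b Y x $ j) = 0"
    by (simp add: sum_distrib_left)
  moreover have "vol x \<noteq> 0" by (simp add: vol_def det[OF x])
  ultimately have "(\<Sum>b\<in>UNIV. \<Sum>j\<in>UNIV. \<gamma> x $ b $ j * pd b Y x $ j) = 0" by simp
  thus ?thesis by (subst sum.swap) (simp add: \<gamma>_nth[OF x])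
qed

end

section \<open>The codifferential\<close>

lemma finite_lists_length: "finite {js :: 'n::finite list. length js = k}"
  using finite_lists_length_eq[of "UNIV :: 'n set" k] by simp

lemma sum_lists_Suc:
  fixes h :: "'n::finite list \<Rightarrow> real"
  shows "(\<Sum>ls\<in>{ls. length ls = Suc k}. h ls) = (\<Sum>b\<in>UNIV. \<Sum>js\<in>{js. length js = k}. h (b # js))"
proof -
  have "{ls :: 'n list. length ls = Suc k} = (\<lambda>(b, js). b # js) ` (UNIV \<times> {js. length js = k})"
    by (auto simp: length_Suc_conv image_iff)
  moreover have "inj_on (\<lambda>(b, js). b # js) (UNIV \<times> {js :: 'n list. length js = k})"
    by (auto simp: inj_on_def)
  ultimately show ?thesis by (simp add: sum.reindex sum.cartesian_product split_def)
qed

lemma sum_lists_0: "(\<Sum>ls\<in>{ls. length ls = 0}. h ls) = h []"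
proof -
  have "{ls :: 'b list. length ls = 0} = {[]}" by auto
  thus ?thesis by simp
qed

lemma sum_lists_2:
  fixes h :: "'n::finite list \<Rightarrow> real"
  shows "(\<Sum>ls\<in>{ls. length ls = 2}. h ls) = (\<Sum>k\<in>UNIV. \<Sum>l\<in>UNIV. h [k, l])"
  unfolding numeral_2_eq_2 sum_lists_Suc sum_lists_0 ..

lemma alternating_move:
  fixes \<omega> :: "'n list \<Rightarrow> real"
  assumes "alternating \<omega>"
  shows "\<omega> (us @ y # xs @ ys) = (-1) ^ length xs * \<omega> (us @ xs @ y # ys)"
proof (induction xs arbitrary: us)
  case (Cons x xs)
  have "\<omega> (us @ y # (x # xs) @ ys) = - \<omega> ((us @ [x]) @ y # xs @ ys)"
    using alternating_swap[OF assms, of us y x "xs @ ys"] by simp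
  also have "\<omega> ((us @ [x]) @ y # xs @ ys) = (-1) ^ length xs * \<omega> (us @ (x # xs) @ y # ys)"
    using Cons[of "us @ [x]"] by simp
  finally show ?case by simp
qed simp

lemma alternating_del_nth:
  fixes \<omega> :: "'n list \<Rightarrow> real"
  assumes "alternating \<omega>" "m < length is"
  shows "\<omega> (us @ is ! m # del_nth m is) = (-1) ^ m * \<omega> (us @ is)"
  using alternating_move[OF assms(1), of us "is ! m" "take m is" "drop (Suc m) is"] assms(2)
  by (simp add: del_nth_def id_take_nth_drop[symmetric])

lemma alternating_not_distinct:
  fixes \<omega> :: "'n list \<Rightarrow> real"
  assumes "alternating \<omega>" "\<not> distinct is"
  shows "\<omega> is = 0"
proof -
  obtain xs ys zs y where "is": "is = xs @ [y] @ ys @ [y] @ zs"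
    using not_distinct_decomp[OF assms(2)] by blast
  have "\<omega> (xs @ y # ys @ y # zs) = (-1) ^ length ys * \<omega> ((xs @ ys) @ y # y # zs)"
    using alternating_move[OF assms(1), of xs y ys "y # zs"] by simp
  also have "\<omega> ((xs @ ys) @ y # y # zs) = 0"
    using alternating_swap[OF assms(1), of "xs @ ys" y y zs] by simp
  finally show ?thesis by (simp add: "is")
qed

section \<open>The Levi-Civita symbol\<close>

lemma coord_order: "distinct (coord_order :: 'n::finite list)" "set (coord_order :: 'n list) = UNIV"
proof -
  have "\<exists>is :: 'n list. distinct is \<and> set is = UNIV" using finite_distinct_list[of "UNIV :: 'n set"] by auto
  from someI_ex[OF this] show "distinct (coord_order :: 'n list)" "set (coord_order :: 'n list) = UNIV"
    unfolding coord_order_def by auto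
qed

lemma length_coord_order: "length (coord_order :: 'n::finite list) = CARD('n)"
  using distinct_card[OF coord_order(1)] coord_order(2) by metis

lemma map_coord_order_eq: "map f coord_order = map h coord_order \<longleftrightarrow> f = h"
  using coord_order(2) by (auto simp: fun_eq_iff)

lemma levi_civita_permutation:
  assumes "\<pi> permutes (UNIV :: 'n::finite set)"
  shows "levi_civita (map \<pi> coord_order) = of_int (sign \<pi>)"
proof -
  have "inj \<pi>" "surj \<pi>" using assms by (simp_all add: permutes_inj permutes_surj)
  hence "distinct (map \<pi> coord_order)" "set (map \<pi> coord_order) = UNIV"
    by (simp_all add: coord_order distinct_map inj_on_def inj_def)
  moreover have "(THE \<rho>. \<rho> permutes UNIV \<and> map \<rho> coord_order = map \<pi> coord_order) = \<pi>"
    using assms by (intro the_equality) (auto simp only: map_coord_order_eq)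
  ultimately show ?thesis by (simp add: levi_civita_def)
qed

lemma list_as_map:
  fixes "is" :: "'n::finite list"
  assumes "length is = CARD('n)" obtains f :: "'n \<Rightarrow> 'n" where "is = map f coord_order"
proof
  show "is = map (\<lambda>x :: 'n. the (map_of (zip coord_order is) x)) coord_order"
    by (rule nth_equalityI) (simp_all add: assms length_coord_order map_of_zip_nth coord_order)
qed

lemma list_as_permutation:
  fixes "is" :: "'n::finite list"
  assumes "distinct is" "set is = UNIV"
  obtains \<pi> where "\<pi> permutes UNIV" "is = map \<pi> coord_order"
proof -
  have "length is = CARD('n)" using distinct_card[OF assms(1)] assms(2) by metis
  then obtain f :: "'n \<Rightarrow> 'n" where f: "is = map f coord_order" by (rule list_as_map)
  have "surj f" using assms(2) unfolding f by (simp add: coord_order)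
  hence "bij f" using finite_UNIV_surj_inj[of f] by (simp add: bij_def)
  hence "f permutes UNIV" by (intro bij_imp_permutes) auto
  with f show thesis by (rule that[rotated])
qed

lemma levi_civita_nonzero: "levi_civita is \<noteq> 0 \<longleftrightarrow> distinct is \<and> set is = UNIV"
  by (simp add: levi_civita_def sign_def)

lemma alternating_levi_civita: "alternating (levi_civita :: 'n::finite list \<Rightarrow> real)"
proof (rule alternatingI)
  fix us vs :: "'n list" and a b
  show "levi_civita (us @ a # b # vs) = - levi_civita (us @ b # a # vs)"
  proof (cases "distinct (us @ a # b # vs) \<and> set (us @ a # b # vs) = UNIV")
    case True
    then obtain \<pi> where \<pi>: "\<pi> permutes UNIV" "us @ a # b # vs = map \<pi> coord_order"
      using list_as_permutation by metis
    have t: "Transposition.transpose a b permutes UNIV" by (rule permutes_swap_id) auto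
    have eq: "us @ b # a # vs = map (Transposition.transpose a b \<circ> \<pi>) coord_order"
    proof -
      have "map (Transposition.transpose a b) xs = xs" if "a \<notin> set xs" "b \<notin> set xs" for xs
        using that by (intro map_idI) (auto simp: Transposition.transpose_def)
      hence "map (Transposition.transpose a b) (us @ a # b # vs) = us @ b # a # vs"
        using True by simp
      thus ?thesis unfolding \<pi>(2) by simp
    qed
    have "a \<noteq> b" using True by auto
    hence "sign (Transposition.transpose a b \<circ> \<pi>) = - sign \<pi>"
      using \<pi>(1) t by (subst sign_compose) (auto simp: sign_swap_id permutes_imp_permutation[OF finite_class.finite_UNIV])
    thus ?thesis
      unfolding eq \<pi>(2) levi_civita_permutation[OF \<pi>(1)] levi_civita_permutation[OF permutes_compose[OF \<pi>(1) t]] by simp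
  next
    case False
    hence "\<not> (distinct (us @ b # a # vs) \<and> set (us @ b # a # vs) = UNIV)" by auto
    with False show ?thesis using levi_civita_nonzero by (metis minus_zero)
  qed
qed

text \<open>The Leibniz formula: only lists that permute the coordinates contribute.\<close>

lemma levi_civita_det_rows:
  fixes B :: "real^'n::finite^'n"
  shows "(\<Sum>js\<in>{js. length js = CARD('n)}. (\<Prod>m<CARD('n). B $ (coord_order ! m) $ (js ! m)) * levi_civita js) = det B"
proof -
  let ?P = "{p. p permutes (UNIV :: 'n set)}" and ?f = "\<lambda>p. map p (coord_order :: 'n list)"
  let ?h = "\<lambda>js. (\<Prod>m<CARD('n). B $ (coord_order ! m) $ (js ! m)) * levi_civita js"
  have "(\<Sum>js\<in>{js. length js = CARD('n)}. ?h js) = (\<Sum>js\<in>?f ` ?P. ?h js)"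
  proof (rule sum.mono_neutral_right[OF finite_lists_length])
    show "\<forall>js\<in>{js. length js = CARD('n)} - ?f ` ?P. ?h js = 0"
    proof
      fix js :: "'n list" assume js: "js \<in> {js. length js = CARD('n)} - ?f ` ?P"
      have "levi_civita js = 0"
      proof (rule ccontr)
        assume "levi_civita js \<noteq> 0"
        then obtain \<pi> where "\<pi> permutes UNIV" "js = map \<pi> coord_order"
          using list_as_permutation levi_civita_nonzero by metis
        with js show False by blast
      qed
      thus "?h js = 0" by simp
    qed
  qed (auto simp: length_coord_order)
  also have "\<dots> = (\<Sum>p\<in>?P. ?h (?f p))"
    by (subst sum.reindex) (auto intro!: inj_onI simp only: map_coord_order_eq o_def)
  also have "\<dots> = det B"
    unfolding det_def
  proof (rule sum.cong[OF refl])
    fix p assume p: "p \<in> ?P"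
    have "(\<Prod>m<CARD('n). B $ (coord_order ! m) $ (?f p ! m)) = (\<Prod>m<CARD('n). B $ (coord_order ! m) $ p (coord_order ! m))"
      by (rule prod.cong) (simp_all add: length_coord_order)
    also have "\<dots> = (\<Prod>x\<in>UNIV. B $ x $ p x)"
      by (rule prod.reindex_bij_betw) (use bij_betw_nth[OF coord_order(1) refl refl] in \<open>simp add: length_coord_order coord_order\<close>)
    finally show "?h (?f p) = of_int (sign p) * (\<Prod>x\<in>UNIV. B $ x $ p x)"
      using p levi_civita_permutation[of p] by simp
  qed
  finally show ?thesis .
qed

text \<open>Reduction to the matrix whose rows are selected by \<open>is\<close>; a repeated index
  makes both sides vanish.\<close>

lemma levi_civita_det:
  fixes A :: "real^'n::finite^'n" and "is" :: "'n list"
  assumes "length is = CARD('n)"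
  shows "(\<Sum>js\<in>{js. length js = CARD('n)}. (\<Prod>m<CARD('n). A $ (is ! m) $ (js ! m)) * levi_civita js) = det A * levi_civita is"
proof -
  obtain f :: "'n \<Rightarrow> 'n" where f: "is = map f coord_order" using list_as_map[OF assms] .
  have "(\<Sum>js\<in>{js. length js = CARD('n)}. (\<Prod>m<CARD('n). A $ (is ! m) $ (js ! m)) * levi_civita js) = det (\<chi> x. A $ f x)"
    unfolding levi_civita_det_rows[symmetric]
    by (intro sum.cong refl arg_cong2[of _ _ _ _ "(*)"] prod.cong) (simp add: f length_coord_order)
  also have "\<dots> = det A * levi_civita is"
  proof (cases "f permutes UNIV")
    case True
    thus ?thesis using det_permute_rows[of f A] levi_civita_permutation[OF True] by (simp add: f)
  next
    case False
    have ninj: "\<not> inj f"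
    proof
      assume "inj f"
      hence "bij f" using finite_UNIV_inj_surj[of f] by (simp add: bij_def)
      hence "f permutes UNIV" by (intro bij_imp_permutes) auto
      with False show False by simp
    qed
    then obtain x y where "x \<noteq> y" "f x = f y" by (auto simp: inj_def)
    hence "det (\<chi> x. A $ f x) = 0" by (intro det_identical_rows[of x y]) (simp_all add: row_def)
    moreover have "levi_civita is = 0"
    proof (rule ccontr)
      assume "levi_civita is \<noteq> 0"
      hence "distinct is" by (simp add: levi_civita_nonzero)
      hence "inj_on f UNIV" unfolding f distinct_map by (simp add: coord_order)
      with ninj show False by simp
    qed
    ultimately show ?thesis by simp
  qed
  finally show ?thesis .
qed

text \<open>For equal indices every arrangement of the remaining coordinates contributes the square
  of a sign; for different ones no list completes both to a permutation.\<close>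

lemma levi_civita_contraction:
  fixes i j :: "'n::finite"
  shows "(\<Sum>is\<in>{is. length is = CARD('n) - 1}. levi_civita (j # is) * levi_civita (i # is))
    = (if i = j then fact (CARD('n) - 1) else 0)"
proof (cases "i = j")
  case True
  let ?Q = "permutations_of_set (UNIV - {i})"
  have iff: "levi_civita (i # is) \<noteq> 0 \<longleftrightarrow> is \<in> ?Q" for "is"
    unfolding levi_civita_nonzero permutations_of_set_def by auto
  have "levi_civita (i # is) * levi_civita (i # is) = (if is \<in> ?Q then 1 else 0)" for "is"
    using iff[of "is"] by (auto simp: levi_civita_def sign_def split: if_splits)
  hence "(\<Sum>is\<in>{is. length is = CARD('n) - 1}. levi_civita (i # is) * levi_civita (i # is))
     = real (card ({is. length is = CARD('n) - 1} \<inter> ?Q))"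
    by (simp add: sum.If_cases[OF finite_lists_length])
  also have "{is. length is = CARD('n) - 1} \<inter> ?Q = ?Q"
    using distinct_card by (fastforce simp: permutations_of_set_def card_Diff_singleton)
  finally show ?thesis using True by (simp add: card_Diff_singleton)
next
  case False
  have "levi_civita (j # is) * levi_civita (i # is) = 0" for "is"
    using False levi_civita_nonzero[of "i # is"] levi_civita_nonzero[of "j # is"] by auto
  hence "(\<Sum>is\<in>{is. length is = CARD('n) - 1}. levi_civita (j # is) * levi_civita (i # is)) = 0"
    by (intro sum.neutral ballI)
  thus ?thesis using False by simp
qed

lemma sum_two:
  fixes f :: "'n::finite \<Rightarrow> 'n \<Rightarrow> real"
  assumes "b \<noteq> c" "\<And>k l. f k l \<noteq> 0 \<Longrightarrow> (k, l) = (b, c) \<or> (k, l) = (c, b)"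
  shows "(\<Sum>k\<in>UNIV. \<Sum>l\<in>UNIV. f k l) = f b c + f c b"
proof -
  have "(\<Sum>k\<in>UNIV. \<Sum>l\<in>UNIV. f k l) = (\<Sum>p\<in>UNIV. f (fst p) (snd p))"
    by (simp add: sum.cartesian_product split_def)
  also have "\<dots> = (\<Sum>p\<in>{(b, c), (c, b)}. f (fst p) (snd p))"
    by (rule sum.mono_neutral_right) (use assms(2) in force)+
  finally show ?thesis using assms(1) by simp
qed

text \<open>The divergence of a bivector field as the exterior derivative of its Hodge dual; \<open>w c\<close> are
  the derivatives of the components in direction \<open>c\<close>.\<close>

lemma levi_civita_divergence:
  fixes w :: "'n::finite \<Rightarrow> 'n \<Rightarrow> 'n \<Rightarrow> real"
  assumes w: "\<And>c k l. w c k l = - w c l k" and len: "length is = CARD('n) - 1"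
  shows "(\<Sum>m<length is. (-1) ^ m * ((\<Sum>k\<in>UNIV. \<Sum>l\<in>UNIV. w (is ! m) k l * levi_civita (k # l # del_nth m is)) / 2))
    = - (\<Sum>b\<in>UNIV. levi_civita (b # is) * (\<Sum>c\<in>UNIV. w c c b))"
proof (cases "distinct is")
  case False
  \<comment> \<open>The left-hand side is the Spencer differential of this cochain at the empty
    tensor list, the direction of differentiation being read off the tensor index. Hence it is
    alternating in \<open>is\<close> and vanishes when an index is repeated.\<close>
  define \<Omega> :: "('n, real) cochain" where
    "\<Omega> js ks = (\<Sum>k\<in>UNIV. \<Sum>l\<in>UNIV. w (hd ks) k l * levi_civita (k # l # js)) / 2" for js ks
  have "alternating \<Omega>"
  proof (rule alternatingI, rule ext)
    fix us vs ks :: "'n list" and a b :: 'n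
    have "levi_civita (k # l # us @ a # b # vs) = - levi_civita (k # l # us @ b # a # vs)" for k l
      using alternating_swap[OF alternating_levi_civita, of "k # l # us" a b vs] by simp
    thus "\<Omega> (us @ a # b # vs) ks = (- \<Omega> (us @ b # a # vs)) ks" by (simp add: \<Omega>_def sum_negf)
  qed
  hence "alternating (spencer_delta \<Omega>)" by (rule alternating_spencer_delta)
  hence "alternating (\<lambda>js. spencer_delta \<Omega> js [])" 
    unfolding alternating_def fun_eq_iff uminus_apply by blast
  hence "spencer_delta \<Omega> is [] = 0" by (rule alternating_not_distinct) (rule False)
  moreover have "levi_civita (b # is) = 0" for b using levi_civita_nonzero[of "b # is"] False by auto
  ultimately show ?thesis by (simp add: spencer_delta_def \<Omega>_def)
next
  case True
  \<comment> \<open>With distinct entries, exactly one coordinate \<open>b\<close> is missing from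
    \<open>is\<close>.\<close>
  have "card (UNIV - set is) = 1"
    using distinct_card[OF True] len by (subst card_Diff_subset) auto
  then obtain b where b: "UNIV - set is = {b}" by (auto simp: card_1_singleton_iff)
  have "(-1) ^ m * ((\<Sum>k\<in>UNIV. \<Sum>l\<in>UNIV. w (is ! m) k l * levi_civita (k # l # del_nth m is)) / 2)
     = - levi_civita (b # is) * w (is ! m) (is ! m) b" if m: "m < length is" for m
  proof -
    let ?c = "is ! m"
    have sd: "set (del_nth m is) = set is - {?c}"
    proof -
      have eq: "is = take m is @ ?c # drop (Suc m) is" using m by (rule id_take_nth_drop)
      have "distinct (take m is @ ?c # drop (Suc m) is)" using True by (simp only: eq[symmetric])
      moreover have "set is = insert ?c (set (take m is) \<union> set (drop (Suc m) is))"
        using arg_cong[OF eq, of set] by simp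
      ultimately show ?thesis unfolding del_nth_def by auto
    qed
    have "b \<noteq> ?c" using b m nth_mem by blast
    moreover have "(k, l) = (b, ?c) \<or> (k, l) = (?c, b)" if "w ?c k l * levi_civita (k # l # del_nth m is) \<noteq> 0" for k l
    proof -
      have "levi_civita (k # l # del_nth m is) \<noteq> 0" using that by auto
      hence "distinct (k # l # del_nth m is)" by (simp add: levi_civita_nonzero)
      moreover have "y = b" if "y \<notin> set is" for y using b that by blast
      ultimately show ?thesis using sd by auto
    qed
    \<comment> \<open>Only the pair formed by \<open>b\<close> and the deleted entry survives, in
      both orders; this uses up the factor 1/2.\<close>
    ultimately have "(\<Sum>k\<in>UNIV. \<Sum>l\<in>UNIV. w ?c k l * levi_civita (k # l # del_nth m is))
      = w ?c b ?c * levi_civita (b # ?c # del_nth m is) + w ?c ?c b * levi_civita (?c # b # del_nth m is)"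
      by (rule sum_two)
    also have "\<dots> = - 2 * (w ?c ?c b * levi_civita (b # ?c # del_nth m is))"
      using w[of ?c b ?c] alternatingD[OF alternating_levi_civita, of ?c b "del_nth m is"] by simp
    also have "levi_civita (b # ?c # del_nth m is) = (-1) ^ m * levi_civita (b # is)"
      using alternating_del_nth[OF alternating_levi_civita m, of "[b]"] by simp
    finally show ?thesis by (simp add: mult_ac flip: power_add mult_2 power_mult_distrib) 
  qed
  hence "(\<Sum>m<length is. (-1) ^ m * ((\<Sum>k\<in>UNIV. \<Sum>l\<in>UNIV. w (is ! m) k l * levi_civita (k # l # del_nth m is)) / 2))
    = (\<Sum>m<length is. - levi_civita (b # is) * w (is ! m) (is ! m) b)"
    by (intro sum.cong) auto
  also have "\<dots> = - levi_civita (b # is) * (\<Sum>c\<in>set is. w c c b)"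
    unfolding sum_distrib_left[symmetric]
    using sum.reindex_bij_betw[OF bij_betw_nth[OF True refl refl], of "\<lambda>c. w c c b"] by simp
  \<comment> \<open>The missing direction can be added to the sum, since \<open>w b b b = 0\<close>
    by skewness.\<close>
  also have "(\<Sum>c\<in>set is. w c c b) = (\<Sum>c\<in>UNIV. w c c b)"
  proof (rule sum.mono_neutral_left)
    show "\<forall>c\<in>UNIV - set is. w c c b = 0" unfolding b using w[of b b b] by simp
  qed auto
  also have "- levi_civita (b # is) * (\<Sum>c\<in>UNIV. w c c b) = - (\<Sum>b'\<in>UNIV. levi_civita (b' # is) * (\<Sum>c\<in>UNIV. w c c b'))"
  proof -
    have "levi_civita (b' # is) * (\<Sum>c\<in>UNIV. w c c b') = (if b' = b then levi_civita (b # is) * (\<Sum>c\<in>UNIV. w c c b) else 0)" for b'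
    proof (cases "b' = b")
      case False
      hence "b' \<in> set is" using b by blast
      hence "levi_civita (b' # is) = 0" using levi_civita_nonzero[of "b' # is"] by auto
      with False show ?thesis by simp
    qed simp
    hence "(\<Sum>b'\<in>UNIV. levi_civita (b' # is) * (\<Sum>c\<in>UNIV. w c c b'))
      = (\<Sum>b'\<in>UNIV. if b' = b then levi_civita (b # is) * (\<Sum>c\<in>UNIV. w c c b) else 0)"
      by (rule sum.cong[OF refl])
    thus ?thesis by simp
  qed
  finally show ?thesis .
qed

section \<open>The codifferential of F as a divergence\<close>

context em_field
begin

lemma hodge_field:
  assumes x: "x \<in> S"
  shows "hodge 2 (g x) (field_strength A x) js = (\<Sum>k\<in>UNIV. \<Sum>l\<in>UNIV. vol x * \<Phi> x $ k $ l * levi_civita (k # l # js)) / 2"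
proof -
  have "raise_indices 2 (g x) (field_strength A x) [k, l] = \<Phi> x $ k $ l" for k l
  proof -
    have "raise_indices 2 (g x) (field_strength A x) [k, l] = (\<Sum>a\<in>UNIV. \<Sum>b\<in>UNIV. \<gamma> x $ k $ a * \<gamma> x $ l $ b * F x $ a $ b)"
      unfolding raise_indices_def sum_lists_2 by (simp add: numeral_2_eq_2 \<gamma>_def field_strength_eq[OF x])
    also have "\<dots> = \<Phi> x $ k $ l"
      unfolding \<Phi>_def matrix_mult_nth
      by (subst sum.swap) (simp add: sum_distrib_left sum_distrib_right \<gamma>_nth[OF x, of l] mult_ac)
    finally show ?thesis .
  qed
  thus ?thesis
    unfolding hodge_def sum_lists_2 by (simp add: vol_def sum_distrib_left mult_ac)
qed

lemma ext_deriv_hodge_field: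
  assumes x: "x \<in> S" and len: "length is = CARD('n) - 1"
  shows "ext_deriv (\<lambda>y. hodge 2 (g y) (field_strength A y)) x is = - (\<Sum>b\<in>UNIV. levi_civita (b # is) * Z b x)"
proof -
  define W where "W k l y = vol y * \<Phi> y $ k $ l" for k l y
  have sW: "smooth_on S (W k l)" for k l
    unfolding W_def[abs_def] by (intro smooth_on_mult smooth_on_nth smooth_vol smooth_\<Phi> S)
  have Wanti: "pd c (W k l) x = - pd c (W l k) x" for c k l
  proof -
    have "pd c (W k l) x = pd c (\<lambda>y. - W l k y) x"
      by (rule pd_cong_open[OF S x]) (simp add: W_def \<Phi>_skew[of _ k l])
    thus ?thesis using pd_linear[OF bounded_linear_minus[OF bounded_linear_ident] smooth_onD[OF sW x]] by metis
  qed
  have "pd c (\<lambda>y. hodge 2 (g y) (field_strength A y) js) x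
    = (\<Sum>k\<in>UNIV. \<Sum>l\<in>UNIV. pd c (W k l) x * levi_civita (k # l # js)) / 2" for c js
  proof -
    have m: "smooth_on S (\<lambda>y. W k l y * r)" for k l r by (intro smooth_on_mult smooth_on_const sW S)
    have ms: "smooth_on S (\<lambda>y. \<Sum>l\<in>UNIV. W k l y * r l)" for k r by (intro smooth_on_sum m S)
    have "pd c (\<lambda>y. hodge 2 (g y) (field_strength A y) js) x = pd c (\<lambda>y. (\<Sum>k\<in>UNIV. \<Sum>l\<in>UNIV. W k l y * levi_civita (k # l # js)) / 2) x"
      by (rule pd_cong_open[OF S x]) (simp add: hodge_field W_def)
    also have "\<dots> = pd c (\<lambda>y. \<Sum>k\<in>UNIV. \<Sum>l\<in>UNIV. W k l y * levi_civita (k # l # js)) x / 2"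
      by (rule pd_linear[OF bounded_linear_divide smooth_onD[OF smooth_on_sum[OF S ms] x]])
    also have "pd c (\<lambda>y. \<Sum>k\<in>UNIV. \<Sum>l\<in>UNIV. W k l y * levi_civita (k # l # js)) x
      = (\<Sum>k\<in>UNIV. \<Sum>l\<in>UNIV. pd c (\<lambda>y. W k l y * levi_civita (k # l # js)) x)"
      by (subst pd_sum[OF smooth_onD[OF ms x]]) (intro sum.cong refl pd_sum smooth_onD[OF m x])
    finally show ?thesis
      by (simp add: pd_mult[OF smooth_onD[OF sW x]] pd_const)
  qed
  hence "ext_deriv (\<lambda>y. hodge 2 (g y) (field_strength A y)) x is
    = (\<Sum>m<length is. (-1) ^ m * ((\<Sum>k\<in>UNIV. \<Sum>l\<in>UNIV. pd (is ! m) (W k l) x * levi_civita (k # l # del_nth m is)) / 2))"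
    by (simp only: ext_deriv_def)
  also have "\<dots> = - (\<Sum>b\<in>UNIV. levi_civita (b # is) * (\<Sum>c\<in>UNIV. pd c (W c b) x))"
    by (rule levi_civita_divergence[OF Wanti len])
  finally show ?thesis by (simp add: Z_def W_def[abs_def])
qed

text \<open>The Levi-Civita symbols contract to the determinant of \<gamma> and to the factorial in
  \<open>hodge\<close>. Since \<open>vol\<close> squared is the absolute value of the determinant of
  the metric, the factor in front of \<open>Y\<close> is a sign.\<close>

lemma codiff_eq:
  assumes x: "x \<in> S" and card: "CARD('n) \<ge> 2"
  shows "codiff 2 g (field_strength A) x [i] = (-1) ^ CARD('n) * (vol x * vol x * det (\<gamma> x)) * Y x $ i"
proof -
  define N where "N = CARD('n) - 1"
  let ?D = "ext_deriv (\<lambda>y. hodge 2 (g y) (field_strength A y)) x"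
  have n: "CARD('n) = Suc N" "CARD('n) - 2 + 1 = N" using card by (simp_all add: N_def)
  \<comment> \<open>The factor \<gamma> coming from \<open>Z_eq\<close> completes the
    \<open>N\<close> raised indices to a full set, so that \<open>levi_civita_det\<close>
    applies.\<close>
  have raise: "raise_indices N (g x) ?D is = - vol x * det (\<gamma> x) * (\<Sum>j\<in>UNIV. Y x $ j * levi_civita (j # is))"
    if "length is = N" for "is"
  proof -
    let ?p = "\<lambda>js. \<Prod>m<N. \<gamma> x $ (is ! m) $ (js ! m)"
    have "raise_indices N (g x) ?D is = (\<Sum>js\<in>{js. length js = N}. ?p js * (- (\<Sum>b\<in>UNIV. levi_civita (b # js) * Z b x)))"
      unfolding raise_indices_def \<gamma>_def using ext_deriv_hodge_field[OF x] by (intro sum.cong) (auto simp: N_def)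
    also have "\<dots> = - (\<Sum>js\<in>{js. length js = N}. \<Sum>b\<in>UNIV. \<Sum>j\<in>UNIV. vol x * Y x $ j * (\<gamma> x $ j $ b * ?p js * levi_civita (b # js)))"
      by (simp add: Z_eq[OF x] sum_distrib_left sum_negf \<gamma>_nth[OF x, of _ b for b] mult_ac)
    also have "(\<Sum>js\<in>{js. length js = N}. \<Sum>b\<in>UNIV. \<Sum>j\<in>UNIV. vol x * Y x $ j * (\<gamma> x $ j $ b * ?p js * levi_civita (b # js)))
      = (\<Sum>j\<in>UNIV. vol x * Y x $ j * (\<Sum>b\<in>UNIV. \<Sum>js\<in>{js. length js = N}. \<gamma> x $ j $ b * ?p js * levi_civita (b # js)))"
      unfolding sum_distrib_left by (subst sum.swap, subst (2) sum.swap, subst sum.swap) (rule refl)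
    also have "\<dots> = (\<Sum>j\<in>UNIV. vol x * Y x $ j * (det (\<gamma> x) * levi_civita (j # is)))"
    proof (intro sum.cong refl arg_cong2[of _ _ _ _ "(*)"])
      fix j
      have "(\<Sum>b\<in>UNIV. \<Sum>js\<in>{js. length js = N}. \<gamma> x $ j $ b * ?p js * levi_civita (b # js))
        = (\<Sum>ls\<in>{ls. length ls = CARD('n)}. (\<Prod>m<CARD('n). \<gamma> x $ ((j # is) ! m) $ (ls ! m)) * levi_civita ls)"
        unfolding n(1) sum_lists_Suc prod.lessThan_Suc_shift by simp
      also have "\<dots> = det (\<gamma> x) * levi_civita (j # is)"
        by (rule levi_civita_det) (use that n(1) in simp)
      finally show "(\<Sum>b\<in>UNIV. \<Sum>js\<in>{js. length js = N}. \<gamma> x $ j $ b * ?p js * levi_civita (b # js)) = det (\<gamma> x) * levi_civita (j # is)" .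
    qed
    finally show ?thesis by (simp add: sum_distrib_left mult_ac sum_negf)
  qed
  \<comment> \<open>\<open>hodge\<close> puts the free index last; moving it to the front passes
    \<open>N\<close> indices.\<close>
  have last: "levi_civita (is @ [i]) = (-1) ^ N * levi_civita (i # is)" if "length is = N" for "is"
  proof -
    have "levi_civita (i # is) = (-1) ^ N * levi_civita (is @ [i])"
      using alternating_move[OF alternating_levi_civita, of "[]" i "is" "[]"] that by simp
    thus ?thesis by (simp flip: mult.assoc power_add)
  qed
  have "(\<Sum>is\<in>{is. length is = N}. raise_indices N (g x) ?D is * levi_civita (is @ [i]))
    = (\<Sum>is\<in>{is. length is = N}. \<Sum>j\<in>UNIV. (- (vol x * det (\<gamma> x) * (-1) ^ N)) * Y x $ j * (levi_civita (j # is) * levi_civita (i # is)))"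
  proof (rule sum.cong[OF refl])
    fix "is" :: "'n list" assume "is \<in> {is. length is = N}"
    hence l: "length is = N" by simp
    show "raise_indices N (g x) ?D is * levi_civita (is @ [i])
      = (\<Sum>j\<in>UNIV. (- (vol x * det (\<gamma> x) * (-1) ^ N)) * Y x $ j * (levi_civita (j # is) * levi_civita (i # is)))"
      unfolding raise[OF l] last[OF l] sum_distrib_left sum_distrib_right
      by (rule sum.cong[OF refl]) (simp only: mult_minus_left mult_minus_right mult_ac)
  qed
  also have "\<dots> = (\<Sum>j\<in>UNIV. (- (vol x * det (\<gamma> x) * (-1) ^ N)) * Y x $ j * (\<Sum>is\<in>{is. length is = N}. levi_civita (j # is) * levi_civita (i # is)))"
    unfolding sum_distrib_left by (rule sum.swap)
  also have "\<dots> = - (vol x * det (\<gamma> x) * (-1) ^ N) * Y x $ i * fact N"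
    unfolding N_def levi_civita_contraction by (simp add: if_distrib cong: if_cong)
  finally have "hodge N (g x) ?D [i] = vol x / fact N * (- (vol x * det (\<gamma> x) * (-1) ^ N) * Y x $ i * fact N)"
    unfolding hodge_def vol_def by simp
  also have "\<dots> = (-1) ^ CARD('n) * (vol x * vol x * det (\<gamma> x)) * Y x $ i"
    unfolding n(1) power_Suc by simp
  finally show ?thesis unfolding codiff_def n(2) .
qed

end

section \<open>Linearisation\<close>

lemma vec_nth_fun: "($) (u + v) = (\<lambda>j. u $ j + v $ j)" "($) (c *\<^sub>R w) = (\<lambda>j. c *\<^sub>R w $ j)"
  by (simp_all add: fun_eq_iff)

lemma bounded_linear_lin_em: "bounded_linear (\<lambda>q :: ('n::finite fibre)^'n^'n. lin_em G \<gamma> (\<lambda>i j. q $ i $ j))"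
  unfolding linear_conv_bounded_linear[symmetric]
  by (rule linearI) (simp_all add: vec_nth_fun lin_em_add lin_em_scaleR)

lemma bounded_linear_lin_ricci: "bounded_linear (\<lambda>q :: (real^'n^'n)^'n::finite^'n. lin_ricci \<gamma> (\<lambda>i j. q $ i $ j))"
  unfolding linear_conv_bounded_linear[symmetric]
  by (rule linearI) (simp_all add: vec_nth_fun lin_ricci_linear)

lemma pds_nth: "open S \<Longrightarrow> smooth_on S f \<Longrightarrow> x \<in> S \<Longrightarrow> pds is (\<lambda>y. f y $ k) x = pds is f x $ k"
  using pds_linear[OF _ bounded_linear_vec_nth] by blast

lemma pds_lin_em:
  fixes Q :: "'n \<Rightarrow> 'n \<Rightarrow> real^'n::finite \<Rightarrow> 'n fibre"
  assumes S: "open S" "x \<in> S" and Q: "\<And>i j. smooth_on S (Q i j)"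
  shows "smooth_on S (\<lambda>y. lin_em G \<gamma> (\<lambda>i j. Q i j y))"
    and "pds is (\<lambda>y. lin_em G \<gamma> (\<lambda>i j. Q i j y)) x = lin_em G \<gamma> (\<lambda>i j. pds is (Q i j) x)"
proof -
  define q where "q y = (\<chi> i j. Q i j y)" for y
  have sq: "smooth_on S q" unfolding q_def by (intro smooth_on_vec S Q)
  have e: "(\<lambda>y. lin_em G \<gamma> (\<lambda>i j. Q i j y)) = (\<lambda>y. lin_em G \<gamma> (\<lambda>i j. q y $ i $ j))" by (simp add: q_def)
  show "smooth_on S (\<lambda>y. lin_em G \<gamma> (\<lambda>i j. Q i j y))"
    unfolding e by (rule smooth_on_linear[OF S(1) bounded_linear_lin_em sq])
  have "pds is q x $ i $ j = pds is (Q i j) x" for i j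
    using pds_nth[OF S(1) smooth_on_nth[OF S(1) sq] S(2), of "is" i j] pds_nth[OF S(1) sq S(2), of "is" i] by (simp add: q_def)
  thus "pds is (\<lambda>y. lin_em G \<gamma> (\<lambda>i j. Q i j y)) x = lin_em G \<gamma> (\<lambda>i j. pds is (Q i j) x)"
    unfolding e pds_linear[OF S(1) bounded_linear_lin_em sq S(2)]
    by (intro arg_cong[of _ _ "lin_em G \<gamma>"] ext)
qed

text \<open>Separates the derivatives of the connection, which carry the symbol, from its products,
  which do not.\<close>

lemma (in metric_field) Ric_split:
  "Ric y = (\<chi> l j. \<Sum>k\<in>UNIV. (pd k (\<Gamma> j) y - pd j (\<Gamma> k) y) $ k $ l)
    + (\<chi> l j. \<Sum>k\<in>UNIV. (\<Gamma> k y ** \<Gamma> j y - \<Gamma> j y ** \<Gamma> k y) $ k $ l)"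
  by (simp add: Ric_def R_def vec_eq_iff sum.distrib[symmetric] add_diff_eq)

section \<open>Agreement of functions to finite order at a point\<close>

locale base_point =
  fixes S :: "(real^'n::finite) set" and a
  assumes S: "open S" and a: "a \<in> S"
begin

text \<open>A congruence modulo functions vanishing to order \<open>k\<close> at \<open>a\<close>;
  it respects sums and bilinear products, and a derivative costs one order.\<close>

definition close :: "nat \<Rightarrow> (real^'n \<Rightarrow> 'v::real_normed_vector) \<Rightarrow> (real^'n \<Rightarrow> 'v) \<Rightarrow> bool"
  where "close k u v \<longleftrightarrow> smooth_on S u \<and> smooth_on S v \<and> vanishes k a (\<lambda>y. u y - v y)"

lemma close_refl: "smooth_on S u \<Longrightarrow> close k u u"
  by (simp add: close_def vanishes_def pds_zero)

lemma close_mono: "close k u v \<Longrightarrow> l \<le> k \<Longrightarrow> close l u v"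
  by (auto simp: close_def intro: vanishes_mono)

lemma close_add: "close k u v \<Longrightarrow> close k u' v' \<Longrightarrow> close k (\<lambda>y. u y + u' y) (\<lambda>y. v y + v' y)"
  using vanishes_add[OF S a, of "\<lambda>y. u y - v y" "\<lambda>y. u' y - v' y" k]
  by (simp add: close_def smooth_on_add[OF S] smooth_on_diff[OF S] algebra_simps)

lemma close_diff: "close k u v \<Longrightarrow> close k u' v' \<Longrightarrow> close k (\<lambda>y. u y - u' y) (\<lambda>y. v y - v' y)"
  using vanishes_diff[OF S a, of "\<lambda>y. u y - v y" "\<lambda>y. u' y - v' y" k]
  by (simp add: close_def smooth_on_diff[OF S] algebra_simps)

lemma close_linear: "bounded_linear L \<Longrightarrow> close k u v \<Longrightarrow> close k (\<lambda>y. L (u y)) (\<lambda>y. L (v y))"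
  using vanishes_linear[OF S a, of L "\<lambda>y. u y - v y" k]
  by (simp add: close_def smooth_on_linear[OF S] smooth_on_diff[OF S] linear_diff bounded_linear.linear)

lemma close_trans: 
  assumes "close k u v" "close k v w" shows "close k u w"
proof -
  have "vanishes k a (\<lambda>y. (u y - v y) + (v y - w y))"
    using assms by (intro vanishes_add[OF S a] smooth_on_diff[OF S]) (simp_all add: close_def)
  thus ?thesis using assms by (simp add: close_def)
qed

lemma close_sym: "close k u v \<Longrightarrow> close k v u"
  using vanishes_linear[OF S a bounded_linear_minus[OF bounded_linear_ident], of "\<lambda>y. u y - v y" k]
  by (simp add: close_def smooth_on_diff[OF S])

lemma close_sum: "(\<And>i. i \<in> A \<Longrightarrow> close k (u i) (v i)) \<Longrightarrow> close k (\<lambda>y. \<Sum>i\<in>A. u i y) (\<lambda>y. \<Sum>i\<in>A. v i y)"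
  by (induction A rule: infinite_finite_induct) (simp_all add: close_refl smooth_on_const close_add)

lemma close_bilinear:
  assumes B: "bounded_bilinear B" and u: "close k u u'" and v: "close k v v'"
  shows "close k (\<lambda>y. B (u y) (v y)) (\<lambda>y. B (u' y) (v' y))"
proof -
  have s: "smooth_on S u" "smooth_on S u'" "smooth_on S v" "smooth_on S v'" using u v by (simp_all add: close_def)
  have "vanishes k a (\<lambda>y. B (u y - u' y) (v y))"
    using vanishes_bilinear[OF S a B, of "\<lambda>y. u y - u' y" v k 0] u s by (simp add: close_def smooth_on_diff[OF S])
  moreover have "vanishes k a (\<lambda>y. B (u' y) (v y - v' y))"
    using vanishes_bilinear[OF S a B, of u' "\<lambda>y. v y - v' y" 0 k] v s by (simp add: close_def smooth_on_diff[OF S])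
  ultimately have "vanishes k a (\<lambda>y. B (u y - u' y) (v y) + B (u' y) (v y - v' y))"
    using s by (intro vanishes_add[OF S a] smooth_on_bilinear[OF S B] smooth_on_diff[OF S])
  moreover have "(\<lambda>y. B (u y - u' y) (v y) + B (u' y) (v y - v' y)) = (\<lambda>y. B (u y) (v y) - B (u' y) (v' y))"
    by (simp add: bounded_bilinear.diff_left[OF B] bounded_bilinear.diff_right[OF B])
  ultimately show ?thesis using s by (simp add: close_def smooth_on_bilinear[OF S B])
qed

lemmas close_mult = close_bilinear[OF bounded_bilinear_mult]
lemmas close_scaleR = close_bilinear[OF bounded_bilinear_scaleR]
lemmas close_matmul = close_bilinear[OF bounded_bilinear_matrix_mult]

lemma close_nth: "close k u v \<Longrightarrow> close k (\<lambda>y. u y $ i) (\<lambda>y. v y $ i)"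
  by (rule close_linear[OF bounded_linear_vec_nth])

lemma close_vec: 
  fixes u :: "'k::finite \<Rightarrow> real^'n \<Rightarrow> 'v::real_normed_vector"
  shows "(\<And>i. close k (u i) (v i)) \<Longrightarrow> close k (\<lambda>y. \<chi> i. u i y) (\<lambda>y. \<chi> i. v i y)"
  unfolding vec_lambda_sum by (intro close_sum close_linear[OF bounded_linear_axis])

lemma close_pd: "close (Suc k) u v \<Longrightarrow> close k (pd i u) (pd i v)"
proof -
  assume uv: "close (Suc k) u v"
  hence s: "smooth_on S u" "smooth_on S v" by (simp_all add: close_def)
  have "vanishes k a (pd i (\<lambda>y. u y - v y))" using uv by (simp add: close_def vanishes_pd)
  hence "vanishes k a (\<lambda>y. pd i u y - pd i v y)"
    by (rule vanishes_cong[OF S a, rotated]) (simp add: pd_diff smooth_onD[OF s(1)] smooth_onD[OF s(2)])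
  thus ?thesis using s by (simp add: close_def smooth_on_pd)
qed

lemma close_0_iff: "close k u (\<lambda>y. 0) \<longleftrightarrow> smooth_on S u \<and> vanishes k a u"
  by (simp add: close_def smooth_on_const)

lemma close_cong: "(\<And>y. y \<in> S \<Longrightarrow> u y = u' y) \<Longrightarrow> (\<And>y. y \<in> S \<Longrightarrow> v y = v' y) \<Longrightarrow> close k u' v' \<Longrightarrow> close k u v"
  using smooth_on_cong[OF S] vanishes_cong[OF S a, of "\<lambda>y. u y - v y" "\<lambda>y. u' y - v' y"]
  unfolding close_def by auto

text \<open>The error is a product of \<open>u y - u a\<close>, of order 1, with \<open>v\<close>,
  of order \<open>k\<close>.\<close>

lemma close_freeze:
  assumes B: "bounded_bilinear B" and u: "smooth_on S u" and v: "smooth_on S v" "vanishes k a v"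
  shows "close (Suc k) (\<lambda>y. B (u y) (v y)) (\<lambda>y. B (u a) (v y))"
proof -
  have s: "smooth_on S (\<lambda>y. u y - u a)" by (intro smooth_on_diff[OF S] u smooth_on_const)
  have "vanishes 1 a (\<lambda>y. u y - u a)" by (simp add: vanishes_Suc)
  from vanishes_bilinear[OF S a B s v(1) this v(2)]
  have "vanishes (Suc k) a (\<lambda>y. B (u y) (v y) - B (u a) (v y))"
    by (simp add: bounded_bilinear.diff_left[OF B])
  thus ?thesis by (simp add: close_def smooth_on_bilinear[OF S B] u v smooth_on_const)
qed

text \<open>The common pattern of the linearisation: the change of the coefficient \<open>u\<close>
  is negligible, and in front of the change of \<open>v\<close> the coefficient can be frozen at
  \<open>a\<close>.\<close>

lemma close_freeze_diff:
  assumes B: "bounded_bilinear B" and u: "close (Suc k) u u'" and v: "smooth_on S v" "smooth_on S v'" "close (Suc k) (\<lambda>y. v y - v' y) w" 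
    and w: "vanishes k a w"
  shows "close (Suc k) (\<lambda>y. B (u y) (v y) - B (u' y) (v' y)) (\<lambda>y. B (u' a) (w y))"
proof -
  have s: "smooth_on S u" "smooth_on S u'" "smooth_on S w" using u v by (simp_all add: close_def)
  have d: "smooth_on S (\<lambda>y. v y - v' y)" by (intro smooth_on_diff[OF S] v)
  have "close (Suc k) (\<lambda>y. B (u y) (v y) - B (u' y) (v y)) (\<lambda>y. 0)"
    using close_diff[OF close_bilinear[OF B u close_refl[OF v(1)]] close_refl[OF smooth_on_bilinear[OF S B s(2) v(1)]]] by simp
  moreover have "close (Suc k) (\<lambda>y. B (u' y) (v y - v' y)) (\<lambda>y. B (u' y) (w y))"
    by (rule close_bilinear[OF B close_refl[OF s(2)] v(3)])
  ultimately have "close (Suc k) (\<lambda>y. (B (u y) (v y) - B (u' y) (v y)) + B (u' y) (v y - v' y)) (\<lambda>y. 0 + B (u' y) (w y))"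
    by (rule close_add)
  moreover have "close (Suc k) (\<lambda>y. B (u' y) (w y)) (\<lambda>y. B (u' a) (w y))"
    by (rule close_freeze[OF B s(2) s(3) w])
  ultimately show ?thesis
    using close_trans by (simp add: bounded_bilinear.diff_right[OF B]) blast
qed

end

text \<open>Two sections whose jets of order k + 1 agree at \<open>a\<close>. Second derivatives of
  their difference vanish to order \<open>k\<close>, and the equations are compared to one order
  more.\<close>

locale em_pair = base_point S a + f1: em_field S g1 A1 + f2: em_field S g2 A2
  for S :: "(real^'n::finite) set" and a g1 A1 g2 A2 +
  fixes k
  assumes g12: "vanishes (Suc (Suc k)) a (\<lambda>y. g1 y - g2 y)"
    and A12: "vanishes (Suc (Suc k)) a (\<lambda>y. A1 y - A2 y)"
begin

definition h where "h y = g1 y - g2 y"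
definition \<alpha> where "\<alpha> y = A1 y - A2 y"

lemma smooth_h: "smooth_on S h" and smooth_\<alpha>: "smooth_on S \<alpha>"
  unfolding h_def[abs_def] \<alpha>_def[abs_def] by (intro smooth_on_diff[OF S] f1.g f2.g f1.A f2.A)+

lemma close_g: "close (Suc (Suc k)) g1 g2" and close_A: "close (Suc (Suc k)) A1 A2"
  using g12 A12 by (simp_all add: close_def f1.g f2.g f1.A f2.A)

text \<open>The metrics are inserted between the two inverses, so that the difference of the
  inverses becomes a multiple of the difference of the metrics.\<close>

lemma close_\<gamma>: "close (Suc (Suc k)) f1.\<gamma> f2.\<gamma>"
proof -
  have "close (Suc (Suc k)) (\<lambda>y. f1.\<gamma> y ** g2 y ** f2.\<gamma> y) (\<lambda>y. f1.\<gamma> y ** g1 y ** f2.\<gamma> y)"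
    by (intro close_matmul close_refl f1.smooth_\<gamma> f2.smooth_\<gamma> close_sym[OF close_g])
  thus ?thesis
    by (rule close_cong[rotated 2]) (simp_all add: f1.inv1 f2.inv2 flip: matrix_mul_assoc)
qed

lemma close_F: "close (Suc k) f1.F f2.F"
  unfolding f1.F_def[abs_def] f2.F_def[abs_def] by (intro close_vec close_diff close_nth close_pd close_A)

lemma close_chr: "close (Suc k) (f1.chr i) (f2.chr i)"
  unfolding f1.chr_def[abs_def] f2.chr_def[abs_def] divide_inverse
  by (intro close_vec close_mult close_add close_diff close_nth close_pd close_g close_refl smooth_on_const)

lemma close_\<Gamma>: "close (Suc k) (f1.\<Gamma> i) (f2.\<Gamma> i)"
  by (rule close_cong[OF f1.\<Gamma>_eq f2.\<Gamma>_eq]) (auto intro!: close_matmul close_chr close_mono[OF close_\<gamma>])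

lemma close_X: "close (Suc k) f1.X f2.X"
  unfolding f1.X_def[abs_def] f2.X_def[abs_def] by (intro close_matmul close_F close_mono[OF close_\<gamma>]) simp

text \<open>The stress tensor contains only first derivatives of the potential, so it does not
  contribute to the linearisation at this order.\<close>

lemma close_T: "close (Suc k) f1.T f2.T"
  unfolding f1.T_def[abs_def] f2.T_def[abs_def] divide_inverse
  by (intro close_diff close_scaleR close_mult close_refl smooth_on_const close_linear[OF bounded_linear_trace]
      close_matmul close_F close_X close_mono[OF close_g]) simp

definition chr_h where "chr_h i y = (\<chi> p l. (pd i h y $ l $ p + pd l h y $ i $ p - pd p h y $ i $ l) / 2)"

lemma smooth_chr_h: "smooth_on S (chr_h i)"
  unfolding chr_h_def[abs_def] divide_inverse
  by (intro smooth_on_vec smooth_on_mult smooth_on_add smooth_on_diff smooth_on_nth smooth_on_pd smooth_on_const smooth_h S)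

lemma pd_h: "y \<in> S \<Longrightarrow> pd i h y = pd i g1 y - pd i g2 y"
  unfolding h_def[abs_def] by (rule pd_diff[OF f1.diff_g f2.diff_g])

lemma chr_h_eq: "y \<in> S \<Longrightarrow> f1.chr i y - f2.chr i y = chr_h i y"
  by (simp add: vec_eq_iff chr_h_def f1.chr_def f2.chr_def pd_h) (simp add: field_simps)

lemma close_chr_h: "close (Suc (Suc k)) (\<lambda>y. f1.chr i y - f2.chr i y) (chr_h i)"
  by (rule close_cong[OF chr_h_eq _ close_refl[OF smooth_chr_h]]) simp_all

lemma vanishes_chr_h: "vanishes (Suc k) a (chr_h i)"
proof (rule vanishes_cong[OF S a])
  show "chr_h i y = f1.chr i y - f2.chr i y" if "y \<in> S" for y using chr_h_eq[OF that] by simp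
qed (use close_chr in \<open>simp add: close_def\<close>)

lemma smooth_chr: "smooth_on S (f1.chr i)" "smooth_on S (f2.chr i)"
  using close_chr by (simp_all add: close_def)

lemma close_\<Gamma>_diff: "close (Suc (Suc k)) (\<lambda>y. f1.\<Gamma> i y - f2.\<Gamma> i y) (\<lambda>y. f2.\<gamma> a ** chr_h i y)"
  by (rule close_cong[OF _ _ close_freeze_diff[OF bounded_bilinear_matrix_mult close_\<gamma> smooth_chr close_chr_h vanishes_chr_h]])
    (simp_all add: f1.\<Gamma>_eq f2.\<Gamma>_eq)

lemma close_pd_\<Gamma>: "close (Suc k) (\<lambda>y. pd j (f1.\<Gamma> i) y - pd j (f2.\<Gamma> i) y) (\<lambda>y. f2.\<gamma> a ** pd j (chr_h i) y)"
proof (rule close_cong[OF _ _ close_pd[OF close_\<Gamma>_diff]])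
  fix y assume y: "y \<in> S"
  show "pd j (f1.\<Gamma> i) y - pd j (f2.\<Gamma> i) y = pd j (\<lambda>y. f1.\<Gamma> i y - f2.\<Gamma> i y) y"
    by (rule pd_diff[OF f1.diff_\<Gamma>[OF y] f2.diff_\<Gamma>[OF y], symmetric])
  show "f2.\<gamma> a ** pd j (chr_h i) y = pd j (\<lambda>y. f2.\<gamma> a ** chr_h i y) y"
    using pd_linear[OF bounded_bilinear.bounded_linear_right[OF bounded_bilinear_matrix_mult] smooth_onD[OF smooth_chr_h y]]
    by metis
qed

definition Lric where "Lric y = lin_ricci (f2.\<gamma> a) (\<lambda>i j. pd i (pd j h) y)"

lemma h_sym: "y \<in> S \<Longrightarrow> transpose (h y) = h y"
  by (simp add: h_def transpose_simps f1.sym f2.sym)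

text \<open>The products of connections agree to the order considered; the derivatives contribute
  their linear part with \<gamma> frozen at \<open>a\<close>.\<close>

lemma close_Ric: "close (Suc k) (\<lambda>y. f1.Ric y - f2.Ric y) Lric"
proof -
  have pc: "pd m (chr_h i) y $ p $ l = (pd m (pd i h) y $ l $ p + pd m (pd l h) y $ i $ p - pd m (pd p h) y $ i $ l) / 2"
    if y: "y \<in> S" for m i p l y
  proof -
    have d: "(\<lambda>y. pd i h y $ l $ p) differentiable (at y)" for i l p
      by (rule smooth_onD[OF smooth_on_nth[OF S smooth_on_nth[OF S smooth_on_pd[OF smooth_h]]] y])
    have "pd m (chr_h i) y $ p $ l = pd m (\<lambda>y. (pd i h y $ l $ p + pd l h y $ i $ p - pd p h y $ i $ l) / 2) y"
      unfolding f1.pd_entry[OF smooth_chr_h y, symmetric] by (simp add: chr_h_def)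
    also have "\<dots> = pd m (\<lambda>y. pd i h y $ l $ p + pd l h y $ i $ p - pd p h y $ i $ l) y / 2"
      by (rule pd_linear[OF bounded_linear_divide]) (intro differentiable_diff differentiable_add d)
    also have "pd m (\<lambda>y. pd i h y $ l $ p + pd l h y $ i $ p - pd p h y $ i $ l) y
      = pd m (pd i h) y $ l $ p + pd m (pd l h) y $ i $ p - pd m (pd p h) y $ i $ l"
      by (simp add: pd_diff pd_add d differentiable_add f1.pd_entry[OF smooth_on_pd[OF smooth_h] y])
    finally show ?thesis .
  qed
  have hs: "pd m (pd i h) y $ l $ p = pd m (pd i h) y $ p $ l" if y: "y \<in> S" for m i p l y
  proof -
    have "transpose (pd i h z) = pd i h z" if "z \<in> S" for z by (rule f1.pd_sym[OF smooth_h that h_sym])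
    from arg_cong[OF f1.pd_sym[OF smooth_on_pd[OF smooth_h] y this, of m], of "\<lambda>M. M $ p $ l"] show ?thesis by simp
  qed
  \<comment> \<open>The term differentiated in directions \<open>k\<close> and \<open>j\<close>
    occurs in both connection derivatives and cancels; the other four are those of
    \<open>lin_ricci\<close>.\<close>
  have lead: "(\<chi> l j. \<Sum>k\<in>UNIV. (f2.\<gamma> a ** pd k (chr_h j) y - f2.\<gamma> a ** pd j (chr_h k) y) $ k $ l) = Lric y" if y: "y \<in> S" for y
  proof -
    have "(\<Sum>k\<in>UNIV. (f2.\<gamma> a ** pd k (chr_h j) y - f2.\<gamma> a ** pd j (chr_h k) y) $ k $ l)
      = (\<Sum>k\<in>UNIV. \<Sum>p\<in>UNIV. f2.\<gamma> a $ k $ p * (pd k (pd l h) y $ j $ p - pd k (pd p h) y $ l $ j - pd j (pd l h) y $ k $ p + pd j (pd p h) y $ l $ k)) / 2" for l j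
      unfolding vector_minus_component matrix_mult_nth pc[OF y] sum_subtractf[symmetric] right_diff_distrib[symmetric] sum_divide_distrib
      using hs[OF y] pd_commute[OF S smooth_h y, of _ j]
      by (intro sum.cong refl) (simp add: field_simps)
    thus ?thesis unfolding Lric_def lin_ricci_def by (simp add: vec_eq_iff)
  qed
  let ?L = "\<lambda>y. \<chi> l j. \<Sum>k\<in>UNIV. (f2.\<gamma> a ** pd k (chr_h j) y - f2.\<gamma> a ** pd j (chr_h k) y) $ k $ l"
  let ?P = "\<lambda>y. \<chi> l j. \<Sum>k\<in>UNIV. ((pd k (f1.\<Gamma> j) y - pd k (f2.\<Gamma> j) y) - (pd j (f1.\<Gamma> k) y - pd j (f2.\<Gamma> k) y)) $ k $ l"
  let ?Q1 = "\<lambda>y. \<chi> l j. \<Sum>k\<in>UNIV. (f1.\<Gamma> k y ** f1.\<Gamma> j y - f1.\<Gamma> j y ** f1.\<Gamma> k y) $ k $ l"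
  let ?Q2 = "\<lambda>y. \<chi> l j. \<Sum>k\<in>UNIV. (f2.\<Gamma> k y ** f2.\<Gamma> j y - f2.\<Gamma> j y ** f2.\<Gamma> k y) $ k $ l"
  have "close (Suc k) ?P ?L"
    by (intro close_vec close_sum close_nth close_diff close_pd_\<Gamma>)
  moreover have Q: "close (Suc k) ?Q1 ?Q2"
    by (intro close_vec close_sum close_nth close_diff close_matmul close_\<Gamma>)
  hence "smooth_on S ?Q2" by (simp add: close_def)
  note close_diff[OF Q close_refl[OF this]]
  ultimately have "close (Suc k) (\<lambda>y. ?P y + (?Q1 y - ?Q2 y)) (\<lambda>y. ?L y + (?Q2 y - ?Q2 y))"
    by (rule close_add)
  thus ?thesis
  proof (rule close_cong[rotated 2])
    show "f1.Ric y - f2.Ric y = ?P y + (?Q1 y - ?Q2 y)" if "y \<in> S" for y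
      unfolding f1.Ric_split f2.Ric_split by (simp add: vec_eq_iff sum_subtractf sum.distrib)
    show "Lric y = ?L y + (?Q2 y - ?Q2 y)" if "y \<in> S" for y
      using lead[OF that] by simp
  qed
qed

lemma smooth_Lric: "smooth_on S Lric"
  using close_Ric by (simp add: close_def)

lemma vanishes_Lric: "vanishes k a Lric"
proof -
  define q where "q y = (\<chi> i j. pd i (pd j h) y)" for y
  have e: "Lric = (\<lambda>y. lin_ricci (f2.\<gamma> a) (\<lambda>i j. q y $ i $ j))" by (simp add: Lric_def[abs_def] q_def)
  have "close k (pd i (pd j h)) (\<lambda>y. 0)" for i j
    using vanishes_pd[OF vanishes_pd, of k a h i j] g12 by (simp add: close_0_iff smooth_on_pd[OF smooth_on_pd[OF smooth_h]] flip: h_def)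
  hence "close k q (\<lambda>y. \<chi> i j. 0)" unfolding q_def by (intro close_vec)
  hence "smooth_on S q" "vanishes k a (\<lambda>y. q y - (\<chi> i j. 0))" by (simp_all add: close_def)
  moreover have "(\<lambda>y. q y - (\<chi> i j. 0)) = q" by (simp add: fun_eq_iff vec_eq_iff)
  ultimately show ?thesis unfolding e using vanishes_linear[OF S a bounded_linear_lin_ricci] by metis
qed

lemma close_Ric12: "smooth_on S f1.Ric" "smooth_on S f2.Ric"
  by (rule f1.smooth_Ric f2.smooth_Ric)+

lemma close_scalar: "close (Suc k) (\<lambda>y. trace (f1.\<gamma> y ** f1.Ric y) - trace (f2.\<gamma> y ** f2.Ric y)) (\<lambda>y. trace (f2.\<gamma> a ** Lric y))"
proof -
  have "close (Suc k) (\<lambda>y. f1.\<gamma> y ** f1.Ric y - f2.\<gamma> y ** f2.Ric y) (\<lambda>y. f2.\<gamma> a ** Lric y)"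
    by (rule close_freeze_diff[OF bounded_bilinear_matrix_mult close_mono[OF close_\<gamma>] close_Ric12 close_Ric vanishes_Lric]) simp
  from close_linear[OF bounded_linear_trace this] show ?thesis by (simp add: trace_simps)
qed

lemma close_Ein: "close (Suc k) (\<lambda>y. f1.Ein y - f2.Ein y) (\<lambda>y. Lric y - (trace (f2.\<gamma> a ** Lric y) / 2) *\<^sub>R g2 a)"
proof -
  have B: "bounded_bilinear (\<lambda>(M :: real^'n^'n) c. c *\<^sub>R M)"
    using bounded_bilinear.flip[OF bounded_bilinear_scaleR] .
  have "smooth_on S (\<lambda>y. f2.\<gamma> a ** Lric y)"
    by (intro smooth_on_matrix_mult S smooth_on_const smooth_Lric)
  note sm = this
  have "vanishes k a (\<lambda>y. f2.\<gamma> a ** Lric y)"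
    using vanishes_bilinear[OF S a bounded_bilinear_matrix_mult smooth_on_const smooth_Lric, where k = 0 and l = k] vanishes_Lric by simp
  hence v: "vanishes k a (\<lambda>y. trace (f2.\<gamma> a ** Lric y))"
    by (rule vanishes_linear[OF S a bounded_linear_trace sm])
  have "close (Suc k) (\<lambda>y. trace (f1.\<gamma> y ** f1.Ric y) *\<^sub>R g1 y - trace (f2.\<gamma> y ** f2.Ric y) *\<^sub>R g2 y) (\<lambda>y. trace (f2.\<gamma> a ** Lric y) *\<^sub>R g2 a)"
    by (rule close_freeze_diff[OF B close_mono[OF close_g] f1.smooth_scalar f2.smooth_scalar close_scalar v]) simp
  from close_linear[OF bounded_linear_scaleR_right[of "1/2"] this]
  have "close (Suc k) (\<lambda>y. (trace (f1.\<gamma> y ** f1.Ric y) / 2) *\<^sub>R g1 y - (trace (f2.\<gamma> y ** f2.Ric y) / 2) *\<^sub>R g2 y) (\<lambda>y. (trace (f2.\<gamma> a ** Lric y) / 2) *\<^sub>R g2 a)"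
    by (simp add: scaleR_diff_right)
  from close_diff[OF close_Ric this] show ?thesis
    by (simp add: f1.Ein_def[abs_def] f2.Ein_def[abs_def] algebra_simps)
qed

definition Fd where "Fd y = f1.F y - f2.F y"

lemma smooth_Fd: "smooth_on S Fd" 
  unfolding Fd_def[abs_def] by (intro smooth_on_diff S f1.smooth_F f2.smooth_F)

lemma vanishes_Fd: "vanishes (Suc k) a Fd"
  using close_F by (simp add: close_def Fd_def[abs_def])

text \<open>The connection terms contain only first derivatives of metric and potential and hence
  agree to this order.\<close>

lemma close_covF: "close (Suc k) (\<lambda>y. f1.cov i f1.F y - f2.cov i f2.F y) (pd i Fd)"
proof -
  let ?N1 = "\<lambda>y. transpose (f1.\<Gamma> i y) ** f1.F y + f1.F y ** f1.\<Gamma> i y" and ?N2 = "\<lambda>y. transpose (f2.\<Gamma> i y) ** f2.F y + f2.F y ** f2.\<Gamma> i y"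
  have N: "close (Suc k) ?N1 ?N2"
    by (intro close_add close_matmul close_linear[OF bounded_linear_transpose] close_F close_\<Gamma>)
  hence "smooth_on S ?N2" by (simp add: close_def)
  from close_diff[OF close_refl[OF smooth_on_pd[OF smooth_Fd]] close_diff[OF N close_refl[OF this]]]
  show ?thesis
  proof (rule close_cong[rotated 2])
    fix y assume y: "y \<in> S"
    have "pd i Fd y = pd i f1.F y - pd i f2.F y"
      unfolding Fd_def[abs_def] by (rule pd_diff[OF smooth_onD[OF f1.smooth_F y] smooth_onD[OF f2.smooth_F y]])
    thus "f1.cov i f1.F y - f2.cov i f2.F y = pd i Fd y - (?N1 y - ?N2 y)"
      by (simp add: f1.cov_def f2.cov_def algebra_simps)
  qed simp
qed

lemma close_Y: "close (Suc k) (\<lambda>y. f1.Y y - f2.Y y) (\<lambda>y. \<chi> j. \<Sum>m\<in>UNIV. \<Sum>i\<in>UNIV. f2.\<gamma> a $ m $ i * pd m Fd y $ i $ j)"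
proof -
  have c: "close (Suc k) (\<lambda>y. f1.cov m f1.F y $ i $ j - f2.cov m f2.F y $ i $ j) (\<lambda>y. pd m Fd y $ i $ j)" for m i j
    using close_nth[OF close_nth[OF close_covF]] by (simp add: vector_minus_component)
  have v: "vanishes k a (\<lambda>y. pd m Fd y $ i $ j)" for m i j
  proof -
    have "vanishes k a (\<lambda>y. pd m Fd y $ i)"
      by (rule vanishes_linear[OF S a bounded_linear_vec_nth smooth_on_pd[OF smooth_Fd] vanishes_pd[OF vanishes_Fd]])
    thus ?thesis
      by (rule vanishes_linear[OF S a bounded_linear_vec_nth smooth_on_nth[OF S smooth_on_pd[OF smooth_Fd]]])
  qed
  have s: "smooth_on S (\<lambda>y. f1.cov m f1.F y $ i $ j)" "smooth_on S (\<lambda>y. f2.cov m f2.F y $ i $ j)" for m i j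
    by (intro smooth_on_nth S f1.smooth_cov f2.smooth_cov f1.smooth_F f2.smooth_F)+
  have "close (Suc k) (\<lambda>y. f1.\<gamma> y $ m $ i * f1.cov m f1.F y $ i $ j - f2.\<gamma> y $ m $ i * f2.cov m f2.F y $ i $ j) (\<lambda>y. f2.\<gamma> a $ m $ i * pd m Fd y $ i $ j)" for m i j
    by (rule close_freeze_diff[OF bounded_bilinear_mult close_nth[OF close_nth[OF close_mono[OF close_\<gamma>]]] s c v]) simp
  hence "close (Suc k) (\<lambda>y. \<chi> j. \<Sum>m\<in>UNIV. \<Sum>i\<in>UNIV. f1.\<gamma> y $ m $ i * f1.cov m f1.F y $ i $ j - f2.\<gamma> y $ m $ i * f2.cov m f2.F y $ i $ j)
     (\<lambda>y. \<chi> j. \<Sum>m\<in>UNIV. \<Sum>i\<in>UNIV. f2.\<gamma> a $ m $ i * pd m Fd y $ i $ j)"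
    by (intro close_vec close_sum)
  thus ?thesis
    by (rule close_cong[rotated 2]) (simp_all add: vec_eq_iff f1.Y_def f2.Y_def f1.dvg_def f2.dvg_def sum_subtractf)
qed

lemma pd_Fd: 
  assumes y: "y \<in> S" shows "pd m Fd y $ i $ j = pd m (pd i \<alpha>) y $ j - pd m (pd j \<alpha>) y $ i"
proof -
  have p\<alpha>: "pd i \<alpha> z = pd i A1 z - pd i A2 z" if "z \<in> S" for i z
    unfolding \<alpha>_def[abs_def] by (rule pd_diff[OF smooth_onD[OF f1.A that] smooth_onD[OF f2.A that]])
  have s: "smooth_on S (\<lambda>z. pd i \<alpha> z $ j)" for i j by (intro smooth_on_nth smooth_on_pd S smooth_\<alpha>)
  have "pd m Fd y $ i $ j = pd m (\<lambda>z. pd i \<alpha> z $ j - pd j \<alpha> z $ i) y"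
    unfolding f1.pd_entry[OF smooth_Fd y, symmetric]
    by (rule pd_cong_open[OF S y]) (simp add: Fd_def f1.F_def f2.F_def p\<alpha>)
  also have "\<dots> = pd m (\<lambda>z. pd i \<alpha> z $ j) y - pd m (\<lambda>z. pd j \<alpha> z $ i) y"
    by (rule pd_diff[OF smooth_onD[OF s y] smooth_onD[OF s y]])
  finally show ?thesis by (simp add: pd_nth[OF smooth_onD[OF smooth_on_pd[OF smooth_\<alpha>] y]])
qed

lemma linearization:
  "close (Suc k) (\<lambda>y. (f1.Ein y - f1.T y, f1.Y y) - (f2.Ein y - f2.T y, f2.Y y))
     (\<lambda>y. lin_em (g2 a) (f2.\<gamma> a) (\<lambda>i j. (pd i (pd j h) y, pd i (pd j \<alpha>) y)))"
proof -
  have "close (Suc k) (\<lambda>y. (f1.Ein y - f2.Ein y) - (f1.T y - f2.T y)) (\<lambda>y. (Lric y - (trace (f2.\<gamma> a ** Lric y) / 2) *\<^sub>R g2 a) - (f2.T y - f2.T y))"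
    by (intro close_diff close_Ein close_T close_refl f2.smooth_T)
  from close_linear[OF bounded_linear_Pair[OF bounded_linear_ident bounded_linear_zero] this]
    close_linear[OF bounded_linear_Pair[OF bounded_linear_zero bounded_linear_ident] close_Y]
  have "close (Suc k) (\<lambda>y. ((f1.Ein y - f2.Ein y) - (f1.T y - f2.T y), 0) + (0, f1.Y y - f2.Y y))
     (\<lambda>y. ((Lric y - (trace (f2.\<gamma> a ** Lric y) / 2) *\<^sub>R g2 a) - (f2.T y - f2.T y), 0)
        + (0, \<chi> j. \<Sum>m\<in>UNIV. \<Sum>i\<in>UNIV. f2.\<gamma> a $ m $ i * pd m Fd y $ i $ j))"
    by (rule close_add)
  thus ?thesis
  proof (rule close_cong[rotated 2])
    fix y assume y: "y \<in> S"
    have sym: "f2.\<gamma> a $ i $ j = f2.\<gamma> a $ j $ i" for i j by (rule f2.\<gamma>_nth[OF a])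
    have "trace (f2.\<gamma> a ** M) = (\<Sum>i\<in>UNIV. \<Sum>j\<in>UNIV. f2.\<gamma> a $ i $ j * M $ i $ j)" for M
      unfolding trace_mult by (subst sum.swap) (simp add: sym)
    thus "lin_em (g2 a) (f2.\<gamma> a) (\<lambda>i j. (pd i (pd j h) y, pd i (pd j \<alpha>) y))
      = ((Lric y - (trace (f2.\<gamma> a ** Lric y) / 2) *\<^sub>R g2 a) - (f2.T y - f2.T y), 0)
        + (0, \<chi> j. \<Sum>m\<in>UNIV. \<Sum>i\<in>UNIV. f2.\<gamma> a $ m $ i * pd m Fd y $ i $ j)"
      by (simp add: lin_em_def Let_def Lric_def pd_Fd[OF y])
  qed simp
qed

end

section \<open>Jets of solutions\<close>

lemma has_signature_symmetric: "has_signature G p q \<Longrightarrow> transpose G = G"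
  by (simp add: has_signature_def)

lemma has_signature_det: "has_signature G p q \<Longrightarrow> det G \<noteq> 0"
proof -
  assume "has_signature G p q"
  then obtain P :: "real^'a^'a" and I where
    P: "transpose P ** G ** P = (\<chi> i j. if i = j then (if i \<in> I then 1 else -1) else 0)"
    unfolding has_signature_def by blast
  have "det (transpose P ** G ** P) = (\<Prod>i\<in>UNIV. if i \<in> I then 1 else - 1)"
    unfolding P by (subst det_diagonal) auto
  hence "det (transpose P ** G ** P) \<noteq> 0" by simp
  thus ?thesis by (simp add: det_mul)
qed

lemma has_signature_congruence:
  assumes "has_signature G p q" and Q: "det Q \<noteq> 0"
  shows "has_signature (transpose Q ** G ** Q) p q"
proof -
  obtain P :: "real^'a^'a" and I where
    P: "invertible P" "card I = p" "card (- I) = q" "transpose P ** G ** P = (\<chi> i j. if i = j then (if i \<in> I then 1 else -1) else 0)"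
    using assms(1) unfolding has_signature_def by blast
  let ?P = "matrix_inv Q ** P"
  have QP: "Q ** ?P = P" by (simp add: matrix_mul_assoc matrix_inv_mult[OF Q])
  have "transpose ?P ** (transpose Q ** G ** Q) ** ?P = transpose (Q ** ?P) ** G ** (Q ** ?P)"
    by (simp add: matrix_transpose_mul matrix_mul_assoc)
  hence t: "transpose ?P ** (transpose Q ** G ** Q) ** ?P = transpose P ** G ** P" unfolding QP .
  have "det ?P \<noteq> 0"
  proof -
    have "det (Q ** ?P) \<noteq> 0" unfolding QP using P(1) by (simp add: invertible_det_nz)
    thus ?thesis by (simp only: det_mul) simp
  qed
  hence i: "invertible ?P" by (simp add: invertible_det_nz)
  have s: "transpose (transpose Q ** G ** Q) = transpose Q ** G ** Q"
    using has_signature_symmetric[OF assms(1)] by (simp add: matrix_transpose_mul matrix_mul_assoc)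
  show ?thesis unfolding has_signature_def
    by (intro conjI exI[of _ ?P] exI[of _ I]) (rule s i P(2,3) t[unfolded P(4)])+
qed

definition local_section :: "nat \<Rightarrow> nat \<Rightarrow> (real^'n::finite) set \<Rightarrow> (real^'n \<Rightarrow> 'n fibre) \<Rightarrow> bool"
  where "local_section p q B f \<longleftrightarrow> open B \<and> smooth_on B f \<and> (\<forall>y\<in>B. has_signature (fst (f y)) p q)"

lemma local_section_subset: "local_section p q B f \<Longrightarrow> open B' \<Longrightarrow> B' \<subseteq> B \<Longrightarrow> local_section p q B' f"
  unfolding local_section_def using smooth_on_subset by blast

lemma local_section_em_field: "local_section p q B f \<Longrightarrow> em_field B (\<lambda>y. fst (f y)) (\<lambda>y. snd (f y))"
  unfolding local_section_def
  by unfold_locales (auto simp: smooth_on_fst smooth_on_snd has_signature_symmetric has_signature_det)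

text \<open>The equation with the codifferential replaced by the covariant divergence of F;
  \<open>em_vanishes_iff\<close> justifies the replacement.\<close>

definition em_reduced :: "(real^'n::finite \<Rightarrow> 'n fibre) \<Rightarrow> real^'n \<Rightarrow> 'n fibre"
  where "em_reduced f y =
    (em_field.Ein (\<lambda>y. fst (f y)) y - em_field.T (\<lambda>y. fst (f y)) (\<lambda>y. snd (f y)) y,
     em_field.Y (\<lambda>y. fst (f y)) (\<lambda>y. snd (f y)) y)"

lemma smooth_em_reduced: "local_section p q B f \<Longrightarrow> smooth_on B (em_reduced f)"
proof -
  assume f: "local_section p q B f"
  interpret em_field B "\<lambda>y. fst (f y)" "\<lambda>y. snd (f y)" by (rule local_section_em_field[OF f])
  show ?thesis unfolding em_reduced_def[abs_def]
    by (intro smooth_on_Pair smooth_on_diff S smooth_Ein smooth_T smooth_Y)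
qed

lemma vanishes_Pair_iff:
  assumes "open B" "a \<in> B" "smooth_on B u" "smooth_on B v"
  shows "vanishes k a (\<lambda>y. (u y, v y)) \<longleftrightarrow> vanishes k a u \<and> vanishes k a v"
proof -
  have "pds is (\<lambda>y. (u y, v y)) a = (pds is u a, pds is v a)" for "is"
    using pds_linear[OF assms(1) bounded_linear_fst smooth_on_Pair[OF assms(1,3,4)] assms(2), of "is"]
      pds_linear[OF assms(1) bounded_linear_snd smooth_on_Pair[OF assms(1,3,4)] assms(2), of "is"] by (simp add: prod_eq_iff)
  thus ?thesis by (auto simp: vanishes_def zero_prod_def)
qed

lemma em_vanishes_iff:
  fixes f :: "real^'n::finite \<Rightarrow> 'n fibre"
  assumes f: "local_section p q B f" and a: "a \<in> B" and card: "CARD('n) \<ge> 2"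
  shows "vanishes k a (einstein_maxwell f) \<longleftrightarrow> vanishes k a (em_reduced f)"
proof -
  interpret em_field B "\<lambda>y. fst (f y)" "\<lambda>y. snd (f y)" by (rule local_section_em_field[OF f])
  \<comment> \<open>The factor of \<open>codiff_eq\<close>, smooth and nowhere zero, so that
    multiplying by it or by its inverse preserves orders of vanishing.\<close>
  define K where "K y = (-1) ^ CARD('n) * (vol y * vol y * det (\<gamma> y))" for y
  have sK: "smooth_on B K"
    unfolding K_def[abs_def] by (intro smooth_on_mult smooth_on_const smooth_vol smooth_on_det smooth_\<gamma> S)
  have K0: "K y \<noteq> 0" if "y \<in> B" for y
  proof -
    have "det (\<gamma> y) * det (fst (f y)) = 1" using arg_cong[OF inv1[OF that], of det] by (simp add: det_mul)
    moreover have "vol y \<noteq> 0" using det[OF that] by (simp add: vol_def)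
    ultimately show ?thesis by (auto simp: K_def)
  qed
  have sE: "smooth_on B (\<lambda>y. Ein y - T y)" by (intro smooth_on_diff S smooth_Ein smooth_T)
  have sKY: "smooth_on B (\<lambda>y. K y *\<^sub>R Y y)" by (intro smooth_on_scaleR S sK smooth_Y)
  have "einstein_maxwell f y = (Ein y - T y, K y *\<^sub>R Y y)" if y: "y \<in> B" for y
    unfolding einstein_maxwell_def Let_def o_def energy_momentum_eq[OF y] codiff_eq[OF y card] ricci_eq[OF y] scalar_curv_eq[OF y]
    by (simp add: Ein_def vec_eq_iff K_def)
  hence "vanishes k a (einstein_maxwell f) \<longleftrightarrow> vanishes k a (\<lambda>y. (Ein y - T y, K y *\<^sub>R Y y))"
    using vanishes_cong[OF S a, of "einstein_maxwell f" "\<lambda>y. (Ein y - T y, K y *\<^sub>R Y y)"]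
      vanishes_cong[OF S a, of "\<lambda>y. (Ein y - T y, K y *\<^sub>R Y y)" "einstein_maxwell f"] by auto
  also have "\<dots> \<longleftrightarrow> vanishes k a (\<lambda>y. Ein y - T y) \<and> vanishes k a (\<lambda>y. K y *\<^sub>R Y y)"
    by (rule vanishes_Pair_iff[OF S a sE sKY])
  also have "vanishes k a (\<lambda>y. K y *\<^sub>R Y y) \<longleftrightarrow> vanishes k a Y"
  proof
    assume v: "vanishes k a (\<lambda>y. K y *\<^sub>R Y y)"
    have "vanishes k a (\<lambda>y. inverse (K y) *\<^sub>R (K y *\<^sub>R Y y))"
      using vanishes_bilinear[OF S a bounded_bilinear_scaleR smooth_on_inverse[OF S sK K0] sKY vanishes_0 v] by simp
    thus "vanishes k a Y" by (rule vanishes_cong[OF S a, rotated]) (simp add: K0)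
  next
    assume v: "vanishes k a Y"
    show "vanishes k a (\<lambda>y. K y *\<^sub>R Y y)"
      using vanishes_bilinear[OF S a bounded_bilinear_scaleR sK smooth_Y vanishes_0 v] by simp
  qed
  also have "vanishes k a (\<lambda>y. Ein y - T y) \<and> vanishes k a Y \<longleftrightarrow> vanishes k a (em_reduced f)"
    unfolding em_reduced_def[abs_def] by (rule vanishes_Pair_iff[OF S a sE smooth_Y, symmetric])
  finally show ?thesis .
qed

text \<open>The linearisation has constant coefficients, so the further derivatives
  \<open>is\<close> pass through it and only derivatives of the difference at \<open>a\<close>
  remain.\<close>

lemma em_reduced_difference:
  fixes f1 f2 :: "real^'n::finite \<Rightarrow> 'n fibre"
  assumes f: "local_section p q B f1" "local_section p q B f2" and a: "a \<in> B"
    and v: "vanishes (Suc (Suc k)) a (\<lambda>y. f1 y - f2 y)" and len: "length is \<le> k"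
  shows "pds is (em_reduced f1) a = pds is (em_reduced f2) a
    + lin_em (fst (f2 a)) (matrix_inv (fst (f2 a))) (\<lambda>i j. pds (is @ [i, j]) (\<lambda>y. f1 y - f2 y) a)"
proof -
  have B: "open B" "smooth_on B f1" "smooth_on B f2" using f by (simp_all add: local_section_def)
  have su: "smooth_on B (\<lambda>y. f1 y - f2 y)" by (intro smooth_on_diff B)
  have "vanishes (Suc (Suc k)) a (\<lambda>y. fst (f1 y) - fst (f2 y))" "vanishes (Suc (Suc k)) a (\<lambda>y. snd (f1 y) - snd (f2 y))"
    using vanishes_linear[OF B(1) a bounded_linear_fst su v] vanishes_linear[OF B(1) a bounded_linear_snd su v] by simp_all
  then interpret em_pair B a "\<lambda>y. fst (f1 y)" "\<lambda>y. snd (f1 y)" "\<lambda>y. fst (f2 y)" "\<lambda>y. snd (f2 y)" k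
    using local_section_em_field[OF f(1)] local_section_em_field[OF f(2)] B(1) a
    by (intro em_pair.intro base_point.intro em_pair_axioms.intro)
  let ?lin = "\<lambda>Q. lin_em (fst (f2 a)) (f2.\<gamma> a) Q"
  have Q: "smooth_on B (\<lambda>y. (pd i (pd j h) y, pd i (pd j \<alpha>) y))" for i j
    by (intro smooth_on_Pair smooth_on_pd B smooth_h smooth_\<alpha>)
  have Qe: "(pd i (pd j h) y, pd i (pd j \<alpha>) y) = pd i (pd j (\<lambda>y. f1 y - f2 y)) y" if y: "y \<in> B" for i j y
  proof -
    have "pds [i, j] (\<lambda>y. fst (f1 y - f2 y)) y = fst (pds [i, j] (\<lambda>y. f1 y - f2 y) y)"
      "pds [i, j] (\<lambda>y. snd (f1 y - f2 y)) y = snd (pds [i, j] (\<lambda>y. f1 y - f2 y) y)"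
      by (rule pds_linear[OF B(1) bounded_linear_fst su y], rule pds_linear[OF B(1) bounded_linear_snd su y])
    thus ?thesis by (simp add: prod_eq_iff h_def[abs_def] \<alpha>_def[abs_def])
  qed
  have "vanishes (Suc k) a (\<lambda>y. (em_reduced f1 y - em_reduced f2 y) - ?lin (\<lambda>i j. (pd i (pd j h) y, pd i (pd j \<alpha>) y)))"
    using linearization unfolding close_def em_reduced_def by simp
  hence "pds is (\<lambda>y. (em_reduced f1 y - em_reduced f2 y) - ?lin (\<lambda>i j. (pd i (pd j h) y, pd i (pd j \<alpha>) y))) a = 0"
    using len by (simp add: vanishes_def)
  moreover have "pds is (\<lambda>y. (em_reduced f1 y - em_reduced f2 y) - ?lin (\<lambda>i j. (pd i (pd j h) y, pd i (pd j \<alpha>) y))) a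
     = pds is (em_reduced f1) a - pds is (em_reduced f2) a - ?lin (\<lambda>i j. pds is (\<lambda>y. (pd i (pd j h) y, pd i (pd j \<alpha>) y)) a)"
    using smooth_em_reduced[OF f(1)] smooth_em_reduced[OF f(2)] pds_lin_em[OF B(1) a, of "\<lambda>i j y. (pd i (pd j h) y, pd i (pd j \<alpha>) y)", OF Q]
    by (simp add: pds_diff[OF B(1) _ _ a] smooth_on_diff[OF B(1)])
  moreover have "pds is (\<lambda>y. (pd i (pd j h) y, pd i (pd j \<alpha>) y)) a = pds (is @ [i, j]) (\<lambda>y. f1 y - f2 y) a" for i j
    unfolding pds_append by (rule pds_cong_open[OF B(1) a]) (simp add: Qe)
  ultimately show ?thesis by (simp add: f2.\<gamma>_def algebra_simps)
qed

text \<open>The homogeneous polynomial centred at \<open>a\<close> whose derivatives of order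
  \<open>m\<close> are given by a symmetric \<open>K\<close>; the recursion is Euler's
  relation.\<close>

primrec hpoly :: "nat \<Rightarrow> ('n list \<Rightarrow> 'v::real_vector) \<Rightarrow> real^'n::finite \<Rightarrow> real^'n \<Rightarrow> 'v" where
  "hpoly 0 K a y = K []"
| "hpoly (Suc m) K a y = (1 / real (Suc m)) *\<^sub>R (\<Sum>i\<in>UNIV. (y $ i - a $ i) *\<^sub>R hpoly m (shift i K) a y)"

lemma smooth_hpoly: "smooth_on UNIV (hpoly m K a :: real^'n::finite \<Rightarrow> 'v::real_normed_vector)"
proof (induction m arbitrary: K)
  case 0
  have "hpoly 0 K a = (\<lambda>y. K [])" by (rule ext) simp
  thus ?case by (simp only: smooth_on_const)
next
  case (Suc m)
  have lin: "smooth_on UNIV (\<lambda>y :: real^'n. y)"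
    unfolding smooth_on_iff_diff_on
  proof
    fix n show "diff_on n UNIV (\<lambda>y :: real^'n. y)"
    proof (cases n)
      case (Suc n')
      have "pd i (\<lambda>y :: real^'n. y) = (\<lambda>y. axis i 1)" for i
        by (rule ext) (rule pd_eq[OF has_derivative_ident])
      thus ?thesis
        unfolding Suc diff_on_Suc using smooth_on_const[of "UNIV :: (real^'n) set" "axis i 1 :: real^'n" for i]
        by (simp add: smooth_on_iff_diff_on)
    qed (simp add: diff_on_0)
  qed
  show ?case
    unfolding hpoly.simps(2)[abs_def]
    by (intro smooth_on_scaleR smooth_on_const smooth_on_sum smooth_on_diff smooth_on_nth lin Suc.IH open_UNIV)
qed

lemma pd_hpoly:
  fixes K :: "'n::finite list \<Rightarrow> 'v::real_normed_vector"
  assumes "symf K"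
  shows "pd j (hpoly (Suc m) K a) y = hpoly m (shift j K) a y"
  using assms
proof (induction m arbitrary: K y)
  case 0
  have "pd j (hpoly (Suc 0) K a) y = (\<Sum>i\<in>UNIV. axis j 1 $ i *\<^sub>R K [i])"
  proof (rule pd_eq)
    show "(hpoly (Suc 0) K a has_derivative (\<lambda>v. \<Sum>i\<in>UNIV. v $ i *\<^sub>R K [i])) (at y)"
      unfolding hpoly.simps[abs_def] shift_def
      by (auto intro!: derivative_eq_intros bounded_linear.has_derivative[OF bounded_linear_vec_nth])
  qed
  also have "\<dots> = (\<Sum>i\<in>UNIV. if i = j then K [i] else 0)" by (intro sum.cong) (auto simp: axis_def)
  finally show ?case by (simp add: shift_def del: hpoly.simps(2))
next
  case (Suc m)
  define H where "H i = hpoly (Suc m) (shift i K) a" for i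
  have sH: "H i differentiable (at z)" for i z unfolding H_def by (rule smooth_onD[OF smooth_hpoly UNIV_I])
  have c: "(\<lambda>z. z $ i - a $ i) differentiable (at z)" for i z
    by (intro differentiable_diff differentiable_linear[OF bounded_linear_vec_nth]) simp_all
  have pc: "pd j (\<lambda>z. z $ i - a $ i) y = (if i = j then 1 else 0)" for i
    by (rule trans[OF pd_eq[OF has_derivative_diff[OF bounded_linear.has_derivative[OF bounded_linear_vec_nth has_derivative_ident] has_derivative_const]]])
      (simp add: axis_def)
  have sHc: "(\<lambda>z. (z $ i - a $ i) *\<^sub>R H i z) differentiable (at y)" for i
    by (rule differentiable_bilinear[OF bounded_bilinear_scaleR c sH])
  have pH: "pd j (H i) y = hpoly m (shift i (shift j K)) a y" for i
    unfolding H_def Suc.IH[OF symf_shift[OF Suc.prems]] by (simp add: shift_commute[OF Suc.prems, of j i])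
  have "pd j (hpoly (Suc (Suc m)) K a) y = pd j (\<lambda>z. (1 / real (Suc (Suc m))) *\<^sub>R (\<Sum>i\<in>UNIV. (z $ i - a $ i) *\<^sub>R H i z)) y"
    unfolding H_def hpoly.simps(2)[of "Suc m", abs_def] ..
  also have "\<dots> = (1 / real (Suc (Suc m))) *\<^sub>R pd j (\<lambda>z. \<Sum>i\<in>UNIV. (z $ i - a $ i) *\<^sub>R H i z) y"
    by (rule pd_linear[OF bounded_linear_scaleR_right]) (intro differentiable_sum ballI sHc finite)
  also have "pd j (\<lambda>z. \<Sum>i\<in>UNIV. (z $ i - a $ i) *\<^sub>R H i z) y = (\<Sum>i\<in>UNIV. pd j (\<lambda>z. (z $ i - a $ i) *\<^sub>R H i z) y)"
    by (rule pd_sum[OF sHc])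
  also have "\<dots> = (\<Sum>i\<in>UNIV. (y $ i - a $ i) *\<^sub>R hpoly m (shift i (shift j K)) a y + (if i = j then H j y else 0))"
    by (intro sum.cong refl) (simp add: pd_bilinear[OF bounded_bilinear_scaleR c sH] pH pc)
  also have "\<dots> = (\<Sum>i\<in>UNIV. (y $ i - a $ i) *\<^sub>R hpoly m (shift i (shift j K)) a y) + H j y"
    by (simp add: sum.distrib)
  \<comment> \<open>By the recursion the sum is \<open>Suc m\<close> copies of \<open>H j y\<close>;
    the additional copy makes \<open>Suc (Suc m)\<close>, which cancels the prefactor.\<close>
  also have "(\<Sum>i\<in>UNIV. (y $ i - a $ i) *\<^sub>R hpoly m (shift i (shift j K)) a y) = real (Suc m) *\<^sub>R H j y"
    by (simp add: H_def)
  also have "(1 / real (Suc (Suc m))) *\<^sub>R (real (Suc m) *\<^sub>R H j y + H j y) = H j y"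
  proof -
    have "real (Suc m) *\<^sub>R H j y + H j y = real (Suc (Suc m)) *\<^sub>R H j y"
      using scaleR_add_left[of "real (Suc m)" 1 "H j y"] by (simp add: add.commute)
    thus ?thesis by simp
  qed
  finally show ?case by (simp add: H_def)
qed

lemma pds_hpoly:
  fixes K :: "'n::finite list \<Rightarrow> 'v::real_normed_vector"
  assumes "symf K" "length is \<le> m"
  shows "pds is (hpoly m K a) a = (if length is = m then K is else 0)"
  using assms
proof (induction m arbitrary: K "is")
  case (Suc m)
  show ?case
  proof (cases "is" rule: rev_cases)
    case (snoc ls j)
    have "pd j (hpoly (Suc m) K a) = hpoly m (shift j K) a" by (rule ext) (rule pd_hpoly[OF Suc.prems(1)])
    hence "pds is (hpoly (Suc m) K a) a = (if length ls = m then K (j # ls) else 0)"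
      unfolding snoc pds_snoc using Suc.IH[OF symf_shift[OF Suc.prems(1)], of ls j] Suc.prems(2) snoc
      by (simp add: shift_def)
    moreover have "K (j # ls) = K (ls @ [j])" by (rule symfD[OF Suc.prems(1)]) simp
    ultimately show ?thesis by (simp add: snoc del: hpoly.simps)
  qed simp
qed simp

lemma hpoly_in: "subspace N \<Longrightarrow> (\<And>is. K is \<in> N) \<Longrightarrow> hpoly m K a y \<in> N"
  by (induction m arbitrary: K) (auto intro!: subspace_scale subspace_sum simp: shift_def)

text \<open>The metric is varied by a congruence, so the signature is kept; to leading order this adds
  the given homogeneous polynomial.\<close>

lemma section_variation:
  fixes f :: "real^'n::finite \<Rightarrow> 'n fibre"
  assumes f: "local_section p q B f" and a: "a \<in> B" and K: "K \<in> sym_tensors m fibre_tangent" and m: "m > 0"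
  obtains B' f' where "local_section p q B' f'" "a \<in> B'" "B' \<subseteq> B" "vanishes m a (\<lambda>y. f' y - f y)"
    "\<And>is. length is = m \<Longrightarrow> pds is (\<lambda>y. f' y - f y) a = K is"
proof -
  interpret em_field B "\<lambda>y. fst (f y)" "\<lambda>y. snd (f y)" by (rule local_section_em_field[OF f])
  interpret base_point B a by unfold_locales (rule S, rule a)
  define g where "g y = fst (f y)" for y
  have sg: "smooth_on B g" unfolding g_def by (rule smooth_on_fst[OF S]) (use f in \<open>simp add: local_section_def\<close>)
  define P where "P = hpoly m K a"
  define hk where "hk y = fst (P y)" for y
  \<comment> \<open>The factor 1/2 is there because \<open>X'\<close> enters the congruence twice to
    first order, as \<open>g y ** X' y\<close> and as its transpose.\<close>
  define X' where "X' y = (1/2) *\<^sub>R (\<gamma> a ** hk y)" for y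
  have sP: "smooth_on B P" unfolding P_def by (rule smooth_on_subset[OF smooth_hpoly]) simp
  have shk: "smooth_on B hk" unfolding hk_def by (rule smooth_on_fst[OF S sP])
  have sX: "smooth_on B X'" unfolding X'_def by (intro smooth_on_scaleR smooth_on_matrix_mult smooth_on_const S shk)
  have KN: "K is \<in> fibre_tangent" for "is"
    using K subspace_0[OF subspace_fibre_tangent] unfolding sym_tensors_iff by metis
  have symK: "symf K" using K by (simp add: sym_tensors_iff)
  have hks: "transpose (hk y) = hk y" for y
    using hpoly_in[OF subspace_fibre_tangent, of K m a y] KN by (simp add: hk_def P_def fibre_tangent_iff vec_eq_iff)
  have vP: "vanishes m a P" unfolding vanishes_def P_def using pds_hpoly[OF symK, of _ m a] by simp
  have vhk: "vanishes m a hk" unfolding hk_def by (rule vanishes_linear[OF S a bounded_linear_fst sP vP])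
  have vX: "vanishes m a X'"
    using vanishes_linear[OF S a bounded_linear_compose[OF bounded_linear_scaleR_right bounded_bilinear.bounded_linear_right[OF bounded_bilinear_matrix_mult]] shk vhk, of "1/2" "\<gamma> a"]
    by (simp add: X'_def[abs_def])
  have X0: "X' a = 0" using vX m by (cases m) (auto simp: vanishes_Suc)
  define Q where "Q y = mat 1 + X' y" for y
  have sQ: "smooth_on B Q" unfolding Q_def by (intro smooth_on_add smooth_on_const S sX)
  define f' where "f' y = (transpose (Q y) ** g y ** Q y, snd (f y) + snd (P y))" for y
  \<comment> \<open>The congruence keeps the signature only where \<open>Q\<close> is invertible;
    this holds at \<open>a\<close>, where \<open>X'\<close> vanishes.\<close>
  define B' where "B' = {y \<in> B. det (Q y) \<noteq> 0}"
  have "continuous_on B (\<lambda>y. det (Q y))"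
    using smooth_onD[OF smooth_on_det[OF S sQ]] by (intro continuous_at_imp_continuous_on ballI) (blast intro: differentiable_imp_continuous_within)
  hence "open B'"
    using continuous_open_preimage[OF _ S open_Compl[OF closed_singleton[of 0]], of "\<lambda>y. det (Q y)"] by (simp add: B'_def vimage_def Int_def)
  moreover have sf': "smooth_on B f'"
    unfolding f'_def by (intro smooth_on_Pair smooth_on_matrix_mult smooth_on_add smooth_on_linear[OF S bounded_linear_transpose] S sQ sg A smooth_on_snd sP)
  moreover have "has_signature (fst (f' y)) p q" if "y \<in> B'" for y
    using has_signature_congruence[of "g y" p q "Q y"] f that by (simp add: f'_def B'_def g_def local_section_def)
  ultimately have 1: "local_section p q B' f'"
    unfolding local_section_def using smooth_on_subset[of B f' B'] by (auto simp: B'_def)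
  have 2: "a \<in> B'" using a by (simp add: B'_def Q_def X0)
  have gX: "close (Suc m) (\<lambda>y. g y ** X' y) (\<lambda>y. (1/2) *\<^sub>R hk y)"
  proof (rule close_cong[OF _ _ close_freeze[OF bounded_bilinear_matrix_mult sg sX vX]])
    show "(1/2) *\<^sub>R hk y = g a ** X' y" for y
      by (simp add: X'_def matmul.scaleR_right matrix_mul_assoc g_def inv2[OF a])
  qed simp
  have Xg: "close (Suc m) (\<lambda>y. transpose (X' y) ** g y) (\<lambda>y. (1/2) *\<^sub>R hk y)"
    by (rule close_cong[OF _ _ close_linear[OF bounded_linear_transpose gX]])
      (simp_all add: transpose_simps hks sym g_def)
  have XgX: "close (Suc m) (\<lambda>y. transpose (X' y) ** g y ** X' y) (\<lambda>y. 0)"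
  proof -
    have s: "smooth_on B (\<lambda>y. transpose (X' y))" by (rule smooth_on_linear[OF S bounded_linear_transpose sX])
    \<comment> \<open>The quadratic term has order 2m, which is at least m + 1 since
      \<open>m > 0\<close>.\<close>
    have "vanishes (m + 0 + m) a (\<lambda>y. transpose (X' y) ** g y ** X' y)"
      by (intro vanishes_bilinear[OF S a bounded_bilinear_matrix_mult] vanishes_linear[OF S a bounded_linear_transpose sX vX] vX s sg sX
          smooth_on_matrix_mult[OF S] vanishes_0)
    hence "vanishes (Suc m) a (\<lambda>y. transpose (X' y) ** g y ** X' y)"
      by (rule vanishes_mono) (use m in simp)
    thus ?thesis by (simp add: close_0_iff smooth_on_matrix_mult[OF S] s sg sX)
  qed
  have "close (Suc m) (\<lambda>y. (transpose (X' y) ** g y + g y ** X' y) + transpose (X' y) ** g y ** X' y) (\<lambda>y. ((1/2) *\<^sub>R hk y + (1/2) *\<^sub>R hk y) + 0)"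
    by (intro close_add Xg gX XgX)
  from close_linear[OF bounded_linear_Pair[OF bounded_linear_ident bounded_linear_zero] this]
    close_linear[OF bounded_linear_Pair[OF bounded_linear_zero bounded_linear_ident] close_refl[OF smooth_on_snd[OF S sP]], of "Suc m"]
  have "close (Suc m) (\<lambda>y. ((transpose (X' y) ** g y + g y ** X' y) + transpose (X' y) ** g y ** X' y, 0) + (0, snd (P y)))
     (\<lambda>y. (((1/2) *\<^sub>R hk y + (1/2) *\<^sub>R hk y) + 0, 0) + (0, snd (P y)))"
    by (rule close_add)
  hence c: "close (Suc m) (\<lambda>y. f' y - f y) P"
  proof (rule close_cong[rotated 2])
    show "f' y - f y = ((transpose (X' y) ** g y + g y ** X' y) + transpose (X' y) ** g y ** X' y, 0) + (0, snd (P y))" for y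
      by (simp add: f'_def Q_def g_def prod_eq_iff transpose_simps matmul_simps transpose_mat)
    show "P y = (((1/2) *\<^sub>R hk y + (1/2) *\<^sub>R hk y) + 0, 0) + (0, snd (P y))" for y
      by (simp add: hk_def flip: scaleR_left.add)
  qed
  have e: "pds is (\<lambda>y. f' y - f y) a = pds is P a" if "length is \<le> m" for "is"
  proof -
    have "pds is (\<lambda>y. (f' y - f y) - P y) a = 0" using c that by (simp add: close_def vanishes_def)
    thus ?thesis using c pds_diff[OF S _ _ a, of "\<lambda>y. f' y - f y" P "is"] by (simp add: close_def)
  qed
  show thesis
  proof (rule that[OF 1 2])
    show "B' \<subseteq> B" by (auto simp: B'_def)
    show "vanishes m a (\<lambda>y. f' y - f y)" using e vP by (simp add: vanishes_def)
    show "pds is (\<lambda>y. f' y - f y) a = K is" if "length is = m" for "is"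
      using e[of "is"] that pds_hpoly[OF symK, of "is" m a] by (simp add: P_def)
  qed
qed

text \<open>\<open>EM\<close> without reference to the manifold, in terms of sections over open sets
  of coordinate space. Derivatives of the equation up to order l - 2 must vanish, which is order of
  vanishing \<open>Suc (l - 2)\<close>.\<close>

definition em_jets :: "nat \<Rightarrow> nat \<Rightarrow> nat \<Rightarrow> real^'n::finite \<Rightarrow> ('n, 'n fibre) jet set"
  where "em_jets p q l a =
    {jet l f a | f B. local_section p q B f \<and> a \<in> B \<and> vanishes (Suc (l - 2)) a (em_reduced f)}"

text \<open>Locality of the operator, obtained from \<open>em_reduced_difference\<close> with a
  difference that is zero near the point.\<close>

lemma vanishes_em_reduced_cong:
  fixes f g :: "real^'n::finite \<Rightarrow> 'n fibre"
  assumes f: "local_section p q B f" and g: "local_section p q B g" and a: "a \<in> B"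
    and eq: "\<And>y. y \<in> B \<Longrightarrow> f y = g y"
  shows "vanishes k a (em_reduced f) \<longleftrightarrow> vanishes k a (em_reduced g)"
proof -
  have B: "open B" using f by (simp add: local_section_def)
  have z: "pds is (\<lambda>y. f y - g y) a = 0" for "is"
    using pds_cong_open[OF B a, of "\<lambda>y. f y - g y" "\<lambda>y. 0" "is"] eq by (simp add: pds_zero)
  have "pds is (em_reduced f) a = pds is (em_reduced g) a" for "is"
    using em_reduced_difference[OF f g a, of "length is" "is"] by (simp add: vanishes_def z lin_em_0)
  thus ?thesis by (simp add: vanishes_def)
qed

lemma local_section_cong:
  assumes "local_section p q B g" "\<And>y. y \<in> B \<Longrightarrow> f y = g y"
  shows "local_section p q B f"
  using assms smooth_on_cong[of B f g] by (simp add: local_section_def)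

text \<open>A chart is a homeomorphism onto an open set, so neighbourhoods of \<open>x\<close> and
  of its image correspond, and with them the domains of sections.\<close>

lemma EM_eq_em_jets:
  fixes \<A> :: "('m, 'n::finite) chart set"
  assumes M: "smooth_manifold M \<A>" and c: "(U, \<phi>) \<in> \<A>" and x: "x \<in> U" and card: "CARD('n) \<ge> 2"
  shows "EM M p q (U, \<phi>) l x = em_jets p q l (\<phi> x)"
proof -
  have U: "openin M U" and oU: "open (\<phi> ` U)" and hom: "homeomorphic_map (subtopology M U) (top_of_set (\<phi> ` U)) \<phi>"
    using M c by (auto simp: smooth_manifold_def)
  have top: "topspace (subtopology M U) = U" using openin_subset[OF U] by auto
  have inj: "inj_on \<phi> U" using homeomorphic_imp_injective_map[OF hom] unfolding top .
  let ?i = "inv_into U \<phi>"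
  have img: "open (\<phi> ` W)" if "openin M W" "W \<subseteq> U" for W
  proof -
    have "openin (subtopology M U) W" using that by (simp add: openin_open_subtopology[OF U])
    hence "openin (top_of_set (\<phi> ` U)) (\<phi> ` W)"
      using homeomorphic_imp_open_map[OF hom] by (simp add: open_map_def)
    thus ?thesis by (simp add: openin_open_eq[OF oU])
  qed
  have pre: "openin M {y \<in> U. \<phi> y \<in> B}" if "open B" for B
  proof -
    have "openin (subtopology M U) {y \<in> topspace (subtopology M U). \<phi> y \<in> \<phi> ` U \<inter> B}"
      by (rule openin_continuous_map_preimage[OF homeomorphic_imp_continuous_map[OF hom] openin_open_Int[OF that]])
    moreover have "{y \<in> topspace (subtopology M U). \<phi> y \<in> \<phi> ` U \<inter> B} = {y \<in> U. \<phi> y \<in> B}" using top by auto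
    ultimately show ?thesis by (simp add: openin_open_subtopology[OF U])
  qed
  have jets: "EM M p q (U, \<phi>) l x = {jet l \<sigma> (\<phi> x) | \<sigma>. \<sigma> \<in> metric_potential_sections M p q (U, \<phi>) x
      \<and> vanishes (Suc (l - 2)) (\<phi> x) (einstein_maxwell \<sigma>)}"
    by (simp add: EM_def equation_jets_def vanishes_def less_Suc_eq_le)
  show ?thesis unfolding jets
  proof (intro equalityI subsetI)
    fix \<theta> assume "\<theta> \<in> {jet l \<sigma> (\<phi> x) | \<sigma>. \<sigma> \<in> metric_potential_sections M p q (U, \<phi>) x
      \<and> vanishes (Suc (l - 2)) (\<phi> x) (einstein_maxwell \<sigma>)}"
    then obtain s W where \<theta>: "\<theta> = jet l (s \<circ> ?i) (\<phi> x)" and v: "vanishes (Suc (l - 2)) (\<phi> x) (einstein_maxwell (s \<circ> ?i))"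
      and W: "openin M W" "x \<in> W" "W \<subseteq> U" "smooth_on (\<phi> ` W) (s \<circ> ?i)" "\<forall>y\<in>W. has_signature (fst (s y)) p q"
      unfolding metric_potential_sections_def by auto
    have "?i (\<phi> y) = y" if "y \<in> W" for y using inj W(3) that by (simp add: inv_into_f_f subset_iff)
    hence ls: "local_section p q (\<phi> ` W) (s \<circ> ?i)" using img[OF W(1,3)] W(4,5) by (auto simp: local_section_def)
    have "\<phi> x \<in> \<phi> ` W" using W(2) by blast
    thus "\<theta> \<in> em_jets p q l (\<phi> x)"
      using ls v em_vanishes_iff[OF ls _ card] \<theta> unfolding em_jets_def by blast
  next
    fix \<theta> assume "\<theta> \<in> em_jets p q l (\<phi> x)"
    then obtain f B where ls: "local_section p q B f" and a: "\<phi> x \<in> B" and v: "vanishes (Suc (l - 2)) (\<phi> x) (em_reduced f)"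
      and \<theta>: "\<theta> = jet l f (\<phi> x)" unfolding em_jets_def by blast
    have B: "open B" using ls by (simp add: local_section_def)
    define W where "W = {y \<in> U. \<phi> y \<in> B}"
    have W: "openin M W" "x \<in> W" "W \<subseteq> U" "\<phi> ` W = B \<inter> \<phi> ` U" using pre[OF B] x a by (auto simp: W_def)
    \<comment> \<open>Sections have to factor through points of the manifold. The detour agrees with
      \<open>f\<close> only inside the image of the chart, hence the restriction to the image of
      \<open>W\<close>.\<close>
    define \<sigma> where "\<sigma> = (f \<circ> \<phi>) \<circ> ?i"
    have eq: "\<sigma> y = f y" if "y \<in> \<phi> ` W" for y using that W(4) by (auto simp: \<sigma>_def f_inv_into_f)
    have oW: "open (\<phi> ` W)" by (rule img[OF W(1,3)])
    have aW: "\<phi> x \<in> \<phi> ` W" using W(2) by blast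
    have lsW: "local_section p q (\<phi> ` W) f" by (rule local_section_subset[OF ls oW]) (use W(4) in blast)
    have ls\<sigma>: "local_section p q (\<phi> ` W) \<sigma>" by (rule local_section_cong[OF lsW eq])
    have "vanishes (Suc (l - 2)) (\<phi> x) (einstein_maxwell \<sigma>)"
      using v vanishes_em_reduced_cong[OF ls\<sigma> lsW aW eq] em_vanishes_iff[OF ls\<sigma> aW card] by blast
    moreover have "\<theta> = jet l \<sigma> (\<phi> x)"
      using pds_cong_open[OF oW aW eq] unfolding \<theta> jet_def by (intro ext) simp
    moreover have "\<forall>y\<in>W. has_signature (fst (f (\<phi> y))) p q"
      using ls by (auto simp: local_section_def W_def)
    hence "\<sigma> \<in> metric_potential_sections M p q (U, \<phi>) x"
      using W ls\<sigma> lsW unfolding metric_potential_sections_def \<sigma>_def local_section_def by (auto intro!: exI[of _ "f \<circ> \<phi>"] exI[of _ W])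
    ultimately show "\<theta> \<in> {jet l \<sigma> (\<phi> x) | \<sigma>. \<sigma> \<in> metric_potential_sections M p q (U, \<phi>) x
      \<and> vanishes (Suc (l - 2)) (\<phi> x) (einstein_maxwell \<sigma>)}" by blast
  qed
qed

text \<open>Realises a prescribed change \<open>K\<close> of the top-order derivatives by an actual
  section. It is used with \<open>m = 2\<close> for the fibres of the equation and with
  \<open>m = 3\<close> for its prolongation.\<close>

lemma jet_variation:
  fixes f :: "real^'n::finite \<Rightarrow> 'n fibre"
  assumes f: "local_section p q B f" and a: "a \<in> B" and K: "K \<in> sym_tensors m fibre_tangent" and m: "m \<ge> 2"
  obtains B' f' where "local_section p q B' f'" "a \<in> B'" "jet m f' a = jet m f a + K"
    "\<And>is. length is \<le> m - 2 \<Longrightarrow> pds is (em_reduced f') a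
      = pds is (em_reduced f) a + em_symbol_map (fst (f a)) (matrix_inv (fst (f a))) K is"
proof -
  obtain B' f' where f': "local_section p q B' f'" "a \<in> B'" "B' \<subseteq> B" "vanishes m a (\<lambda>y. f' y - f y)"
    "\<And>is. length is = m \<Longrightarrow> pds is (\<lambda>y. f' y - f y) a = K is"
    using section_variation[OF f a K] m by auto
  have B': "open B'" "smooth_on B' f'" using f'(1) by (simp_all add: local_section_def)
  have fB': "local_section p q B' f" by (rule local_section_subset[OF f B'(1) f'(3)])
  hence sf: "smooth_on B' f" by (simp add: local_section_def)
  have K0: "K is = 0" if "length is \<noteq> m" for "is" using K that by (simp add: sym_tensors_iff)
  have symK: "symf K" using K by (simp add: sym_tensors_iff)
  have d: "pds is (\<lambda>y. f' y - f y) a = K is" if "length is \<le> m" for "is"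
    using that f'(4,5) K0[of "is"] by (cases "length is = m") (auto simp: vanishes_def)
  have "pds is f' a = pds is f a + K is" if "length is \<le> m" for "is"
    using d[OF that] pds_diff[OF B' sf f'(2), of "is"] by (simp add: algebra_simps)
  hence 3: "jet m f' a = jet m f a + K" by (auto simp: jet_def fun_eq_iff K0)
  have 4: "pds is (em_reduced f') a
      = pds is (em_reduced f) a + em_symbol_map (fst (f a)) (matrix_inv (fst (f a))) K is" if len: "length is \<le> m - 2" for "is"
  proof -
    have "pds (is @ [i, j]) (\<lambda>y. f' y - f y) a = K (i # j # is)" for i j
    proof -
      have "pds (is @ [i, j]) (\<lambda>y. f' y - f y) a = K (is @ [i, j])" using len m by (intro d) simp
      also have "\<dots> = K (i # j # is)" by (rule symfD[OF symK]) simp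
      finally show ?thesis .
    qed
    moreover have "vanishes (Suc (Suc (m - 2))) a (\<lambda>y. f' y - f y)"
      by (rule vanishes_mono[OF f'(4)]) (use m in simp)
    ultimately show ?thesis
      using em_reduced_difference[OF f'(1) fB' f'(2), of "m - 2" "is"] len by (simp add: em_symbol_map_def)
  qed
  show thesis by (rule that[OF f'(1,2) 3 4])
qed

text \<open>A converse of \<open>jet_variation\<close> in order 2. Symmetry of the difference comes
  from commuting partial derivatives, its values in \<open>fibre_tangent\<close> from
  differentiating the symmetry of the two metrics.\<close>

lemma jet_difference:
  fixes f f' :: "real^'n::finite \<Rightarrow> 'n fibre"
  assumes f: "local_section p q B f" "a \<in> B" and f': "local_section p q B' f'" "a \<in> B'"
    and eq: "jet_proj 1 (jet 2 f' a) = jet_proj 1 (jet 2 f a)"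
  shows "jet 2 f' a - jet 2 f a \<in> sym_tensors 2 fibre_tangent" (is "?v \<in> _")
    and "em_reduced f' a = em_reduced f a + em_symbol_map (fst (f a)) (matrix_inv (fst (f a))) (jet 2 f' a - jet 2 f a) []"
proof -
  let ?S = "B \<inter> B'"
  have S: "open ?S" "a \<in> ?S" using f f' by (auto simp: local_section_def)
  have ls: "local_section p q ?S f" "local_section p q ?S f'"
    using local_section_subset[OF f(1) S(1)] local_section_subset[OF f'(1) S(1)] by auto
  have s: "smooth_on ?S f" "smooth_on ?S f'" using ls by (auto simp: local_section_def)
  let ?d = "\<lambda>y. f' y - f y"
  have sd: "smooth_on ?S ?d" by (rule smooth_on_diff[OF S(1) s(2,1)])
  have v: "?v is = (if length is \<le> 2 then pds is ?d a else 0)" for "is"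
    by (simp add: jet_def pds_diff[OF S(1) s(2,1) S(2)])
  have low: "pds is ?d a = 0" if "length is < 2" for "is"
    using fun_cong[OF eq, of "is"] that v[of "is"] by (simp add: jet_proj_def)
  have "symf ?v"
  proof (rule symf_via_swaps)
    fix us b c vs show "?v (us @ b # c # vs) = ?v (us @ c # b # vs)"
      unfolding v by (simp only: pds_perm[OF S(1) sd S(2), of us b c vs] length_append list.size)
  qed
  moreover have "?v is \<in> fibre_tangent" if "length is = 2" for "is"
  proof -
    have L: "bounded_linear (\<lambda>u :: 'n fibre. transpose (fst u) - fst u)"
      by (intro bounded_linear_sub bounded_linear_compose[OF bounded_linear_transpose] bounded_linear_fst)
    have "transpose (fst (pds is ?d a)) - fst (pds is ?d a) = pds is (\<lambda>y. transpose (fst (?d y)) - fst (?d y)) a"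
      by (rule pds_linear[OF S(1) L sd S(2), symmetric])
    also have "\<dots> = pds is (\<lambda>y. 0) a"
    proof (rule pds_cong_open[OF S])
      fix y assume "y \<in> ?S"
      thus "transpose (fst (?d y)) - fst (?d y) = 0"
        using ls has_signature_symmetric[of "fst (f y)" p q] has_signature_symmetric[of "fst (f' y)" p q]
        by (simp add: local_section_def transpose_simps)
    qed
    finally have "transpose (fst (pds is ?d a)) = fst (pds is ?d a)" by (simp add: pds_zero)
    thus ?thesis using that v[of "is"] by (simp add: fibre_tangent_iff vec_eq_iff)
  qed
  moreover have "?v is = 0" if "length is \<noteq> 2" for "is"
    using low[of "is"] that unfolding v by simp
  ultimately show "?v \<in> sym_tensors 2 fibre_tangent" unfolding sym_tensors_iff by blast
  have van: "vanishes (Suc (Suc 0)) a ?d" using low by (simp add: vanishes_def)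
  have "em_reduced f' a = em_reduced f a + lin_em (fst (f a)) (matrix_inv (fst (f a))) (\<lambda>i j. pds [i, j] ?d a)"
    using em_reduced_difference[OF ls(2,1) S(2) van, of "[]"] by simp
  moreover have "pds [i, j] ?d a = ?v [i, j]" for i j using v[of "[i, j]"] by simp
  ultimately show "em_reduced f' a = em_reduced f a + em_symbol_map (fst (f a)) (matrix_inv (fst (f a))) ?v []"
    by (simp only: em_symbol_map_def)
qed

section \<open>Symbol spaces and prolongation\<close>

lemma vector_derivative_zero:
  assumes "(F has_vector_derivative d) (at 0)" "\<And>t. F t = 0" shows "d = 0"
proof -
  have "F = (\<lambda>t. 0)" using assms(2) by (rule ext)
  hence "(F has_vector_derivative 0) (at 0)" by (simp only: has_vector_derivative_const)
  from vector_derivative_unique_at[OF assms(1) this] show ?thesis .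
qed

lemma has_vector_derivative_vec:
  fixes f :: "'k::finite \<Rightarrow> real \<Rightarrow> 'v::real_normed_vector"
  assumes "\<And>i. (f i has_vector_derivative d i) F"
  shows "((\<lambda>t. \<chi> i. f i t) has_vector_derivative (\<chi> i. d i)) F"
  unfolding vec_lambda_sum
  by (intro has_vector_derivative_sum bounded_linear.has_vector_derivative[OF bounded_linear_axis] assms)

text \<open>Straight lines give one inclusion. Conversely, each defining condition of
  \<open>V\<close> is linear in finitely many jet coordinates, so it passes to the velocity of a
  curve.\<close>

lemma tangent_space_translate:
  fixes G \<gamma> :: "real^'n::finite^'n"
  defines "V \<equiv> {v \<in> sym_tensors 2 fibre_tangent. em_symbol_map G \<gamma> v = 0}"
  shows "tangent_space ((\<lambda>v. \<theta> + v) ` V) \<theta> = V"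
proof (intro equalityI subsetI)
  have sub: "subspace V"
    unfolding V_def using subspace_inter[OF subspace_sym_tensors[OF subspace_fibre_tangent] subspace_ker[OF linear_em_symbol_map]]
    by (simp add: Int_def)
  fix v assume v: "v \<in> V"
  show "v \<in> tangent_space ((\<lambda>v. \<theta> + v) ` V) \<theta>"
    unfolding tangent_space_def
  proof (intro CollectI exI[of _ "\<lambda>t. \<theta> + t *\<^sub>R v"] conjI allI)
    show "\<theta> + t *\<^sub>R v \<in> (\<lambda>v. \<theta> + v) ` V" for t using subspace_scale[OF sub v] by blast
    show "((\<lambda>t. (\<theta> + t *\<^sub>R v) is) has_vector_derivative v is) (at 0)" for "is"
      by (auto simp: scaleR_apply intro!: derivative_eq_intros)
  qed simp
next
  fix v assume "v \<in> tangent_space ((\<lambda>v. \<theta> + v) ` V) \<theta>"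
  then obtain c :: "real \<Rightarrow> ('n, 'n fibre) jet" where c: "\<And>t. c t \<in> (\<lambda>v. \<theta> + v) ` V"
    "\<And>is. ((\<lambda>t. c t is) has_vector_derivative v is) (at 0)" unfolding tangent_space_def by blast
  define w where "w t = c t - \<theta>" for t
  have wV: "w t \<in> V" for t using c(1)[of t] by (auto simp: w_def)
  hence sym: "symf (w t)" and ft: "length is = 2 \<Longrightarrow> w t is \<in> fibre_tangent" and sup: "length is \<noteq> 2 \<Longrightarrow> w t is = 0"
    and em: "em_symbol_map G \<gamma> (w t) = 0" for t "is" by (simp_all add: V_def sym_tensors_iff)
  have dw: "((\<lambda>t. w t is) has_vector_derivative v is) (at 0)" for "is"
    using has_vector_derivative_diff[OF c(2) has_vector_derivative_const, of "is" "\<theta> is"] by (simp add: w_def)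
  have "symf v"
    unfolding symf_def
  proof (intro allI impI)
    fix "is" js :: "'n list" assume m: "mset is = mset js"
    have "w t is - w t js = 0" for t by (simp only: symfD[OF sym m] diff_self)
    from vector_derivative_zero[OF has_vector_derivative_diff[OF dw dw] this] show "v is = v js" by simp
  qed
  moreover have "v is \<in> fibre_tangent" if "length is = 2" for "is"
  proof -
    have L: "bounded_linear (\<lambda>u :: 'n fibre. transpose (fst u) - fst u)"
      by (intro bounded_linear_sub bounded_linear_compose[OF bounded_linear_transpose] bounded_linear_fst)
    have "transpose (fst (w t is)) - fst (w t is) = 0" for t
      using ft[OF that, of t] by (simp add: fibre_tangent_iff vec_eq_iff)
    from vector_derivative_zero[OF bounded_linear.has_vector_derivative[OF L dw] this]
    show ?thesis by (simp add: fibre_tangent_iff vec_eq_iff)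
  qed
  moreover have "v is = 0" if "length is \<noteq> 2" for "is"
    by (rule vector_derivative_zero[OF dw]) (rule sup[OF that])
  moreover have "em_symbol_map G \<gamma> v is = 0" for "is"
  proof -
    have "((\<lambda>t. \<chi> i j. w t (i # j # is)) has_vector_derivative (\<chi> i j. v (i # j # is))) (at 0)"
      by (intro has_vector_derivative_vec dw)
    from vector_derivative_zero[OF bounded_linear.has_vector_derivative[OF bounded_linear_lin_em[of G \<gamma>] this]]
    have "lin_em G \<gamma> (\<lambda>i j. (\<chi> i j. v (i # j # is)) $ i $ j) = 0"
      using fun_cong[OF em, of _ "is"] by (simp add: em_symbol_map_def)
    thus ?thesis by (simp add: em_symbol_map_def)
  qed
  ultimately show "v \<in> V" unfolding V_def sym_tensors_iff by (auto simp: fun_eq_iff)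
qed

locale em_jet_point =
  fixes p q :: nat and a :: "real^'n::finite" and \<theta> :: "('n, 'n fibre) jet"
  assumes \<theta>: "\<theta> \<in> em_jets p q 2 a" and card: "CARD('n) \<ge> 3"
begin

definition G\<^sub>0 where "G\<^sub>0 = fst (\<theta> [])"
definition \<gamma>\<^sub>0 where "\<gamma>\<^sub>0 = matrix_inv G\<^sub>0"

lemma has_section:
  obtains f B where "local_section p q B f" "a \<in> B" "em_reduced f a = 0" "jet 2 f a = \<theta>" "fst (f a) = G\<^sub>0"
proof -
  obtain f B where f: "local_section p q B f" "a \<in> B" "vanishes (Suc 0) a (em_reduced f)" "\<theta> = jet 2 f a"
    using \<theta> unfolding em_jets_def by auto
  have "fst (f a) = G\<^sub>0" unfolding G\<^sub>0_def by (simp add: f(4) jet_def)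
  with f(3) show thesis by (intro that[OF f(1,2) _ f(4)[symmetric]]) (simp_all add: vanishes_Suc)
qed

lemma cometric: "transpose G\<^sub>0 = G\<^sub>0" "transpose \<gamma>\<^sub>0 = \<gamma>\<^sub>0" "\<gamma>\<^sub>0 ** G\<^sub>0 = mat 1"
proof -
  obtain f B where f: "local_section p q B f" "a \<in> B" "fst (f a) = G\<^sub>0" using has_section by blast
  interpret em_field B "\<lambda>y. fst (f y)" "\<lambda>y. snd (f y)" by (rule local_section_em_field[OF f(1)])
  have "\<gamma> a = \<gamma>\<^sub>0" by (simp add: \<gamma>_def \<gamma>\<^sub>0_def f(3))
  thus "transpose G\<^sub>0 = G\<^sub>0" "transpose \<gamma>\<^sub>0 = \<gamma>\<^sub>0" "\<gamma>\<^sub>0 ** G\<^sub>0 = mat 1"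
    using sym[OF f(2)] \<gamma>_sym[OF f(2)] inv1[OF f(2)] f(3) by simp_all
qed

sublocale sc: symbol_complex "fibre_tangent :: 'n fibre set" "fibre_tangent :: 'n fibre set" UNIV
  "em_symbol_map G\<^sub>0 \<gamma>\<^sub>0" "bianchi_symbol_map \<gamma>\<^sub>0"
  by (rule em_symbol_complex; rule cometric card)

lemma symbol_map_support:
  assumes "v \<in> sym_tensors m fibre_tangent" "length is + 2 \<noteq> m" shows "em_symbol_map G\<^sub>0 \<gamma>\<^sub>0 v is = 0"
proof (cases "m < 2")
  case True
  thus ?thesis using sc.low1[OF assms(1)] by simp
next
  case False
  hence "m - 2 + 2 = m" by simp
  with assms(1) have "v \<in> sym_tensors (m - 2 + 2) fibre_tangent" by (simp only:)
  from sc.degree1[OF this] show ?thesis using assms(2) False by (simp add: sym_tensors_iff)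
qed

text \<open>With the 1-jet fixed, the equation is affine in the second derivatives by
  \<open>jet_difference\<close>, and \<open>jet_variation\<close> realises every solution of the
  linear condition.\<close>

lemma jet_fibre: "{\<theta>' \<in> em_jets p q 2 a. jet_proj 1 \<theta>' = jet_proj 1 \<theta>} = (\<lambda>v. \<theta> + v) ` sc.symbol 2"
proof (intro equalityI subsetI)
  obtain f B where f: "local_section p q B f" "a \<in> B" "em_reduced f a = 0" "jet 2 f a = \<theta>" "fst (f a) = G\<^sub>0"
    by (rule has_section)
  fix \<theta>'
  {
    assume "\<theta>' \<in> {\<theta>' \<in> em_jets p q 2 a. jet_proj 1 \<theta>' = jet_proj 1 \<theta>}"
    then obtain f' B' where f': "local_section p q B' f'" "a \<in> B'" "em_reduced f' a = 0" "jet 2 f' a = \<theta>'"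
      and proj: "jet_proj 1 (jet 2 f' a) = jet_proj 1 (jet 2 f a)"
      unfolding em_jets_def by (auto simp: vanishes_Suc f(4))
    note d = jet_difference[OF f(1,2) f'(1,2) proj, unfolded f f'(3,4), folded \<gamma>\<^sub>0_def]
    have "em_symbol_map G\<^sub>0 \<gamma>\<^sub>0 (\<theta>' - \<theta>) is = 0" for "is"
      using d(2) symbol_map_support[OF d(1), of "is"] by (cases "is") simp_all
    hence "\<theta>' - \<theta> \<in> sc.symbol 2" using d(1) by (simp add: sc.symbol_def fun_eq_iff[of "em_symbol_map G\<^sub>0 \<gamma>\<^sub>0 (\<theta>' - \<theta>)"])
    thus "\<theta>' \<in> (\<lambda>v. \<theta> + v) ` sc.symbol 2" by (intro image_eqI[of _ _ "\<theta>' - \<theta>"]) simp_all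
  next
    assume "\<theta>' \<in> (\<lambda>v. \<theta> + v) ` sc.symbol 2"
    then obtain v where v: "v \<in> sym_tensors 2 fibre_tangent" "em_symbol_map G\<^sub>0 \<gamma>\<^sub>0 v = 0" "\<theta>' = \<theta> + v"
      by (auto simp: sc.symbol_def)
    obtain B' f' where f': "local_section p q B' f'" "a \<in> B'" "jet 2 f' a = \<theta> + v"
      and e: "\<And>is. length is \<le> 2 - 2 \<Longrightarrow> pds is (em_reduced f') a = pds is (em_reduced f) a + em_symbol_map G\<^sub>0 \<gamma>\<^sub>0 v is"
      using jet_variation[OF f(1,2) v(1) order_refl, unfolded f(4,5), folded \<gamma>\<^sub>0_def] by blast
    have "vanishes (Suc (2 - 2)) a (em_reduced f')" using e[of "[]"] f(3) v(2) by (simp add: vanishes_Suc)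
    hence "\<theta>' \<in> em_jets p q 2 a" using f'(1,2) f'(3)[symmetric] unfolding em_jets_def v(3) by blast
    moreover have "v is = 0" if "length is \<le> 1" for "is" using v(1) that by (simp add: sym_tensors_iff)
    hence "jet_proj 1 \<theta>' = jet_proj 1 \<theta>" by (simp add: jet_proj_def v(3) fun_eq_iff)
    ultimately show "\<theta>' \<in> {\<theta>' \<in> em_jets p q 2 a. jet_proj 1 \<theta>' = jet_proj 1 \<theta>}" by blast
  }
qed

lemma symbol_space_eq: "symbol_space fibre_tangent 2 (em_jets p q 2 a) \<theta> = sc.symbol"
proof
  fix t :: nat
  have g2: "tangent_space {\<theta>' \<in> em_jets p q 2 a. jet_proj (2 - 1) \<theta>' = jet_proj (2 - 1) \<theta>} \<theta> = sc.symbol 2"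
    using tangent_space_translate[of \<theta> G\<^sub>0 \<gamma>\<^sub>0] jet_fibre by (simp add: sc.symbol_def)
  consider "t < 2" | "t = 2" | "t > 2" by linarith
  thus "symbol_space fibre_tangent 2 (em_jets p q 2 a) \<theta> t = sc.symbol t"
  proof cases
    case 1
    thus ?thesis unfolding symbol_space_def Let_def g2 by (auto simp: sc.symbol_def sc.low1)
  next
    case 2
    thus ?thesis unfolding symbol_space_def Let_def g2 by simp
  next
    case 3
    {
      fix f :: "('n, 'n fibre) jet" assume f: "f \<in> sym_tensors t fibre_tangent"
      let ?w = "\<lambda>js is. if length is = 2 then f (js @ is) else 0"
      have symf: "symf f" using f by (simp add: sym_tensors_iff)
      have ft: "f is \<in> fibre_tangent" for "is"
        using f subspace_0[OF subspace_fibre_tangent] unfolding sym_tensors_iff by metis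
      have w: "?w js \<in> sym_tensors 2 fibre_tangent" for js
      proof -
        have "symf (?w js)"
          unfolding symf_def
        proof (intro allI impI)
          fix "is" is' :: "'n list" assume m: "mset is = mset is'"
          have "f (js @ is) = f (js @ is')" by (rule symfD[OF symf]) (simp add: m)
          thus "?w js is = ?w js is'" using mset_eq_length[OF m] by simp
        qed
        thus ?thesis using ft by (simp add: sym_tensors_iff)
      qed
      \<comment> \<open>Contraction with \<open>js\<close> corresponds to evaluating the symbol map
        at \<open>js\<close>; letting \<open>js\<close> range over all lists of length t - 2
        recovers the kernel in degree \<open>t\<close>.\<close>
      have nil: "em_symbol_map G\<^sub>0 \<gamma>\<^sub>0 (?w js) [] = em_symbol_map G\<^sub>0 \<gamma>\<^sub>0 f js" for js
      proof -
        have "f (js @ [i, j]) = f (i # j # js)" for i j by (rule symfD[OF symf]) simp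
        thus ?thesis by (simp add: em_symbol_map_def)
      qed
      have sup: "em_symbol_map G\<^sub>0 \<gamma>\<^sub>0 (?w js) is = 0" if "is \<noteq> []" for js "is"
        by (rule symbol_map_support[OF w]) (use that in simp)
      have "em_symbol_map G\<^sub>0 \<gamma>\<^sub>0 (?w js) = 0" if "em_symbol_map G\<^sub>0 \<gamma>\<^sub>0 f js = 0" for js
      proof
        show "em_symbol_map G\<^sub>0 \<gamma>\<^sub>0 (?w js) is = 0 is" for "is"
        proof (cases "is = []")
          case True
          show ?thesis unfolding True nil that zero_fun_apply ..
        next
          case False
          show ?thesis unfolding sup[OF False] zero_fun_apply ..
        qed
      qed
      moreover have "em_symbol_map G\<^sub>0 \<gamma>\<^sub>0 f js = 0" if "em_symbol_map G\<^sub>0 \<gamma>\<^sub>0 (?w js) = 0" for js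
        unfolding nil[symmetric] that zero_fun_apply ..
      ultimately have sym: "?w js \<in> sc.symbol 2 \<longleftrightarrow> em_symbol_map G\<^sub>0 \<gamma>\<^sub>0 f js = 0" for js
        using w unfolding sc.symbol_def mem_Collect_eq by iprover
      have "(\<forall>js. length js = t - 2 \<longrightarrow> ?w js \<in> sc.symbol 2) \<longleftrightarrow> em_symbol_map G\<^sub>0 \<gamma>\<^sub>0 f = 0"
        unfolding sym
      proof
        assume *: "\<forall>js. length js = t - 2 \<longrightarrow> em_symbol_map G\<^sub>0 \<gamma>\<^sub>0 f js = 0"
        show "em_symbol_map G\<^sub>0 \<gamma>\<^sub>0 f = 0"
        proof
          fix js
          show "em_symbol_map G\<^sub>0 \<gamma>\<^sub>0 f js = 0 js"
          proof (cases "length js = t - 2")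
            case False
            thus ?thesis using symbol_map_support[OF f, of js] 3 by simp
          qed (use * in simp)
        qed
      qed simp
    }
    note iff = this
    have "{f \<in> sym_tensors t fibre_tangent. \<forall>js. length js = t - 2 \<longrightarrow>
        (\<lambda>is. if length is = 2 then f (js @ is) else 0) \<in> sc.symbol 2} = sc.symbol t"
      unfolding sc.symbol_def[of t] by (rule Collect_cong, rule conj_cong, rule refl, rule iff)
    moreover have "\<not> t < 2" "t \<noteq> 2" using 3 by simp_all
    ultimately show ?thesis unfolding symbol_space_def Let_def g2 by (simp only: if_False simp_thms)
  qed
qed

lemma jet_extends: "\<theta> \<in> jet_proj 2 ` em_jets p q 3 a"
proof -
  obtain f B where f: "local_section p q B f" "a \<in> B" "em_reduced f a = 0" "jet 2 f a = \<theta>" "fst (f a) = G\<^sub>0"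
    by (rule has_section)
  interpret em_field B "\<lambda>y. fst (f y)" "\<lambda>y. snd (f y)" by (rule local_section_em_field[OF f(1)])
  \<comment> \<open>Minus the first derivatives of the equation: the value that the symbol map must
    take on the change of the 3-jet.\<close>
  define z where "z is = (if length is = 1 then - pds is (em_reduced f) a else 0)" for "is"
  have d: "pd k (em_reduced f) a = (pd k (\<lambda>y. Ein y - T y) a, pd k Y a)" for k
  proof -
    have "pds [k] (\<lambda>y. fst (em_reduced f y)) a = fst (pds [k] (em_reduced f) a)"
      "pds [k] (\<lambda>y. snd (em_reduced f y)) a = snd (pds [k] (em_reduced f) a)"
      by (rule pds_linear[OF S bounded_linear_fst smooth_em_reduced[OF f(1)] f(2)],
        rule pds_linear[OF S bounded_linear_snd smooth_em_reduced[OF f(1)] f(2)])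
    thus ?thesis by (simp add: prod_eq_iff em_reduced_def)
  qed
  have "z is \<in> fibre_tangent" if len: "length is = 1" for "is"
  proof -
    obtain k where k: "is = [k]" using len by (auto simp: length_Suc_conv)
    have sE: "smooth_on B (\<lambda>y. Ein y - T y)" by (intro smooth_on_diff S smooth_Ein smooth_T)
    have "transpose (pd k (\<lambda>y. Ein y - T y) a) = pd k (\<lambda>y. transpose (Ein y - T y)) a"
      by (rule pd_linear[OF bounded_linear_transpose smooth_onD[OF sE f(2)], symmetric])
    also have "\<dots> = pd k (\<lambda>y. Ein y - T y) a"
      by (rule pd_cong_open[OF S f(2)]) (simp add: transpose_simps Ein_sym T_sym)
    finally show ?thesis by (simp add: z_def k d fibre_tangent_iff vec_eq_iff)
  qed
  moreover have "symf z"
    unfolding symf_def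
  proof (intro allI impI)
    fix "is" js :: "'n list" assume m: "mset is = mset js"
    show "z is = z js"
    proof (cases "length is = 1")
      case True
      then obtain k where "is = [k]" by (auto simp: length_Suc_conv)
      moreover from this m have "js = [k]" by simp
      ultimately show ?thesis by simp
    next
      case False
      thus ?thesis using mset_eq_length[OF m] by (simp add: z_def)
    qed
  qed
  ultimately have z: "z \<in> sym_tensors 1 fibre_tangent"
    unfolding sym_tensors_iff by (simp add: z_def)
  have "bianchi_symbol_map \<gamma>\<^sub>0 z is = 0" for "is"
  proof (cases "is")
    case Nil
    \<comment> \<open>Since \<open>z\<close> has degree 1, only the empty list matters; there the
      divergence identities apply, because the equation holds at \<open>a\<close>.\<close>
    have E: "Ein a - T a = 0" "Y a = 0" using f(3) by (simp_all add: em_reduced_def prod_eq_iff)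
    have "\<gamma> a = \<gamma>\<^sub>0" by (simp add: \<gamma>_def \<gamma>\<^sub>0_def f(5))
    hence "(\<Sum>i\<in>UNIV. \<Sum>k\<in>UNIV. \<gamma>\<^sub>0 $ i $ k * pd k (\<lambda>y. Ein y - T y) a $ i $ j) = 0"
      "(\<Sum>i\<in>UNIV. \<Sum>k\<in>UNIV. \<gamma>\<^sub>0 $ i $ k * pd k Y a $ i) = 0" for j
      using einstein_divergence[OF f(2) E(2,1)] maxwell_divergence[OF f(2) E(2)] by simp_all
    thus ?thesis by (simp add: Nil bianchi_symbol_map_def lin_bianchi_def z_def d sum_negf zero_prod_def vec_eq_iff)
  next
    case (Cons i ls)
    thus ?thesis by (simp add: bianchi_symbol_map_def z_def lin_bianchi_0)
  qed
  hence "bianchi_symbol_map \<gamma>\<^sub>0 z = 0" by (simp add: fun_eq_iff)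
  from sc.exact[OF z this] obtain K where K: "K \<in> sym_tensors 3 fibre_tangent" "em_symbol_map G\<^sub>0 \<gamma>\<^sub>0 K = z"
    by (auto simp: numeral_3_eq_3)
  have two_le_three: "2 \<le> (3 :: nat)" by simp
  obtain B' f' where f': "local_section p q B' f'" "a \<in> B'" "jet 3 f' a = jet 3 f a + K"
    and e: "\<And>is. length is \<le> 3 - 2 \<Longrightarrow> pds is (em_reduced f') a = pds is (em_reduced f) a + em_symbol_map G\<^sub>0 \<gamma>\<^sub>0 K is"
    using jet_variation[OF f(1,2) K(1) two_le_three, unfolded f(5), folded \<gamma>\<^sub>0_def] by blast
  have "vanishes (Suc (3 - 2)) a (em_reduced f')"
    unfolding vanishes_def
  proof (intro allI impI)
    fix "is" :: "'n list" assume "length is < Suc (3 - 2)"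
    hence "length is \<le> 3 - 2" by simp
    note e[OF this, unfolded K(2) z_def]
    thus "pds is (em_reduced f') a = 0" using f(3) \<open>length is \<le> 3 - 2\<close> by (cases "is") auto
  qed
  hence m: "jet 3 f' a \<in> em_jets p q 3 a" using f'(1,2) unfolding em_jets_def by blast
  have K0: "K is = 0" if "length is \<le> 2" for "is" using K(1) that by (simp add: sym_tensors_iff)
  have e: "jet_proj 2 (jet 3 f' a) = \<theta>"
    unfolding f'(3) f(4)[symmetric] by (rule ext) (simp add: jet_proj_def jet_def K0)
  show ?thesis using imageI[OF m, of "jet_proj 2"] unfolding e .
qed

end

lemma jet_proj_em_jets:
  fixes a :: "real^'n::finite"
  assumes "CARD('n) \<ge> 3"
  shows "jet_proj 2 ` em_jets p q 3 a = em_jets p q 2 a"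
proof (intro equalityI subsetI)
  fix \<theta> :: "('n, 'n fibre) jet" assume "\<theta> \<in> jet_proj 2 ` em_jets p q 3 a"
  then obtain f B where f: "local_section p q B f" "a \<in> B" "vanishes (Suc (3 - 2)) a (em_reduced f)" "\<theta> = jet_proj 2 (jet 3 f a)"
    unfolding em_jets_def by blast
  have "\<theta> = jet 2 f a" unfolding f(4) by (auto simp: jet_proj_def jet_def fun_eq_iff)
  thus "\<theta> \<in> em_jets p q 2 a" unfolding em_jets_def using f(1,2) vanishes_mono[OF f(3), of "Suc (2 - 2)"] by auto
next
  fix \<theta> :: "('n, 'n fibre) jet" assume "\<theta> \<in> em_jets p q 2 a"
  then interpret em_jet_point p q a \<theta> using assms by unfold_locales
  show "\<theta> \<in> jet_proj 2 ` em_jets p q 3 a" by (rule jet_extends)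
qed

theorem theorem3:
  fixes M :: "'m topology" and \<A> :: "('m, 'n::finite) chart set" and p q :: nat
  assumes "smooth_manifold M \<A>"
    and "CARD('n) \<ge> 3"
    and "p + q = CARD('n)"
  shows "(\<forall>c\<in>\<A>. \<forall>x\<in>fst c. \<forall>\<theta>\<in>EM M p q c 2 x.
           (\<forall>i j. \<not> cohomology_zero (EM_symbol M p q c x \<theta>) i j
                    \<longleftrightarrow> (i, j) \<in> {(0, 0), (1, 1), (1, 2)})
         \<and> cohomology_iso (EM_symbol M p q c x \<theta>) 0 0 (fibre_tangent :: 'n fibre set)
         \<and> cohomology_iso (EM_symbol M p q c x \<theta>) 1 1 (fibre_tangent :: 'n fibre set)
         \<and> cohomology_iso (EM_symbol M p q c x \<theta>) 1 2 (UNIV :: ((real^'n) \<times> real) set))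
       \<and> involutive_equation \<A> fibre_tangent 2 (EM M p q)"
proof -
  have EM: "EM M p q c l x = em_jets p q l (snd c x)" if "c \<in> \<A>" "x \<in> fst c" for c l x
  proof -
    have "CARD('n) \<ge> 2" using assms(2) by linarith
    with EM_eq_em_jets[OF assms(1) _ that(2), of "snd c" p q l] that(1) show ?thesis
      by (simp only: prod.collapse)
  qed
  have coh: "(\<forall>i j. \<not> cohomology_zero (EM_symbol M p q c x \<theta>) i j \<longleftrightarrow> (i, j) \<in> {(0, 0), (1, 1), (1, 2)})
         \<and> cohomology_iso (EM_symbol M p q c x \<theta>) 0 0 (fibre_tangent :: 'n fibre set)
         \<and> cohomology_iso (EM_symbol M p q c x \<theta>) 1 1 (fibre_tangent :: 'n fibre set)
         \<and> cohomology_iso (EM_symbol M p q c x \<theta>) 1 2 (UNIV :: ((real^'n) \<times> real) set)"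
    if c: "c \<in> \<A>" "x \<in> fst c" and \<theta>: "\<theta> \<in> EM M p q c 2 x" for c x \<theta>
  proof -
    interpret em_jet_point p q "snd c x" \<theta> using \<theta> assms(2) unfolding EM[OF c] by unfold_locales
    have eq: "EM_symbol M p q c x \<theta> = sc.symbol"
      unfolding EM_symbol_def EM[OF c] by (rule symbol_space_eq)
    note iso = sc.symbol_cohomology_00 sc.symbol_cohomology_11 sc.symbol_cohomology_12
    have 0: "(0 :: 'n fibre) \<in> fibre_tangent" by (rule subspace_0[OF subspace_fibre_tangent])
    \<comment> \<open>The covector with all components 1 is a second element of the target of the
      first two isomorphisms, so these cohomology groups are nonzero.\<close>
    have 1: "(0, 1) \<in> (fibre_tangent :: 'n fibre set)" by (simp add: fibre_tangent_iff)
    have ne: "(0 :: 'n fibre) \<noteq> (0, 1)" "(0 :: (real^'n) \<times> real) \<noteq> (0, 1)" by (simp_all add: zero_prod_def vec_eq_iff)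
    have nz: "\<not> cohomology_zero sc.symbol i j" if "(i, j) \<in> {(0, 0), (1, 1), (1, 2)}" for i j
      using that cohomology_iso_nonzero[OF iso(1) 0 1 ne(1)] cohomology_iso_nonzero[OF iso(2) 0 1 ne(1)]
        cohomology_iso_nonzero[OF iso(3) UNIV_I UNIV_I ne(2)] by auto
    show ?thesis unfolding eq
    proof (intro conjI allI iso iffI)
      show "(i, j) \<in> {(0, 0), (1, 1), (1, 2)}" if "\<not> cohomology_zero sc.symbol i j" for i j
        using that by (rule contrapos_np) (rule sc.symbol_cohomology_zero)
    qed (rule nz)
  qed
  have "involutive_equation \<A> fibre_tangent 2 (EM M p q)"
    unfolding involutive_equation_def
  proof (intro ballI conjI)
    fix c x assume c: "c \<in> \<A>" "x \<in> fst c"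
    show "jet_proj 2 ` EM M p q c (2 + 1) x = EM M p q c 2 x"
      using jet_proj_em_jets[OF assms(2), of p q "snd c x"] EM[OF c] by simp
    fix \<theta> assume \<theta>: "\<theta> \<in> EM M p q c 2 x"
    show "involutive_symbol 2 (symbol_space fibre_tangent 2 (EM M p q c 2 x) \<theta>)"
      unfolding involutive_symbol_def
    proof (intro allI impI)
      fix i j :: nat assume "i \<noteq> 2 - 1 \<and> i + j > 0"
      hence "(i, j) \<notin> {(0, 0), (1, 1), (1, 2)}" by auto
      with coh[OF c \<theta>, THEN conjunct1] show "cohomology_zero (symbol_space fibre_tangent 2 (EM M p q c 2 x) \<theta>) i j"
        unfolding EM_symbol_def by blast
    qed
  qed
  with coh show ?thesis by blast
qed

end
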